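(* Let $H=-I_1+I_2+\eta I_3^2+F$ with $\eta\neq0$ be as in the context and let $\mathcal{K}=\Theta_1^+\Theta_1^-$ be its Stokes constant. If $\mathcal{K}\ne0$ then $H$ is non-integrable.
   Context: Coordinates on $\mathbb{C}^4$ are $(\mathbf q,\mathbf p)=(q_1,q_2,p_1,p_2)$; $\Omega(\mathbf x,\mathbf y)=\mathbf x^TJ\mathbf y$ with $J=\begin{pmatrix}0&\mathrm{Id}\\-\mathrm{Id}&0\end{pmatrix}$; $X_H=(\partial H/\partial\mathbf p,-\partial H/\partial\mathbf q)$; $\mathcal{D}=\partial_\varphi+\partial_\tau$. Set $I_1=q_2p_1-q_1p_2$, $I_2=\frac12(q_1^2+q_2^2)$, $I_3=\frac12(p_1^2+p_2^2)$. The (weighted) order of a monomial is computed by giving each $q_i$ order $2$ and each $p_i$ order $1$. Standing assumption: $H=-I_1+I_2+\eta I_3^2+F$, where $\eta\in\mathbb{C}\setminus\{0\}$ and $F$ is a bounded analytic complex-valued function on an open neighbourhood of the origin in $\mathbb{C}^4$ containing only monomials of weighted order $\geq5$. $H$ is integrable if, in a neighbourhood of the origin, $X_H$ has an analytic first integral functionally independent of $H$ (Liouville integrability in the analytic category); non-integrable otherwise. Definition of $\mathcal{K}$. Fix $h>0$, $0<\theta<\pi/4$; $\mathbb{T}_h=\{\varphi\in\mathbb{C}/2\pi\mathbb{Z}:|\mathrm{Im}\,\varphi|<h\}$, $D_r^-=\{\tau:|\arg(\tau+r)|>\theta\}$, $D_r^+=-D_r^-$. Let $\mathsf{T}$ be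 the trigonometric polynomials in $\varphi$ with complex coefficients. A formal separatrix is a non-zero formal solution $\hat{\mathbf\Gamma}=(\tau^{-2}\hat\Gamma_1,\tau^{-2}\hat\Gamma_2,\tau^{-1}\hat\Gamma_3,\tau^{-1}\hat\Gamma_4)^T$, $\hat\Gamma_i\in\mathsf{T}[[\tau^{-1}]]$, of $\mathcal{D}\hat{\mathbf\Gamma}=X_H(\hat{\mathbf\Gamma})$. For $r$ large there are unique analytic solutions $\mathbf\Gamma^\pm:\mathbb{T}_h\times D_r^\pm\to\mathbb{C}^4$ of $\mathcal{D}\mathbf\Gamma^\pm=X_H(\mathbf\Gamma^\pm)$ with asymptotic expansion $\hat{\mathbf\Gamma}$ (uniformly in $\varphi$) as $\tau\to\infty$ in $D_r^\pm$. With $\Delta=\mathbf\Gamma^+-\mathbf\Gamma^-$ the limits $$\Theta_1^\pm=\lim_{\mathrm{Im}\,\tau\to\pm\infty}\Omega(\Delta(\varphi,\tau),\partial_\varphi\mathbf\Gamma^-(\varphi,\tau))e^{\mp i(\tau-\varphi)}\quad(\tau\in D_r^+\cap D_r^-)$$ exist, and the product $\mathcal{K}=\Theta_1^+\Theta_1^-$, called the Stokes constant of $H$, does not depend on the choice of $\hat{\mathbf\Gamma}$. *)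

theory Defs
  imports
    "HOL-Analysis.Analysis"
    "HOL-Library.Poly_Mapping"
    "HOL-Computational_Algebra.Formal_Power_Series"
begin

unbundle no fps_syntax

section \<open>Analytic functions of several complex variables\<close>

definition has_power_series_at ::
    "(complex ^ 'n \<Rightarrow> complex) \<Rightarrow> complex ^ 'n \<Rightarrow> (('n \<Rightarrow> nat) \<Rightarrow> complex) \<Rightarrow> bool" where
  "has_power_series_at f a c \<longleftrightarrow>
     (\<exists>r>0. \<forall>x\<in>ball a r.
        ((\<lambda>\<alpha>. c \<alpha> * (\<Prod>i\<in>UNIV. (x $ i - a $ i) ^ \<alpha> i)) has_sum f x) UNIV)"

definition mv_analytic_on :: "(complex ^ 'n \<Rightarrow> complex) \<Rightarrow> (complex ^ 'n) set \<Rightarrow> bool" where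
  "mv_analytic_on f S \<longleftrightarrow> (\<forall>a\<in>S. \<exists>c. has_power_series_at f a c)"

definition pdiff :: "'n \<Rightarrow> (complex ^ 'n \<Rightarrow> complex) \<Rightarrow> complex ^ 'n \<Rightarrow> complex" where
  "pdiff i f x = deriv (\<lambda>t. f (x + t *s axis i 1)) 0"

definition grad :: "(complex ^ 'n \<Rightarrow> complex) \<Rightarrow> complex ^ 'n \<Rightarrow> complex ^ 'n" where
  "grad f x = (\<chi> i. pdiff i f x)"

section \<open>Hamiltonians on \<open>\<complex>\<^sup>4\<close>\<close>

text \<open>The components \<open>1, 2, 3, 4\<close> of a point are \<open>q\<^sub>1, q\<^sub>2, p\<^sub>1, p\<^sub>2\<close>.\<close>

lemma vector_4 [simp]:
  "(vector [x, y, z, w] :: ('a::zero) ^ 4) $ 1 = x"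
  "(vector [x, y, z, w] :: ('a::zero) ^ 4) $ 2 = y"
  "(vector [x, y, z, w] :: ('a::zero) ^ 4) $ 3 = z"
  "(vector [x, y, z, w] :: ('a::zero) ^ 4) $ 4 = w"
  unfolding vector_def by simp_all

definition symp :: "complex ^ 4 \<Rightarrow> complex ^ 4 \<Rightarrow> complex" where
  "symp x y = x $ 1 * y $ 3 + x $ 2 * y $ 4 - x $ 3 * y $ 1 - x $ 4 * y $ 2"

definition ham_vf :: "(complex ^ 4 \<Rightarrow> complex) \<Rightarrow> complex ^ 4 \<Rightarrow> complex ^ 4" where
  "ham_vf H x = vector [pdiff 3 H x, pdiff 4 H x, - pdiff 1 H x, - pdiff 2 H x]"

definition I1 :: "complex ^ 4 \<Rightarrow> complex" where
  "I1 x = x $ 2 * x $ 3 - x $ 1 * x $ 4"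

definition I2 :: "complex ^ 4 \<Rightarrow> complex" where
  "I2 x = ((x $ 1)\<^sup>2 + (x $ 2)\<^sup>2) / 2"

definition I3 :: "complex ^ 4 \<Rightarrow> complex" where
  "I3 x = ((x $ 3)\<^sup>2 + (x $ 4)\<^sup>2) / 2"

definition ham :: "complex \<Rightarrow> (complex ^ 4 \<Rightarrow> complex) \<Rightarrow> complex ^ 4 \<Rightarrow> complex" where
  "ham \<eta> F x = - I1 x + I2 x + \<eta> * (I3 x)\<^sup>2 + F x"

definition weighted_order :: "(4 \<Rightarrow> nat) \<Rightarrow> nat" where
  "weighted_order \<alpha> = 2 * \<alpha> 1 + 2 * \<alpha> 2 + \<alpha> 3 + \<alpha> 4"

definition weighted_order_ge :: "(complex ^ 4 \<Rightarrow> complex) \<Rightarrow> nat \<Rightarrow> bool" where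
  "weighted_order_ge F m \<longleftrightarrow>
     (\<exists>c. has_power_series_at F 0 c \<and> (\<forall>\<alpha>. c \<alpha> \<noteq> 0 \<longrightarrow> weighted_order \<alpha> \<ge> m))"

text \<open>
  Functional independence means that the differentials are linearly independent over \<open>\<complex>\<close>
  on a dense subset of the neighbourhood.  On a connected neighbourhood this is the same as linear
  independence at a single point, since the \<open>2 \<times> 2\<close> minors are analytic; density also excludes a
  first integral that is independent of \<open>H\<close> only on a component not containing the origin.
\<close>

definition functionally_independent_on ::
    "(complex ^ 'n \<Rightarrow> complex) \<Rightarrow> (complex ^ 'n \<Rightarrow> complex) \<Rightarrow> (complex ^ 'n) set \<Rightarrow> bool" where
  "functionally_independent_on G H V \<longleftrightarrow>
     V \<subseteq> closure {x \<in> V. \<forall>a b. a *s grad G x + b *s grad H x = 0 \<longrightarrow> a = 0 \<and> b = 0}"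

definition first_integral_on ::
    "(complex ^ 4 \<Rightarrow> complex) \<Rightarrow> (complex ^ 4 \<Rightarrow> complex) \<Rightarrow> (complex ^ 4) set \<Rightarrow> bool" where
  "first_integral_on G H V \<longleftrightarrow> (\<forall>x\<in>V. (\<Sum>i\<in>UNIV. pdiff i G x * ham_vf H x $ i) = 0)"

definition integrable_at_origin :: "(complex ^ 4 \<Rightarrow> complex) \<Rightarrow> bool" where
  "integrable_at_origin H \<longleftrightarrow>
     (\<exists>V G. open V \<and> 0 \<in> V \<and> mv_analytic_on H V \<and> mv_analytic_on G V \<and>
            first_integral_on G H V \<and> functionally_independent_on G H V)"

section \<open>Formal separatrices\<close>

text \<open>
  A trigonometric polynomial \<open>\<Sum>\<^sub>k c\<^sub>k e\<^bsup>ik\<phi>\<^esup>\<close> is represented by its finitely supported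
  family of Fourier coefficients, so multiplication is convolution.  The variable \<open>fps_X\<close> of
  \<^typ>\<open>(int \<Rightarrow>\<^sub>0 complex) fps\<close> stands for \<open>\<tau>\<^sup>-\<^sup>1\<close>.
\<close>

type_synonym trig_poly = "int \<Rightarrow>\<^sub>0 complex"

definition trig_eval :: "trig_poly \<Rightarrow> complex \<Rightarrow> complex" where
  "trig_eval p \<phi> =
     (\<Sum>k\<in>Poly_Mapping.keys p. Poly_Mapping.lookup p k * exp (\<i> * of_int k * \<phi>))"

definition trig_deriv :: "trig_poly \<Rightarrow> trig_poly" where
  "trig_deriv p = Poly_Mapping.mapp (\<lambda>k c. \<i> * of_int k * c) p"

text \<open>\<open>\<partial>\<^sub>\<phi> + \<partial>\<^sub>\<tau>\<close>; in the variable \<open>z = \<tau>\<^sup>-\<^sup>1\<close> one has \<open>\<partial>\<^sub>\<tau> = - z\<^sup>2 \<partial>\<^sub>z\<close>.\<close>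

definition formal_D :: "trig_poly fps \<Rightarrow> trig_poly fps" where
  "formal_D g = Abs_fps (\<lambda>n. trig_deriv (fps_nth g n)) - fps_X ^ 2 * fps_deriv g"

text \<open>
  Substitution of \<open>g\<close> into the power series with coefficients \<open>c\<close>.  This is only meaningful if the
  components of \<open>g\<close> have zero constant term: then multi-indices of total degree greater than \<open>n\<close> do
  not contribute to the coefficient of index \<open>n\<close>.
\<close>

definition formal_subst ::
    "(('n::finite \<Rightarrow> nat) \<Rightarrow> complex) \<Rightarrow> trig_poly fps ^ 'n \<Rightarrow> trig_poly fps" where
  "formal_subst c g = Abs_fps (\<lambda>n. \<Sum>\<alpha> | (\<Sum>i\<in>UNIV. \<alpha> i) \<le> n.
     Poly_Mapping.single 0 (c \<alpha>) * fps_nth (\<Prod>i\<in>UNIV. (g $ i) ^ \<alpha> i) n)"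

lemma finite_multi_indices: "finite {\<alpha> :: 'n::finite \<Rightarrow> nat. (\<Sum>i\<in>UNIV. \<alpha> i) \<le> n}"
proof (rule finite_subset)
  show "{\<alpha> :: 'n \<Rightarrow> nat. (\<Sum>i\<in>UNIV. \<alpha> i) \<le> n} \<subseteq> PiE UNIV (\<lambda>_. {..n})"
  proof
    fix \<alpha> :: "'n \<Rightarrow> nat"
    assume "\<alpha> \<in> {\<alpha>. (\<Sum>i\<in>UNIV. \<alpha> i) \<le> n}"
    then have *: "(\<Sum>i\<in>UNIV. \<alpha> i) \<le> n" by simp
    have "\<alpha> i \<le> n" for i
      by (rule order_trans[OF member_le_sum[of i UNIV \<alpha>] *]) simp_all
    then show "\<alpha> \<in> PiE UNIV (\<lambda>_. {..n})" by (simp add: PiE_iff)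
  qed
  show "finite (PiE (UNIV :: 'n set) (\<lambda>_. {..n}))"
    by (intro finite_PiE) auto
qed

definition formal_separatrix :: "(complex ^ 4 \<Rightarrow> complex) \<Rightarrow> trig_poly fps ^ 4 \<Rightarrow> bool" where
  "formal_separatrix H \<Gamma>f \<longleftrightarrow>
     \<Gamma>f \<noteq> 0 \<and>
     (\<exists>g1 g2 g3 g4. \<Gamma>f = vector [fps_X ^ 2 * g1, fps_X ^ 2 * g2, fps_X * g3, fps_X * g4]) \<and>
     (\<exists>c. \<forall>i. has_power_series_at (\<lambda>x. ham_vf H x $ i) 0 (c i) \<and>
              formal_D (\<Gamma>f $ i) = formal_subst (c i) \<Gamma>f)"

section \<open>Analytic separatrices and the Stokes constant\<close>

text \<open>
  Functions on \<open>\<T>\<^sub>h\<close> are represented by \<open>2\<pi>\<close>-periodic functions on the strip below.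
\<close>

definition strip :: "real \<Rightarrow> complex set" where
  "strip h = {\<phi>. \<bar>Im \<phi>\<bar> < h}"

text \<open>As \<^prop>\<open>Arg 0 = 0\<close>, the vertices \<open>\<tau> = \<mp>r\<close>, where the argument is undefined, are excluded.\<close>

definition Dminus :: "real \<Rightarrow> real \<Rightarrow> complex set" where
  "Dminus \<theta> r = {\<tau>. \<bar>Arg (\<tau> + of_real r)\<bar> > \<theta>}"

definition Dplus :: "real \<Rightarrow> real \<Rightarrow> complex set" where
  "Dplus \<theta> r = uminus ` Dminus \<theta> r"

definition dphi :: "(complex \<Rightarrow> complex \<Rightarrow> complex ^ 4) \<Rightarrow> complex \<Rightarrow> complex \<Rightarrow> complex ^ 4" where
  "dphi \<Gamma> \<phi> \<tau> = (\<chi> i. deriv (\<lambda>s. \<Gamma> s \<tau> $ i) \<phi>)"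

definition dtau :: "(complex \<Rightarrow> complex \<Rightarrow> complex ^ 4) \<Rightarrow> complex \<Rightarrow> complex \<Rightarrow> complex ^ 4" where
  "dtau \<Gamma> \<phi> \<tau> = (\<chi> i. deriv (\<lambda>t. \<Gamma> \<phi> t $ i) \<tau>)"

definition asymptotic_expansion ::
    "real \<Rightarrow> complex set \<Rightarrow> (complex \<Rightarrow> complex \<Rightarrow> complex ^ 4) \<Rightarrow> trig_poly fps ^ 4 \<Rightarrow> bool" where
  "asymptotic_expansion h D \<Gamma> \<Gamma>f \<longleftrightarrow>
     (\<forall>i N. \<exists>C R. R > 0 \<and> (\<forall>\<phi>\<in>strip h. \<forall>\<tau>\<in>D. norm \<tau> \<ge> R \<longrightarrow>
        norm (\<Gamma> \<phi> \<tau> $ i - (\<Sum>n<N. trig_eval (fps_nth (\<Gamma>f $ i) n) \<phi> / \<tau> ^ n)) \<le> C / norm \<tau> ^ N))"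

text \<open>
  \<open>U\<close> is the domain of the Hamiltonian \<open>H\<close>; a solution has to take its values there.
\<close>

definition analytic_separatrix ::
    "(complex ^ 4) set \<Rightarrow> (complex ^ 4 \<Rightarrow> complex) \<Rightarrow> real \<Rightarrow> complex set \<Rightarrow> trig_poly fps ^ 4 \<Rightarrow>
     (complex \<Rightarrow> complex \<Rightarrow> complex ^ 4) \<Rightarrow> bool" where
  "analytic_separatrix U H h D \<Gamma>f \<Gamma> \<longleftrightarrow>
     (\<forall>i. mv_analytic_on (\<lambda>z :: complex ^ 2. \<Gamma> (z $ 1) (z $ 2) $ i)
            {z. z $ 1 \<in> strip h \<and> z $ 2 \<in> D}) \<and>
     (\<forall>\<phi>\<in>strip h. \<forall>\<tau>\<in>D.
        \<Gamma> (\<phi> + 2 * of_real pi) \<tau> = \<Gamma> \<phi> \<tau> \<and>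
        \<Gamma> \<phi> \<tau> \<in> U \<and>
        dphi \<Gamma> \<phi> \<tau> + dtau \<Gamma> \<phi> \<tau> = ham_vf H (\<Gamma> \<phi> \<tau>)) \<and>
     asymptotic_expansion h D \<Gamma> \<Gamma>f"

text \<open>
  The value of the constant does not depend on the choice of the formal separatrix, and the
  solutions \<open>\<Gamma>\<^sup>\<plusminus>\<close> are unique for large \<open>r\<close>.  These are theorems, so the constant is introduced here
  as a relation: \<open>K\<close> is the number obtained from some choice of the data.
\<close>

definition is_stokes_constant ::
    "(complex ^ 4) set \<Rightarrow> (complex ^ 4 \<Rightarrow> complex) \<Rightarrow> real \<Rightarrow> real \<Rightarrow> complex \<Rightarrow> bool" where
  "is_stokes_constant U H h \<theta> K \<longleftrightarrow>
     (\<exists>\<Gamma>f r \<Gamma>p \<Gamma>m \<Theta>p \<Theta>m.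
        formal_separatrix H \<Gamma>f \<and> r > 0 \<and>
        analytic_separatrix U H h (Dplus \<theta> r) \<Gamma>f \<Gamma>p \<and>
        analytic_separatrix U H h (Dminus \<theta> r) \<Gamma>f \<Gamma>m \<and>
        (\<forall>\<phi>\<in>strip h.
           ((\<lambda>\<tau>. symp (\<Gamma>p \<phi> \<tau> - \<Gamma>m \<phi> \<tau>) (dphi \<Gamma>m \<phi> \<tau>) * exp (- \<i> * (\<tau> - \<phi>))) \<longlongrightarrow> \<Theta>p)
             (inf (filtercomap Im at_top) (principal (Dplus \<theta> r \<inter> Dminus \<theta> r))) \<and>
           ((\<lambda>\<tau>. symp (\<Gamma>p \<phi> \<tau> - \<Gamma>m \<phi> \<tau>) (dphi \<Gamma>m \<phi> \<tau>) * exp (\<i> * (\<tau> - \<phi>))) \<longlongrightarrow> \<Theta>m)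
             (inf (filtercomap Im at_bot) (principal (Dplus \<theta> r \<inter> Dminus \<theta> r)))) \<and>
        K = \<Theta>p * \<Theta>m)"

end

(*
  Suppose G is a first integral independent of H.  On the image of each separatrix G is constant:
  pulled back, it is invariant under the flow, hence 2 pi-periodic and of at most polynomial
  growth as Im tau tends to infinity.  The two images lie in the same level S of H, and for large
  |Im tau| they are exponentially close: their distance is O(exp (-(1-eps) |Im tau|)), because the
  difference, suitably rotated and scaled, is almost 2 pi-periodic in tau.  As K is nonzero, their
  distance transversally to the tangent plane, measured by the symplectic form, is at least
  c exp (-|Im tau|).

  Let k be minimal such that some k-th derivative of G tangent to S does not vanish identically
  along the image of one separatrix.  It is the product of a coefficient, invariant under the flow
  and hence constant, and of the k-th power of the transversal displacement.  Since G takes the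
  same value at the nearby point of the other separatrix, Taylor's formula bounds the coefficient by a
  power of |Im tau| times exp (-(1-eps)(k+1) |Im tau|) / exp (-k |Im tau|), which tends to zero.
  So all tangential jets vanish, G is constant on S near the separatrices, and G - a is divisible
  by H - H0.  The quotient is again a first integral with polynomial bounds, so one can
  divide again and again.  Hence the minors of (dG, dH) vanish to infinite order at a point, and
  G and H are dependent there.
*)
theory Submission
  imports Defs "HOL-Complex_Analysis.Complex_Analysis"
begin

no_notation Formal_Power_Series.fps.fps_nth (infixl "$" 75)

section \<open>Holomorphic functions of several variables\<close>

text \<open>Why both factors of K must be nonzero: a leading coefficient is a 2 pi-periodic function
  of tau, and a bound at only one of the ends Im tau -> +infinity, -infinity would still admit exp
  (i tau) or its inverse. The obstacle is that the separatrices run into the equilibrium at the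
  origin, where dH degenerates. No chart has uniform size along them, so all radii and bounds are
  powers of |Im tau|; first integrals with such bounds form a class closed under division.
  Exponential smallness beats every power, and since (1 - eps) (k + 1) > k for small eps, the
  non-sharp decay suffices against the sharp lower bound. Jets are taken with vector fields tangent
  to the levels of H instead of canonical coordinates: at the lowest order their brackets contribute
  nothing, so only transversal components count. The decay comes from the linear rotation with
  eigenvalues i and -i: after scaling q by tau^2 and p by tau the rest of the field is an O(1/tau)
  perturbation, and the flow over time 2 pi is nearly the identity. Division takes place near both
  separatrices, because every round compares them again.\<close>

definition dd :: "(complex ^ 'n \<Rightarrow> complex) \<Rightarrow> complex ^ 'n \<Rightarrow> complex ^ 'n \<Rightarrow> complex" where
 "dd f x v = (\<Sum>i\<in>UNIV. v $ i * pdiff i f x)"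

text \<open>Real differentiability together with the value \<open>dd f x\<close> of the derivative.
  This map is complex linear by its formula, so the Cauchy-Riemann equations are built in;
  continuity of the derivative follows from Cauchy estimates in
  \<open>dd_continuous\<close>.\<close>

definition hol :: "(complex ^ 'n \<Rightarrow> complex) \<Rightarrow> (complex ^ 'n) set \<Rightarrow> bool" where
 "hol f S \<longleftrightarrow> (\<forall>x\<in>S. (f has_derivative dd f x) (at x))"

lemma bounded_linear_scale: "bounded_linear (\<lambda>t::complex. t *s (v::complex^'n))"
proof -
 have "linear (\<lambda>t::complex. t *s (v::complex^'n))"
  by (rule linearI) (auto simp: vec_eq_iff algebra_simps)
 thus ?thesis by (simp add: linear_conv_bounded_linear)
qed

lemma norm_scale: "norm (c *s (v::complex^'n)) = norm c * norm v"
proof -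
 have "norm (c *s v) = L2_set (\<lambda>i. norm c * norm (v$i)) UNIV"
  by (simp add: norm_vec_def norm_mult)
 also have "\<dots> = norm c * norm v" by (simp add: norm_vec_def L2_set_right_distrib)
 finally show ?thesis .
qed

lemma norm_axis_1 [simp]: "norm (axis i (1::complex) :: complex^'n) = 1"
proof -
 have "(\<Sum>j\<in>UNIV. (norm ((axis i (1::complex) :: complex^'n) $ j))\<^sup>2) = (\<Sum>j\<in>UNIV. if j = i then 1 else 0)"
  by (rule sum.cong) (auto simp: axis_def)
 thus ?thesis by (simp add: norm_vec_def L2_set_def)
qed

lemma component_le: "norm ((x::complex^'n) $ i) \<le> norm x"
 by (rule Finite_Cartesian_Product.norm_nth_le)

lemma has_derivative_vec_components:
 fixes p :: "'a::real_normed_vector \<Rightarrow> complex ^ 'n"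
 assumes "\<And>i. ((\<lambda>t. p t $ i) has_derivative p' i) F"
 shows "(p has_derivative (\<lambda>h. \<chi> i. p' i h)) F"
proof -
 have "((\<lambda>t. \<Sum>i\<in>UNIV. (p t $ i) *s axis i 1) has_derivative (\<lambda>h. \<Sum>i\<in>UNIV. (p' i h) *s axis i (1::complex))) F"
  by (intro has_derivative_sum bounded_linear.has_derivative[OF bounded_linear_scale] assms)
 moreover have "(\<lambda>t. \<Sum>i\<in>UNIV. (p t $ i) *s axis i 1) = p" by (simp add: basis_expansion)
 moreover have "(\<lambda>h. \<Sum>i\<in>UNIV. (p' i h) *s axis i (1::complex)) = (\<lambda>h. \<chi> i. p' i h)"
  using basis_expansion[of "\<chi> i. p' i h" for h] by (simp add: fun_eq_iff)
 ultimately show ?thesis by simp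
qed

lemma pdiff_eq:
 fixes f :: "complex ^ 'n \<Rightarrow> complex"
 assumes "(f has_derivative f') (at x)" and lin: "\<And>c v. f' (c *s v) = c * f' v"
 shows "pdiff i f x = f' (axis i 1)" and "((\<lambda>t. f (x + t *s v)) has_field_derivative f' v) (at 0)"
proof -
 have *: "((\<lambda>t. f (x + t *s v)) has_field_derivative f' v) (at 0)" for v
 proof -
  have 1: "((\<lambda>t. x + t *s v) has_derivative (\<lambda>t. t *s v)) (at (0::complex))"
   by (auto intro!: derivative_eq_intros bounded_linear_imp_has_derivative[OF bounded_linear_scale])
  have "((\<lambda>t. f (x + t *s v)) has_derivative (\<lambda>t. f' (t *s v))) (at 0)"
   using has_derivative_compose[OF 1, of f f'] assms(1) by simp
  thus ?thesis by (simp add: has_field_derivative_def lin mult.commute[of _ "f' v"])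
 qed
 show "pdiff i f x = f' (axis i 1)" unfolding pdiff_def by (rule DERIV_imp_deriv[OF *])
 show "((\<lambda>t. f (x + t *s v)) has_field_derivative f' v) (at 0)" by (rule *)
qed

text \<open>A complex linear map is determined by its values on the coordinate axes, and these are
  the partial derivatives.\<close>

lemma dd_eq:
 fixes f :: "complex ^ 'n \<Rightarrow> complex"
 assumes "(f has_derivative f') (at x)" and lin: "\<And>c v. f' (c *s v) = c * f' v"
 shows "f' = dd f x"
proof
 fix v
 interpret f': bounded_linear f' using assms(1) by (rule has_derivative_bounded_linear)
 have "f' v = f' (\<Sum>i\<in>UNIV. v $ i *s axis i 1)" by (simp add: basis_expansion)
 also have "\<dots> = (\<Sum>i\<in>UNIV. v $ i * f' (axis i 1))" by (simp add: f'.sum lin)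
 finally show "f' v = dd f x v" using pdiff_eq[OF assms] by (simp add: dd_def)
qed

lemma holI:
 assumes "\<And>x. x \<in> S \<Longrightarrow> \<exists>f'. (f has_derivative f') (at x) \<and> (\<forall>c v. f' (c *s v) = c * f' v)"
 shows "hol f S"
 unfolding hol_def using assms dd_eq by metis

lemma holI2:
 assumes "\<And>x. x \<in> S \<Longrightarrow> (f has_derivative f' x) (at x)" "\<And>x c v. f' x (c *s v) = c * f' x v"
 shows "hol f S \<and> (\<forall>x\<in>S. \<forall>v. dd f x v = f' x v)"
proof
 show "hol f S" using assms by (intro holI) blast
 show "\<forall>x\<in>S. \<forall>v. dd f x v = f' x v" using dd_eq[OF assms(1) assms(2)] by (simp add: fun_eq_iff)
qed

lemma holD: "hol f S \<Longrightarrow> x \<in> S \<Longrightarrow> (f has_derivative dd f x) (at x)"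
 by (simp add: hol_def)

lemma hol_subset: "hol f S \<Longrightarrow> T \<subseteq> S \<Longrightarrow> hol f T"
 by (auto simp: hol_def)

lemma hol_continuous: "hol f S \<Longrightarrow> continuous_on S f"
 by (meson continuous_at_imp_continuous_on has_derivative_continuous holD)

lemma dd_scale: "dd f x (c *s v) = c * dd f x v"
 by (simp add: dd_def sum_distrib_left mult.assoc)

lemma dd_add: "dd f x (v + w) = dd f x v + dd f x w"
 by (simp add: dd_def sum.distrib algebra_simps)

lemma dd_diff: "dd f x (v - w) = dd f x v - dd f x w"
 by (simp add: dd_def sum_subtractf algebra_simps)

lemma dd_axis [simp]: "dd f x (axis i 1) = pdiff i f x"
proof -
 have "dd f x (axis i 1) = (\<Sum>j\<in>UNIV. if j = i then pdiff j f x else 0)"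
  unfolding dd_def by (rule sum.cong) (auto simp: axis_def)
 thus ?thesis by simp
qed

lemma hol_transform:
 assumes "hol f S" "open S" "\<And>x. x \<in> S \<Longrightarrow> g x = f x"
 shows "hol g S" "\<And>x v. x \<in> S \<Longrightarrow> dd g x v = dd f x v" "\<And>x i. x \<in> S \<Longrightarrow> pdiff i g x = pdiff i f x"
proof -
 have *: "(g has_derivative dd f x) (at x)" if "x \<in> S" for x
  using has_derivative_transform_within_open[OF holD[OF assms(1) that] assms(2) that] assms(3) by force
 have e: "dd f x = dd g x" if "x \<in> S" for x
  by (rule dd_eq[OF *[OF that] dd_scale])
 show "hol g S" using * by (intro holI) (blast intro: dd_scale)
 show "\<And>x v. x \<in> S \<Longrightarrow> dd g x v = dd f x v" using e by simp
 show "\<And>x i. x \<in> S \<Longrightarrow> pdiff i g x = pdiff i f x" using e dd_axis by metis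
qed

lemma hol_path:
 fixes p :: "complex \<Rightarrow> complex ^ 'n"
 assumes "hol f S" "p t \<in> S" "\<And>i. ((\<lambda>t. p t $ i) has_field_derivative p' $ i) (at t within T)"
 shows "((\<lambda>t. f (p t)) has_field_derivative dd f (p t) p') (at t within T)"
proof -
 have "(p has_derivative (\<lambda>h. \<chi> i. p' $ i * h)) (at t within T)"
  by (rule has_derivative_vec_components) (use assms(3) in \<open>simp add: has_field_derivative_def\<close>)
 hence "((\<lambda>t. f (p t)) has_derivative (\<lambda>h. dd f (p t) (\<chi> i. p' $ i * h))) (at t within T)"
  using has_derivative_compose[where f=p and g=f and g'="dd f (p t)", OF _ holD[OF assms(1,2)]] by simp
 moreover have "(\<chi> i. p' $ i * h) = h *s p'" for h by (simp add: vec_eq_iff mult.commute)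
 ultimately show ?thesis by (simp add: has_field_derivative_def dd_scale mult.commute[of _ "dd f (p t) p'"])
qed

lemma hol_line:
 assumes "hol f S" "x + z *s v \<in> S"
 shows "((\<lambda>z. f (x + z *s v)) has_field_derivative dd f (x + z *s v) v) (at z within T)"
 by (rule hol_path[where p="\<lambda>z. x + z *s v", OF assms]) (auto intro!: derivative_eq_intros)

lemma hol_line_holomorphic:
 assumes "hol f S" "\<And>z. z \<in> T \<Longrightarrow> x + z *s v \<in> S"
 shows "(\<lambda>z. f (x + z *s v)) holomorphic_on T"
 unfolding holomorphic_on_def field_differentiable_def using hol_line[OF assms(1) assms(2)] by blast

text \<open>Chain rule.\<close>

lemma hol_compose:
 fixes f :: "complex ^ 'n \<Rightarrow> complex" and g :: "complex ^ 'm \<Rightarrow> complex ^ 'n"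
 assumes "hol f S" "\<And>i. hol (\<lambda>x. g x $ i) T" "\<And>x. x \<in> T \<Longrightarrow> g x \<in> S"
 shows "hol (\<lambda>x. f (g x)) T"
  and "\<And>x v. x \<in> T \<Longrightarrow> dd (\<lambda>x. f (g x)) x v = dd f (g x) (\<chi> i. dd (\<lambda>x. g x $ i) x v)"
proof -
 have *: "((\<lambda>x. f (g x)) has_derivative (\<lambda>h. dd f (g x) (\<chi> i. dd (\<lambda>x. g x $ i) x h))) (at x)" if "x \<in> T" for x
 proof -
  have "(g has_derivative (\<lambda>h. \<chi> i. dd (\<lambda>x. g x $ i) x h)) (at x)"
   by (rule has_derivative_vec_components) (use holD[OF assms(2) that] in simp)
  from has_derivative_compose[OF this holD[OF assms(1) assms(3)[OF that]]] show ?thesis by simp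
 qed
 have lin: "dd f (g x) (\<chi> i. dd (\<lambda>x. g x $ i) x (c *s v)) = c * dd f (g x) (\<chi> i. dd (\<lambda>x. g x $ i) x v)" for x c v
 proof -
  have "(\<chi> i. dd (\<lambda>x. g x $ i) x (c *s v)) = c *s (\<chi> i. dd (\<lambda>x. g x $ i) x v)"
   by (simp add: vec_eq_iff dd_scale)
  thus ?thesis by (simp add: dd_scale)
 qed
 show "hol (\<lambda>x. f (g x)) T" using * lin by (intro holI) blast
 show "dd (\<lambda>x. f (g x)) x v = dd f (g x) (\<chi> i. dd (\<lambda>x. g x $ i) x v)" if "x \<in> T" for x v
  using dd_eq[OF *[OF that] lin] by (simp add: fun_eq_iff)
qed

lemma hol_coord: "hol (\<lambda>x::complex^'n. x $ i) S" and dd_coord [simp]: "dd (\<lambda>x::complex^'n. x $ i) y v = v $ i"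
proof -
 have *: "((\<lambda>x::complex^'n. x $ i) has_derivative (\<lambda>v. v $ i)) (at x)" for x
  by (intro bounded_linear_imp_has_derivative bounded_linear_vec_nth)
 from holI2[OF *] show "hol (\<lambda>x::complex^'n. x $ i) S" by simp
 from holI2[of UNIV, OF *] show "dd (\<lambda>x::complex^'n. x $ i) y v = v $ i" by simp
qed

lemma hol_const: "hol (\<lambda>x::complex^'n. c) S" and dd_const [simp]: "dd (\<lambda>x::complex^'n. c) y v = 0"
proof -
 have *: "((\<lambda>x::complex^'n. c) has_derivative (\<lambda>v. 0)) (at x)" for x by simp
 from holI2[OF *] show "hol (\<lambda>x::complex^'n. c) S" by simp
 from holI2[of UNIV, OF *] show "dd (\<lambda>x::complex^'n. c) y v = 0" by simp
qed

lemma hol_add_aux: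
 assumes "hol f S" "hol g S"
 shows "hol (\<lambda>x. f x + g x) S \<and> (\<forall>x\<in>S. \<forall>v. dd (\<lambda>x. f x + g x) x v = dd f x v + dd g x v)"
proof -
 have *: "((\<lambda>x. f x + g x) has_derivative (\<lambda>v. dd f x v + dd g x v)) (at x)" if "x \<in> S" for x
  using assms that by (intro derivative_intros holD)
 have l: "dd f x (c *s v) + dd g x (c *s v) = c * (dd f x v + dd g x v)" for c v x
  by (simp add: dd_scale algebra_simps)
 show ?thesis by (rule holI2[OF * l])
qed

lemma hol_mult_aux:
 assumes "hol f S" "hol g S"
 shows "hol (\<lambda>x. f x * g x) S \<and> (\<forall>x\<in>S. \<forall>v. dd (\<lambda>x. f x * g x) x v = f x * dd g x v + dd f x v * g x)"
proof -
 have *: "((\<lambda>x. f x * g x) has_derivative (\<lambda>v. f x * dd g x v + dd f x v * g x)) (at x)" if "x \<in> S" for x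
  using assms that by (intro derivative_intros holD)
 have l: "f x * dd g x (c *s v) + dd f x (c *s v) * g x = c * (f x * dd g x v + dd f x v * g x)" for c v x
  by (simp add: dd_scale algebra_simps)
 show ?thesis by (rule holI2[OF * l])
qed

lemma hol_divide_aux:
 assumes "hol f S" "hol g S" "\<And>x. x \<in> S \<Longrightarrow> g x \<noteq> 0"
 shows "hol (\<lambda>x. f x / g x) S \<and> (\<forall>x\<in>S. \<forall>v. dd (\<lambda>x. f x / g x) x v = (dd f x v * g x - f x * dd g x v) / (g x)\<^sup>2)"
proof -
 have *: "((\<lambda>x. f x / g x) has_derivative (\<lambda>v. (dd f x v * g x - f x * dd g x v) / (g x * g x))) (at x)" if "x \<in> S" for x
  using assms that by (intro has_derivative_divide' holD)
 have l: "(dd f x (c *s v) * g x - f x * dd g x (c *s v)) / (g x * g x) = c * ((dd f x v * g x - f x * dd g x v) / (g x * g x))" for c v x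
  by (simp add: dd_scale algebra_simps diff_divide_distrib)
 show ?thesis using holI2[OF * l] by (simp add: power2_eq_square)
qed

lemmas hol_add = hol_add_aux[THEN conjunct1]
lemmas dd_plus = hol_add_aux[THEN conjunct2, rule_format]
lemmas hol_mult = hol_mult_aux[THEN conjunct1]
lemmas dd_mult = hol_mult_aux[THEN conjunct2, rule_format]
lemmas hol_divide = hol_divide_aux[THEN conjunct1]

lemma hol_cmult: "hol f S \<Longrightarrow> hol (\<lambda>x. c * f x) S"
 by (rule hol_mult[OF hol_const])
lemma dd_cmult: "hol f S \<Longrightarrow> x \<in> S \<Longrightarrow> dd (\<lambda>x. c * f x) x v = c * dd f x v"
 using dd_mult[OF hol_const, of f S x c v] by simp
lemma hol_uminus: "hol f S \<Longrightarrow> hol (\<lambda>x. - f x) S"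
 using hol_cmult[of f S "-1"] by simp
lemma dd_uminus: "hol f S \<Longrightarrow> x \<in> S \<Longrightarrow> dd (\<lambda>x. - f x) x v = - dd f x v"
 using dd_cmult[of f S x "-1" v] by simp
lemma hol_diff: "hol f S \<Longrightarrow> hol g S \<Longrightarrow> hol (\<lambda>x. f x - g x) S"
 using hol_add[OF _ hol_uminus, of f S g] by simp
lemma dd_minus: "hol f S \<Longrightarrow> hol g S \<Longrightarrow> x \<in> S \<Longrightarrow> dd (\<lambda>x. f x - g x) x v = dd f x v - dd g x v"
 using dd_plus[OF _ hol_uminus, of f S g x v] by (simp add: dd_uminus)
lemma hol_power: "hol f S \<Longrightarrow> hol (\<lambda>x. f x ^ n) S"
 by (induction n) (auto intro: hol_const hol_mult)
lemma hol_sum: "(\<And>i. i \<in> I \<Longrightarrow> hol (f i) S) \<Longrightarrow> hol (\<lambda>x. \<Sum>i\<in>I. f i x) S"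
 by (induction I rule: infinite_finite_induct) (auto intro: hol_const hol_add)
lemma dd_sum: "(\<And>i. i \<in> I \<Longrightarrow> hol (f i) S) \<Longrightarrow> x \<in> S \<Longrightarrow> dd (\<lambda>x. \<Sum>i\<in>I. f i x) x v = (\<Sum>i\<in>I. dd (f i) x v)"
proof (induction I rule: infinite_finite_induct)
 case (insert a F)
 have "hol (\<lambda>x. \<Sum>i\<in>F. f i x) S" by (rule hol_sum) (use insert in auto)
 thus ?case using insert dd_plus[of "f a" S "\<lambda>x. \<Sum>i\<in>F. f i x" x v] by simp
qed simp_all

lemma pdiff_dd: "pdiff i f x = dd f x (axis i 1)" by simp

section \<open>Power series are holomorphic\<close>

lemma quadratic_remainder_has_derivative:
 fixes f :: "complex ^ 'n \<Rightarrow> complex"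
 assumes "bounded_linear L" "r > 0" "\<And>v. norm v < r \<Longrightarrow> norm (f (x + v) - f x - L v) \<le> K * (norm v)\<^sup>2"
 shows "(f has_derivative L) (at x)"
 unfolding has_derivative_at
proof (intro conjI assms(1))
 show "(\<lambda>h. norm (f (x + h) - f x - L h) / norm h) \<midarrow>0\<rightarrow> 0"
 proof (rule Lim_null_comparison)
  show "\<forall>\<^sub>F v in at 0. norm (norm (f (x + v) - f x - L v) / norm v) \<le> \<bar>K\<bar> * norm v"
  proof -
   have "\<forall>\<^sub>F v in at 0. v \<in> ball (0::complex^'n) r \<and> v \<noteq> 0"
    using assms(2) by (intro eventually_conj eventually_at_in_open' eventually_neq_at_within) auto
   thus ?thesis
   proof eventually_elim
    case (elim v)
    have "norm (f (x + v) - f x - L v) \<le> \<bar>K\<bar> * (norm v)\<^sup>2"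
     using assms(3)[of v] elim by (smt (verit) dist_norm mem_ball mult_right_mono norm_minus_cancel zero_le_power2 diff_0)
    thus ?case using elim by (simp add: divide_simps power2_eq_square mult.assoc)
   qed
  qed
  have "((\<lambda>v::complex^'n. \<bar>K\<bar> * norm v) \<longlongrightarrow> \<bar>K\<bar> * norm (0::complex^'n)) (at 0)"
   by (intro tendsto_intros)
  thus "((\<lambda>v::complex^'n. \<bar>K\<bar> * norm v) \<longlongrightarrow> 0) (at 0)" by simp
 qed
qed

lemma bounded_linear_sum_coord: "bounded_linear (\<lambda>v::complex^'n. \<Sum>i\<in>UNIV. v $ i * c i)"
 by (intro bounded_linear_sum bounded_linear_compose[OF bounded_linear_mult_left bounded_linear_vec_nth])

lemma norm_monomial_le: "norm (\<Prod>i\<in>UNIV. (y::complex^'n) $ i ^ \<alpha> i) \<le> norm y ^ (\<Sum>i\<in>UNIV. \<alpha> i)"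
 by (auto simp: prod_norm[symmetric] norm_power power_sum intro!: prod_mono power_mono Finite_Cartesian_Product.norm_nth_le)

lemma power_series_abs_summable:
 assumes "has_power_series_at f a (c :: ('n::finite \<Rightarrow> nat) \<Rightarrow> complex)"
 obtains \<rho> where "\<rho> > 0" "(\<lambda>\<alpha>. norm (c \<alpha>) * \<rho> ^ (\<Sum>i\<in>UNIV. \<alpha> i)) summable_on UNIV"
  "\<And>x. norm (x - a) \<le> \<rho> \<Longrightarrow> ((\<lambda>\<alpha>. c \<alpha> * (\<Prod>i\<in>UNIV. (x $ i - a $ i) ^ \<alpha> i)) has_sum f x) UNIV"
proof -
 obtain r where r: "r > 0" "\<And>x. x \<in> ball a r \<Longrightarrow> ((\<lambda>\<alpha>. c \<alpha> * (\<Prod>i\<in>UNIV. (x $ i - a $ i) ^ \<alpha> i)) has_sum f x) UNIV"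
  using assms unfolding has_power_series_at_def by blast
 \<comment> \<open>The point whose increments all equal rho lies in the ball, its distance from a
   being at most n * rho = r / 2. There every monomial becomes rho^|alpha|, and an unconditionally
   summable complex family is absolutely summable.\<close>
 define \<rho> where "\<rho> = r / (2 * real CARD('n))"
 have c1: "real CARD('n) \<ge> 1" using zero_less_card_finite[where 'a='n] by linarith
 have c2: "1 < real CARD('n) * 2" using c1 by linarith
 have \<rho>: "\<rho> > 0" "\<rho> < r" "real CARD('n) * \<rho> < r" using r c2 by (auto simp: \<rho>_def field_simps)
 define x where "x = a + (\<chi> i. of_real \<rho>)"
 have "norm (x - a) \<le> (\<Sum>i\<in>UNIV. norm ((x - a) $ i))" unfolding norm_vec_def by (rule L2_set_le_sum) simp
 also have "\<dots> = real CARD('n) * \<rho>" using \<rho> by (simp add: x_def)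
 finally have "x \<in> ball a r" using \<rho> by (simp add: dist_norm norm_minus_commute)
 from r(2)[OF this] have "(\<lambda>\<alpha>. c \<alpha> * (\<Prod>i\<in>UNIV. (x $ i - a $ i) ^ \<alpha> i)) summable_on UNIV"
  by (auto simp: summable_on_def)
 hence "(\<lambda>\<alpha>. norm (c \<alpha> * (\<Prod>i\<in>UNIV. (x $ i - a $ i) ^ \<alpha> i))) summable_on UNIV"
  by (simp add: summable_on_iff_abs_summable_on_complex)
 moreover have "norm (c \<alpha> * (\<Prod>i\<in>UNIV. (x $ i - a $ i) ^ \<alpha> i)) = norm (c \<alpha>) * \<rho> ^ (\<Sum>i\<in>UNIV. \<alpha> i)" for \<alpha>
  using \<rho>(1) by (simp add: x_def norm_mult prod_norm[symmetric] norm_power power_sum)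
 ultimately have "(\<lambda>\<alpha>. norm (c \<alpha>) * \<rho> ^ (\<Sum>i\<in>UNIV. \<alpha> i)) summable_on UNIV" by simp
 thus ?thesis using that[OF \<rho>(1)] r(2) \<rho>(2) by (auto simp: dist_norm norm_minus_commute)
qed

lemma power_series_has_derivative:
 assumes "has_power_series_at f a (c :: ('n::finite \<Rightarrow> nat) \<Rightarrow> complex)"
 shows "(f has_derivative (\<lambda>v. \<Sum>i\<in>UNIV. v $ i * c (\<lambda>j. if j = i then 1 else 0))) (at a)"
proof -
 obtain \<rho> where \<rho>: "\<rho> > 0" and sm: "(\<lambda>\<alpha>. norm (c \<alpha>) * \<rho> ^ (\<Sum>i\<in>UNIV. \<alpha> i)) summable_on UNIV"
  and hs: "\<And>x. norm (x - a) \<le> \<rho> \<Longrightarrow> ((\<lambda>\<alpha>. c \<alpha> * (\<Prod>i\<in>UNIV. (x $ i - a $ i) ^ \<alpha> i)) has_sum f x) UNIV"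
  using power_series_abs_summable[OF assms] by blast
 define e :: "'n \<Rightarrow> 'n \<Rightarrow> nat" where "e = (\<lambda>i j. if j = i then 1 else 0)"
 have inj_e: "inj e"
 proof (rule injI)
  fix i j assume "e i = e j"
  hence "e i i = e j i" by simp
  thus "i = j" by (auto simp: e_def split: if_splits)
 qed
 \<comment> \<open>The multi-indices of degree at most one. Their terms form the affine part; every
   other term carries the factor (norm v / rho)^2.\<close>
 define A where "A = insert (\<lambda>_. 0) (range e)"
 have finA: "finite A" by (simp add: A_def)
 have ne: "(\<lambda>_. 0) \<notin> range e"
 proof
  assume "(\<lambda>_. 0) \<in> range e"
  then obtain i where "(\<lambda>_. 0) = e i" by blast
  hence "e i i = 0" by metis
  thus False by (simp add: e_def)
 qed
 have deg: "(\<Sum>i\<in>UNIV. \<alpha> i) \<ge> 2" if "\<alpha> \<notin> A" for \<alpha>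
 proof (rule ccontr)
  assume "\<not> (\<Sum>i\<in>UNIV. \<alpha> i) \<ge> 2"
  hence "(\<Sum>i\<in>UNIV. \<alpha> i) = 0 \<or> (\<Sum>i\<in>UNIV. \<alpha> i) = 1" by linarith
  thus False
  proof
   assume "(\<Sum>i\<in>UNIV. \<alpha> i) = 0" hence "\<alpha> = (\<lambda>_. 0)" by auto
   thus False using that by (simp add: A_def)
  next
   assume 1: "(\<Sum>i\<in>UNIV. \<alpha> i) = 1"
   hence "\<exists>i\<in>UNIV. \<alpha> i = Suc 0 \<and> (\<forall>j\<in>UNIV. i \<noteq> j \<longrightarrow> \<alpha> j = 0)"
    using sum_eq_1_iff[of UNIV \<alpha>] by auto
   then obtain i where i: "\<alpha> i = 1" "\<And>j. i \<noteq> j \<Longrightarrow> \<alpha> j = 0" by auto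
   have "\<alpha> = e i" unfolding e_def fun_eq_iff using i by auto
   thus False using that by (simp add: A_def)
  qed
 qed
 define L where "L = (\<lambda>v::complex^'n. \<Sum>i\<in>UNIV. v $ i * c (e i))"
 define B where "B = (\<Sum>\<^sub>\<infinity>\<alpha>. norm (c \<alpha>) * \<rho> ^ (\<Sum>i\<in>UNIV. \<alpha> i))"
 have rem: "norm (f (a + v) - c (\<lambda>_. 0) - L v) \<le> B / \<rho>\<^sup>2 * (norm v)\<^sup>2" if v: "norm v \<le> \<rho>" for v
 proof -
  define t where "t = (\<lambda>\<alpha>. c \<alpha> * (\<Prod>i\<in>UNIV. (v $ i) ^ \<alpha> i))"
  have h1: "(t has_sum f (a + v)) UNIV" using hs[of "a + v"] v by (simp add: t_def)
  have "sum t A = t (\<lambda>_. 0) + sum t (range e)" by (simp add: A_def ne)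
  also have "sum t (range e) = (\<Sum>i\<in>UNIV. t (e i))" by (rule sum.reindex[OF inj_e, unfolded comp_def])
  also have "\<dots> = L v"
  proof -
   have "(\<Prod>j\<in>UNIV. (v $ j) ^ e i j) = v $ i" for i
   proof -
    have "(\<Prod>j\<in>UNIV. (v $ j) ^ e i j) = (\<Prod>j\<in>UNIV. if j = i then v $ j else 1)"
     by (rule prod.cong) (auto simp: e_def)
    thus ?thesis by simp
   qed
   thus ?thesis by (simp add: t_def L_def mult.commute)
  qed
  finally have sA: "sum t A = c (\<lambda>_. 0) + L v" by (simp add: t_def)
  have h2: "(t has_sum (f (a + v) - sum t A)) (UNIV - A)"
   by (rule has_sum_Diff[OF h1 has_sum_finite[OF finA]]) simp
  have abs: "(\<lambda>\<alpha>. norm (t \<alpha>)) summable_on (UNIV - A)"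
   using has_sum_imp_summable[OF h2] summable_on_iff_abs_summable_on_complex by blast
  have "norm (f (a + v) - sum t A) \<le> (\<Sum>\<^sub>\<infinity>\<alpha>\<in>UNIV - A. norm (t \<alpha>))"
   using norm_infsum_bound[OF abs] infsumI[OF h2] by simp
  also have "\<dots> \<le> (\<Sum>\<^sub>\<infinity>\<alpha>\<in>UNIV. ((norm v)\<^sup>2 / \<rho>\<^sup>2) * (norm (c \<alpha>) * \<rho> ^ (\<Sum>i\<in>UNIV. \<alpha> i)))"
  proof (rule infsum_mono_neutral[OF abs summable_on_cmult_right[OF sm]])
   fix \<alpha> assume "\<alpha> \<in> (UNIV - A) \<inter> UNIV"
   hence d: "(\<Sum>i\<in>UNIV. \<alpha> i) \<ge> 2" using deg by auto
   have "norm v ^ (\<Sum>i\<in>UNIV. \<alpha> i) = (norm v)\<^sup>2 * norm v ^ ((\<Sum>i\<in>UNIV. \<alpha> i) - 2)"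
    using d by (metis power_add le_add_diff_inverse)
   also have "\<dots> \<le> (norm v)\<^sup>2 * \<rho> ^ ((\<Sum>i\<in>UNIV. \<alpha> i) - 2)"
    using v by (intro mult_left_mono power_mono) auto
   also have "\<dots> = ((norm v)\<^sup>2 / \<rho>\<^sup>2) * \<rho> ^ (\<Sum>i\<in>UNIV. \<alpha> i)"
    using d \<rho> by (simp add: power_diff)
   finally have "norm v ^ (\<Sum>i\<in>UNIV. \<alpha> i) \<le> ((norm v)\<^sup>2 / \<rho>\<^sup>2) * \<rho> ^ (\<Sum>i\<in>UNIV. \<alpha> i)" .
   hence "norm (t \<alpha>) \<le> norm (c \<alpha>) * (((norm v)\<^sup>2 / \<rho>\<^sup>2) * \<rho> ^ (\<Sum>i\<in>UNIV. \<alpha> i))"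
    unfolding t_def norm_mult using norm_monomial_le[of v \<alpha>] by (intro mult_left_mono) auto
   thus "norm (t \<alpha>) \<le> ((norm v)\<^sup>2 / \<rho>\<^sup>2) * (norm (c \<alpha>) * \<rho> ^ (\<Sum>i\<in>UNIV. \<alpha> i))" by (simp add: mult_ac)
  qed (use \<rho> in auto)
  also have "\<dots> = ((norm v)\<^sup>2 / \<rho>\<^sup>2) * B" unfolding B_def by (rule infsum_cmult_right')
  finally show ?thesis by (simp add: sA algebra_simps)
 qed
 have f0: "f a = c (\<lambda>_. 0)" using rem[of 0] \<rho> by (simp add: L_def)
 have "(f has_derivative L) (at a)"
  by (rule quadratic_remainder_has_derivative[OF _ \<rho>, of _ _ _ "B / \<rho>\<^sup>2"])
   (use rem f0 in \<open>auto simp: L_def bounded_linear_sum_coord\<close>)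
 thus ?thesis by (simp add: L_def e_def)
qed

lemma mv_analytic_imp_hol: "mv_analytic_on f S \<Longrightarrow> hol f S"
proof (rule holI)
 fix x assume "mv_analytic_on f S" "x \<in> S"
 then obtain c where "has_power_series_at f x c" by (auto simp: mv_analytic_on_def)
 from power_series_has_derivative[OF this]
 show "\<exists>f'. (f has_derivative f') (at x) \<and> (\<forall>c v. f' (c *s v) = c * f' v)"
  by (intro exI conjI, assumption) (simp add: sum_distrib_left mult.assoc)
qed

text \<open>Cauchy's inequality on the circle of radius rho / 2 bounds the j-th Taylor coefficient
  by M * (2 / rho)^j. As 2 / rho is at most 1/2, the geometric tail is at most twice its first
  term.\<close>

lemma holomorphic_tail_bound:
 assumes "\<psi> holomorphic_on ball 0 \<rho>" "\<rho> \<ge> 4" "\<And>z. z \<in> ball 0 \<rho> \<Longrightarrow> norm (\<psi> z) \<le> M"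
 shows "norm (\<psi> 1 - (\<Sum>j<k. (deriv ^^ j) \<psi> 0 / fact j)) \<le> 2 * M * (2 / \<rho>) ^ k"
proof -
 define a where "a = (\<lambda>j. (deriv ^^ j) \<psi> 0 / fact j)"
 have s: "a sums \<psi> 1"
  using holomorphic_power_series[OF assms(1), of 1] assms(2) by (simp add: a_def)
 have M0: "M \<ge> 0" using assms(3)[of 0] assms(2) by (smt (verit) centre_in_ball norm_ge_zero)
 have bd: "norm (a j) \<le> M * (2 / \<rho>) ^ j" for j
 proof -
  have "norm ((deriv ^^ j) \<psi> 0) \<le> fact j * M / (\<rho> / 2) ^ j"
   by (rule Cauchy_inequality) (use assms in \<open>auto intro!: holomorphic_on_subset[OF assms(1)] continuous_on_subset[OF holomorphic_on_imp_continuous_on[OF assms(1)]]\<close>)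
  thus ?thesis by (simp add: a_def norm_divide field_simps)
 qed
 have q: "norm (2 / \<rho>) < 1" "2/\<rho> \<le> 1/2" "2/\<rho> \<ge> 0" using assms(2) by (auto simp: field_simps)
 have gs: "(\<lambda>j. M * (2/\<rho>)^(j + k)) sums (M * (2/\<rho>)^k * (1 / (1 - 2/\<rho>)))"
  using sums_mult[OF geometric_sums[OF q(1)], of "M * (2/\<rho>)^k"] by (simp add: power_add mult_ac)
 have t: "(\<lambda>j. a (j + k)) sums (\<psi> 1 - (\<Sum>j<k. a j))" using s sums_split_initial_segment by blast
 have sn: "summable (\<lambda>j. norm (a (j + k)))"
  by (rule summable_comparison_test[OF _ sums_summable[OF gs]]) (use bd in auto)
 have "norm (\<psi> 1 - (\<Sum>j<k. a j)) \<le> suminf (\<lambda>j. norm (a (j + k)))"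
  using summable_norm[OF sn] sums_unique[OF t] by simp
 also have "\<dots> \<le> suminf (\<lambda>j. M * (2/\<rho>)^(j + k))"
  by (rule suminf_le[OF _ sn sums_summable[OF gs]]) (rule bd)
 also have "\<dots> = M * (2/\<rho>)^k * (1 / (1 - 2/\<rho>))" using sums_unique[OF gs] by simp
 also have "\<dots> \<le> M * (2/\<rho>)^k * 2"
  using q M0 by (intro mult_left_mono mult_nonneg_nonneg) (auto simp: divide_simps)
 finally show ?thesis by (simp add: a_def mult_ac)
qed

text \<open>Cauchy's inequality on the complex line through x in direction v. Every radius below r /
  norm v is allowed, and the bound at that radius itself is obtained as a limit.\<close>

lemma dd_bound:
 assumes "hol f (ball x r)" "r > 0" "\<And>y. y \<in> ball x r \<Longrightarrow> norm (f y) \<le> M"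
 shows "norm (dd f x v) \<le> M / r * norm v"
proof (cases "v = 0")
 case True thus ?thesis by (simp add: dd_def)
next
 case False
 have *: "norm (dd f x v) \<le> M / s" if s: "0 < s" "s < r / norm v" for s
 proof -
  have in_b: "x + z *s v \<in> ball x r" if "z \<in> cball 0 s" for z
  proof -
   have "norm (z *s v) \<le> s * norm v" using that by (auto simp: norm_scale intro: mult_right_mono)
   also have "\<dots> < r" using s False by (simp add: field_simps)
   finally show ?thesis by (simp add: dist_norm)
  qed
  have h: "(\<lambda>z. f (x + z *s v)) holomorphic_on cball 0 s"
   by (rule hol_line_holomorphic[OF assms(1) in_b])
  have "norm ((deriv ^^ 1) (\<lambda>z. f (x + z *s v)) 0) \<le> fact 1 * M / s ^ 1"
   by (rule Cauchy_inequality) (use s h in_b assms(3) in \<open>auto intro: holomorphic_on_subset holomorphic_on_imp_continuous_on\<close>)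
  moreover have "deriv (\<lambda>z. f (x + z *s v)) 0 = dd f x v"
   using hol_line[OF assms(1), of x 0 v UNIV] assms(2) by (intro DERIV_imp_deriv) simp
  ultimately show ?thesis by simp
 qed
 have M0: "M \<ge> 0" using assms(3)[of x] assms(2) by (smt (verit) centre_in_ball norm_ge_zero)
 show ?thesis
 proof (rule field_le_mult_one_interval)
  fix z :: real assume z: "0 < z" "z < 1"
  have "norm (dd f x v) \<le> M / (z * (r / norm v))"
   by (rule *) (use z assms(2) False in \<open>auto simp: divide_strict_right_mono\<close>)
  hence "z * norm (dd f x v) \<le> z * (M / (z * (r / norm v)))" using z by (intro mult_left_mono) auto
  also have "\<dots> = M / r * norm v" using z False assms(2) by simp
  finally show "z * norm (dd f x v) \<le> M / r * norm v" .
 qed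
qed

text \<open>The line z -> x + z v stays in the ball for norm z < r / norm v, a radius of at least 4;
  the estimates are \<open>holomorphic_tail_bound\<close> with one and with two Taylor
  terms.\<close>

lemma hol_first_order:
 assumes "hol f (ball x r)" "r > 0" "\<And>y. y \<in> ball x r \<Longrightarrow> norm (f y) \<le> M" "4 * norm v \<le> r"
 shows "norm (f (x + v) - f x) \<le> 4 * M / r * norm v"
  and "norm (f (x + v) - f x - dd f x v) \<le> 8 * M / r\<^sup>2 * (norm v)\<^sup>2"
proof -
 have "norm (f (x + v) - f x) \<le> 4 * M / r * norm v \<and> norm (f (x + v) - f x - dd f x v) \<le> 8 * M / r\<^sup>2 * (norm v)\<^sup>2"
 proof (cases "v = 0")
  case True thus ?thesis by (simp add: dd_def)
 next
  case False
  define \<psi> where "\<psi> = (\<lambda>z. f (x + z *s v))"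
  have in_b: "x + z *s v \<in> ball x r" if "z \<in> ball 0 (r / norm v)" for z
  proof -
   have "norm (z *s v) < r" using that False by (auto simp: norm_scale field_simps)
   thus ?thesis by (simp add: dist_norm)
  qed
  have h: "\<psi> holomorphic_on ball 0 (r / norm v)"
   unfolding \<psi>_def by (rule hol_line_holomorphic[OF assms(1) in_b])
  have r4: "r / norm v \<ge> 4" using False assms(4) by (simp add: field_simps)
  have d: "deriv \<psi> 0 = dd f x v"
   unfolding \<psi>_def using hol_line[OF assms(1), of x 0 v UNIV] assms(2) by (intro DERIV_imp_deriv) simp
  have t: "norm (\<psi> 1 - (\<Sum>j<k. (deriv ^^ j) \<psi> 0 / fact j)) \<le> 2 * M * (2 / (r / norm v)) ^ k" for k
   by (rule holomorphic_tail_bound[OF h r4]) (use in_b assms(3) in \<open>auto simp: \<psi>_def\<close>)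
  from t[of 1] have 1: "norm (f (x + v) - f x) \<le> 4 * M / r * norm v" by (simp add: \<psi>_def)
  from t[of 2] have 2: "norm (f (x + v) - f x - dd f x v) \<le> 8 * M / r\<^sup>2 * (norm v)\<^sup>2"
   by (simp add: numeral_2_eq_2 d) (simp add: \<psi>_def power2_eq_square diff_diff_eq)
  from 1 2 show ?thesis ..
 qed
 thus "norm (f (x + v) - f x) \<le> 4 * M / r * norm v"
  and "norm (f (x + v) - f x - dd f x v) \<le> 8 * M / r\<^sup>2 * (norm v)\<^sup>2" by auto
qed

lemma hol_locally_bounded:
 assumes "hol f S" "open S" "x \<in> S"
 obtains r M where "r > 0" "ball x r \<subseteq> S" "\<And>y. y \<in> ball x r \<Longrightarrow> norm (f y) \<le> M" "M \<ge> 0"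
proof -
 have "continuous (at x) f" using has_derivative_continuous[OF holD[OF assms(1,3)]] .
 then obtain d where d: "d > 0" "\<And>y. dist y x < d \<Longrightarrow> dist (f y) (f x) < 1"
  unfolding continuous_at_eps_delta by (metis zero_less_one)
 obtain e where e: "e > 0" "ball x e \<subseteq> S" using assms open_contains_ball by metis
 show ?thesis
 proof (rule that[of "min d e" "norm (f x) + 1"])
  fix y assume "y \<in> ball x (min d e)"
  hence "dist (f y) (f x) < 1" using d(2)[of y] by (simp add: dist_commute[of y x])
  thus "norm (f y) \<le> norm (f x) + 1" by (smt (verit) dist_norm norm_triangle_ineq2)
 qed (use d e in auto)
qed

lemma hol_translate:
 fixes w :: "complex ^ 'n"
 assumes "hol f S" "\<And>u. u \<in> T \<Longrightarrow> u + w \<in> S"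
 shows "hol (\<lambda>u. f (u + w)) T" "\<And>u v. u \<in> T \<Longrightarrow> dd (\<lambda>u. f (u + w)) u v = dd f (u + w) v"
proof -
 have c: "hol (\<lambda>u. (u + w) $ i) T" for i
  by (simp add: hol_add hol_coord hol_const)
 show "hol (\<lambda>u. f (u + w)) T" using hol_compose(1)[of f S "\<lambda>u. u + w" T, OF assms(1) c assms(2)] by simp
 show "dd (\<lambda>u. f (u + w)) u v = dd f (u + w) v" if u: "u \<in> T" for u v
 proof -
  have "dd (\<lambda>u. (u + w) $ i) u v = v $ i" for i
   using dd_plus[OF hol_coord hol_const u, of i "w $ i" v] by simp
  hence "(\<chi> i. dd (\<lambda>u. (u + w) $ i) u v) = v" by (simp only: vec_eq_iff vec_lambda_beta) simp
  thus ?thesis using hol_compose(2)[of f S "\<lambda>u. u + w" T u v, OF assms(1) c assms(2) u] by metis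
 qed
qed

text \<open>\<open>dd_bound\<close> is applied to the difference of f and its translate by y - x.
  This function has size O(norm (y - x)), hence so does its derivative at x, which is the difference
  of the two derivatives of f.\<close>

lemma dd_continuous:
 assumes "hol f S" "open S" "x \<in> S"
 shows "isCont (\<lambda>y. dd f y v) x"
proof -
 obtain r M where r: "r > 0" "ball x r \<subseteq> S" and M: "\<And>y. y \<in> ball x r \<Longrightarrow> norm (f y) \<le> M" "M \<ge> 0"
  using hol_locally_bounded[OF assms] by blast
 have h: "hol f (ball x r)" using assms(1) r(2) hol_subset by blast
 define K where "K = (4 * M / (r/2)) / (r/4) * norm v"
 have est: "norm (dd f y v - dd f x v) \<le> K * norm (y - x)" if y: "norm (y - x) < r / 8" for y
 proof -
  define g where "g = (\<lambda>u. f (u + (y - x)) - f u)"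
  have sub: "u + (y - x) \<in> ball x r" "ball u (r/2) \<subseteq> ball x r" "u \<in> ball x r" if "u \<in> ball x (r/4)" for u
  proof -
   have "norm (u - x + (y - x)) \<le> norm (u - x) + norm (y - x)" by (rule norm_triangle_ineq)
   thus "u + (y - x) \<in> ball x r" using that y r(1) by (simp add: dist_norm norm_minus_commute algebra_simps)
   show "ball u (r/2) \<subseteq> ball x r" using that r(1) by (auto simp: dist_norm) (smt (verit) dist_norm dist_triangle_half_r field_sum_of_halves dist_triangle)
   show "u \<in> ball x r" using that r(1) by auto
  qed
  have hs: "hol (\<lambda>u. f (u + (y - x))) (ball x (r/4))" "\<And>u. u \<in> ball x (r/4) \<Longrightarrow> dd (\<lambda>u. f (u + (y - x))) u v = dd f (u + (y - x)) v"
   by (rule hol_translate[OF h sub(1)], assumption)+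
  have hf: "hol f (ball x (r/4))" by (rule hol_subset[OF h]) (use r(1) in auto)
  have hg: "hol g (ball x (r/4))" unfolding g_def by (rule hol_diff[OF hs(1) hf])
  have "norm (dd g x v) \<le> (4 * M / (r/2) * norm (y - x)) / (r/4) * norm v"
  proof (rule dd_bound[OF hg])
   fix u assume u: "u \<in> ball x (r/4)"
   show "norm (g u) \<le> 4 * M / (r/2) * norm (y - x)" unfolding g_def
    by (rule hol_first_order(1)) (use sub(2)[OF u] h M y r(1) in \<open>auto intro: hol_subset\<close>)
  qed (use r in auto)
  moreover have "dd g x v = dd f y v - dd f x v"
   unfolding g_def using dd_minus[OF hs(1) hf, of x v] hs(2)[of x] r(1) by simp
  ultimately show ?thesis by (simp add: K_def mult_ac)
 qed
 show ?thesis unfolding isCont_def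
 proof (rule LIM_zero_cancel, rule Lim_null_comparison)
  have "\<forall>\<^sub>F y in at x. y \<in> ball x (r/8)" using r(1) by (intro eventually_at_in_open') auto
  thus "\<forall>\<^sub>F y in at x. norm (dd f y v - dd f x v) \<le> K * norm (y - x)"
   by eventually_elim (use est in \<open>auto simp: dist_norm norm_minus_commute\<close>)
  have "((\<lambda>y. K * norm (y - x)) \<longlongrightarrow> K * norm (x - x)) (at x)" by (intro tendsto_intros)
  thus "((\<lambda>y. K * norm (y - x)) \<longlongrightarrow> 0) (at x)" by simp
 qed
qed

lemma dd_continuous_on:
 assumes "hol f S" "open S"
 shows "continuous_on S (\<lambda>y. dd f y v)"
 using dd_continuous[OF assms] by (intro continuous_at_imp_continuous_on) auto

text \<open>A Cauchy integral over the circle of radius delta in the complex line through x in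
  direction b. The kernel 1 / zeta^2 yields a directional derivative, the kernel 1 / zeta a value;
  the latter extends quotients across a level set in \<open>division\<close>.\<close>

definition circ where
 "circ f b \<delta> k x = contour_integral (circlepath 0 \<delta>) (\<lambda>\<zeta>. f (x + \<zeta> *s b) * k \<zeta>)"

lemma continuous_on_scale: "continuous_on A (\<lambda>\<zeta>::complex. x + \<zeta> *s (b::complex^'n))"
 by (intro continuous_intros linear_continuous_on bounded_linear_scale)

text \<open>Differentiation under the integral sign: a compact neighbourhood of the circle lies in
  S, so the quadratic Taylor remainder of f is uniform along the circle and can be
  integrated.\<close>

lemma circ_has_derivative:
 fixes f :: "complex ^ 'n \<Rightarrow> complex"
 assumes "open S" "hol f S" "\<delta> > 0" "continuous_on (sphere 0 \<delta>) k"
  and "\<And>\<zeta>. norm \<zeta> = \<delta> \<Longrightarrow> x0 + \<zeta> *s b \<in> S"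
 shows "(circ f b \<delta> k has_derivative (\<lambda>v. contour_integral (circlepath 0 \<delta>) (\<lambda>\<zeta>. dd f (x0 + \<zeta> *s b) v * k \<zeta>))) (at x0)"
proof -
 define C where "C = (\<lambda>\<zeta>. x0 + \<zeta> *s b) ` sphere 0 \<delta>"
 have C: "compact C" unfolding C_def by (intro compact_continuous_image continuous_on_scale) auto
 have "C \<subseteq> S" using assms(5) by (auto simp: C_def)
 from compact_subset_open_imp_cball_epsilon_subset[OF C assms(1) this]
 obtain e where e: "e > 0" "(\<Union>x\<in>C. cball x e) \<subseteq> S" by blast
 define T where "T = {x + y |x y. x \<in> C \<and> y \<in> cball 0 e}"
 have TS: "T \<subseteq> S"
 proof
  fix z assume "z \<in> T"
  then obtain x y where "z = x + y" "x \<in> C" "y \<in> cball 0 e" by (auto simp: T_def)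
  hence "z \<in> cball x e" by (simp add: dist_norm)
  thus "z \<in> S" using e \<open>x \<in> C\<close> by blast
 qed
 have "compact T" unfolding T_def by (intro compact_sums C) auto
 hence "compact (f ` T)"
  by (intro compact_continuous_image continuous_on_subset[OF hol_continuous[OF assms(2)] TS])
 then obtain M where M: "\<And>y. y \<in> T \<Longrightarrow> norm (f y) \<le> M" using compact_imp_bounded bounded_iff by (metis imageI)
 have "compact (k ` sphere 0 \<delta>)" by (intro compact_continuous_image assms(4)) auto
 then obtain K where K: "\<And>\<zeta>. norm \<zeta> = \<delta> \<Longrightarrow> norm (k \<zeta>) \<le> K" using compact_imp_bounded bounded_iff
  by (metis imageI mem_sphere_0)
 have bT: "ball c e \<subseteq> T" if "c \<in> C" for c
 proof
  fix y assume "y \<in> ball c e"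
  hence "y = c + (y - c)" "y - c \<in> cball 0 e" by (auto simp: dist_norm norm_minus_commute)
  thus "y \<in> T" unfolding T_def using that by blast
 qed
 have int1: "(\<lambda>\<zeta>. f (x0 + v + \<zeta> *s b) * k \<zeta>) contour_integrable_on circlepath 0 \<delta>" if v: "norm v \<le> e" for v :: "complex^'n"
 proof -
  have sub: "x0 + v + \<zeta> *s b \<in> S" if "\<zeta> \<in> sphere 0 \<delta>" for \<zeta>
  proof -
   have "x0 + v + \<zeta> *s b \<in> T" unfolding T_def
    by (rule CollectI, rule exI[of _ "x0 + \<zeta> *s b"], rule exI[of _ v]) (use that v in \<open>auto simp: C_def algebra_simps\<close>)
   thus ?thesis using TS by blast
  qed
  show ?thesis
   by (intro contour_integrable_continuous_circlepath continuous_on_mult continuous_on_compose2[OF hol_continuous[OF assms(2)] continuous_on_scale])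
    (use sub assms(3,4) in \<open>auto simp: sphere_def dist_norm\<close>)
 qed
 have int2: "(\<lambda>\<zeta>. dd f (x0 + \<zeta> *s b) v * k \<zeta>) contour_integrable_on circlepath 0 \<delta>" for v
  by (intro contour_integrable_continuous_circlepath continuous_on_mult continuous_on_compose2[OF dd_continuous_on[OF assms(2,1)] continuous_on_scale])
    (use assms(3-5) in \<open>auto simp: sphere_def dist_norm\<close>)
 let ?L = "\<lambda>v. contour_integral (circlepath 0 \<delta>) (\<lambda>\<zeta>. dd f (x0 + \<zeta> *s b) v * k \<zeta>)"
 show ?thesis
 proof (rule quadratic_remainder_has_derivative[where r = "e / 4" and K = "8 * M / e\<^sup>2 * K * (2 * pi * \<delta>)"])
  have "?L = (\<lambda>v. \<Sum>i\<in>UNIV. v $ i * ?L (axis i 1))"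
  proof
   fix v
   have "?L v = contour_integral (circlepath 0 \<delta>) (\<lambda>\<zeta>. \<Sum>i\<in>UNIV. v $ i * (dd f (x0 + \<zeta> *s b) (axis i 1) * k \<zeta>))"
    by (simp add: dd_def[of _ _ v] sum_distrib_left sum_distrib_right mult_ac)
   also have "\<dots> = (\<Sum>i\<in>UNIV. contour_integral (circlepath 0 \<delta>) (\<lambda>\<zeta>. v $ i * (dd f (x0 + \<zeta> *s b) (axis i 1) * k \<zeta>)))"
    by (intro contour_integral_sum contour_integrable_lmul int2) auto
   finally show "?L v = (\<Sum>i\<in>UNIV. v $ i * ?L (axis i 1))"
    by (subst (asm) contour_integral_lmul[OF int2])
  qed
  thus "bounded_linear ?L" by (metis (no_types) bounded_linear_sum_coord)
 next
  fix v :: "complex^'n" assume v: "norm v < e / 4"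
  have v': "norm v \<le> e" using v e by linarith
  have hc: "((\<lambda>\<zeta>. f (x0 + v + \<zeta> *s b) * k \<zeta> - f (x0 + 0 + \<zeta> *s b) * k \<zeta> - dd f (x0 + \<zeta> *s b) v * k \<zeta>) has_contour_integral
    (circ f b \<delta> k (x0 + v) - circ f b \<delta> k (x0 + 0) - ?L v)) (circlepath 0 \<delta>)"
   unfolding circ_def
   by (intro has_contour_integral_diff has_contour_integral_integral int1 int2 v') (use e in auto)
  have "norm (circ f b \<delta> k (x0 + v) - circ f b \<delta> k (x0 + 0) - ?L v) \<le> (8 * M / e\<^sup>2 * (norm v)\<^sup>2 * K) * (2 * pi * \<delta>)"
  proof (rule has_contour_integral_bound_circlepath[OF hc _ assms(3)])
   fix \<zeta> :: complex assume z: "norm (\<zeta> - 0) = \<delta>"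
   define c where "c = x0 + \<zeta> *s b"
   have c: "c \<in> C" using z by (auto simp: C_def c_def)
   have b: "norm (f (c + v) - f c - dd f c v) \<le> 8 * M / e\<^sup>2 * (norm v)\<^sup>2"
    by (rule hol_first_order(2)) (use hol_subset[OF assms(2)] bT[OF c] TS M e v in auto)
   have "norm (f (x0 + v + \<zeta> *s b) * k \<zeta> - f (x0 + 0 + \<zeta> *s b) * k \<zeta> - dd f (x0 + \<zeta> *s b) v * k \<zeta>) = norm (f (c + v) - f c - dd f c v) * norm (k \<zeta>)"
    by (simp add: c_def norm_mult[symmetric] algebra_simps)
   also have "\<dots> \<le> 8 * M / e\<^sup>2 * (norm v)\<^sup>2 * K"
    by (rule mult_mono[OF b K]) (use z b in \<open>auto intro: order_trans[OF norm_ge_zero]\<close>)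
   finally show "norm (f (x0 + v + \<zeta> *s b) * k \<zeta> - f (x0 + 0 + \<zeta> *s b) * k \<zeta> - dd f (x0 + \<zeta> *s b) v * k \<zeta>) \<le> 8 * M / e\<^sup>2 * (norm v)\<^sup>2 * K" .
  next
   have "norm (of_real \<delta> :: complex) = \<delta>" using assms(3) by simp
   hence "K \<ge> 0" "x0 + of_real \<delta> *s b \<in> C" using K[of "of_real \<delta>"] by (auto simp: C_def intro: order_trans[OF norm_ge_zero])
   moreover from this(2) have "M \<ge> 0" using bT M e(1) by (meson centre_in_ball norm_ge_zero order_trans subsetD)
   ultimately show "0 \<le> 8 * M / e\<^sup>2 * (norm v)\<^sup>2 * K" by simp
  qed
  thus "norm (circ f b \<delta> k (x0 + v) - circ f b \<delta> k x0 - ?L v) \<le> 8 * M / e\<^sup>2 * K * (2 * pi * \<delta>) * (norm v)\<^sup>2"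
   by (simp add: mult_ac)
 qed (use e in auto)
qed

lemma circ_hol:
 fixes f :: "complex ^ 'n \<Rightarrow> complex"
 assumes "open S" "hol f S" "\<delta> > 0" "continuous_on (sphere 0 \<delta>) k"
  and "\<And>x \<zeta>. x \<in> T \<Longrightarrow> norm \<zeta> = \<delta> \<Longrightarrow> x + \<zeta> *s b \<in> S"
 shows "hol (circ f b \<delta> k) T"
  and "\<And>x v. x \<in> T \<Longrightarrow> dd (circ f b \<delta> k) x v = circ (\<lambda>y. dd f y v) b \<delta> k x"
proof -
 have *: "(circ f b \<delta> k has_derivative (\<lambda>v. circ (\<lambda>y. dd f y v) b \<delta> k x)) (at x)" if "x \<in> T" for x
  using circ_has_derivative[OF assms(1-4) assms(5)[OF that]] by (simp add: circ_def)
 have int: "(\<lambda>\<zeta>. dd f (x + \<zeta> *s b) v * k \<zeta>) contour_integrable_on circlepath 0 \<delta>" if "x \<in> T" for x v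
  by (intro contour_integrable_continuous_circlepath continuous_on_mult continuous_on_compose2[OF dd_continuous_on[OF assms(2,1)] continuous_on_scale])
    (use assms(3-4) assms(5)[OF that] in \<open>auto simp: sphere_def dist_norm\<close>)
 have lin: "circ (\<lambda>y. dd f y (c *s v)) b \<delta> k x = c * circ (\<lambda>y. dd f y v) b \<delta> k x" if "x \<in> T" for c v x
  unfolding circ_def dd_scale mult.assoc by (rule contour_integral_lmul[OF int[OF that]])
 show "hol (circ f b \<delta> k) T" using * lin by (intro holI exI conjI allI)
 show "dd (circ f b \<delta> k) x v = circ (\<lambda>y. dd f y v) b \<delta> k x" if "x \<in> T" for x v
  using dd_eq[OF *[OF that] lin[OF that]] by metis
qed

lemma dd_circ:
 fixes f :: "complex ^ 'n \<Rightarrow> complex"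
 assumes "hol f S" "\<delta> > 0" "\<And>\<zeta>. norm \<zeta> \<le> \<delta> \<Longrightarrow> x + \<zeta> *s b \<in> S"
 shows "dd f x b = 1 / (2 * of_real pi * \<i>) * circ f b \<delta> (\<lambda>\<zeta>. 1 / \<zeta>\<^sup>2) x"
proof -
 have h: "(\<lambda>z. f (x + z *s b)) holomorphic_on cball 0 \<delta>"
  by (rule hol_line_holomorphic[OF assms(1)]) (use assms(3) in auto)
 have "((\<lambda>z. f (x + z *s b)) has_field_derivative (1 / (2 * of_real pi * \<i>) * contour_integral(circlepath 0 \<delta>) (\<lambda>u. f (x + u *s b) / (u-0)^2))) (at 0)"
  by (rule Cauchy_derivative_integral_circlepath(2))
   (use h assms(2) in \<open>auto intro: holomorphic_on_subset holomorphic_on_imp_continuous_on\<close>)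
 moreover have "((\<lambda>z. f (x + z *s b)) has_field_derivative dd f x b) (at 0)"
  using hol_line[OF assms(1), of x 0 b UNIV] assms(3)[of 0] assms(2) by simp
 ultimately have "dd f x b = (1 / (2 * of_real pi * \<i>) * contour_integral(circlepath 0 \<delta>) (\<lambda>u. f (x + u *s b) / (u-0)^2))"
  by (rule DERIV_unique[rotated])
 thus ?thesis by (simp add: circ_def)
qed

text \<open>Locally a directional derivative is a Cauchy integral of f itself, hence holomorphic.
  Its own derivative in direction v is the same integral of \<open>dd f y v\<close>, which prepares
  the symmetry of second derivatives.\<close>

lemma hol_dd_aux:
 fixes f :: "complex ^ 'n \<Rightarrow> complex"
 assumes "open S" "hol f S" "x \<in> S"
 obtains \<epsilon> where "\<epsilon> > 0" "ball x \<epsilon> \<subseteq> S" "hol (\<lambda>y. dd f y b) (ball x \<epsilon>)"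
  "\<And>v. dd (\<lambda>y. dd f y b) x v = 1 / (2 * of_real pi * \<i>) * circ (\<lambda>y. dd f y v) b \<epsilon> (\<lambda>\<zeta>. 1 / \<zeta>\<^sup>2) x"
  "\<And>\<zeta>. norm \<zeta> \<le> \<epsilon> \<Longrightarrow> x + \<zeta> *s b \<in> S"
proof -
 obtain e where e: "e > 0" "ball x e \<subseteq> S" using assms open_contains_ball by metis
 define \<epsilon> where "\<epsilon> = e / (2 + norm b)"
 have pos: "2 + norm b > 0" by (simp add: add_pos_nonneg)
 have \<epsilon>: "\<epsilon> > 0" "\<epsilon> * (1 + norm b) < e" "\<epsilon> \<le> e" using e pos by (auto simp: \<epsilon>_def field_simps)
 have sub: "y + \<zeta> *s b \<in> S" if "y \<in> ball x \<epsilon>" "norm \<zeta> \<le> \<epsilon>" for y \<zeta>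
 proof -
  have "norm (y + \<zeta> *s b - x) \<le> norm (y - x) + norm (\<zeta> *s b)"
   by (metis add_diff_eq add.commute diff_add_eq norm_triangle_ineq)
  also have "\<dots> \<le> \<epsilon> + \<epsilon> * norm b" using that by (intro add_mono) (auto simp: norm_scale dist_norm norm_minus_commute intro: mult_right_mono)
  also have "\<dots> < e" using \<epsilon> by (simp add: algebra_simps)
  finally show ?thesis using e(2) by (auto simp: dist_norm norm_minus_commute)
 qed
 have k: "continuous_on (sphere 0 \<epsilon>) (\<lambda>\<zeta>::complex. 1 / \<zeta>\<^sup>2)"
  by (intro continuous_intros) (use \<epsilon> in auto)
 note c = circ_hol[OF assms(1,2) \<epsilon>(1) k, of "ball x \<epsilon>" b]
 have hc: "hol (circ f b \<epsilon> (\<lambda>\<zeta>. 1 / \<zeta>\<^sup>2)) (ball x \<epsilon>)" by (rule c) (use sub in auto)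
 have dc: "dd (circ f b \<epsilon> (\<lambda>\<zeta>. 1 / \<zeta>\<^sup>2)) x v = circ (\<lambda>y. dd f y v) b \<epsilon> (\<lambda>\<zeta>. 1 / \<zeta>\<^sup>2) x" for v
  by (rule c(2)) (use sub \<epsilon> in auto)
 have eq: "dd f y b = 1 / (2 * of_real pi * \<i>) * circ f b \<epsilon> (\<lambda>\<zeta>. 1 / \<zeta>\<^sup>2) y" if "y \<in> ball x \<epsilon>" for y
  by (rule dd_circ[OF assms(2) \<epsilon>(1) sub[OF that]])
 note t = hol_transform[OF hol_cmult[OF hc, of "1 / (2 * of_real pi * \<i>)"] open_ball eq]
 show ?thesis
 proof (rule that[OF \<epsilon>(1)])
  show "ball x \<epsilon> \<subseteq> S" using \<epsilon> e by (auto simp: subset_iff)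
  show "hol (\<lambda>y. dd f y b) (ball x \<epsilon>)" by (rule t(1))
  show "dd (\<lambda>y. dd f y b) x v = 1 / (2 * of_real pi * \<i>) * circ (\<lambda>y. dd f y v) b \<epsilon> (\<lambda>\<zeta>. 1 / \<zeta>\<^sup>2) x" for v
   using t(2)[of x v] dd_cmult[OF hc, of x "1 / (2 * of_real pi * \<i>)" v] dc[of v] \<epsilon>(1) by simp
  show "\<And>\<zeta>. norm \<zeta> \<le> \<epsilon> \<Longrightarrow> x + \<zeta> *s b \<in> S" using sub[of x] \<epsilon>(1) by simp
 qed
qed

lemma hol_dd:
 fixes f :: "complex ^ 'n \<Rightarrow> complex"
 assumes "open S" "hol f S"
 shows "hol (\<lambda>y. dd f y b) S"
 unfolding hol_def
proof
 fix x assume "x \<in> S"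
 from hol_dd_aux[OF assms this] obtain \<epsilon> where "\<epsilon> > 0" "hol (\<lambda>y. dd f y b) (ball x \<epsilon>)" by metis
 thus "((\<lambda>y. dd f y b) has_derivative dd (\<lambda>y. dd f y b) x) (at x)" by (simp add: hol_def)
qed

lemma hol_pdiff: "open S \<Longrightarrow> hol f S \<Longrightarrow> hol (pdiff i f) S"
 using hol_dd[of S f "axis i 1"] by simp

text \<open>Differentiating the Cauchy integral for direction b along a gives the Cauchy integral of
  \<open>dd f y a\<close>, and this is the derivative of \<open>dd f y a\<close> in direction
  b.\<close>

lemma dd_commute:
 fixes f :: "complex ^ 'n \<Rightarrow> complex"
 assumes "open S" "hol f S" "x \<in> S"
 shows "dd (\<lambda>y. dd f y a) x b = dd (\<lambda>y. dd f y b) x a"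
proof -
 obtain \<epsilon> where \<epsilon>: "\<epsilon> > 0" and 1: "\<And>v. dd (\<lambda>y. dd f y b) x v = 1 / (2 * of_real pi * \<i>) * circ (\<lambda>y. dd f y v) b \<epsilon> (\<lambda>\<zeta>. 1 / \<zeta>\<^sup>2) x"
  and sub: "\<And>\<zeta>. norm \<zeta> \<le> \<epsilon> \<Longrightarrow> x + \<zeta> *s b \<in> S"
  using hol_dd_aux[OF assms] by metis
 show ?thesis unfolding 1[of a] by (rule dd_circ[OF hol_dd[OF assms(1,2)] \<epsilon> sub])
qed

section \<open>Periodic and almost periodic functions of one variable\<close>

text \<open>The plane minus a closed cone of half-angle pi/4 opening in direction sigma. As pi/4
  exceeds theta, for large R the set lies in \<open>Dminus\<close> if sigma = 1 and in
  \<open>Dplus\<close> if sigma = -1. It is stable under real shifts against sigma and contains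
  every vertical strip at large |Im tau|.\<close>

definition Lset :: "real \<Rightarrow> real \<Rightarrow> complex set" where
 "Lset \<sigma> R = {\<tau>. \<sigma> * Re \<tau> < \<bar>Im \<tau>\<bar> - R}"

lemma open_Lset: "open (Lset \<sigma> R)"
 unfolding Lset_def by (intro open_Collect_less continuous_intros)

lemma Lset_shift_left: "\<tau> \<in> Lset 1 R \<Longrightarrow> t \<ge> 0 \<Longrightarrow> \<tau> - of_real t \<in> Lset 1 R"
 by (simp add: Lset_def)

text \<open>Shifting left by multiples of 2 pi continues g to an entire periodic function. Its
  growth is polynomial at both ends of a period strip, so it is a polynomial, and a polynomial that
  takes one value infinitely often is constant.\<close>

lemma periodic_holomorphic_const_left:
 assumes hol: "g holomorphic_on Lset 1 R"
  and per: "\<And>\<tau>. \<tau> \<in> Lset 1 R \<Longrightarrow> g (\<tau> - of_real (2 * pi)) = g \<tau>"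
  and bd: "\<And>\<tau>. \<bar>Re \<tau>\<bar> \<le> 7 \<Longrightarrow> \<bar>Im \<tau>\<bar> \<ge> Y \<Longrightarrow> norm (g \<tau>) \<le> B * \<bar>Im \<tau>\<bar> ^ m"
 obtains c where "\<And>\<tau>. \<tau> \<in> Lset 1 R \<Longrightarrow> g \<tau> = c"
proof -
 define Y' where "Y' = max Y (max 1 (\<bar>R\<bar> + 8))"
 define sh where "sh = (\<lambda>n::nat. of_real (2 * pi * real n) :: complex)"
 have sh_in: "\<tau> - sh n \<in> Lset 1 R" if "\<tau> \<in> Lset 1 R" for \<tau> n
  unfolding sh_def by (rule Lset_shift_left[OF that]) simp
 have gsh: "g (\<tau> - sh n) = g \<tau>" if "\<tau> \<in> Lset 1 R" for \<tau> n
 proof (induction n)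
  case (Suc n)
  have "\<tau> - sh (Suc n) = (\<tau> - sh n) - of_real (2 * pi)" by (simp add: sh_def algebra_simps)
  thus ?case using per[OF sh_in[OF that, of n]] Suc by metis
 qed (simp add: sh_def)
 define N where "N = (\<lambda>\<tau>. nat \<lceil>\<bar>Re \<tau>\<bar> + \<bar>R\<bar> + 1\<rceil>)"
 have N: "real (N \<tau>) \<ge> \<bar>Re \<tau>\<bar> + \<bar>R\<bar> + 1" for \<tau> unfolding N_def by linarith
 have pi1: "2 * pi * real n \<ge> real n" for n using pi_gt3 by (simp add: mult_le_cancel_right1)
 have in_L: "\<tau> - sh n \<in> Lset 1 R" if "real n \<ge> \<bar>Re \<tau>\<bar> + \<bar>R\<bar> + 1" for n \<tau>
  unfolding Lset_def sh_def using that pi1[of n] by simp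
 \<comment> \<open>The number of shifts depends on tau, but \<open>Geq\<close> shows that every
   admissible number gives the same value; near a given point one shift serves for all, so
   \<open>G\<close> is holomorphic.\<close>
 define G where "G = (\<lambda>\<tau>. g (\<tau> - sh (N \<tau>)))"
 have Geq: "G \<tau> = g (\<tau> - sh n)" if "\<tau> - sh n \<in> Lset 1 R" for \<tau> n
 proof (cases "n \<le> N \<tau>")
  case True
  have "\<tau> - sh (N \<tau>) = (\<tau> - sh n) - sh (N \<tau> - n)" using True by (simp add: sh_def of_nat_diff algebra_simps)
  thus ?thesis using gsh[OF that, of "N \<tau> - n"] unfolding G_def by metis
 next
  case False
  hence "\<tau> - sh n = (\<tau> - sh (N \<tau>)) - sh (n - N \<tau>)" by (simp add: sh_def of_nat_diff algebra_simps)
  thus ?thesis using gsh[OF in_L[OF N], of \<tau> "n - N \<tau>"] unfolding G_def by metis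
 qed
 have Gg: "G \<tau> = g \<tau>" if "\<tau> \<in> Lset 1 R" for \<tau> using Geq[of \<tau> 0] that by (simp add: sh_def)
 have Gper: "G (\<tau> + sh n) = G \<tau>" for \<tau> n
 proof -
  define k where "k = N \<tau>"
  have "\<tau> + sh n - sh (k + n) = \<tau> - sh k" by (simp add: sh_def algebra_simps)
  moreover have "\<tau> - sh k \<in> Lset 1 R" using in_L[OF N[of \<tau>]] by (simp add: k_def)
  ultimately show ?thesis using Geq[of "\<tau> + sh n" "k + n"] Geq[of \<tau> k] by metis
 qed
 have Ghol: "G holomorphic_on UNIV"
 proof (subst holomorphic_on_open)
  show "\<forall>z\<in>UNIV. \<exists>f'. (G has_field_derivative f') (at z)"
  proof
   fix z :: complex
   define n where "n = N z + 1"
   have sub: "w - sh n \<in> Lset 1 R" if "w \<in> ball z 1" for w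
   proof (rule in_L)
    have "\<bar>Re w - Re z\<bar> \<le> norm (w - z)" using abs_Re_le_cmod[of "w - z"] by simp
    hence "\<bar>Re w - Re z\<bar> < 1" using that by (simp add: dist_norm norm_minus_commute)
    thus "real n \<ge> \<bar>Re w\<bar> + \<bar>R\<bar> + 1" unfolding n_def using N[of z] by simp
   qed
   have "(\<lambda>w. g (w - sh n)) holomorphic_on ball z 1"
    using holomorphic_on_compose_gen[of "\<lambda>w. w - sh n" "ball z 1" g "Lset 1 R", OF holomorphic_on_diff[OF holomorphic_on_ident holomorphic_on_const] hol] sub
    by (simp add: comp_def image_subset_iff)
   hence "G holomorphic_on ball z 1" by (rule holomorphic_transform) (rule Geq[OF sub, symmetric])
   thus "\<exists>f'. (G has_field_derivative f') (at z)" by (metis centre_in_ball holomorphic_on_open open_ball zero_less_one)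
  qed
 qed simp
 have "compact (cbox (Complex (-7) (-Y')) (Complex 7 Y'))" by simp
 hence "compact (G ` cbox (Complex (-7) (-Y')) (Complex 7 Y'))"
  by (intro compact_continuous_image continuous_on_subset[OF holomorphic_on_imp_continuous_on[OF Ghol]]) auto
 then obtain B2 where B2: "\<And>z. \<bar>Re z\<bar> \<le> 7 \<Longrightarrow> \<bar>Im z\<bar> \<le> Y' \<Longrightarrow> norm (G z) \<le> B2"
 proof -
  assume "compact (G ` cbox (Complex (-7) (-Y')) (Complex 7 Y'))"
  then obtain B2 where "\<forall>x\<in>G ` cbox (Complex (-7) (-Y')) (Complex 7 Y'). norm x \<le> B2"
   using compact_imp_bounded bounded_iff by metis
  hence "norm (G z) \<le> B2" if "\<bar>Re z\<bar> \<le> 7" "\<bar>Im z\<bar> \<le> Y'" for z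
   using that by (auto simp: in_cbox_complex_iff abs_le_iff)
  thus ?thesis using that by blast
 qed
 have strip: "\<exists>w. \<bar>Re w\<bar> \<le> 7 \<and> Im w = Im z \<and> G w = G z" for z
 proof -
  define k where "k = \<lfloor>Re z / (2 * pi)\<rfloor>"
  define w where "w = z - of_real (2 * pi * of_int k)"
  have "Re z / (2 * pi) - 1 < of_int k" "of_int k \<le> Re z / (2 * pi)" unfolding k_def by linarith+
  hence "0 \<le> Re w" "Re w \<le> 2 * pi" by (auto simp: w_def field_simps)
  moreover have "2 * pi \<le> 7" using pi_approx by simp
  moreover have "G w = G z"
  proof (cases "k \<ge> 0")
   case True
   hence "z = w + sh (nat k)" by (simp add: w_def sh_def)
   thus ?thesis using Gper by metis
  next
   case False
   hence "w = z + sh (nat (-k))" by (simp add: w_def sh_def)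
   thus ?thesis using Gper by metis
  qed
  ultimately show ?thesis by (intro exI[of _ w]) (auto simp: w_def)
 qed
 have growth: "norm (G z) \<le> max B B2 * norm z ^ m" if z: "norm z \<ge> 1" for z
 proof -
  obtain w where w: "\<bar>Re w\<bar> \<le> 7" "Im w = Im z" "G w = G z" using strip by blast
  show ?thesis
  proof (cases "\<bar>Im z\<bar> \<ge> Y'")
   case True
   hence "w \<in> Lset 1 R" using w by (auto simp: Lset_def Y'_def)
   hence "norm (G z) \<le> B * \<bar>Im z\<bar> ^ m" using bd[of w] w True Gg[of w] by (simp add: Y'_def)
   from this have "B \<ge> 0"
   proof -
    have "0 \<le> B * \<bar>Im z\<bar> ^ m" using \<open>norm (G z) \<le> _\<close> by (rule order_trans[OF norm_ge_zero])
    moreover have "\<bar>Im z\<bar> ^ m > 0" using True by (auto simp: Y'_def)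
    ultimately show ?thesis by (simp add: zero_le_mult_iff)
   qed
   note B0 = this
   have "norm (G z) \<le> B * \<bar>Im z\<bar> ^ m" by fact
   also have "\<dots> \<le> B * norm z ^ m" using B0 by (intro mult_left_mono power_mono abs_Im_le_cmod) auto
   also have "\<dots> \<le> max B B2 * norm z ^ m" by (intro mult_right_mono) auto
   finally show ?thesis .
  next
   case False
   hence "norm (G z) \<le> B2" using B2[of w] w by simp
   then have "B2 \<ge> 0" using norm_ge_zero order_trans by blast
   have "norm (G z) \<le> B2 * 1" using \<open>norm (G z) \<le> B2\<close> by simp
   also have "\<dots> \<le> B2 * norm z ^ m" using z \<open>B2 \<ge> 0\<close> by (intro mult_left_mono) auto
   also have "\<dots> \<le> max B B2 * norm z ^ m" by (intro mult_right_mono) auto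
   finally show ?thesis .
  qed
 qed
 \<comment> \<open>The coefficients of G - G 0. The constant one is set to 0, because it is this
   difference that vanishes at all nonnegative multiples of 2 pi.\<close>
 define c where "c = (\<lambda>k. if k = 0 then 0 else (deriv ^^ k) G 0 / fact k)"
 have poly: "G z - G 0 = (\<Sum>k\<le>m. c k * z ^ k)" for z
 proof -
  have "G z = (\<Sum>k\<le>m. (deriv^^k) G 0 / fact k * z ^ k)"
   by (rule Liouville_polynomial[OF Ghol, of 1]) (use growth in auto)
  also have "\<dots> = G 0 + (\<Sum>k\<le>m. c k * z ^ k)"
   by (simp add: sum.atMost_shift c_def)
  finally show ?thesis by simp
 qed
 have "range sh \<subseteq> {x. (\<Sum>k\<le>m. c k * x ^ k) = 0}"
 proof
  fix x assume "x \<in> range sh"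
  then obtain n where "x = sh n" by auto
  hence "G x = G 0" using Gper[of 0 n] by simp
  thus "x \<in> {x. (\<Sum>k\<le>m. c k * x ^ k) = 0}" using poly[of x] by simp
 qed
 moreover have "inj sh" by (rule injI) (simp add: sh_def)
 hence "infinite (range sh)" using finite_imageD infinite_UNIV_nat by blast
 ultimately have "infinite {x. (\<Sum>k\<le>m. c k * x ^ k) = 0}" using infinite_super by blast
 hence "\<forall>i\<le>m. c i = 0" using polyfun_finite_roots[where c=c and n=m] by blast
 hence "G z = G 0" for z using poly[of z] by simp
 thus ?thesis using Gg that by metis
qed

lemma periodic_holomorphic_const:
 assumes \<sigma>: "\<sigma> = 1 \<or> \<sigma> = -1" and hol: "g holomorphic_on Lset \<sigma> R"
  and per: "\<And>\<tau>. \<tau> \<in> Lset \<sigma> R \<Longrightarrow> g (\<tau> - of_real (\<sigma> * (2 * pi))) = g \<tau>"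
  and bd: "\<And>\<tau>. \<bar>Re \<tau>\<bar> \<le> 7 \<Longrightarrow> \<bar>Im \<tau>\<bar> \<ge> Y \<Longrightarrow> norm (g \<tau>) \<le> B * \<bar>Im \<tau>\<bar> ^ m"
 obtains c where "\<And>\<tau>. \<tau> \<in> Lset \<sigma> R \<Longrightarrow> g \<tau> = c"
proof -
 have s2: "of_real \<sigma> * (of_real \<sigma> * \<tau>) = (\<tau>::complex)" for \<tau> using \<sigma> by auto
 have L: "of_real \<sigma> * \<tau> \<in> Lset \<sigma> R \<longleftrightarrow> \<tau> \<in> Lset 1 R" for \<tau> using \<sigma> by (auto simp: Lset_def)
 obtain c where c: "\<And>\<tau>. \<tau> \<in> Lset 1 R \<Longrightarrow> g (of_real \<sigma> * \<tau>) = c"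
 proof (rule periodic_holomorphic_const_left[of "\<lambda>\<tau>. g (of_real \<sigma> * \<tau>)" R Y B m])
  show "(\<lambda>\<tau>. g (of_real \<sigma> * \<tau>)) holomorphic_on Lset 1 R"
   using holomorphic_on_compose_gen[of "\<lambda>w. of_real \<sigma> * w" "Lset 1 R" g "Lset \<sigma> R", OF holomorphic_on_mult[OF holomorphic_on_const holomorphic_on_ident] hol] L
   by (simp add: comp_def image_subset_iff)
  show "g (of_real \<sigma> * (\<tau> - of_real (2 * pi))) = g (of_real \<sigma> * \<tau>)" if "\<tau> \<in> Lset 1 R" for \<tau>
   using per[of "of_real \<sigma> * \<tau>"] L that by (simp add: algebra_simps)
  show "norm (g (of_real \<sigma> * \<tau>)) \<le> B * \<bar>Im \<tau>\<bar> ^ m" if "\<bar>Re \<tau>\<bar> \<le> 7" "\<bar>Im \<tau>\<bar> \<ge> Y" for \<tau>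
   using bd[of "of_real \<sigma> * \<tau>"] that \<sigma> by auto
 qed blast
 show ?thesis
 proof (rule that[of c])
  fix \<tau> assume "\<tau> \<in> Lset \<sigma> R"
  hence "of_real \<sigma> * \<tau> \<in> Lset 1 R" using L[of "of_real \<sigma> * \<tau>"] s2 by simp
  from c[OF this] show "g \<tau> = c" using s2 by simp
 qed
qed

text \<open>psi is (exp (i w) - 1) / w without its removable singularity. Its freedom from zeros
  says that the periodic kernel 1 / (exp (i w) - 1) has only the simple pole 0 in |Re w| < 2
  pi.\<close>

lemma exp_kernel:
 obtains \<psi> where "\<psi> holomorphic_on UNIV" "\<psi> 0 = \<i>" "\<And>w. w * \<psi> w = exp (\<i> * w) - 1"
  "\<And>w. \<bar>Re w\<bar> < 2 * pi \<Longrightarrow> \<psi> w \<noteq> 0"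
proof -
 define E where "E = (\<lambda>w. exp (\<i> * w))"
 have dE: "(E has_field_derivative \<i>) (at 0)" unfolding E_def by (auto intro!: derivative_eq_intros)
 define \<psi> where "\<psi> = (\<lambda>z. if z = 0 then deriv E 0 else (E z - E 0) / (z - 0))"
 have h: "\<psi> holomorphic_on UNIV" unfolding \<psi>_def E_def
  by (rule pole_lemma) (auto intro!: holomorphic_intros)
 have 0: "\<psi> 0 = \<i>" using DERIV_imp_deriv[OF dE] by (simp add: \<psi>_def)
 have m: "w * \<psi> w = exp (\<i> * w) - 1" for w by (simp add: \<psi>_def E_def)
 have "\<psi> w \<noteq> 0" if w: "\<bar>Re w\<bar> < 2 * pi" for w
 proof (cases "w = 0")
  case False
  show ?thesis
  proof
   assume "\<psi> w = 0"
   hence "exp (\<i> * w) = 1" using m[of w] by simp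
   then obtain n :: int where n: "Im w = 0" "Re w = of_int (2 * n) * pi" by (auto simp: exp_eq_1)
   have "\<bar>of_int n\<bar> < (1::real)" using w unfolding n(2) by (simp add: abs_mult)
   hence "n = 0" by linarith
   thus False using n False complex_eq_iff by auto
  qed
 qed (use 0 in simp)
 thus ?thesis using that h 0 m by blast
qed

text \<open>Residue theorem on a rectangle of width 2 pi around tau, for f times a 2 pi-periodic
  kernel. Periodicity merges the two vertical sides into one integral of f (zeta + 2 pi) - f zeta,
  which is small when f is almost periodic.\<close>

lemma rectangle_formula:
 fixes f :: "complex \<Rightarrow> complex"
 assumes "f holomorphic_on S" "open S" "convex S" "cbox (Complex (Re \<tau> - pi) y1) (Complex (Re \<tau> + pi) y2) \<subseteq> S"
  "y1 < Im \<tau>" "Im \<tau> < y2"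
 shows "2 * pi * f \<tau> =
   contour_integral (linepath (Complex (Re \<tau> - pi) y1) (Complex (Re \<tau> + pi) y1)) (\<lambda>\<zeta>. f \<zeta> / (exp (\<i> * (\<zeta> - \<tau>)) - 1))
  - contour_integral (linepath (Complex (Re \<tau> - pi) y2) (Complex (Re \<tau> + pi) y2)) (\<lambda>\<zeta>. f \<zeta> / (exp (\<i> * (\<zeta> - \<tau>)) - 1))
  + contour_integral (linepath (Complex (Re \<tau> - pi) y1) (Complex (Re \<tau> - pi) y2)) (\<lambda>\<zeta>. (f (\<zeta> + 2 * pi) - f \<zeta>) / (exp (\<i> * (\<zeta> - \<tau>)) - 1))"
proof -
 obtain \<psi> where \<psi>: "\<psi> holomorphic_on UNIV" "\<psi> 0 = \<i>" "\<And>w. w * \<psi> w = exp (\<i> * w) - 1"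
  "\<And>w. \<bar>Re w\<bar> < 2 * pi \<Longrightarrow> \<psi> w \<noteq> 0" using exp_kernel by blast
 define a1 a2 a3 a4 where "a1 = Complex (Re \<tau> - pi) y1" and "a2 = Complex (Re \<tau> + pi) y1"
  and "a3 = Complex (Re \<tau> + pi) y2" and "a4 = Complex (Re \<tau> - pi) y2"
 note ad = a1_def a2_def a3_def a4_def
 define S' where "S' = S \<inter> {\<zeta>. Re \<zeta> > Re \<tau> - 2 * pi} \<inter> {\<zeta>. Re \<zeta> < Re \<tau> + 2 * pi}"
 have S': "open S'" "convex S'"
  unfolding S'_def by (intro open_Int convex_Int assms open_halfspace_Re_gt open_halfspace_Re_lt convex_halfspace_Re_gt convex_halfspace_Re_lt)+
 have sub: "cbox a1 a3 \<subseteq> S'" using assms(4) by (auto simp: S'_def ad in_cbox_complex_iff) (use pi_gt_zero in linarith)+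
 have nz: "\<psi> (\<zeta> - \<tau>) \<noteq> 0" if "\<zeta> \<in> S'" for \<zeta> by (rule \<psi>(4)) (use that in \<open>auto simp: S'_def abs_less_iff\<close>)
 \<comment> \<open>With the integrand written as h / (zeta - tau), Cauchy's formula applies, and h
   tau = f tau / i.\<close>
 define h where "h = (\<lambda>\<zeta>. f \<zeta> / \<psi> (\<zeta> - \<tau>))"
 have h: "h holomorphic_on S'"
 proof -
  have "(\<lambda>\<zeta>. \<psi> (\<zeta> - \<tau>)) holomorphic_on S'"
   using holomorphic_on_compose_gen[of "\<lambda>w. w - \<tau>" S' \<psi> UNIV, OF holomorphic_on_diff[OF holomorphic_on_ident holomorphic_on_const] \<psi>(1)] by (simp add: comp_def)
  moreover have "f holomorphic_on S'" using assms(1) by (rule holomorphic_on_subset) (auto simp: S'_def)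
  ultimately show ?thesis unfolding h_def using nz by (intro holomorphic_on_divide) auto
 qed
 have tau: "\<tau> \<in> box a1 a3" using assms(5,6) by (simp add: ad in_box_complex_iff)
 have pimg: "path_image (rectpath a1 a3) = cbox a1 a3 - box a1 a3"
  by (rule path_image_rectpath_cbox_minus_box) (use assms in \<open>auto simp: ad\<close>)
 have "((\<lambda>w. h w / (w - \<tau>)) has_contour_integral (2 * pi * \<i> * winding_number (rectpath a1 a3) \<tau> * h \<tau>)) (rectpath a1 a3)"
 proof (rule Cauchy_integral_formula_convex_simple[OF S'(2) h])
  show "\<tau> \<in> interior S'" using S'(1) sub tau box_subset_cbox by (auto simp: interior_open)
  show "path_image (rectpath a1 a3) \<subseteq> S' - {\<tau>}" using pimg sub tau by auto
  show "valid_path (rectpath a1 a3)" by (simp add: rectpath_def Let_def valid_path_join)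
 qed auto
 hence 1: "((\<lambda>w. h w / (w - \<tau>)) has_contour_integral (2 * pi * f \<tau>)) (rectpath a1 a3)"
 proof -
  have "2 * pi * \<i> * 1 * (f \<tau> / \<i>) = 2 * pi * f \<tau>" by simp
  thus ?thesis using \<open>((\<lambda>w. h w / (w - \<tau>)) has_contour_integral _) _\<close> unfolding winding_number_rectpath[OF tau]
   by (simp only: h_def \<psi>(2) diff_self)
 qed
 define g where "g = (\<lambda>\<zeta>. f \<zeta> / (exp (\<i> * (\<zeta> - \<tau>)) - 1))"
 have ge: "h w / (w - \<tau>) = g w" for w unfolding h_def g_def using \<psi>(3)[of "w - \<tau>"] by (simp add: mult.commute)
 have rp: "rectpath a1 a3 = linepath a1 a2 +++ linepath a2 a3 +++ linepath a3 a4 +++ linepath a4 a1"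
  by (simp add: rectpath_def Let_def ad)
 have gh: "continuous_on (S' - {\<tau>}) g"
 proof -
  have "continuous_on (S' - {\<tau>}) (\<lambda>w. h w / (w - \<tau>))"
   by (intro continuous_intros continuous_on_subset[OF holomorphic_on_imp_continuous_on[OF h]]) auto
  thus ?thesis by (simp add: ge)
 qed
 have segs: "closed_segment a1 a2 \<subseteq> S' - {\<tau>}" "closed_segment a2 a3 \<subseteq> S' - {\<tau>}"
   "closed_segment a3 a4 \<subseteq> S' - {\<tau>}" "closed_segment a4 a1 \<subseteq> S' - {\<tau>}"
  using pimg sub tau unfolding rp by (auto simp: path_image_join)
 have i: "g contour_integrable_on linepath u v" if "closed_segment u v \<subseteq> S' - {\<tau>}" for u v
  by (rule contour_integrable_continuous_linepath[OF continuous_on_subset[OF gh that]])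
 have "2 * pi * f \<tau> = contour_integral (rectpath a1 a3) g"
  using contour_integral_unique[OF 1] by (simp add: ge)
 also have "\<dots> = contour_integral (linepath a1 a2) g + contour_integral (linepath a2 a3) g
   + contour_integral (linepath a3 a4) g + contour_integral (linepath a4 a1) g"
  unfolding rp by (simp add: i segs contour_integrable_joinI valid_path_join)
 also have "contour_integral (linepath a3 a4) g = - contour_integral (linepath a4 a3) g"
  using contour_integral_reversepath[of "linepath a4 a3" g] by simp
 also have "contour_integral (linepath a4 a1) g = - contour_integral (linepath a1 a4) g"
  using contour_integral_reversepath[of "linepath a1 a4" g] by simp
 also have "contour_integral (linepath a2 a3) g = contour_integral (linepath a1 a4) (\<lambda>\<zeta>. g (\<zeta> + 2 * pi))"
 proof -
  have "(+) (complex_of_real (2 * pi)) \<circ> linepath a1 a4 = linepath a2 a3"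
   by (auto simp: linepath_def fun_eq_iff ad complex_eq_iff scaleR_conv_of_real algebra_simps)
  thus ?thesis using contour_integral_translate[of "of_real (2*pi)" "linepath a1 a4" g] by simp
 qed
 also have "\<dots> = contour_integral (linepath a1 a4) (\<lambda>\<zeta>. f (\<zeta> + 2 * pi) / (exp (\<i> * (\<zeta> - \<tau>)) - 1))"
 proof -
  have "exp (\<i> * (\<zeta> + 2 * pi - \<tau>)) = exp (\<i> * (\<zeta> - \<tau>))" for \<zeta> :: complex
  proof -
   have "\<i> * (\<zeta> + 2 * pi - \<tau>) = \<i> * (\<zeta> - \<tau>) + of_real (2 * pi) * \<i>" by (simp add: algebra_simps)
   thus ?thesis by (simp add: exp_add)
  qed
  thus ?thesis by (simp add: g_def)
 qed
 finally have 2: "2 * pi * f \<tau> = contour_integral (linepath a1 a2) g + contour_integral (linepath a1 a4) (\<lambda>\<zeta>. f (\<zeta> + 2 * pi) / (exp (\<i> * (\<zeta> - \<tau>)) - 1))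
   - contour_integral (linepath a4 a3) g - contour_integral (linepath a1 a4) g" by simp
 have i14: "g contour_integrable_on linepath a1 a4" using i[of a1 a4] segs(4) by (simp add: closed_segment_commute)
 have i23: "(\<lambda>\<zeta>. f (\<zeta> + 2 * pi) / (exp (\<i> * (\<zeta> - \<tau>)) - 1)) contour_integrable_on linepath a1 a4"
 proof -
  have "(+) (complex_of_real (2 * pi)) \<circ> linepath a1 a4 = linepath a2 a3"
   by (auto simp: linepath_def fun_eq_iff ad complex_eq_iff scaleR_conv_of_real algebra_simps)
  hence "(\<lambda>\<zeta>. g (\<zeta> + 2 * pi)) contour_integrable_on linepath a1 a4"
   using i[OF segs(2)] contour_integrable_translate[of g "of_real (2*pi)" "linepath a1 a4"] by simp
  moreover have "exp (\<i> * (\<zeta> + 2 * pi - \<tau>)) = exp (\<i> * (\<zeta> - \<tau>))" for \<zeta> :: complex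
  proof -
   have "\<i> * (\<zeta> + 2 * pi - \<tau>) = \<i> * (\<zeta> - \<tau>) + of_real (2 * pi) * \<i>" by (simp add: algebra_simps)
   thus ?thesis by (simp add: exp_add)
  qed
  ultimately show ?thesis by (simp add: g_def)
 qed
 have 3: "contour_integral (linepath a1 a4) (\<lambda>\<zeta>. (f (\<zeta> + 2 * pi) - f \<zeta>) / (exp (\<i> * (\<zeta> - \<tau>)) - 1))
   = contour_integral (linepath a1 a4) (\<lambda>\<zeta>. f (\<zeta> + 2 * pi) / (exp (\<i> * (\<zeta> - \<tau>)) - 1)) - contour_integral (linepath a1 a4) g"
  using contour_integral_diff[OF i23 i14] by (simp add: diff_divide_distrib g_def)
 have "2 * pi * f \<tau> = contour_integral (linepath a1 a2) g - contour_integral (linepath a4 a3) g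
   + contour_integral (linepath a1 a4) (\<lambda>\<zeta>. (f (\<zeta> + 2 * pi) - f \<zeta>) / (exp (\<i> * (\<zeta> - \<tau>)) - 1))"
  unfolding 3 2 by simp
 thus ?thesis unfolding g_def ad .
qed

lemma contour_integral_bound_linepath_weak:
 assumes "0 \<le> B" "\<And>x. x \<in> closed_segment a b \<Longrightarrow> norm (f x) \<le> B" "norm (b - a) \<le> l"
 shows "norm (contour_integral (linepath a b) f) \<le> B * l"
proof (cases "f contour_integrable_on linepath a b")
 case True
 from contour_integral_bound_linepath[OF this assms(1,2)]
 show ?thesis using mult_left_mono[OF assms(3,1)] by linarith
next
 case False
 have "l \<ge> 0" using assms(3) norm_ge_zero order_trans by blast
 thus ?thesis using False assms(1) by (simp add: not_integrable_contour_integral)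
qed

lemma power_shift_bound:
 fixes t L :: real
 assumes "L > 0" "t \<ge> 2 * real m * L" "t > L"
 shows "1 / (t - L) ^ m \<le> 2 / t ^ m"
proof -
 have "1 + real m * (- L / t) \<le> (1 + (- L / t)) ^ m"
  by (rule Bernoulli_inequality) (use assms in auto)
 moreover have "1 + real m * (- L / t) = 1 - real m * (L / t)" "1 + (- L / t) = (t - L) / t" using assms by (auto simp: diff_divide_distrib)
 moreover have "real m * (L / t) \<le> 1 / 2" using assms by (simp add: field_simps)
 ultimately have "1 / 2 \<le> ((t - L) / t) ^ m" by (metis (no_types, opaque_lifting) diff_left_mono field_sum_of_halves add_diff_cancel_right' order_trans)
 thus ?thesis using assms by (simp add: power_divide field_simps)
qed

text \<open>Decay faster than every power improves itself to exponential decay. Suppose |f| \<le> A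
  / (Im tau)^N on one period above Y. In a rectangle from height t - L to (1 + eta) t the bottom
  contributes about exp (-L), the top (1 + eta)^(-N), and the vertical side about eta, since the
  shift defect is O(1/t). So A improves to q * A above Y + L with q = exp (-(1 - eps) L), and
  iteration yields the rate 1 - eps.\<close>

lemma almost_periodic_decay:
 fixes f :: "'i::finite \<Rightarrow> complex \<Rightarrow> complex"
 assumes hol: "\<And>j. f j holomorphic_on {\<tau>. \<bar>Re \<tau>\<bar> < Im \<tau> - R}"
  and super: "\<And>N. \<exists>C Y. \<forall>j \<tau>. \<bar>Re \<tau>\<bar> \<le> 7 \<longrightarrow> Im \<tau> \<ge> Y \<longrightarrow> norm (f j \<tau>) \<le> C / Im \<tau> ^ N"
  and rec1: "\<And>j \<tau>. \<bar>Re \<tau>\<bar> \<le> 20 \<Longrightarrow> Im \<tau> \<ge> Y1 \<Longrightarrow> norm (f j (\<tau> + 2 * pi) - f j \<tau>) \<le> C / Im \<tau> * (\<Sum>l\<in>UNIV. norm (f l \<tau>))"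
  and rec2: "\<And>j \<tau>. \<bar>Re \<tau>\<bar> \<le> 20 \<Longrightarrow> Im \<tau> \<ge> Y1 \<Longrightarrow> norm (f j (\<tau> - 2 * pi) - f j \<tau>) \<le> C / Im \<tau> * (\<Sum>l\<in>UNIV. norm (f l \<tau>))"
  and C: "C > 0" and eps: "\<epsilon> > 0"
 obtains A Y where "A > 0" "\<And>j \<tau>. \<bar>Re \<tau>\<bar> \<le> 8 \<Longrightarrow> Im \<tau> \<ge> Y \<Longrightarrow> norm (f j \<tau>) \<le> A * exp (- (1 - \<epsilon>) * Im \<tau>)"
proof -
 define K where "K = C * real CARD('i)"
 have K: "K > 0" using C by (simp add: K_def)
 \<comment> \<open>\<open>L\<close>, then \<open>\<eta>\<close>, then \<open>N\<close> are chosen so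
   that each of the three kinds of sides contributes at most q / 3; the 24 makes 8 * exp (- L) \<le>
   q / 3.\<close>
 define L where "L = max 1 (ln 24 / \<epsilon>)"
 have L: "L \<ge> 1" "exp (\<epsilon> * L) \<ge> 24"
 proof -
  have "ln 24 \<le> \<epsilon> * L" unfolding L_def using eps by (simp add: max_def field_simps)
  thus "exp (\<epsilon> * L) \<ge> 24" by (metis exp_le_cancel_iff exp_ln zero_less_numeral)
 qed (simp add: L_def)
 define q where "q = exp (- (1 - \<epsilon>) * L)"
 have q: "q > 0" by (simp add: q_def)
 have q1: "8 * exp (- L) \<le> q / 3"
 proof -
  have "q = exp (- L) * exp (\<epsilon> * L)" by (simp add: q_def exp_add[symmetric] algebra_simps)
  also have "\<dots> \<ge> exp (- L) * 24" using L by (intro mult_left_mono) auto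
  finally show ?thesis by simp
 qed
 define \<eta> where "\<eta> = q / (6 * K)"
 have \<eta>: "\<eta> > 0" "2 * K * \<eta> \<le> q / 3" using q K by (auto simp: \<eta>_def)
 obtain N where "12 / q < (1 + \<eta>) ^ N" using real_arch_pow[of "1 + \<eta>" "12/q"] \<eta> by auto
 hence N: "4 / (1 + \<eta>) ^ N \<le> q / 3" using q \<eta> by (simp add: field_simps)
 obtain C0 Y2 where sup: "\<And>j \<tau>. \<bar>Re \<tau>\<bar> \<le> 7 \<Longrightarrow> Im \<tau> \<ge> Y2 \<Longrightarrow> norm (f j \<tau>) \<le> C0 / Im \<tau> ^ N"
  using super[of N] by blast
 define Y0 where "Y0 = Max {Y1, Y2, K, \<bar>R\<bar> + 40, 2 * real (N+1) * L, L + 1, L / \<eta>, 1 / \<eta>}"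
 have Y0: "Y0 \<ge> Y1" "Y0 \<ge> Y2" "Y0 \<ge> K" "Y0 \<ge> \<bar>R\<bar> + 40" "Y0 \<ge> 2 * real (N+1) * L" "Y0 \<ge> L + 1" "Y0 \<ge> L / \<eta>" "Y0 \<ge> 1 / \<eta>"
  unfolding Y0_def by (rule Max_ge; simp)+
 have pi7: "2 * pi \<le> 7" "3 < pi" using pi_approx by auto
 define P where "P = (\<lambda>A Y. \<forall>j \<tau>. 0 \<le> Re \<tau> \<longrightarrow> Re \<tau> \<le> 2 * pi \<longrightarrow> Im \<tau> \<ge> Y \<longrightarrow> norm (f j \<tau>) \<le> A / Im \<tau> ^ N)"
 have r: "norm (f j w) \<le> 2 * A" if "\<And>l. norm (f l \<tau>) \<le> A" "\<bar>Re \<tau>\<bar> \<le> 20" "Im \<tau> \<ge> Y0" "w = \<tau> + 2 * pi \<or> w = \<tau> - 2 * pi" for j \<tau> A w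
 proof -
  have "(\<Sum>l\<in>UNIV. norm (f l \<tau>)) \<le> real CARD('i) * A" using sum_bounded_above[of UNIV "\<lambda>l. norm (f l \<tau>)" A] that by simp
  hence "C / Im \<tau> * (\<Sum>l\<in>UNIV. norm (f l \<tau>)) \<le> C / Im \<tau> * (real CARD('i) * A)"
   using that(3) Y0 C by (intro mult_left_mono) auto
  also have "\<dots> = K / Im \<tau> * A" by (simp add: K_def)
  also have "\<dots> \<le> 1 * A" using that(3) Y0(3) K that(1)[of j] by (intro mult_right_mono) (auto intro: order_trans[OF norm_ge_zero])
  finally have "norm (f j w - f j \<tau>) \<le> A" using rec1[of \<tau> j] rec2[of \<tau> j] that(2-4) Y0(1) by auto
  moreover have "norm (f j w) \<le> norm (f j w - f j \<tau>) + norm (f j \<tau>)" by (metis diff_add_cancel norm_triangle_ineq)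
  ultimately show ?thesis using that(1)[of j] by simp
 qed
 \<comment> \<open>The induction keeps the bound only for Re tau between 0 and 2 pi. The rectangle
   around such a tau extends by pi on either side, and one application of the shift relation costs
   the factor 2.\<close>
 have ext: "norm (f j \<tau>) \<le> 2 * (A / Im \<tau> ^ N)" if "P A Y" "Y \<ge> Y0" "Re \<tau> \<ge> - 2 * pi" "Re \<tau> \<le> 4 * pi" "Im \<tau> \<ge> Y" for A Y j \<tau>
 proof -
  have A0: "A / Im \<tau> ^ N \<ge> 0" using that(1)[unfolded P_def, rule_format, of "Complex 0 (Im \<tau>)" j] that(5) by (auto intro: order_trans[OF norm_ge_zero])
  have Pd: "norm (f l z) \<le> A / Im z ^ N" if "0 \<le> Re z" "Re z \<le> 2 * pi" "Im z \<ge> Y" for l z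
   using \<open>P A Y\<close> that unfolding P_def by blast
  consider "Re \<tau> < 0" | "0 \<le> Re \<tau>" "Re \<tau> \<le> 2 * pi" | "Re \<tau> > 2 * pi" by linarith
  thus ?thesis
  proof cases
   case 1
   have "norm (f j ((\<tau> + 2 * pi) - 2 * pi)) \<le> 2 * (A / Im (\<tau> + 2 * pi) ^ N)"
    by (rule r, rule Pd) (use that 1 pi7 in auto)
   thus ?thesis by simp
  next
   case 2 thus ?thesis using that A0 unfolding P_def by (smt (verit))
  next
   case 3
   have "norm (f j ((\<tau> - 2 * pi) + 2 * pi)) \<le> 2 * (A / Im (\<tau> - 2 * pi) ^ N)"
    by (rule r, rule Pd) (use that 3 pi7 in auto)
   thus ?thesis by simp
  qed
 qed
 have step: "P (q * A) (Y + L)" if P: "P A Y" and Y: "Y \<ge> Y0" for A Y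
  unfolding P_def
 proof (intro allI impI)
  fix j \<tau> assume re: "0 \<le> Re \<tau>" "Re \<tau> \<le> 2 * pi" and im: "Im \<tau> \<ge> Y + L"
  define t where "t = Im \<tau>"
  define T where "T = (1 + \<eta>) * t"
  have t: "t \<ge> Y + L" "t > 0" "t - L \<ge> Y" "t - L > 0" "t > L" using im Y Y0 L by (auto simp: t_def)
  have t1: "\<eta> * t \<ge> 1" "\<eta> * t \<ge> L"
  proof -
   have "t \<ge> 1 / \<eta>" "t \<ge> L / \<eta>" using t Y Y0 L by linarith+
   thus "\<eta> * t \<ge> 1" "\<eta> * t \<ge> L" using \<eta> by (auto simp: field_simps)
  qed
  have Tt: "T = t + \<eta> * t" by (simp add: T_def algebra_simps)
  have A0: "A \<ge> 0"
  proof -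
   have "0 \<le> A / Y ^ N" using P[unfolded P_def, rule_format, of "Complex 0 Y" j] by (auto intro: order_trans[OF norm_ge_zero])
   moreover have "Y ^ N > 0" using Y Y0 L by auto
   ultimately show ?thesis by (simp add: zero_le_divide_iff)
  qed
  define S where "S = {\<zeta>. Re \<zeta> > - 12} \<inter> {\<zeta>. Re \<zeta> < 12} \<inter> {\<zeta>. Im \<zeta> > \<bar>R\<bar> + 20}"
  have S: "open S" "convex S" unfolding S_def
   by (intro open_Int convex_Int open_halfspace_Re_gt open_halfspace_Re_lt open_halfspace_Im_gt convex_halfspace_Re_gt convex_halfspace_Re_lt convex_halfspace_Im_gt)+
  have fS: "f j holomorphic_on S" by (rule holomorphic_on_subset[OF hol]) (auto simp: S_def)
  let ?k = "\<lambda>\<zeta>. exp (\<i> * (\<zeta> - \<tau>)) - 1"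
  let ?l = "Complex (Re \<tau> - pi)" and ?r = "Complex (Re \<tau> + pi)"
  have ek: "norm (exp (\<i> * (\<zeta> - \<tau>))) = exp (t - Im \<zeta>)" for \<zeta> by (simp add: t_def)
  have form: "2 * pi * f j \<tau> =
   contour_integral (linepath (?l (t - L)) (?r (t - L))) (\<lambda>\<zeta>. f j \<zeta> / ?k \<zeta>)
  - contour_integral (linepath (?l T) (?r T)) (\<lambda>\<zeta>. f j \<zeta> / ?k \<zeta>)
  + contour_integral (linepath (?l (t - L)) (?l T)) (\<lambda>\<zeta>. (f j (\<zeta> + 2 * pi) - f j \<zeta>) / ?k \<zeta>)"
  proof (rule rectangle_formula[OF fS S])
   show "cbox (?l (t - L)) (?r T) \<subseteq> S"
    using re pi7 t Y Y0(4) by (auto simp: S_def in_cbox_complex_iff)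
  qed (use L t1 Tt in \<open>auto simp: t_def\<close>)
  have nrm: "norm (?r y - ?l y) \<le> 2 * pi" for y
  proof -
   have "?r y - ?l y = of_real (2 * pi)" by (simp add: complex_eq_iff)
   thus ?thesis by (simp only: norm_of_real) simp
  qed
  have hseg: "Im \<zeta> = y \<and> Re \<zeta> \<ge> - pi \<and> Re \<zeta> \<le> 3 * pi" if "\<zeta> \<in> closed_segment (?l y) (?r y)" for \<zeta> y
   using that re by (auto simp: closed_segment_same_Im closed_segment_eq_real_ivl split: if_splits)
  have vseg: "Re \<zeta> = Re \<tau> - pi \<and> Im \<zeta> \<ge> t - L \<and> Im \<zeta> \<le> T" if "\<zeta> \<in> closed_segment (?l (t - L)) (?l T)" for \<zeta>
   using that L t1 Tt by (auto simp: closed_segment_same_Re closed_segment_eq_real_ivl split: if_splits)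
  have b1: "norm (contour_integral (linepath (?l (t - L)) (?r (t - L))) (\<lambda>\<zeta>. f j \<zeta> / ?k \<zeta>))
    \<le> (2 * (A / (t - L) ^ N) * (2 * exp (- L))) * (2 * pi)"
  proof (rule contour_integral_bound_linepath_weak)
   fix \<zeta> assume "\<zeta> \<in> closed_segment (?l (t - L)) (?r (t - L))"
   from hseg[OF this] have z: "Im \<zeta> = t - L" "Re \<zeta> \<ge> - pi" "Re \<zeta> \<le> 3 * pi" by auto
   have "norm (f j \<zeta>) \<le> 2 * (A / Im \<zeta> ^ N)" by (rule ext[OF P Y]) (use z pi7 t in auto)
   moreover have "norm (?k \<zeta>) \<ge> exp L - 1" using norm_triangle_ineq2[of "exp (\<i> * (\<zeta> - \<tau>))" 1] unfolding ek using z by simp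
   moreover have "exp L \<ge> 2" using exp_ge_add_one_self[of L] L by linarith
   ultimately have "norm (f j \<zeta>) \<le> 2 * (A / (t - L) ^ N)" "norm (?k \<zeta>) \<ge> exp L / 2" using z by auto
   hence "norm (f j \<zeta>) / norm (?k \<zeta>) \<le> (2 * (A / (t - L) ^ N)) / (exp L / 2)"
    using A0 t by (intro frac_le) auto
   also have "\<dots> = 2 * (A / (t - L) ^ N) * (2 * exp (- L))" by (simp add: exp_minus field_simps)
   finally show "norm (f j \<zeta> / ?k \<zeta>) \<le> 2 * (A / (t - L) ^ N) * (2 * exp (- L))" by (simp add: norm_divide)
  qed (use A0 t nrm in auto)
  have b2: "norm (contour_integral (linepath (?l T) (?r T)) (\<lambda>\<zeta>. f j \<zeta> / ?k \<zeta>))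
    \<le> (2 * (A / T ^ N) * 2) * (2 * pi)"
  proof (rule contour_integral_bound_linepath_weak)
   fix \<zeta> assume "\<zeta> \<in> closed_segment (?l T) (?r T)"
   from hseg[OF this] have z: "Im \<zeta> = T" "Re \<zeta> \<ge> - pi" "Re \<zeta> \<le> 3 * pi" by auto
   have 1: "norm (f j \<zeta>) \<le> 2 * (A / Im \<zeta> ^ N)" by (rule ext[OF P Y]) (use z pi7 t t1 Tt L in auto)
   have "exp (t - T) \<le> exp (-1)" using t1 Tt by simp
   also have "\<dots> \<le> 1 / (2::real)" using exp_ge_add_one_self[of 1] by (simp add: exp_minus field_simps)
   finally have "norm (?k \<zeta>) \<ge> 1 / 2" using norm_triangle_ineq2[of 1 "exp (\<i> * (\<zeta> - \<tau>))"] unfolding ek using z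
    by (simp add: norm_minus_commute)
   hence "norm (f j \<zeta>) / norm (?k \<zeta>) \<le> (2 * (A / T ^ N)) / (1 / 2)"
    using A0 t 1 z Tt t1 by (intro frac_le) auto
   thus "norm (f j \<zeta> / ?k \<zeta>) \<le> 2 * (A / T ^ N) * 2" by (simp add: norm_divide)
  qed (use A0 t Tt t1 nrm in auto)
  have b3: "norm (contour_integral (linepath (?l (t - L)) (?l T)) (\<lambda>\<zeta>. (f j (\<zeta> + 2 * pi) - f j \<zeta>) / ?k \<zeta>))
    \<le> (2 * K * (A / (t - L) ^ (N + 1))) * (2 * \<eta> * t)"
  proof (rule contour_integral_bound_linepath_weak)
   fix \<zeta> assume "\<zeta> \<in> closed_segment (?l (t - L)) (?l T)"
   from vseg[OF this] have z: "Re \<zeta> = Re \<tau> - pi" "Im \<zeta> \<ge> t - L" "Im \<zeta> \<le> T" by auto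
   have 1: "norm (f l \<zeta>) \<le> 2 * (A / Im \<zeta> ^ N)" for l by (rule ext[OF P Y]) (use z pi7 t t1 Tt L re in auto)
   have "norm (f j (\<zeta> + 2 * pi) - f j \<zeta>) \<le> C / Im \<zeta> * (\<Sum>l\<in>UNIV. norm (f l \<zeta>))"
    by (rule rec1) (use z re pi7 t Y Y0 in auto)
   also have "\<dots> \<le> C / Im \<zeta> * (real CARD('i) * (2 * (A / Im \<zeta> ^ N)))"
    using sum_bounded_above[of UNIV "\<lambda>l. norm (f l \<zeta>)", OF 1] C z t by (intro mult_left_mono) auto
   also have "\<dots> = 2 * K * (A / Im \<zeta> ^ (N + 1))" by (simp add: K_def field_simps)
   also have "\<dots> \<le> 2 * K * (A / (t - L) ^ (N + 1))"
    using K A0 t z by (intro mult_left_mono divide_left_mono power_mono mult_pos_pos zero_less_power) auto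
   finally have 2: "norm (f j (\<zeta> + 2 * pi) - f j \<zeta>) \<le> 2 * K * (A / (t - L) ^ (N + 1))" .
   \<comment> \<open>On the vertical side Re (zeta - tau) = - pi, so the exponential is negative
     real and the denominator has norm at least 1.\<close>
   have "exp (\<i> * (\<zeta> - \<tau>)) = - of_real (exp (t - Im \<zeta>))"
   proof -
    have "\<i> * (\<zeta> - \<tau>) = of_real (t - Im \<zeta>) - \<i> * of_real pi" using z by (simp add: complex_eq_iff t_def)
    thus ?thesis by (simp add: exp_diff exp_of_real)
   qed
   hence "?k \<zeta> = - of_real (1 + exp (t - Im \<zeta>))" by simp
   hence "norm (?k \<zeta>) = 1 + exp (t - Im \<zeta>)" by (metis norm_minus_cancel norm_of_real abs_of_pos add_pos_pos exp_gt_zero zero_less_one)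
   hence "norm (?k \<zeta>) \<ge> 1" by simp
   hence "norm (f j (\<zeta> + 2 * pi) - f j \<zeta>) / norm (?k \<zeta>) \<le> (2 * K * (A / (t - L) ^ (N + 1))) / 1"
    using 2 by (intro frac_le) (use K A0 t in auto)
   thus "norm ((f j (\<zeta> + 2 * pi) - f j \<zeta>) / ?k \<zeta>) \<le> 2 * K * (A / (t - L) ^ (N + 1))" by (simp add: norm_divide)
  next
   have "norm (?l T - ?l (t - L)) = T - (t - L)"
    using Tt t1 L by (simp add: cmod_def)
   thus "norm (?l T - ?l (t - L)) \<le> 2 * \<eta> * t" using Tt t1 by simp
  qed (use A0 K t in auto)
  have s1: "1 / (t - L) ^ N \<le> 2 / t ^ N" "1 / (t - L) ^ (N+1) \<le> 2 / t ^ (N+1)"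
   by (rule power_shift_bound; use L t Y Y0 in \<open>auto simp: algebra_simps\<close>)+
  have "norm (2 * pi * f j \<tau>) \<le> (2 * (A / (t - L) ^ N) * (2 * exp (- L))) * (2 * pi) + (2 * (A / T ^ N) * 2) * (2 * pi) + (2 * K * (A / (t - L) ^ (N + 1))) * (2 * \<eta> * t)"
   unfolding form using b1 b2 b3 norm_triangle_ineq norm_triangle_ineq4 by (smt (verit))
  also have "\<dots> = A * ((1 / (t - L) ^ N) * (4 * exp (- L) * (2 * pi)) + 4 / ((1 + \<eta>) ^ N * t ^ N) * (2 * pi) + (1 / (t - L) ^ (N+1)) * (4 * K * \<eta> * t))"
   unfolding T_def power_mult_distrib by (simp add: distrib_left mult_ac)
  also have "\<dots> \<le> A * ((2 / t ^ N) * (4 * exp (- L) * (2 * pi)) + 4 / ((1 + \<eta>) ^ N * t ^ N) * (2 * pi) + (2 / t ^ (N+1)) * (4 * K * \<eta> * t))"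
   using A0 s1 K \<eta> t by (intro mult_left_mono add_mono mult_right_mono order_refl) auto
  also have "\<dots> = A / t ^ N * ((8 * exp (- L) + 4 / (1 + \<eta>) ^ N) * (2 * pi) + 4 * (2 * K * \<eta>))"
   using t by (simp add: field_simps)
  also have "\<dots> \<le> A / t ^ N * ((8 * exp (- L) + 4 / (1 + \<eta>) ^ N) * (2 * pi) + (2 * K * \<eta>) * (2 * pi))"
   using A0 t pi7 K \<eta> by (intro mult_left_mono add_mono order_refl) auto
  also have "\<dots> = A / t ^ N * (8 * exp (- L) + 4 / (1 + \<eta>) ^ N + 2 * K * \<eta>) * (2 * pi)" by (simp add: algebra_simps)
  also have "\<dots> \<le> A / t ^ N * q * (2 * pi)"
   using A0 t q1 N \<eta> by (intro mult_right_mono mult_left_mono) auto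
  finally have "norm (f j \<tau>) * (2 * pi) \<le> A / t ^ N * q * (2 * pi)" by (simp add: norm_mult mult.commute)
  hence "norm (f j \<tau>) \<le> A / t ^ N * q" by (rule mult_right_le_imp_le) simp
  thus "norm (f j \<tau>) \<le> q * A / Im \<tau> ^ N" by (simp add: t_def mult.commute)
 qed
 define A1 where "A1 = max C0 1"
 have P0: "P A1 Y0" unfolding P_def
 proof (intro allI impI)
  fix j \<tau> assume a: "0 \<le> Re \<tau>" "Re \<tau> \<le> 2 * pi" "Y0 \<le> Im \<tau>"
  have "norm (f j \<tau>) \<le> C0 / Im \<tau> ^ N" using sup[of \<tau> j] a pi7 Y0 by auto
  also have "\<dots> \<le> A1 / Im \<tau> ^ N" using a Y0 L by (intro divide_right_mono) (auto simp: A1_def)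
  finally show "norm (f j \<tau>) \<le> A1 / Im \<tau> ^ N" .
 qed
 have Pn: "P (q ^ n * A1) (Y0 + real n * L)" for n
 proof (induction n)
  case (Suc n)
  from step[OF this] L show ?case by (simp add: algebra_simps)
 qed (use P0 in simp)
 have A1: "A1 \<ge> 1" by (simp add: A1_def)
 define M where "M = exp (\<bar>1 - \<epsilon>\<bar> * (Y0 + L))"
 have fin: "norm (f j \<tau>) \<le> 2 * A1 * M * exp (- (1 - \<epsilon>) * Im \<tau>)" if "Re \<tau> \<ge> - 2 * pi" "Re \<tau> \<le> 4 * pi" "Im \<tau> \<ge> Y0" for j \<tau>
 proof -
  \<comment> \<open>The number of improvement steps that fit below the height of tau; the rounding
    loss is absorbed by \<open>M\<close>.\<close>
  define n where "n = nat \<lfloor>(Im \<tau> - Y0) / L\<rfloor>"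
  have "0 \<le> (Im \<tau> - Y0) / L" using that L by simp
  hence n: "real n \<le> (Im \<tau> - Y0) / L" "(Im \<tau> - Y0) / L < real n + 1" unfolding n_def by linarith+
  hence n': "Y0 + real n * L \<le> Im \<tau>" "Im \<tau> < Y0 + real n * L + L" using L by (auto simp: field_simps)
  have im1: "Im \<tau> \<ge> 1" using that Y0 L by linarith
  have "norm (f j \<tau>) \<le> 2 * (q ^ n * A1 / Im \<tau> ^ N)"
   by (rule ext[OF Pn[of n]]) (use that n' L in auto)
  also have "\<dots> \<le> 2 * (q ^ n * A1 / 1)"
   using im1 q A1 by (intro mult_left_mono divide_left_mono) auto
  also have "q ^ n = exp (- (1 - \<epsilon>) * (real n * L))" by (simp add: q_def exp_of_nat_mult[symmetric] mult_ac)
  also have "- (1 - \<epsilon>) * (real n * L) = - (1 - \<epsilon>) * Im \<tau> + (1 - \<epsilon>) * (Im \<tau> - real n * L)" by (simp add: algebra_simps)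
  also have "exp \<dots> \<le> M * exp (- (1 - \<epsilon>) * Im \<tau>)"
  proof -
   have "(1 - \<epsilon>) * (Im \<tau> - real n * L) \<le> \<bar>1 - \<epsilon>\<bar> * (Y0 + L)"
   proof -
    have "(1 - \<epsilon>) * (Im \<tau> - real n * L) \<le> \<bar>(1 - \<epsilon>) * (Im \<tau> - real n * L)\<bar>" by (rule abs_ge_self)
    also have "\<dots> = \<bar>1 - \<epsilon>\<bar> * \<bar>Im \<tau> - real n * L\<bar>" by (rule abs_mult)
    also have "\<dots> \<le> \<bar>1 - \<epsilon>\<bar> * (Y0 + L)" using n' Y0 L by (intro mult_left_mono) auto
    finally show ?thesis .
   qed
   thus ?thesis unfolding M_def exp_add by (simp add: mult.commute)
  qed
  finally show ?thesis using A1 by (simp add: mult_ac)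
 qed
 show ?thesis
 proof (rule that[of "2 * (2 * A1 * M)" Y0])
  fix j \<tau> assume a: "\<bar>Re \<tau>\<bar> \<le> 8" "Im \<tau> \<ge> Y0"
  have AM: "A1 * M > 0" using A1 by (simp add: M_def)
  show "norm (f j \<tau>) \<le> 2 * (2 * A1 * M) * exp (- (1 - \<epsilon>) * Im \<tau>)"
  proof (cases "Re \<tau> \<ge> - 2 * pi")
   case True
   have "norm (f j \<tau>) \<le> 2 * A1 * M * exp (- (1 - \<epsilon>) * Im \<tau>)" by (rule fin) (use a True pi7 in auto)
   also have "\<dots> \<le> 2 * (2 * A1 * M) * exp (- (1 - \<epsilon>) * Im \<tau>)" using AM by (intro mult_right_mono) auto
   finally show ?thesis .
  next
   case False
   have "norm (f j ((\<tau> + 2 * pi) - 2 * pi)) \<le> 2 * (2 * A1 * M * exp (- (1 - \<epsilon>) * Im \<tau>))"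
   proof (rule r)
    show "norm (f l (\<tau> + 2 * pi)) \<le> 2 * A1 * M * exp (- (1 - \<epsilon>) * Im \<tau>)" for l
     using fin[of "\<tau> + 2 * pi" l] False a pi7 by simp
   qed (use a pi7 in auto)
   thus ?thesis by (simp add: mult_ac)
  qed
 qed (use A1 in \<open>auto simp: M_def\<close>)
qed

section \<open>Derivations tangent to the level sets of a Hamiltonian\<close>

definition vhol :: "(complex ^ 'm \<Rightarrow> complex ^ 'n) \<Rightarrow> (complex ^ 'm) set \<Rightarrow> bool" where
 "vhol T S \<longleftrightarrow> (\<forall>i. hol (\<lambda>x. T x $ i) S)"

definition vdd :: "(complex ^ 'm \<Rightarrow> complex ^ 'n) \<Rightarrow> complex ^ 'm \<Rightarrow> complex ^ 'm \<Rightarrow> complex ^ 'n" where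
 "vdd T x v = (\<chi> i. dd (\<lambda>y. T y $ i) x v)"

definition Ld :: "(complex ^ 'n \<Rightarrow> complex ^ 'n) \<Rightarrow> (complex ^ 'n \<Rightarrow> complex) \<Rightarrow> complex ^ 'n \<Rightarrow> complex" where
 "Ld T f x = dd f x (T x)"

text \<open>The Lie bracket, with the sign for which it is the commutator S T - T S of
  derivations.\<close>

definition comm :: "(complex ^ 'n \<Rightarrow> complex ^ 'n) \<Rightarrow> (complex ^ 'n \<Rightarrow> complex ^ 'n) \<Rightarrow> complex ^ 'n \<Rightarrow> complex ^ 'n" where
 "comm S T x = vdd T x (S x) - vdd S x (T x)"

lemma vholD: "vhol T S \<Longrightarrow> hol (\<lambda>x. T x $ i) S" by (simp add: vhol_def)

lemma vhol_subset: "vhol f S \<Longrightarrow> T \<subseteq> S \<Longrightarrow> vhol f T"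
 unfolding vhol_def using hol_subset by blast

lemma hol_Ld:
 assumes "open V" "hol f V" "vhol T V"
 shows "hol (Ld T f) V"
 unfolding Ld_def dd_def using assms by (intro hol_sum hol_mult hol_pdiff) (auto simp: vhol_def)

lemma dd_sum_right: "dd f x (\<Sum>i\<in>I. v i) = (\<Sum>i\<in>I. dd f x (v i))"
proof (induction I rule: infinite_finite_induct)
qed (auto simp: dd_add, auto simp: dd_def)

lemma dd_second_sum:
 fixes f :: "complex ^ 'n \<Rightarrow> complex"
 assumes "open V" "hol f V" "x \<in> V"
 shows "(\<Sum>i\<in>UNIV. u $ i * dd (pdiff i f) x v) = dd (\<lambda>y. dd f y v) x u"
proof -
 have "dd (\<lambda>y. dd f y v) x (axis i 1) = dd (pdiff i f) x v" for i
  using dd_commute[OF assms, of v "axis i 1"] by simp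
 hence "dd (\<lambda>y. dd f y v) x (\<Sum>i\<in>UNIV. u $ i *s axis i 1) = (\<Sum>i\<in>UNIV. u $ i * dd (pdiff i f) x v)"
  unfolding dd_sum_right dd_scale by simp
 thus ?thesis by (simp only: basis_expansion)
qed

lemma dd_Ld:
 assumes "open V" "hol f V" "vhol T V" "x \<in> V"
 shows "dd (Ld T f) x v = dd (\<lambda>y. dd f y v) x (T x) + dd f x (vdd T x v)"
proof -
 have "Ld T f = (\<lambda>x. \<Sum>i\<in>UNIV. T x $ i * pdiff i f x)" by (simp add: Ld_def dd_def fun_eq_iff)
 hence "dd (Ld T f) x v = (\<Sum>i\<in>UNIV. dd (\<lambda>x. T x $ i * pdiff i f x) x v)"
  using assms by (simp add: dd_sum[of UNIV _ V] hol_mult hol_pdiff vholD)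
 also have "\<dots> = (\<Sum>i\<in>UNIV. T x $ i * dd (pdiff i f) x v + dd (\<lambda>x. T x $ i) x v * pdiff i f x)"
  using assms by (simp add: dd_mult[of _ V] hol_pdiff vholD)
 also have "\<dots> = dd (\<lambda>y. dd f y v) x (T x) + dd f x (vdd T x v)"
  by (simp add: sum.distrib dd_second_sum[OF assms(1,2,4)] vdd_def) (simp add: dd_def[of f x "\<chi> i. dd (\<lambda>y. T y $ i) x v"])
 finally show ?thesis .
qed

text \<open>The second derivatives of f are symmetric and cancel, leaving a first-order operator:
  reordering derivations costs only terms of lower order.\<close>

lemma Ld_comm:
 assumes "open V" "hol f V" "vhol S V" "vhol T V" "x \<in> V"
 shows "Ld S (Ld T f) x - Ld T (Ld S f) x = Ld (comm S T) f x"
 unfolding Ld_def[of S] Ld_def[of T] Ld_def[of "comm S T"] dd_Ld[OF assms(1,2,3,5), folded Ld_def, unfolded Ld_def]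
 using dd_Ld[OF assms(1,2,3,5)] dd_Ld[OF assms(1,2,4,5)] dd_commute[OF assms(1,2,5)]
 by (simp add: Ld_def[abs_def] comm_def dd_diff)

lemma vhol_vdd: "open V \<Longrightarrow> vhol T V \<Longrightarrow> vhol (\<lambda>x. vdd T x v) V"
 by (simp add: vhol_def vdd_def hol_dd)

lemma vhol_vdd_field: "open V \<Longrightarrow> vhol T V \<Longrightarrow> vhol S V \<Longrightarrow> vhol (\<lambda>x. vdd T x (S x)) V"
 unfolding vhol_def vdd_def by (auto simp: Ld_def[symmetric] vhol_def intro!: hol_Ld)

lemma vhol_comm: "open V \<Longrightarrow> vhol S V \<Longrightarrow> vhol T V \<Longrightarrow> vhol (comm S T) V"
 using vhol_vdd_field[of V T S] vhol_vdd_field[of V S T] unfolding vhol_def comm_def by (auto intro: hol_diff)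

text \<open>The head of the list is the outermost derivation; the last field acts on f
  first.\<close>

fun Lds :: "(complex ^ 'n \<Rightarrow> complex ^ 'n) list \<Rightarrow> (complex ^ 'n \<Rightarrow> complex) \<Rightarrow> complex ^ 'n \<Rightarrow> complex" where
 "Lds [] f = f" | "Lds (T # Ts) f = Ld T (Lds Ts f)"

lemma Lds_append: "Lds (Ts @ Us) f = Lds Ts (Lds Us f)"
 by (induction Ts) auto

lemma hol_Lds: "open V \<Longrightarrow> hol f V \<Longrightarrow> \<forall>T\<in>set Ts. vhol T V \<Longrightarrow> hol (Lds Ts f) V"
 by (induction Ts) (auto intro: hol_Ld)

lemma Ld_cong: "open V \<Longrightarrow> hol f V \<Longrightarrow> (\<And>x. x \<in> V \<Longrightarrow> g x = f x) \<Longrightarrow> x \<in> V \<Longrightarrow> Ld T g x = Ld T f x"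
 unfolding Ld_def using hol_transform(2) by metis

lemma Lds_cong:
 assumes "open V" "hol f V" "\<And>x. x \<in> V \<Longrightarrow> g x = f x" "\<forall>T\<in>set Ts. vhol T V"
 shows "x \<in> V \<Longrightarrow> Lds Ts g x = Lds Ts f x"
 using assms(4)
proof (induction Ts arbitrary: x)
 case (Cons T Ts)
 show ?case using Cons assms by (auto intro!: Ld_cong[of V] hol_Lds)
qed (use assms in auto)

lemma Lds_diff:
 assumes "open V" "hol f V" "hol g V" "\<forall>T\<in>set Ts. vhol T V"
 shows "x \<in> V \<Longrightarrow> Lds Ts (\<lambda>x. f x - g x) x = Lds Ts f x - Lds Ts g x"
 using assms(4)
proof (induction Ts arbitrary: x)
 case (Cons T Ts)
 have h: "hol (Lds Ts f) V" "hol (Lds Ts g) V" using Cons assms by (auto intro: hol_Lds)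
 have "Ld T (Lds Ts (\<lambda>x. f x - g x)) x = Ld T (\<lambda>x. Lds Ts f x - Lds Ts g x) x"
  by (rule Ld_cong[OF assms(1) hol_diff[OF h]]) (use Cons in auto)
 thus ?case using dd_minus[OF h Cons.prems(1)] by (simp add: Ld_def)
qed auto

lemma Lds_zero:
 assumes "open V" "\<And>x. x \<in> V \<Longrightarrow> g x = 0" "\<forall>T\<in>set Ts. vhol T V" "x \<in> V"
 shows "Lds Ts g x = 0"
proof -
 have "Lds Ts (\<lambda>x. 0 - 0) x = Lds Ts (\<lambda>x. 0) x - Lds Ts (\<lambda>x. 0) x"
  by (rule Lds_diff[OF assms(1) hol_const hol_const assms(3,4)])
 hence "Lds Ts (\<lambda>x. 0) x = 0" by simp
 moreover have "Lds Ts g x = Lds Ts (\<lambda>x. 0) x"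
  by (rule Lds_cong[OF assms(1) hol_const]) (use assms in auto)
 ultimately show ?thesis by simp
qed

section \<open>Symplectic linear algebra and Hamiltonian vector fields\<close>

lemma symp_add_left: "symp (u + v) w = symp u w + symp v w"
 and symp_diff_left: "symp (u - v) w = symp u w - symp v w"
 and symp_scale_left: "symp (c *s u) w = c * symp u w"
 and symp_add_right: "symp w (u + v) = symp w u + symp w v"
 and symp_diff_right: "symp w (u - v) = symp w u - symp w v"
 and symp_scale_right: "symp w (c *s u) = c * symp w u"
 and symp_self: "symp u u = 0" and symp_zero: "symp 0 u = 0"
 and symp_skew: "symp u v = - symp v u"
 by (simp_all add: symp_def algebra_simps)

lemma vec4_eq: "(x = y) \<longleftrightarrow> x $ 1 = y $ 1 \<and> x $ 2 = y $ 2 \<and> x $ 3 = y $ 3 \<and> x $ 4 = y $ (4::4)"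
 by (simp add: vec_eq_iff forall_4)

lemma symp_nondegenerate: "(\<And>w. symp u w = 0) \<Longrightarrow> u = 0"
proof -
 assume a: "\<And>w. symp u w = 0"
 show "u = 0" using a[of "axis 1 1"] a[of "axis 2 1"] a[of "axis 3 1"] a[of "axis 4 1"]
  by (simp add: vec4_eq symp_def axis_def)
qed

text \<open>Both sides are contractions of \<open>y \<and> u \<and> v\<close> with the symplectic form; in dimension four they agree.\<close>

lemma symp_contraction:
 "y $ k * (symp u a * symp v b - symp u b * symp v a) + u $ k * (symp v a * symp y b - symp v b * symp y a)
   + v $ k * (symp y a * symp u b - symp y b * symp u a)
  = symp u v * (symp a b * y $ k - symp y b * a $ k + symp y a * b $ k)
   + symp v y * (symp a b * u $ k - symp u b * a $ k + symp u a * b $ k)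
   + symp y u * (symp a b * v $ k - symp v b * a $ k + symp v a * b $ k)"
proof -
 have "k = 1 \<or> k = 2 \<or> k = 3 \<or> k = 4" using exhaust_4 by blast
 thus ?thesis by (elim disjE) (simp_all add: symp_def algebra_simps)
qed

text \<open>Two independent vectors with \<open>symp u v = 0\<close> span a Lagrangian plane, which
  is its own symplectic complement. Nondegeneracy supplies a, b with nonzero 2 x 2 determinant, and
  contracting with them solves for y.\<close>

lemma lagrangian_span:
 fixes u v y :: "complex ^ 4"
 assumes indep: "\<And>a b. a *s u + b *s v = 0 \<Longrightarrow> a = 0 \<and> b = 0"
  and uv: "symp u v = 0" and yu: "symp y u = 0" and yv: "symp y v = 0"
 obtains a b where "y = a *s u + b *s v"
proof -
 have "u \<noteq> 0" using indep[of 1 0] by auto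
 then obtain a where a: "symp u a \<noteq> 0" using symp_nondegenerate by blast
 have "\<exists>b. symp u a * symp v b - symp u b * symp v a \<noteq> 0"
 proof (rule ccontr)
  assume "\<not> ?thesis"
  hence "symp ((- symp v a) *s u + symp u a *s v) b = 0" for b
   by (simp add: symp_add_left symp_diff_left symp_scale_left mult.commute)
  from indep[OF symp_nondegenerate[OF this]] a show False by simp
 qed
 then obtain b where b: "symp u a * symp v b - symp u b * symp v a \<noteq> 0" (is "?m \<noteq> 0") by blast
 have "y $ k * ?m = (- (symp v a * symp y b - symp v b * symp y a)) * u $ k + (- (symp y a * symp u b - symp y b * symp u a)) * v $ k" for k
  using symp_contraction[of y k u a v b] uv yu yv symp_skew[of v y] by (simp add: algebra_simps)
 hence "y = ((- (symp v a * symp y b - symp v b * symp y a)) / ?m) *s u + ((- (symp y a * symp u b - symp y b * symp u a)) / ?m) *s v"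
  using b unfolding vec_eq_iff vector_add_component vector_smult_component
  by (metis add_divide_distrib nonzero_eq_divide_eq times_divide_eq_left)
 thus ?thesis by (rule that)
qed

lemma symp_ham_vf: "symp (ham_vf H x) y = dd H x y"
 by (simp add: symp_def ham_vf_def dd_def sum_4 algebra_simps)

lemma dd_ham_vf_self: "dd H x (ham_vf H x) = 0"
 using symp_ham_vf[of H x "ham_vf H x"] symp_self by simp

lemma vhol_ham_vf:
 assumes "open V" "hol H V"
 shows "vhol (ham_vf H) V"
 unfolding vhol_def
proof
 fix i :: 4
 have "i = 1 \<or> i = 2 \<or> i = 3 \<or> i = 4" using exhaust_4 by blast
 thus "hol (\<lambda>x. ham_vf H x $ i) V"
  using assms by (elim disjE) (auto simp: ham_vf_def intro!: hol_pdiff hol_uminus)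
qed

text \<open>The derivative of the field is J times the Hessian, and the Hessian is symmetric by
  \<open>dd_commute\<close>.\<close>

lemma hamiltonian_matrix:
 assumes "open V" "hol H V" "x \<in> V"
 shows "symp (vdd (ham_vf H) x u) w = - symp u (vdd (ham_vf H) x w)"
proof -
 have c: "vdd (ham_vf H) x u $ 1 = dd (pdiff 3 H) x u" "vdd (ham_vf H) x u $ 2 = dd (pdiff 4 H) x u"
  "vdd (ham_vf H) x u $ 3 = - dd (pdiff 1 H) x u" "vdd (ham_vf H) x u $ 4 = - dd (pdiff 2 H) x u" for u
  using assms by (simp_all add: vdd_def ham_vf_def dd_uminus[of _ V] hol_pdiff)
 have "symp (vdd (ham_vf H) x u) w = (\<Sum>i\<in>UNIV. w $ i * dd (pdiff i H) x u)"
  by (simp add: symp_def c sum_4 algebra_simps)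
 also have "\<dots> = dd (\<lambda>y. dd H y u) x w" by (rule dd_second_sum[OF assms])
 also have "\<dots> = dd (\<lambda>y. dd H y w) x u" by (rule dd_commute[OF assms])
 also have "\<dots> = (\<Sum>i\<in>UNIV. u $ i * dd (pdiff i H) x w)" by (rule dd_second_sum[OF assms, symmetric])
 also have "\<dots> = - symp u (vdd (ham_vf H) x w)"
  by (simp add: symp_def c sum_4 algebra_simps)
 finally show ?thesis .
qed

text \<open>Tangent to every level of H in V, not only to the level of the separatrix; this is what
  makes the class closed under brackets on open sets.\<close>

definition tang :: "(complex ^ 4 \<Rightarrow> complex) \<Rightarrow> (complex ^ 4 \<Rightarrow> complex ^ 4) \<Rightarrow> (complex ^ 4) set \<Rightarrow> bool" where
 "tang H T V \<longleftrightarrow> vhol T V \<and> (\<forall>x\<in>V. dd H x (T x) = 0)"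

lemma tang_subset: "tang H T V \<Longrightarrow> V' \<subseteq> V \<Longrightarrow> tang H T V'"
 unfolding tang_def using vhol_subset by blast

lemma tang_comm:
 assumes "open V" "hol H V" "tang H S V" "tang H T V"
 shows "tang H (comm S T) V"
 unfolding tang_def
proof (intro conjI ballI)
 show "vhol (comm S T) V" using assms vhol_comm by (auto simp: tang_def)
 fix x assume x: "x \<in> V"
 have "Ld S (Ld T H) x = Ld S (\<lambda>x. 0) x" "Ld T (Ld S H) x = Ld T (\<lambda>x. 0) x"
  by (rule Ld_cong[OF assms(1) hol_const _ x]; use assms in \<open>auto simp: tang_def Ld_def\<close>)+
 moreover have "Ld S (\<lambda>x. 0) x = 0" "Ld T (\<lambda>x. 0) x = 0" by (simp_all add: Ld_def)
 ultimately show "dd H x (comm S T x) = 0"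
  using Ld_comm[OF assms(1,2) _ _ x, of S T] assms(3,4) by (simp add: tang_def Ld_def[of "comm S T"])
qed

text \<open>The combination of the constant fields a and b that dH annihilates. It needs no division
  by a derivative of H, and such fields span the tangent space of the level wherever dH is
  nonzero.\<close>

definition Zf :: "(complex ^ 4 \<Rightarrow> complex) \<Rightarrow> complex ^ 4 \<Rightarrow> complex ^ 4 \<Rightarrow> complex ^ 4 \<Rightarrow> complex ^ 4" where
 "Zf H a b x = dd H x b *s a - dd H x a *s b"

lemma tang_Zf:
 assumes "open V" "hol H V"
 shows "tang H (Zf H a b) V"
 unfolding tang_def vhol_def Zf_def
proof (intro conjI allI ballI)
 show "hol (\<lambda>x. (dd H x b *s a - dd H x a *s b) $ i) V" for i
  using assms by (simp add: hol_diff hol_mult hol_dd hol_const)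
qed (simp add: dd_diff dd_scale)

lemma tang_ham_vf: "open V \<Longrightarrow> hol H V \<Longrightarrow> tang H (ham_vf H) V"
 by (simp add: tang_def vhol_ham_vf dd_ham_vf_self)

section \<open>Separatrices and jets of a first integral along them\<close>

abbreviation e1 :: "complex ^ 2" where "e1 \<equiv> axis 1 1"
text \<open>The direction of the operator that adds the phase and the tau derivative: moving along
  it is the time flow.\<close>

definition e11 :: "complex ^ 2" where "e11 = vector [1, 1]"

definition DD :: "real \<Rightarrow> real \<Rightarrow> real \<Rightarrow> (complex ^ 2) set" where
 "DD h \<sigma> R = {z. \<bar>Im (z $ 1)\<bar> < h \<and> z $ 2 \<in> Lset \<sigma> R}"
text \<open>Real phases only: under real time the phase stays real, and it can be brought to any
  chosen value modulo 2 pi.\<close>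

definition RD :: "real \<Rightarrow> real \<Rightarrow> (complex ^ 2) set" where
 "RD \<sigma> R = {z. Im (z $ 1) = 0 \<and> z $ 2 \<in> Lset \<sigma> R}"

abbreviation pt :: "real \<Rightarrow> complex \<Rightarrow> complex ^ 2" where "pt \<phi> \<tau> \<equiv> vector [of_real \<phi>, \<tau>]"

lemma e11_comp [simp]: "e11 $ 1 = 1" "e11 $ 2 = 1" by (simp_all add: e11_def)
lemma e1_comp [simp]: "e1 $ 1 = 1" "e1 $ 2 = 0" by (simp_all add: axis_def)

lemma open_DD: "open (DD h \<sigma> R)"
 unfolding DD_def Lset_def by (simp, intro open_Collect_conj open_Collect_less continuous_intros)

lemma vhol_continuous: "vhol T S \<Longrightarrow> continuous_on S T"
proof (rule continuous_at_imp_continuous_on, rule ballI)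
 fix x assume "vhol T S" "x \<in> S"
 hence "(T has_derivative (\<lambda>h. \<chi> i. dd (\<lambda>y. T y $ i) x h)) (at x)"
  by (intro has_derivative_vec_components holD[of _ S]) (auto simp: vhol_def)
 thus "isCont T x" by (rule has_derivative_continuous)
qed

lemma vhol_line:
 assumes "vhol T S" "x + z *s v \<in> S"
 shows "((\<lambda>z. T (x + z *s v) $ i) has_field_derivative vdd T (x + z *s v) v $ i) (at z within A)"
 unfolding vdd_def using hol_line[OF vholD[OF assms(1), of i] assms(2)] by simp

text \<open>The flow by time - 2 pi sigma moves phase and tau together, and periodicity undoes the
  change of phase. The sign of sigma decides from which of the two points the phase shift
  starts.\<close>

lemma invariant_shift:
 fixes C :: "complex ^ 2 \<Rightarrow> complex"
 assumes sig: "\<sigma> = 1 \<or> \<sigma> = -1"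
  and inv: "\<And>z t. z \<in> RD \<sigma> R \<Longrightarrow> \<sigma> * t \<le> 0 \<Longrightarrow> C (z + of_real t *s e11) = C z"
  and per: "\<And>z. z \<in> RD \<sigma> R \<Longrightarrow> C (z + of_real (2 * pi) *s e1) = C z"
  and z: "z \<in> RD \<sigma> R"
 shows "C (z - of_real (\<sigma> * (2 * pi)) *s axis 2 1) = C z"
proof -
 have 1: "C (z + of_real (- \<sigma> * (2 * pi)) *s e11) = C z"
  by (rule inv[OF z]) (use sig in auto)
 define w where "w = z - of_real (\<sigma> * (2 * pi)) *s axis 2 1"
 have ineq: "x < y - R \<Longrightarrow> x - 2 * pi < y - R" for x y using pi_gt_zero by linarith
 have wW: "w \<in> RD \<sigma> R" using z sig ineq by (auto simp: w_def RD_def Lset_def axis_def)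
 show ?thesis
 proof (cases "\<sigma> = 1")
  case True
  define u where "u = z + of_real (- \<sigma> * (2 * pi)) *s e11"
  have "u \<in> RD \<sigma> R" using z sig True ineq by (auto simp: u_def RD_def Lset_def)
  moreover have "u + of_real (2 * pi) *s e1 = w" using True
   by (simp add: u_def w_def vec_eq_iff forall_2 axis_def)
  ultimately show ?thesis using per[of u] 1 unfolding u_def[symmetric] w_def[symmetric] by simp
 next
  case False
  hence s: "\<sigma> = -1" using sig by simp
  have "w + of_real (2 * pi) *s e1 = z + of_real (- \<sigma> * (2 * pi)) *s e11" using s
   by (simp add: w_def vec_eq_iff forall_2 axis_def)
  thus ?thesis using per[OF wW] 1 unfolding w_def[symmetric] by simp
 qed
qed

lemma periodic_shift_int:
 fixes C :: "complex ^ 2 \<Rightarrow> 'a"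
 assumes per: "\<And>z. z \<in> RD \<sigma> R \<Longrightarrow> C (z + of_real (2 * pi) *s e1) = C z" and z: "z \<in> RD \<sigma> R"
 shows "C (z + of_real (2 * pi * of_int k) *s e1) = C z"
proof -
 have W: "z + of_real t *s e1 \<in> RD \<sigma> R" if "z \<in> RD \<sigma> R" for z t using that by (auto simp: RD_def)
 have pos: "C (z + of_real (2 * pi * real n) *s e1) = C z" if "z \<in> RD \<sigma> R" for n z
 proof (induction n)
  case (Suc n)
  have "z + of_real (2 * pi * real (Suc n)) *s e1 = (z + of_real (2 * pi * real n) *s e1) + of_real (2 * pi) *s e1"
   by (simp add: vec_eq_iff algebra_simps)
  thus ?case using per[OF W[OF that, of "2 * pi * real n"]] Suc by metis
 qed simp
 show ?thesis
 proof (cases "k \<ge> 0")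
  case True thus ?thesis using pos[OF z, of "nat k"] by simp
 next
  case False
  define w where "w = z + of_real (2 * pi * of_int k) *s e1"
  have "w + of_real (2 * pi * real (nat (- k))) *s e1 = z" using False by (simp add: w_def vec_eq_iff algebra_simps)
  thus ?thesis using pos[of w "nat (- k)"] W[OF z] unfolding w_def by metis
 qed
qed

lemma flow_to_phase:
 fixes \<phi>0 \<phi> T \<sigma> :: real
 assumes "\<sigma> = 1 \<or> \<sigma> = -1"
 obtains t k where "\<sigma> * t \<le> - T" "\<phi> + t = \<phi>0 + 2 * pi * of_int k"
proof (cases "\<sigma> = 1")
 case True
 define k where "k = - \<lceil>\<bar>(\<bar>T\<bar> + \<bar>\<phi>0 - \<phi>\<bar>) / (2 * pi)\<bar>\<rceil>"
 have "of_int k \<le> - ((\<bar>T\<bar> + \<bar>\<phi>0 - \<phi>\<bar>) / (2 * pi))" unfolding k_def using le_of_int_ceiling[of "\<bar>(\<bar>T\<bar> + \<bar>\<phi>0 - \<phi>\<bar>) / (2 * pi)\<bar>"] by simp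
 hence "2 * pi * of_int k \<le> - (\<bar>T\<bar> + \<bar>\<phi>0 - \<phi>\<bar>)" by (simp add: field_simps)
 thus ?thesis using that[of "\<phi>0 + 2 * pi * of_int k - \<phi>" k] True by simp
next
 case False
 hence s: "\<sigma> = -1" using assms by simp
 define k where "k = \<lceil>\<bar>(\<bar>T\<bar> + \<bar>\<phi>0 - \<phi>\<bar>) / (2 * pi)\<bar>\<rceil>"
 have "of_int k \<ge> (\<bar>T\<bar> + \<bar>\<phi>0 - \<phi>\<bar>) / (2 * pi)" unfolding k_def using le_of_int_ceiling[of "\<bar>(\<bar>T\<bar> + \<bar>\<phi>0 - \<phi>\<bar>) / (2 * pi)\<bar>"] by simp
 hence "2 * pi * of_int k \<ge> \<bar>T\<bar> + \<bar>\<phi>0 - \<phi>\<bar>" by (simp add: field_simps)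
 thus ?thesis using that[of "\<phi>0 + 2 * pi * of_int k - \<phi>" k] s by simp
qed

text \<open>By \<open>invariant_shift\<close> the values in the column of phase psi form a periodic
  function of tau alone, which is constant by the Liouville argument; the flow transports every
  point with real phase into this column.\<close>

lemma invariant_const:
 fixes C :: "complex ^ 2 \<Rightarrow> complex" and \<psi> :: real
 assumes sig: "\<sigma> = 1 \<or> \<sigma> = -1"
  and inv: "\<And>z t. z \<in> RD \<sigma> R \<Longrightarrow> \<sigma> * t \<le> 0 \<Longrightarrow> C (z + of_real t *s e11) = C z"
  and per: "\<And>z. z \<in> RD \<sigma> R \<Longrightarrow> C (z + of_real (2 * pi) *s e1) = C z"
  and hol: "(\<lambda>\<tau>. C (pt \<psi> \<tau>)) holomorphic_on Lset \<sigma> R"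
  and bd: "\<And>\<tau>. \<bar>Re \<tau>\<bar> \<le> 7 \<Longrightarrow> \<bar>Im \<tau>\<bar> \<ge> Y \<Longrightarrow> norm (C (pt \<psi> \<tau>)) \<le> B * \<bar>Im \<tau>\<bar> ^ m"
 obtains c where "\<And>z. z \<in> RD \<sigma> R \<Longrightarrow> C z = c"
proof -
 obtain c where c: "\<And>\<tau>. \<tau> \<in> Lset \<sigma> R \<Longrightarrow> C (pt \<psi> \<tau>) = c"
 proof (rule periodic_holomorphic_const[OF sig hol _ bd])
  fix \<tau> assume t: "\<tau> \<in> Lset \<sigma> R"
  have "(pt \<psi> \<tau>) \<in> RD \<sigma> R" using t by (simp add: RD_def)
  from invariant_shift[OF sig inv per this]
  have "C (vector [of_real \<psi>, \<tau>] - of_real (\<sigma> * (2 * pi)) *s axis 2 1) = C (pt \<psi> \<tau>)" .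
  moreover have "vector [of_real \<psi>, \<tau>] - of_real (\<sigma> * (2 * pi)) *s axis 2 1 = (pt \<psi> (\<tau> - of_real (\<sigma> * (2 * pi))))"
   by (simp add: vec_eq_iff forall_2 axis_def)
  ultimately show "C (pt \<psi> (\<tau> - of_real (\<sigma> * (2 * pi)))) = C (pt \<psi> \<tau>)" by simp
 next
  fix c assume "\<And>\<tau>. \<tau> \<in> Lset \<sigma> R \<Longrightarrow> C (pt \<psi> \<tau>) = c"
  thus thesis by (rule that)
 qed
 show ?thesis
 proof (rule that)
  fix z assume z: "z \<in> RD \<sigma> R"
  obtain t k where t: "\<sigma> * t \<le> - 0" "Re (z $ 1) + t = \<psi> + 2 * pi * of_int k"
   using flow_to_phase[OF sig, of 0 "Re (z $ 1)" \<psi>] by blast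
  define u :: "complex^2" where "u = vector [of_real \<psi>, z $ 2 + of_real t]"
  have "z $ 2 + of_real t \<in> Lset \<sigma> R" using z t(1) sig by (auto simp: RD_def Lset_def)
  hence u: "u \<in> RD \<sigma> R" "C u = c" using c by (auto simp: u_def RD_def)
  have "z + of_real t *s e11 = u + of_real (2 * pi * of_int k) *s e1"
   using z t(2) by (simp add: u_def vec_eq_iff forall_2 RD_def complex_eq_iff)
  thus "C z = c" using inv[OF z, of t] t(1) periodic_shift_int[of \<sigma> R C, OF per u(1), of k] u(2) by simp
 qed
qed

lemma has_vector_derivative_transform_at:
 fixes f :: "real \<Rightarrow> complex"
 assumes "(f has_vector_derivative d) (at x)" "\<forall>\<^sub>F t in at x. f t = g t" "f x = g x"
 shows "(g has_vector_derivative d) (at x)"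
proof -
 have "\<forall>\<^sub>F t in nhds x. t \<in> UNIV \<longrightarrow> f t = g t" using assms(2,3) by (simp add: eventually_nhds_conv_at)
 from has_vector_derivative_cong_ev[OF this assms(3)] assms(1) show ?thesis by simp
qed

text \<open>sigma = 1 is for Gamma^-, whose sector reaches to the left, and sigma = -1 for Gamma^+.
  Independence of the tangent vectors and the energy value are added in \<open>sep\<close>; they are
  first derived in the present weaker setting.\<close>

locale sep0 =
 fixes H :: "complex ^ 4 \<Rightarrow> complex" and V0 :: "(complex ^ 4) set" and \<gamma> :: "complex ^ 2 \<Rightarrow> complex ^ 4"
  and h \<sigma> R :: real
 assumes V0: "open V0" and holH: "hol H V0" and sig: "\<sigma> = 1 \<or> \<sigma> = -1" and h: "h > 0"
  and hol\<gamma>: "vhol \<gamma> (DD h \<sigma> R)"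
  and \<gamma>_in: "\<And>z. z \<in> DD h \<sigma> R \<Longrightarrow> \<gamma> z \<in> V0"
  and pde: "\<And>z. z \<in> DD h \<sigma> R \<Longrightarrow> vdd \<gamma> z e11 = ham_vf H (\<gamma> z)"
  and per: "\<And>z. z \<in> DD h \<sigma> R \<Longrightarrow> \<gamma> (z + of_real (2 * pi) *s e1) = \<gamma> z"
begin

abbreviation "D \<equiv> DD h \<sigma> R"
abbreviation "W \<equiv> RD \<sigma> R"
abbreviation "X \<equiv> ham_vf H"
definition g\<phi> :: "complex ^ 2 \<Rightarrow> complex ^ 4" where "g\<phi> z = vdd \<gamma> z e1"
definition pre where "pre V = {z \<in> D. \<gamma> z \<in> V}"

lemma W_sub: "W \<subseteq> D" using h by (auto simp: RD_def DD_def)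

lemma open_pre: "open V \<Longrightarrow> open (pre V)"
proof -
 assume "open V"
 hence "open (D \<inter> \<gamma> -` V)"
  by (intro continuous_open_preimage open_DD vhol_continuous[OF hol\<gamma>])
 thus ?thesis by (simp add: pre_def vimage_def Int_def)
qed

lemma hol_pre:
 assumes "open V" "hol f V"
 shows "hol (\<lambda>z. f (\<gamma> z)) (pre V)" "\<And>z v. z \<in> pre V \<Longrightarrow> dd (\<lambda>z. f (\<gamma> z)) z v = dd f (\<gamma> z) (vdd \<gamma> z v)"
proof -
 have *: "hol (\<lambda>z. \<gamma> z $ i) (pre V)" for i by (rule hol_subset[OF vholD[OF hol\<gamma>]]) (auto simp: pre_def)
 show "hol (\<lambda>z. f (\<gamma> z)) (pre V)" by (rule hol_compose(1)[OF assms(2) *]) (auto simp: pre_def)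
 show "dd (\<lambda>z. f (\<gamma> z)) z v = dd f (\<gamma> z) (vdd \<gamma> z v)" if "z \<in> pre V" for z v
  unfolding vdd_def by (rule hol_compose(2)[where S=V and T="pre V", OF assms(2) *]) (use that in \<open>auto simp: pre_def\<close>)
qed

lemma real_shift_W:
 assumes "open V" "z \<in> W" "\<gamma> z \<in> V" "v = e1 \<or> v = e11"
 shows "\<forall>\<^sub>F t in at (0::real). z + of_real t *s v \<in> W \<inter> pre V"
proof -
 have "z \<in> pre V" using assms W_sub by (auto simp: pre_def)
 moreover have "((\<lambda>t::real. z + of_real t *s v) \<longlongrightarrow> z + of_real 0 *s v) (at 0)"
  by (intro tendsto_add tendsto_const bounded_linear.tendsto[OF bounded_linear_scale] tendsto_of_real tendsto_ident_at)
 hence "((\<lambda>t::real. z + of_real t *s v) \<longlongrightarrow> z) (at 0)" by simp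
 ultimately have "\<forall>\<^sub>F t in at (0::real). z + of_real t *s v \<in> pre V"
  using open_pre[OF assms(1)] topological_tendstoD by blast
 thus ?thesis
 proof eventually_elim
  case (elim t)
  have "Im ((z + of_real t *s v) $ 1) = 0" using assms(2,4) by (auto simp: RD_def)
  thus ?case using elim by (auto simp: pre_def DD_def RD_def)
 qed
qed

text \<open>Constancy is known only for real phases and times, but the complex derivative of the
  holomorphic pullback can be computed along real increments.\<close>

lemma tangential_zero:
 assumes "open V" "hol f V" "z \<in> W" "\<gamma> z \<in> V" and c: "\<And>z. z \<in> W \<Longrightarrow> \<gamma> z \<in> V \<Longrightarrow> f (\<gamma> z) = c"
 shows "dd f (\<gamma> z) (g\<phi> z) = 0" "dd f (\<gamma> z) (X (\<gamma> z)) = 0"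
proof -
 have zp: "z \<in> pre V" using assms W_sub by (auto simp: pre_def)
 have *: "dd f (\<gamma> z) (vdd \<gamma> z v) = 0" if v: "v = e1 \<or> v = e11" for v
 proof -
  have "((\<lambda>t. f (\<gamma> (z + t *s v))) has_field_derivative dd (\<lambda>z. f (\<gamma> z)) (z + 0 *s v) v) (at 0)"
   by (rule hol_line[OF hol_pre(1)[OF assms(1,2)]]) (use zp in simp)
  hence "((\<lambda>t. f (\<gamma> (z + t *s v))) has_field_derivative dd f (\<gamma> z) (vdd \<gamma> z v)) (at (of_real 0))"
   using hol_pre(2)[OF assms(1,2) zp] by simp
  from has_vector_derivative_real_field[OF this]
  have 1: "((\<lambda>t. f (\<gamma> (z + of_real t *s v))) has_vector_derivative dd f (\<gamma> z) (vdd \<gamma> z v)) (at 0)" by simp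
  have ev: "\<forall>\<^sub>F t in at (0::real). f (\<gamma> (z + of_real t *s v)) = c"
   using real_shift_W[OF assms(1,3,4) v] by eventually_elim (use c in \<open>auto simp: pre_def\<close>)
  have "f (\<gamma> z) = c" using c assms(3,4) by blast
  have "((\<lambda>t::real. c) has_vector_derivative dd f (\<gamma> z) (vdd \<gamma> z v)) (at 0)"
   by (rule has_vector_derivative_transform_at[OF 1 ev]) (use \<open>f (\<gamma> z) = c\<close> in simp)
  moreover have "((\<lambda>t::real. c) has_vector_derivative 0) (at 0)" by simp
  ultimately show ?thesis by (rule vector_derivative_unique_at)
 qed
 show "dd f (\<gamma> z) (g\<phi> z) = 0" using *[of e1] by (simp add: g\<phi>_def)
 have "z \<in> D" using assms(3) W_sub by blast
 thus "dd f (\<gamma> z) (X (\<gamma> z)) = 0" using *[of e11] pde by simp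
qed

lemma \<gamma>_V0: "z \<in> W \<Longrightarrow> \<gamma> z \<in> V0" using \<gamma>_in W_sub by blast

lemma vhol_g\<phi>: "vhol g\<phi> D"
 unfolding g\<phi>_def by (rule vhol_vdd[OF open_DD hol\<gamma>])

text \<open>Differentiating the equation in the phase and exchanging the two derivatives: the phase
  derivative solves the variational equation.\<close>

lemma vdd_g\<phi>:
 assumes "z \<in> D"
 shows "vdd g\<phi> z e11 = vdd X (\<gamma> z) (g\<phi> z)"
 unfolding vec_eq_iff
proof
 fix i
 have X: "hol (\<lambda>x. X x $ i) V0" using vhol_ham_vf[OF V0 holH] vholD by blast
 have z: "z \<in> pre V0" and pD: "pre V0 = D" using assms \<gamma>_in by (auto simp: pre_def)
 have "vdd g\<phi> z e11 $ i = dd (\<lambda>y. dd (\<lambda>w. \<gamma> w $ i) y e1) z e11" by (simp add: vdd_def g\<phi>_def)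
 also have "\<dots> = dd (\<lambda>y. dd (\<lambda>w. \<gamma> w $ i) y e11) z e1" by (rule dd_commute[OF open_DD vholD[OF hol\<gamma>] assms])
 also have "\<dots> = dd (\<lambda>y. X (\<gamma> y) $ i) z e1"
  by (rule hol_transform(2)[OF hol_pre(1)[OF V0 X] open_pre[OF V0]])
   (use pde pD assms in \<open>auto simp: vdd_def vec_eq_iff\<close>)
 also have "\<dots> = dd (\<lambda>x. X x $ i) (\<gamma> z) (g\<phi> z)" using hol_pre(2)[OF V0 X z, of e1] unfolding g\<phi>_def .
 finally show "vdd g\<phi> z e11 $ i = vdd X (\<gamma> z) (g\<phi> z) $ i" by (simp add: vdd_def)
qed

lemma g\<phi>_per: "z \<in> D \<Longrightarrow> g\<phi> (z + of_real (2 * pi) *s e1) = g\<phi> z"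
proof -
 assume z: "z \<in> D"
 have sh: "u + of_real (2 * pi) *s e1 \<in> D" if "u \<in> D" for u using that by (auto simp: DD_def)
 have "dd (\<lambda>u. \<gamma> (u + of_real (2 * pi) *s e1) $ i) z e1 = dd (\<lambda>u. \<gamma> u $ i) z e1" for i
  by (rule hol_transform(2)[OF vholD[OF hol\<gamma>] open_DD _ z]) (use per in auto)
 moreover have "dd (\<lambda>u. \<gamma> (u + of_real (2 * pi) *s e1) $ i) z e1 = dd (\<lambda>u. \<gamma> u $ i) (z + of_real (2 * pi) *s e1) e1" for i
  by (rule hol_translate(2)[OF vholD[OF hol\<gamma>, of i] sh z])
 ultimately show ?thesis by (simp add: g\<phi>_def vdd_def vec_eq_iff)
qed

end

locale sep = sep0 +
 fixes H0 :: complex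
 assumes indep: "\<And>z a b. z \<in> RD \<sigma> R \<Longrightarrow> a *s vdd \<gamma> z e1 + b *s ham_vf H (\<gamma> z) = 0 \<Longrightarrow> a = 0 \<and> b = 0"
  and H\<gamma>: "\<And>z. z \<in> RD \<sigma> R \<Longrightarrow> H (\<gamma> z) = H0"
begin

lemma dH_g\<phi>: "z \<in> W \<Longrightarrow> dd H (\<gamma> z) (g\<phi> z) = 0"
 by (rule tangential_zero(1)[OF V0 holH _ \<gamma>_V0]) (use H\<gamma> in auto)

lemma symp_g\<phi>_X: "z \<in> W \<Longrightarrow> symp (g\<phi> z) (X (\<gamma> z)) = 0"
 using dH_g\<phi>[of z] symp_ham_vf[of H "\<gamma> z" "g\<phi> z"] symp_skew[of "g\<phi> z"] by simp

text \<open>The plane spanned by the phase derivative and X is Lagrangian. Hence on the tangent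
  space of the energy level, \<open>symp y (g\<phi> z)\<close> measures exactly the component of y
  transversal to the separatrix.\<close>

lemma tangent_span:
 assumes "z \<in> W" "symp y (g\<phi> z) = 0" "dd H (\<gamma> z) y = 0"
 obtains a b where "y = a *s g\<phi> z + b *s X (\<gamma> z)"
proof (rule lagrangian_span[of "g\<phi> z" "X (\<gamma> z)" y])
 show "\<And>a b. a *s g\<phi> z + b *s X (\<gamma> z) = 0 \<Longrightarrow> a = 0 \<and> b = 0" using indep[OF assms(1)] by (simp add: g\<phi>_def)
 show "symp y (X (\<gamma> z)) = 0" using symp_ham_vf[of H "\<gamma> z" y] symp_skew[of y "X (\<gamma> z)"] assms(3) by simp
qed (use assms symp_g\<phi>_X that in auto)

definition Nz where "Nz a b z = symp (Zf H a b (\<gamma> z)) (g\<phi> z)"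

text \<open>If all these values vanished, nondegeneracy would give a linear relation between the
  phase derivative and X whose coefficient \<open>dd H (\<gamma> z) b\<close> can be made
  nonzero.\<close>

lemma Nz_nonzero:
 assumes "z \<in> W"
 obtains a b where "Nz a b z \<noteq> 0"
proof -
 have "\<exists>a b. Nz a b z \<noteq> 0"
 proof (rule ccontr)
  assume c: "\<not> (\<exists>a b. Nz a b z \<noteq> 0)"
  have "X (\<gamma> z) \<noteq> 0" using indep[OF assms, of 0 1] by auto
  then obtain b where b: "dd H (\<gamma> z) b \<noteq> 0" using symp_nondegenerate[of "X (\<gamma> z)"] symp_ham_vf by metis
  have "symp (dd H (\<gamma> z) b *s g\<phi> z - symp b (g\<phi> z) *s - X (\<gamma> z)) a = 0" for a
  proof -
   have "Nz a b z = 0" using c by blast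
   hence "dd H (\<gamma> z) b * symp a (g\<phi> z) = dd H (\<gamma> z) a * symp b (g\<phi> z)"
    by (simp add: Nz_def Zf_def symp_diff_left symp_scale_left)
   moreover have "symp (- X (\<gamma> z)) a = - dd H (\<gamma> z) a"
    unfolding symp_ham_vf[of H "\<gamma> z" a, symmetric] by (simp add: symp_def)
   ultimately show ?thesis using symp_skew[of "g\<phi> z" a]
    by (simp add: symp_diff_left symp_scale_left symp_add_left symp_ham_vf)
  qed
  from symp_nondegenerate[OF this]
  have "dd H (\<gamma> z) b *s g\<phi> z + symp b (g\<phi> z) *s X (\<gamma> z) = 0" by (simp add: vec_eq_iff)
  from indep[OF assms this[unfolded g\<phi>_def]] b show False by (simp add: g\<phi>_def)
 qed
 thus ?thesis using that by blast
qed

lemma hol_symp: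
 assumes "vhol S A" "vhol T A"
 shows "hol (\<lambda>z. symp (S z) (T z)) A"
  and "\<And>z v. z \<in> A \<Longrightarrow> dd (\<lambda>z. symp (S z) (T z)) z v = symp (vdd S z v) (T z) + symp (S z) (vdd T z v)"
proof -
 note S = vholD[OF assms(1)] and T = vholD[OF assms(2)]
 show "hol (\<lambda>z. symp (S z) (T z)) A" unfolding symp_def by (intro hol_diff hol_add hol_mult S T)
 fix z v assume z: "z \<in> A"
 have m: "hol (\<lambda>z. S z $ i * T z $ j) A" for i j by (intro hol_mult S T)
 show "dd (\<lambda>z. symp (S z) (T z)) z v = symp (vdd S z v) (T z) + symp (S z) (vdd T z v)"
  unfolding symp_def
  unfolding dd_minus[OF hol_diff[OF hol_add[OF m m] m] m z] dd_minus[OF hol_add[OF m m] m z] dd_plus[OF m m z] dd_mult[OF S T z]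
  by (simp add: vdd_def algebra_simps)
qed

lemma vhol_Zf: "vhol (Zf H a b) V0" using tang_Zf[OF V0 holH] by (simp add: tang_def)

text \<open>The linearised flow preserves the symplectic form, so the time derivative of the
  transversal component of a field Z is the transversal component of [X, Z].\<close>

lemma hol_Nz: "hol (Nz a b) D"
 and dd_Nz: "\<And>z. z \<in> D \<Longrightarrow> dd (Nz a b) z e11 = symp (comm X (Zf H a b) (\<gamma> z)) (g\<phi> z)"
proof -
 have pD: "pre V0 = D" using \<gamma>_in by (auto simp: pre_def)
 have v: "vhol (\<lambda>z. Zf H a b (\<gamma> z)) D"
  unfolding vhol_def using hol_pre(1)[OF V0 vholD[OF vhol_Zf]] pD by simp
 note * = hol_symp[OF v vhol_g\<phi>]
 show "hol (Nz a b) D" using *(1) by (simp add: Nz_def[abs_def])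
 fix z assume z: "z \<in> D"
 have "vdd (\<lambda>z. Zf H a b (\<gamma> z)) z e11 = vdd (Zf H a b) (\<gamma> z) (X (\<gamma> z))"
  using hol_pre(2)[OF V0 vholD[OF vhol_Zf], where z=z and v=e11] z pD pde[OF z] by (simp add: vdd_def vec_eq_iff)
 hence "dd (Nz a b) z e11 = symp (vdd (Zf H a b) (\<gamma> z) (X (\<gamma> z))) (g\<phi> z) + symp (Zf H a b (\<gamma> z)) (vdd X (\<gamma> z) (g\<phi> z))"
  using *(2)[OF z, of e11] vdd_g\<phi>[OF z] by (simp add: Nz_def[abs_def])
 also have "\<dots> = symp (comm X (Zf H a b) (\<gamma> z)) (g\<phi> z)"
  using hamiltonian_matrix[OF V0 holH \<gamma>_in[OF z], of "Zf H a b (\<gamma> z)" "g\<phi> z"] by (simp add: comm_def symp_diff_left)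
 finally show "dd (Nz a b) z e11 = symp (comm X (Zf H a b) (\<gamma> z)) (g\<phi> z)" .
qed

end

section \<open>The lowest nonvanishing tangential jet of a first integral\<close>

locale first_int = sep +
 fixes G :: "complex ^ 4 \<Rightarrow> complex" and V :: "(complex ^ 4) set" and a0 :: complex
 assumes V: "open V" "V \<subseteq> V0" and holG: "hol G V" and XG: "\<And>x. x \<in> V \<Longrightarrow> dd G x (ham_vf H x) = 0"
  and \<gamma>V: "\<And>z. z \<in> RD \<sigma> R \<Longrightarrow> \<gamma> z \<in> V" and G\<gamma>: "\<And>z. z \<in> RD \<sigma> R \<Longrightarrow> G (\<gamma> z) = a0"
begin

text \<open>Vanishing of all tangential derivatives of orders 1 to k - 1. The fields live on
  arbitrary open subsets, because the fields of the later charts exist only near one point. Order 0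
  is left out, as G itself has the value \<open>a0\<close>.\<close>

definition Van :: "nat \<Rightarrow> bool" where
 "Van k \<longleftrightarrow> (\<forall>V'. open V' \<longrightarrow> V' \<subseteq> V \<longrightarrow> (\<forall>Ts. (\<forall>T\<in>set Ts. tang H T V') \<longrightarrow> 0 < length Ts \<longrightarrow> length Ts < k \<longrightarrow>
   (\<forall>z\<in>W. \<gamma> z \<in> V' \<longrightarrow> Lds Ts G (\<gamma> z) = 0)))"

lemma VanD: "Van k \<Longrightarrow> open V' \<Longrightarrow> V' \<subseteq> V \<Longrightarrow> \<forall>T\<in>set Ts. tang H T V' \<Longrightarrow> 0 < length Ts \<Longrightarrow> length Ts < k \<Longrightarrow> z \<in> W \<Longrightarrow> \<gamma> z \<in> V' \<Longrightarrow> Lds Ts G (\<gamma> z) = 0"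
 unfolding Van_def by blast

lemma Van_1: "Van (Suc 0)" by (simp add: Van_def)

context
 fixes k V'
 assumes van: "Van k" and V': "open V'" "V' \<subseteq> V"
begin

lemma hol': "hol G V'" "hol H V'"
 using hol_subset[OF holG V'(2)] hol_subset[OF holH] V V' by auto

lemma hol_Lds_tang: "\<forall>T\<in>set Ts. tang H T V' \<Longrightarrow> hol (Lds Ts G) V'"
 by (rule hol_Lds[OF V'(1) hol'(1)]) (auto simp: tang_def)

text \<open>The bracket term has at most k - 1 derivations and vanishes by \<open>van\<close>, so at
  order k the derivations commute along the separatrix.\<close>

lemma Lds_swap:
 assumes "\<forall>T\<in>set (P @ [S, T] @ Q). tang H T V'" "length (P @ [S, T] @ Q) \<le> k" "z \<in> W" "\<gamma> z \<in> V'"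
 shows "Lds (P @ [S, T] @ Q) G (\<gamma> z) = Lds (P @ [T, S] @ Q) G (\<gamma> z)"
  and "Lds (P @ [comm S T] @ Q) G (\<gamma> z) = 0"
proof -
 have vh: "vhol S V'" "vhol T V'" "\<forall>T\<in>set P. vhol T V'" using assms(1) by (auto simp: tang_def)
 have hQ: "hol (Lds Q G) V'" by (rule hol_Lds_tang) (use assms(1) in auto)
 have "Lds P (\<lambda>x. Ld S (Ld T (Lds Q G)) x - Ld T (Ld S (Lds Q G)) x) (\<gamma> z) = Lds P (Ld (comm S T) (Lds Q G)) (\<gamma> z)"
  by (rule Lds_cong[OF V'(1) _ _ vh(3) assms(4)]) (use Ld_comm[OF V'(1) hQ vh(1,2)] hol_Ld[OF V'(1) hQ vhol_comm[OF V'(1) vh(1,2)]] in auto)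
 moreover have "Lds P (\<lambda>x. Ld S (Ld T (Lds Q G)) x - Ld T (Ld S (Lds Q G)) x) (\<gamma> z)
   = Lds P (Ld S (Ld T (Lds Q G))) (\<gamma> z) - Lds P (Ld T (Ld S (Lds Q G))) (\<gamma> z)"
  by (rule Lds_diff[OF V'(1) _ _ vh(3) assms(4)]) (auto intro: hol_Ld V'(1) vh hQ)
 moreover show 0: "Lds (P @ [comm S T] @ Q) G (\<gamma> z) = 0"
  by (rule VanD[OF van V' _ _ _ assms(3,4)]) (use assms(1,2) tang_comm[OF V'(1) hol'(2)] in auto)
 ultimately show "Lds (P @ [S, T] @ Q) G (\<gamma> z) = Lds (P @ [T, S] @ Q) G (\<gamma> z)"
  by (simp add: Lds_append)
qed

text \<open>The same exchange without a bound on the length, hence with the bracket term kept; it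
  serves for k + 1 fields one of which is X.\<close>

lemma Lds_comm_term:
 assumes "\<forall>T\<in>set (P @ [S, T] @ Q). tang H T V'" "z \<in> W" "\<gamma> z \<in> V'"
 shows "Lds (P @ [S, T] @ Q) G (\<gamma> z) = Lds (P @ [T, S] @ Q) G (\<gamma> z) + Lds (P @ [comm S T] @ Q) G (\<gamma> z)"
proof -
 have vh: "vhol S V'" "vhol T V'" "\<forall>T\<in>set P. vhol T V'" using assms(1) by (auto simp: tang_def)
 have hQ: "hol (Lds Q G) V'" by (rule hol_Lds_tang) (use assms(1) in auto)
 have "Lds P (\<lambda>x. Ld S (Ld T (Lds Q G)) x - Ld T (Ld S (Lds Q G)) x) (\<gamma> z) = Lds P (Ld (comm S T) (Lds Q G)) (\<gamma> z)"
  by (rule Lds_cong[OF V'(1) _ _ vh(3) assms(3)]) (use Ld_comm[OF V'(1) hQ vh(1,2)] hol_Ld[OF V'(1) hQ vhol_comm[OF V'(1) vh(1,2)]] in auto)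
 moreover have "Lds P (\<lambda>x. Ld S (Ld T (Lds Q G)) x - Ld T (Ld S (Lds Q G)) x) (\<gamma> z)
   = Lds P (Ld S (Ld T (Lds Q G))) (\<gamma> z) - Lds P (Ld T (Ld S (Lds Q G))) (\<gamma> z)"
  by (rule Lds_diff[OF V'(1) _ _ vh(3) assms(3)]) (auto intro: hol_Ld V'(1) vh hQ)
 ultimately show ?thesis by (simp add: Lds_append) (metis diff_eq_eq add.commute)
qed

text \<open>The inner derivative is constant along the separatrix, so its derivatives in the tangent
  plane vanish and only the transversal component of the outermost field matters.\<close>

lemma Lds_first:
 assumes "\<forall>T\<in>set (T # Z # Us). tang H T V'" "length Us < k" "z \<in> W" "\<gamma> z \<in> V'"
  "symp (Z (\<gamma> z)) (g\<phi> z) \<noteq> 0"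
 shows "Lds (T # Us) G (\<gamma> z) = symp (T (\<gamma> z)) (g\<phi> z) / symp (Z (\<gamma> z)) (g\<phi> z) * Lds (Z # Us) G (\<gamma> z)"
proof -
 define \<alpha> where "\<alpha> = symp (T (\<gamma> z)) (g\<phi> z) / symp (Z (\<gamma> z)) (g\<phi> z)"
 have hU: "hol (Lds Us G) V'" by (rule hol_Lds_tang) (use assms(1) in auto)
 obtain a b where ab: "T (\<gamma> z) - \<alpha> *s Z (\<gamma> z) = a *s g\<phi> z + b *s X (\<gamma> z)"
 proof (rule tangent_span[OF assms(3)])
  show "symp (T (\<gamma> z) - \<alpha> *s Z (\<gamma> z)) (g\<phi> z) = 0" using assms(5) by (simp add: symp_diff_left symp_scale_left \<alpha>_def)
  show "dd H (\<gamma> z) (T (\<gamma> z) - \<alpha> *s Z (\<gamma> z)) = 0" using assms(1,4) by (simp add: tang_def dd_diff dd_scale)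
 qed blast
 \<comment> \<open>The empty list is not covered by \<open>Van\<close>; there the constant is the
   value of G.\<close>
 have const: "Lds Us G (\<gamma> w) = (if Us = [] then a0 else 0)" if "w \<in> W" "\<gamma> w \<in> V'" for w
 proof (cases "Us = []")
  case False
  thus ?thesis using VanD[OF van V' _ _ assms(2) that, of ] assms(1) by simp
 qed (use G\<gamma> that in auto)
 note tz = tangential_zero[OF V'(1) hU assms(3,4) const]
 have "dd (Lds Us G) (\<gamma> z) (T (\<gamma> z) - \<alpha> *s Z (\<gamma> z)) = 0"
  unfolding ab dd_add dd_scale using tz by simp
 thus ?thesis by (simp add: dd_diff dd_scale Ld_def \<alpha>_def)
qed

lemma Lds_rotate:
 assumes "\<forall>T\<in>set (P @ Z # Q). tang H T V'" "length (P @ Z # Q) \<le> k" "z \<in> W" "\<gamma> z \<in> V'"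
 shows "Lds (P @ Z # Q) G (\<gamma> z) = Lds (P @ Q @ [Z]) G (\<gamma> z)"
 using assms(1,2)
proof (induction Q arbitrary: P)
 case (Cons q Q)
 have "Lds (P @ Z # q # Q) G (\<gamma> z) = Lds (P @ q # Z # Q) G (\<gamma> z)"
  using Lds_swap(1)[of P Z q Q z] Cons.prems assms(3,4) by simp
 also have "\<dots> = Lds ((P @ [q]) @ Z # Q) G (\<gamma> z)" by simp
 also have "\<dots> = Lds ((P @ [q]) @ Q @ [Z]) G (\<gamma> z)" by (rule Cons.IH) (use Cons.prems in auto)
 finally show ?case by simp
qed simp

text \<open>The outermost field is replaced by a multiple of Z, which is then moved to the innermost
  place by commutation, so that the next field becomes outermost. The k-th jet is thus a product of
  transversal components.\<close>

lemma Lds_symbol: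
 assumes "\<forall>T\<in>set Ts. tang H T V'" "tang H Z V'" "length Ts + m = k" "z \<in> W" "\<gamma> z \<in> V'"
  "symp (Z (\<gamma> z)) (g\<phi> z) \<noteq> 0"
 shows "Lds (Ts @ replicate m Z) G (\<gamma> z) = prod_list (map (\<lambda>T. symp (T (\<gamma> z)) (g\<phi> z) / symp (Z (\<gamma> z)) (g\<phi> z)) Ts) * Lds (replicate k Z) G (\<gamma> z)"
 using assms(1,3)
proof (induction Ts arbitrary: m)
 case (Cons T Us)
 let ?R = "Us @ replicate m Z"
 have tR: "\<forall>T\<in>set ?R. tang H T V'" using Cons.prems(1) assms(2) by auto
 have "Lds (T # ?R) G (\<gamma> z) = symp (T (\<gamma> z)) (g\<phi> z) / symp (Z (\<gamma> z)) (g\<phi> z) * Lds (Z # ?R) G (\<gamma> z)"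
  by (rule Lds_first) (use Cons.prems assms tR in auto)
 also have "Lds (Z # ?R) G (\<gamma> z) = Lds (?R @ [Z]) G (\<gamma> z)"
  using Lds_rotate[of "[]" Z ?R z] Cons.prems assms tR by simp
 also have "?R @ [Z] = Us @ replicate (Suc m) Z" by (simp add: replicate_append_same)
 also have "Lds (Us @ replicate (Suc m) Z) G (\<gamma> z) = prod_list (map (\<lambda>T. symp (T (\<gamma> z)) (g\<phi> z) / symp (Z (\<gamma> z)) (g\<phi> z)) Us) * Lds (replicate k Z) G (\<gamma> z)"
  by (rule Cons.IH) (use Cons.prems in auto)
 finally show ?case by simp
qed (use assms(3) in simp)

end

text \<open>The coefficient of the k-th jet. A pair a, b with nonzero transversal component is
  chosen separately at each point; \<open>Cf_eq\<close> shows that every such pair gives the same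
  value.\<close>

definition Cf :: "nat \<Rightarrow> complex ^ 2 \<Rightarrow> complex" where
 "Cf k z = (let p = (SOME p. Nz (fst p) (snd p) z \<noteq> 0) in
   Lds (replicate k (Zf H (fst p) (snd p))) G (\<gamma> z) / Nz (fst p) (snd p) z ^ k)"

lemma tang_Zf_V: "tang H (Zf H a b) V" "V' \<subseteq> V \<Longrightarrow> tang H (Zf H a b) V'"
 using tang_subset[OF tang_Zf[OF V0 holH]] V(2) by blast+

lemma Lds_Cf:
 assumes van: "Van k" and V': "open V'" "V' \<subseteq> V"
  and "\<forall>T\<in>set Ts. tang H T V'" "length Ts = k" "z \<in> W" "\<gamma> z \<in> V'"
 shows "Lds Ts G (\<gamma> z) = Cf k z * prod_list (map (\<lambda>T. symp (T (\<gamma> z)) (g\<phi> z)) Ts)"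
proof -
 define p where "p = (SOME p. Nz (fst p) (snd p) z \<noteq> 0)"
 define Z where "Z = Zf H (fst p) (snd p)"
 have "\<exists>p. Nz (fst p) (snd p) z \<noteq> 0" using Nz_nonzero[OF assms(6)] by (metis fst_conv snd_conv)
 hence p: "Nz (fst p) (snd p) z \<noteq> 0" unfolding p_def by (rule someI_ex)
 have C: "Cf k z = Lds (replicate k Z) G (\<gamma> z) / Nz (fst p) (snd p) z ^ k"
  by (simp add: Cf_def p_def[symmetric] Z_def Let_def)
 have "Lds (Ts @ replicate 0 Z) G (\<gamma> z) = prod_list (map (\<lambda>T. symp (T (\<gamma> z)) (g\<phi> z) / symp (Z (\<gamma> z)) (g\<phi> z)) Ts) * Lds (replicate k Z) G (\<gamma> z)"
  by (rule Lds_symbol[OF van V' assms(4)]) (use assms p tang_Zf_V in \<open>auto simp: Z_def Nz_def\<close>)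
 moreover have "prod_list (map (\<lambda>T. symp (T (\<gamma> z)) (g\<phi> z) / c) Ts) = prod_list (map (\<lambda>T. symp (T (\<gamma> z)) (g\<phi> z)) Ts) / c ^ length Ts" for c
  by (induction Ts) auto
 ultimately show ?thesis using assms(5) by (simp add: C Nz_def Z_def)
qed

lemma Cf_eq:
 assumes "Van k" "z \<in> W" "Nz a b z \<noteq> 0"
 shows "Cf k z = Lds (replicate k (Zf H a b)) G (\<gamma> z) / Nz a b z ^ k"
 using Lds_Cf[OF assms(1) V(1) order_refl, of "replicate k (Zf H a b)" z] assms tang_Zf_V \<gamma>V
 by (simp add: Nz_def prod_list_replicate)

lemma Van_Suc:
 assumes "Van k" "\<And>z. z \<in> W \<Longrightarrow> Cf k z = 0"
 shows "Van (Suc k)"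
 unfolding Van_def
proof (intro allI impI ballI)
 fix V' Ts z assume a: "open V'" "V' \<subseteq> V" "\<forall>T\<in>set Ts. tang H T V'" "0 < length Ts" "length Ts < Suc k" "z \<in> W" "\<gamma> z \<in> V'"
 show "Lds Ts G (\<gamma> z) = 0"
 proof (cases "length Ts = k")
  case True thus ?thesis using Lds_Cf[OF assms(1) a(1,2,3) True a(6,7)] assms(2) a by simp
 next
  case False thus ?thesis using VanD[OF assms(1) a(1,2,3,4) _ a(6,7)] a(5) by simp
 qed
qed

text \<open>X kills G when it acts first. Moving it outwards past one Z at a time creates bracket
  terms with exactly k fields, evaluated by \<open>Lds_Cf\<close>. For m = k this gives the time
  derivative of the k-th Z-derivative of G.\<close>

lemma X_through:
 assumes van: "Van k" "z \<in> W" "m \<le> k"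
 shows "Lds (replicate (k - m) (Zf H a b) @ X # replicate m (Zf H a b)) G (\<gamma> z)
   = of_nat m * Cf k z * Nz a b z ^ (k - 1) * symp (comm X (Zf H a b) (\<gamma> z)) (g\<phi> z)"
 using assms(3)
proof (induction m)
 case 0
 have vZ: "\<forall>T\<in>set (replicate k (Zf H a b)). vhol T V" using tang_Zf_V(1)[of a b] by (auto simp: tang_def)
 have "Lds (replicate k (Zf H a b)) (Ld X G) (\<gamma> z) = 0"
  by (rule Lds_zero[OF V(1) _ vZ \<gamma>V[OF van(2)]]) (use XG in \<open>auto simp: Ld_def\<close>)
 thus ?case by (simp add: Lds_append)
next
 case (Suc m)
 let ?Z = "Zf H a b" and ?P = "replicate (k - Suc m) (Zf H a b)"
 have tX: "tang H X V" using tang_subset[OF tang_ham_vf[OF V0 holH] V(2)] .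
 have hHV: "hol H V" using hol_subset[OF holH V(2)] .
 have tc: "tang H (comm X ?Z) V" by (rule tang_comm[OF V(1) hHV tX tang_Zf_V(1)])
 have k: "k - m = Suc (k - Suc m)" using Suc.prems by simp
 have P: "replicate (k - m) ?Z = ?P @ [?Z]" unfolding k by (simp add: replicate_append_same)
 have "Lds (?P @ [X, ?Z] @ replicate m ?Z) G (\<gamma> z) = Lds (?P @ [?Z, X] @ replicate m ?Z) G (\<gamma> z) + Lds (?P @ [comm X ?Z] @ replicate m ?Z) G (\<gamma> z)"
  by (rule Lds_comm_term[OF van(1) V(1) order_refl]) (use tX tang_Zf_V(1) van(2) \<gamma>V in auto)
 also have "Lds (?P @ [?Z, X] @ replicate m ?Z) G (\<gamma> z) = of_nat m * Cf k z * Nz a b z ^ (k - 1) * symp (comm X ?Z (\<gamma> z)) (g\<phi> z)"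
  using Suc.IH Suc.prems P by simp
 also have "Lds (?P @ [comm X ?Z] @ replicate m ?Z) G (\<gamma> z) = Cf k z * prod_list (map (\<lambda>T. symp (T (\<gamma> z)) (g\<phi> z)) (?P @ [comm X ?Z] @ replicate m ?Z))"
  by (rule Lds_Cf[OF van(1) V(1) order_refl]) (use tc tang_Zf_V(1) van(2) \<gamma>V Suc.prems in auto)
 also have "\<dots> = Cf k z * (Nz a b z ^ (k - Suc m) * Nz a b z ^ m * symp (comm X ?Z (\<gamma> z)) (g\<phi> z))"
  by (simp add: prod_list_replicate Nz_def mult_ac)
 also have "Nz a b z ^ (k - Suc m) * Nz a b z ^ m = Nz a b z ^ (k - 1)"
  using Suc.prems by (simp add: power_add[symmetric])
 finally show ?case by (simp add: algebra_simps)
qed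

text \<open>By \<open>X_through\<close> the numerator g satisfies N g' = k g N', which is the
  relation satisfied by N^k; the quotient is therefore stationary along the flow.\<close>

lemma Cf_deriv:
 assumes van: "Van k" "k > 0" and z: "z \<in> W"
 shows "((\<lambda>t::real. Cf k (z + of_real t *s e11)) has_vector_derivative 0) (at 0)"
proof -
 obtain a b where N: "Nz a b z \<noteq> 0" using Nz_nonzero[OF z] by blast
 let ?Z = "Zf H a b"
 define g where "g = Lds (replicate k ?Z) G"
 have hg: "hol g V" unfolding g_def by (rule hol_Lds_tang[OF van(1) V(1) order_refl]) (use tang_Zf_V(1) in auto)
 have zp: "z \<in> pre V" "z \<in> D" using z W_sub \<gamma>V by (auto simp: pre_def)
 have d1: "((\<lambda>t. g (\<gamma> (z + t *s e11))) has_field_derivative dd g (\<gamma> z) (X (\<gamma> z))) (at 0)"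
  using hol_line[OF hol_pre(1)[OF V(1) hg], of z 0 e11 UNIV] hol_pre(2)[OF V(1) hg zp(1)] pde[OF zp(2)] zp by simp
 have d2: "((\<lambda>t. Nz a b (z + t *s e11)) has_field_derivative symp (comm X ?Z (\<gamma> z)) (g\<phi> z)) (at 0)"
  using hol_line[OF hol_Nz[of a b], of z 0 e11 UNIV] dd_Nz[OF zp(2)] zp by simp
 have dg: "dd g (\<gamma> z) (X (\<gamma> z)) = of_nat k * Cf k z * Nz a b z ^ (k - 1) * symp (comm X ?Z (\<gamma> z)) (g\<phi> z)"
  using X_through[OF van(1) z order_refl, of a b] by (simp add: Ld_def g_def)
 have C: "Cf k z = g (\<gamma> z) / Nz a b z ^ k" using Cf_eq[OF van(1) z N] by (simp add: g_def)
 have "((\<lambda>t. g (\<gamma> (z + t *s e11)) / Nz a b (z + t *s e11) ^ k) has_field_derivative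
   (dd g (\<gamma> z) (X (\<gamma> z)) * Nz a b z ^ k - g (\<gamma> z) * (of_nat k * (symp (comm X ?Z (\<gamma> z)) (g\<phi> z) * Nz a b z ^ (k - Suc 0)))) / (Nz a b z ^ k * Nz a b z ^ k)) (at 0)"
  using DERIV_divide[OF d1 DERIV_power[OF d2, of k]] N by simp
 also have "(dd g (\<gamma> z) (X (\<gamma> z)) * Nz a b z ^ k - g (\<gamma> z) * (of_nat k * (symp (comm X ?Z (\<gamma> z)) (g\<phi> z) * Nz a b z ^ (k - Suc 0)))) = 0"
  unfolding dg C using N by simp
 finally have "((\<lambda>t. g (\<gamma> (z + t *s e11)) / Nz a b (z + t *s e11) ^ k) has_field_derivative 0) (at (of_real 0))" by simp
 from has_vector_derivative_real_field[OF this]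
 have 1: "((\<lambda>t::real. g (\<gamma> (z + of_real t *s e11)) / Nz a b (z + of_real t *s e11) ^ k) has_vector_derivative 0) (at 0)" .
 have "isCont (\<lambda>t::real. Nz a b (z + of_real t *s e11)) 0"
  using has_vector_derivative_continuous[OF has_vector_derivative_real_field[of "\<lambda>t. Nz a b (z + t *s e11)" _ 0 UNIV]] d2 by auto
 hence "\<forall>\<^sub>F t in at (0::real). Nz a b (z + of_real t *s e11) \<noteq> 0"
  using N by (intro tendsto_imp_eventually_ne[where c="Nz a b z"]) (auto simp: isCont_def)
 moreover have "\<forall>\<^sub>F t in at (0::real). z + of_real t *s e11 \<in> W \<inter> pre V" by (rule real_shift_W[OF V(1) z \<gamma>V[OF z]]) simp
 ultimately have ev: "\<forall>\<^sub>F t in at (0::real). g (\<gamma> (z + of_real t *s e11)) / Nz a b (z + of_real t *s e11) ^ k = Cf k (z + of_real t *s e11)"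
  by eventually_elim (use Cf_eq[OF van(1)] in \<open>auto simp: g_def\<close>)
 show ?thesis by (rule has_vector_derivative_transform_at[OF 1 ev]) (use C in auto)
qed

lemma Cf_invariant:
 assumes van: "Van k" "k > 0" and z: "z \<in> W" and t: "\<sigma> * t \<le> 0"
 shows "Cf k (z + of_real t *s e11) = Cf k z"
proof -
 have W: "z + of_real s *s e11 \<in> W" if "\<sigma> * s \<le> 0" for s
  using z that sig by (auto simp: RD_def Lset_def)
 define S where "S = closed_segment 0 t"
 have Sd: "\<sigma> * s \<le> 0" if "s \<in> S" for s
  using that t sig by (auto simp: S_def closed_segment_eq_real_ivl split: if_splits)
 have conv: "convex S" by (simp add: S_def)
 obtain c where "\<And>s. s \<in> S \<Longrightarrow> Cf k (z + of_real s *s e11) = c"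
 proof (rule has_vector_derivative_zero_constant[OF conv, of "\<lambda>s. Cf k (z + of_real s *s e11)"])
  fix s assume "s \<in> S"
  from Cf_deriv[OF van W[OF Sd[OF this]]]
  have "((\<lambda>u. Cf k (z + of_real s *s e11 + of_real u *s e11)) has_vector_derivative 0) (at (s - s))" by simp
  moreover have dsh: "((\<lambda>u. u - s) has_vector_derivative 1) (at s)"
   unfolding has_real_derivative_iff_has_vector_derivative[symmetric] by (auto intro!: derivative_eq_intros)
  ultimately have "((\<lambda>u. Cf k (z + of_real s *s e11 + of_real (u - s) *s e11)) has_vector_derivative 0) (at s)"
   using vector_diff_chain_at[of "\<lambda>u. u - s" 1 s "\<lambda>u. Cf k (z + of_real s *s e11 + of_real u *s e11)" 0]
    dsh by (simp add: comp_def)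
  moreover have "z + of_real s *s e11 + of_real (u - s) *s e11 = z + of_real u *s e11" for u
   by (simp add: vec_eq_iff algebra_simps)
  ultimately show "((\<lambda>s. Cf k (z + of_real s *s e11)) has_vector_derivative 0) (at s within S)"
   by (auto intro: has_vector_derivative_at_within)
 qed blast
 from this[of t] this[of 0] show ?thesis by (simp add: S_def)
qed

lemma Cf_per: "z \<in> W \<Longrightarrow> Cf k (z + of_real (2 * pi) *s e1) = Cf k z"
 using per g\<phi>_per W_sub by (auto simp: Cf_def Nz_def)

text \<open>Near each tau a single pair a, b keeps a nonzero transversal component, so the pointwise
  choice in \<open>Cf\<close> does no harm.\<close>

lemma Cf_holomorphic:
 assumes van: "Van k" "k > 0"
 shows "(\<lambda>\<tau>. Cf k (pt \<phi> \<tau>)) holomorphic_on Lset \<sigma> R"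
proof (subst holomorphic_on_open[OF open_Lset], rule ballI)
 fix \<tau> assume "\<tau> \<in> Lset \<sigma> R"
 define z :: "complex^2" where "z = vector [of_real \<phi>, \<tau>]"
 define e2 :: "complex^2" where "e2 = axis 2 1"
 have sh: "z + (t - \<tau>) *s e2 = vector [of_real \<phi>, t]" for t by (simp add: z_def e2_def vec_eq_iff forall_2 axis_def)
 have z: "z \<in> W" using \<open>\<tau> \<in> _\<close> by (simp add: z_def RD_def)
 obtain a b where N: "Nz a b z \<noteq> 0" using Nz_nonzero[OF z] by blast
 define g where "g = Lds (replicate k (Zf H a b)) G"
 have hg: "hol g V" unfolding g_def by (rule hol_Lds_tang[OF van(1) V(1) order_refl]) (use tang_Zf_V(1) in auto)
 have zp: "z \<in> pre V" "z \<in> D" using z W_sub \<gamma>V by (auto simp: pre_def)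
 have dsh: "((\<lambda>t. t - \<tau>) has_field_derivative 1) (at \<tau>)" by (auto intro!: derivative_eq_intros)
 have d1: "((\<lambda>t. g (\<gamma> (z + (t - \<tau>) *s e2))) has_field_derivative dd (\<lambda>z. g (\<gamma> z)) z e2) (at \<tau>)"
  using DERIV_chain2[of "\<lambda>t. g (\<gamma> (z + t *s e2))" _ "\<lambda>t. t - \<tau>" \<tau> 1 UNIV, OF _ dsh]
   hol_line[OF hol_pre(1)[OF V(1) hg], of z 0 e2 UNIV] zp by simp
 have d2: "((\<lambda>t. Nz a b (z + (t - \<tau>) *s e2)) has_field_derivative dd (Nz a b) z e2) (at \<tau>)"
  using DERIV_chain2[of "\<lambda>t. Nz a b (z + t *s e2)" _ "\<lambda>t. t - \<tau>" \<tau> 1 UNIV, OF _ dsh]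
   hol_line[OF hol_Nz[of a b], of z 0 e2 UNIV] zp by simp
 have "\<exists>f'. ((\<lambda>t. g (\<gamma> (z + (t - \<tau>) *s e2)) / Nz a b (z + (t - \<tau>) *s e2) ^ k) has_field_derivative f') (at \<tau>)"
  using DERIV_divide[OF d1 DERIV_power[OF d2, of k]] N by auto
 then obtain f' where f': "((\<lambda>t. g (\<gamma> (z + (t - \<tau>) *s e2)) / Nz a b (z + (t - \<tau>) *s e2) ^ k) has_field_derivative f') (at \<tau>)" by blast
 have "isCont (\<lambda>t. Nz a b (z + (t - \<tau>) *s e2)) \<tau>" using d2 DERIV_isCont by blast
 hence "\<forall>\<^sub>F t in at \<tau>. Nz a b (z + (t - \<tau>) *s e2) \<noteq> 0"
  using N by (intro tendsto_imp_eventually_ne[where c="Nz a b z"]) (auto simp: isCont_def)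
 moreover have "\<forall>\<^sub>F t in at \<tau>. t \<in> Lset \<sigma> R" using \<open>\<tau> \<in> _\<close> open_Lset by (intro eventually_at_in_open') auto
 ultimately have ev: "\<forall>\<^sub>F t in at \<tau>. g (\<gamma> (z + (t - \<tau>) *s e2)) / Nz a b (z + (t - \<tau>) *s e2) ^ k = Cf k (pt \<phi> t)"
 proof eventually_elim
  case (elim t)
  have "z + (t - \<tau>) *s e2 \<in> W" unfolding sh using elim(2) by (simp add: RD_def)
  from Cf_eq[OF van(1) this elim(1)] show ?case unfolding g_def sh by (rule sym)
 qed
 have "((\<lambda>t. Cf k (pt \<phi> t)) has_field_derivative f') (at \<tau>)"
  using has_field_derivative_cong_eventually[OF ev, of f'] f' Cf_eq[OF van(1) z N] sh[of \<tau>] by (simp add: g_def)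
 thus "\<exists>f'. ((\<lambda>t. Cf k (pt \<phi> t)) has_field_derivative f') (at \<tau>)" by blast
qed

text \<open>The coefficient is one constant on the whole separatrix, so being small far out in one
  column makes it zero.\<close>

lemma Van_Suc_small:
 assumes van: "Van k" "k > 0" and lim: "\<And>\<epsilon>. \<epsilon> > 0 \<Longrightarrow> \<exists>Y. \<forall>\<tau>. \<bar>Re \<tau>\<bar> \<le> 7 \<longrightarrow> \<bar>Im \<tau>\<bar> \<ge> Y \<longrightarrow> norm (Cf k (pt \<phi>0 \<tau>)) \<le> \<epsilon>"
 shows "Van (Suc k)"
proof -
 obtain Y where Y: "\<forall>\<tau>. \<bar>Re \<tau>\<bar> \<le> 7 \<longrightarrow> \<bar>Im \<tau>\<bar> \<ge> Y \<longrightarrow> norm (Cf k (pt \<phi>0 \<tau>)) \<le> 1" using lim[of 1] by auto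
 obtain c where c: "\<And>z. z \<in> W \<Longrightarrow> Cf k z = c"
  by (rule invariant_const[where \<psi>=\<phi>0 and Y=Y and B=1 and m=0, OF sig Cf_invariant[OF van] Cf_per Cf_holomorphic[OF van]]) (use Y in auto)
 have "norm c \<le> \<epsilon>" if e: "\<epsilon> > 0" for \<epsilon>
 proof -
  obtain Y where Y: "\<forall>\<tau>. \<bar>Re \<tau>\<bar> \<le> 7 \<longrightarrow> \<bar>Im \<tau>\<bar> \<ge> Y \<longrightarrow> norm (Cf k (pt \<phi>0 \<tau>)) \<le> \<epsilon>" using lim[OF e] by auto
  define \<tau> where "\<tau> = Complex 0 (max Y (\<bar>R\<bar> + 1))"
  have "norm (Cf k (pt \<phi>0 \<tau>)) \<le> \<epsilon>" using Y by (simp add: \<tau>_def)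
  moreover have "Cf k (pt \<phi>0 \<tau>) = c" by (rule c) (simp add: RD_def Lset_def \<tau>_def)
  ultimately show ?thesis by simp
 qed
 hence "norm c \<le> 0" by (rule field_le_epsilon) simp
 hence "c = 0" by simp
 thus ?thesis using Van_Suc[OF van(1)] c by simp
qed

end

section \<open>Charts of an energy level\<close>

text \<open>On the level H = c the value is the limit from outside the level. No chart enters, so
  quotients obtained near different points agree on overlaps by themselves.\<close>

definition quot :: "(complex ^ 4 \<Rightarrow> complex) \<Rightarrow> complex \<Rightarrow> (complex ^ 4 \<Rightarrow> complex) \<Rightarrow> complex \<Rightarrow> complex ^ 4 \<Rightarrow> complex" where
 "quot G a H c x = (if H x \<noteq> c then (G x - a) / (H x - c)
   else Lim (at x within {y. H y \<noteq> c}) (\<lambda>y. (G y - a) / (H y - c)))"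

text \<open>Data for a quantitative implicit function theorem that solves for the coordinate in
  direction b. All sizes will be explicit in r, B and l, because l decays like a power of 1 / |Im
  tau| along a separatrix.\<close>

locale chart =
 fixes H :: "complex ^ 4 \<Rightarrow> complex" and x0 :: "complex ^ 4" and r B :: real and b :: "complex ^ 4" and l :: real
 assumes holH: "hol H (ball x0 r)" and r: "r > 0" and B: "\<And>y. y \<in> ball x0 r \<Longrightarrow> norm (H y) \<le> B"
  and b: "norm b = 1" and l: "l > 0" "l \<le> norm (dd H x0 b)"
begin

text \<open>With this value \<open>dd H y b\<close> stays within half of its value at
  \<open>x0\<close> for y up to 2 eta away. Then \<open>\<eta>'\<close> is chosen so that H changes
  by at most l * eta / 4 over the distance eta', which a move along b of length at most eta can
  compensate.\<close>

definition "\<eta> = l * r\<^sup>2 / (64 * B)"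
definition "\<eta>' = l * \<eta> * r / (16 * B)"
abbreviation "lb \<equiv> dd H x0 b"

lemma lB: "l * r \<le> B" "B > 0"
proof -
 have "norm lb \<le> B / r * norm b" by (rule dd_bound[OF holH r B])
 hence "l \<le> B / r" using l b by simp
 thus "l * r \<le> B" using r by (simp add: field_simps)
 thus "B > 0" using l r by (smt (verit) mult_pos_pos)
qed

lemma \<eta>: "\<eta> > 0" "\<eta> \<le> r / 64" "\<eta>' > 0" "\<eta>' \<le> \<eta> / 16"
proof -
 show 1: "\<eta> > 0" using l r lB by (simp add: \<eta>_def)
 show 2: "\<eta>' > 0" using l r lB 1 by (simp add: \<eta>'_def)
 have "l * r * r \<le> B * r" using lB r by (intro mult_right_mono) auto
 thus "\<eta> \<le> r / 64" using lB r by (simp add: \<eta>_def field_simps power2_eq_square)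
 have "l * r * \<eta> \<le> B * \<eta>" using lB 1 by (intro mult_right_mono) auto
 thus "\<eta>' \<le> \<eta> / 16" using lB 1 by (simp add: \<eta>'_def field_simps)
qed

lemma l0: "lb \<noteq> 0" using l by auto

lemma dH_near:
 assumes "norm (y - x0) \<le> 2 * \<eta>"
 shows "norm (dd H y b - lb) \<le> norm lb / 2" "dd H y b \<noteq> 0"
proof -
 have sub: "ball u (r / 2) \<subseteq> ball x0 r" if "u \<in> ball x0 (r/2)" for u
 proof
  fix w assume "w \<in> ball u (r/2)"
  thus "w \<in> ball x0 r" using that dist_triangle[of x0 w u] by simp
 qed
 have h: "hol (\<lambda>y. dd H y b) (ball x0 (r/2))"
  by (rule hol_subset[OF hol_dd[OF open_ball holH]]) (use r in auto)
 have bd: "norm (dd H u b) \<le> 2 * B / r" if "u \<in> ball x0 (r/2)" for u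
 proof -
  have "norm (dd H u b) \<le> B / (r/2) * norm b"
   by (rule dd_bound[OF hol_subset[OF holH sub[OF that]]]) (use r B sub[OF that] in auto)
  thus ?thesis using b by (simp add: mult.commute)
 qed
 have "norm (dd H (x0 + (y - x0)) b - dd H x0 b) \<le> 4 * (2 * B / r) / (r/2) * norm (y - x0)"
  by (rule hol_first_order(1)[OF h _ bd]) (use r assms \<eta> in auto)
 also have "\<dots> \<le> 4 * (2 * B / r) / (r/2) * (2 * \<eta>)" using assms r lB by (intro mult_left_mono) auto
 also have "\<dots> = l / 2" using r lB by (simp add: \<eta>_def field_simps power2_eq_square)
 also have "\<dots> \<le> norm lb / 2" using l by simp
 finally show 1: "norm (dd H y b - lb) \<le> norm lb / 2" by simp
 show "dd H y b \<noteq> 0"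
 proof
  assume "dd H y b = 0"
  thus False using 1 l0 by simp
 qed
qed

lemma H_along_b:
 assumes "norm (y - x0) \<le> \<eta>" "norm v \<le> \<eta>" "norm v' \<le> \<eta>"
 shows "norm (H (y + v *s b) - H (y + v' *s b) - lb * (v - v')) \<le> norm lb / 2 * norm (v - v')"
proof -
 have n: "norm (y + u *s b - x0) \<le> 2 * \<eta>" if "norm u \<le> \<eta>" for u
 proof -
  have "norm (y - x0 + u *s b) \<le> norm (y - x0) + norm (u *s b)" by (rule norm_triangle_ineq)
  thus ?thesis using assms(1) that b by (simp add: norm_scale algebra_simps)
 qed
 have inb: "y + u *s b \<in> ball x0 r" if "norm u \<le> \<eta>" for u
  using n[OF that] \<eta> r by (simp add: dist_norm norm_minus_commute)
 have "norm ((\<lambda>u. H (y + u *s b) - lb * u) v - (\<lambda>u. H (y + u *s b) - lb * u) v') \<le> norm lb / 2 * norm (v - v')"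
 proof (rule field_differentiable_bound[of "cball 0 \<eta>"])
  fix u assume u: "u \<in> cball (0::complex) \<eta>"
  show "((\<lambda>u. H (y + u *s b) - lb * u) has_field_derivative (dd H (y + u *s b) b - lb)) (at u within cball 0 \<eta>)"
   using DERIV_diff[OF hol_line[OF holH inb] DERIV_cmult_Id[of lb]] u by simp
  show "norm (dd H (y + u *s b) b - lb) \<le> norm lb / 2" by (rule dH_near(1), rule n) (use u in auto)
 qed (use assms in auto)
 thus ?thesis by (simp add: algebra_simps)
qed

lemma H_near:
 assumes "norm d \<le> \<eta>"
 shows "norm (H (x0 + d) - H x0) \<le> 4 * B / r * norm d"
 by (rule hol_first_order(1)[OF holH r B]) (use assms \<eta> r in auto)

text \<open>Newton iteration with the fixed slope \<open>lb\<close>: the map \<open>F z\<close> is a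
  contraction with constant 1/2 on norm v \<le> eta, uniformly in z. Its fixed point zeta z puts x0
  + z d + zeta z b on the level of x0, and uniform convergence makes it holomorphic in z.\<close>

lemma s_curve:
 assumes d: "norm d > 0"
 defines "\<rho> \<equiv> \<eta>' / norm d"
 obtains \<zeta> where "\<zeta> holomorphic_on ball 0 \<rho>" "\<zeta> 0 = 0" "H (x0 + d) = H x0 \<Longrightarrow> \<rho> > 1 \<Longrightarrow> \<zeta> 1 = 0"
  "\<And>z. z \<in> ball 0 \<rho> \<Longrightarrow> norm (\<zeta> z) \<le> \<eta>" "\<And>z. z \<in> ball 0 \<rho> \<Longrightarrow> H (x0 + z *s d + \<zeta> z *s b) = H x0"
proof -
 define F where "F = (\<lambda>z v. v - (H (x0 + z *s d + v *s b) - H x0) / lb)"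
 define Z where "Z = rec_nat (\<lambda>z. 0) (\<lambda>n f z. F z (f z))"
 have Z0: "Z 0 z = 0" and ZS: "Z (Suc n) z = F z (Z n z)" for n z by (simp_all add: Z_def)
 have zd: "norm (z *s d) \<le> \<eta>'" if "z \<in> ball 0 \<rho>" for z
  using that d by (simp add: norm_scale \<rho>_def field_simps)
 have zd': "norm (x0 + z *s d - x0) \<le> \<eta>" if "z \<in> ball 0 \<rho>" for z using zd[OF that] \<eta> by simp
 have contr: "norm (F z v - F z v') \<le> norm (v - v') / 2" if z: "z \<in> ball 0 \<rho>" and v: "norm v \<le> \<eta>" "norm v' \<le> \<eta>" for z v v'
 proof -
  have "F z v - F z v' = - (H (x0 + z *s d + v *s b) - H (x0 + z *s d + v' *s b) - lb * (v - v')) / lb"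
   using l0 by (simp add: F_def field_simps)
  hence "norm (F z v - F z v') = norm (H (x0 + z *s d + v *s b) - H (x0 + z *s d + v' *s b) - lb * (v - v')) / norm lb"
   by (metis norm_divide norm_minus_cancel)
  also have "\<dots> \<le> (norm lb / 2 * norm (v - v')) / norm lb"
   by (intro divide_right_mono H_along_b zd'[OF z] v) auto
  finally show ?thesis using l0 by simp
 qed
 have F0: "norm (F z 0) \<le> \<eta> / 4" if z: "z \<in> ball 0 \<rho>" for z
 proof -
  have "norm (H (x0 + z *s d) - H x0) \<le> 4 * B / r * norm (z *s d)" by (rule H_near) (use zd'[OF z] in simp)
  also have "\<dots> \<le> 4 * B / r * \<eta>'" using zd[OF z] lB r by (intro mult_left_mono) auto
  also have "\<dots> = l * \<eta> / 4" using lB r by (simp add: \<eta>'_def field_simps)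
  also have "\<dots> \<le> norm lb * (\<eta> / 4)" using l \<eta> by (simp add: mult_right_mono)
  finally show ?thesis using l0 by (simp add: F_def norm_divide divide_simps mult.commute norm_minus_commute[of "H x0"])
 qed
 have bd: "norm (Z n z) \<le> \<eta>" if z: "z \<in> ball 0 \<rho>" for n z
 proof (induction n)
  case (Suc n)
  have "norm (F z (Z n z)) \<le> norm (F z (Z n z) - F z 0) + norm (F z 0)" by (metis diff_add_cancel norm_triangle_ineq)
  also have "\<dots> \<le> norm (Z n z - 0) / 2 + \<eta> / 4" by (intro add_mono contr z Suc F0) (use \<eta> in auto)
  also have "\<dots> \<le> \<eta>" using Suc \<eta> by simp
  finally show ?case by (simp add: ZS)
 qed (use Z0 \<eta> in auto)
 have diffs: "norm (Z (Suc n) z - Z n z) \<le> \<eta> * (1/2) ^ n" if z: "z \<in> ball 0 \<rho>" for n z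
 proof (induction n)
  case 0 show ?case using bd[OF z, of 1] Z0 by simp
 next
  case (Suc n)
  have "norm (Z (Suc (Suc n)) z - Z (Suc n) z) = norm (F z (Z (Suc n) z) - F z (Z n z))" by (simp add: ZS)
  also have "\<dots> \<le> norm (Z (Suc n) z - Z n z) / 2" by (intro contr z bd)
  finally show ?case using Suc by simp
 qed
 define \<zeta> where "\<zeta> = (\<lambda>z. suminf (\<lambda>n. Z (Suc n) z - Z n z))"
 have "uniform_limit (ball 0 \<rho>) (\<lambda>n z. \<Sum>i<n. Z (Suc i) z - Z i z) \<zeta> sequentially"
  unfolding \<zeta>_def by (rule Weierstrass_m_test[OF diffs summable_mult[OF summable_geometric]]) auto
 moreover have "(\<lambda>n z. \<Sum>i<n. Z (Suc i) z - Z i z) = Z"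
 proof (intro ext)
  show "(\<Sum>i<n. Z (Suc i) z - Z i z) = Z n z" for n z
   using sum_lessThan_telescope[of "\<lambda>i. Z i z" n] Z0 by simp
 qed
 ultimately have ul: "uniform_limit (ball 0 \<rho>) Z \<zeta> sequentially" by simp
 have holZ: "Z n holomorphic_on ball 0 \<rho>" for n
 proof (induction n)
  case (Suc n)
  have "((\<lambda>z. H (x0 + z *s d + Z n z *s b)) has_field_derivative dd H (x0 + z *s d + Z n z *s b) (d + deriv (Z n) z *s b)) (at z)" if z: "z \<in> ball 0 \<rho>" for z
  proof (rule hol_path[OF holH])
   have "norm (z *s d + Z n z *s b) \<le> \<eta>' + \<eta>"
    by (rule norm_triangle_mono) (use zd[OF z] bd[OF z, of n] b in \<open>auto simp: norm_scale\<close>)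
   hence "norm (z *s d + Z n z *s b) < r" using \<eta> r by linarith
   moreover have "x0 - (x0 + z *s d + Z n z *s b) = - (z *s d + Z n z *s b)" by simp
   ultimately show "x0 + z *s d + Z n z *s b \<in> ball x0 r" by (simp only: mem_ball dist_norm norm_minus_cancel)
   show "((\<lambda>t. (x0 + t *s d + Z n t *s b) $ i) has_field_derivative (d + deriv (Z n) z *s b) $ i) (at z)" for i
    using holomorphic_derivI[OF Suc open_ball z] by (auto intro!: derivative_eq_intros)
  qed
  hence "(\<lambda>z. H (x0 + z *s d + Z n z *s b)) holomorphic_on ball 0 \<rho>"
   by (subst holomorphic_on_open) blast+
  hence "(\<lambda>z. Z n z - (H (x0 + z *s d + Z n z *s b) - H x0) / lb) holomorphic_on ball 0 \<rho>"
   using Suc l0 by (intro holomorphic_intros) auto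
  thus ?case by (simp add: ZS[abs_def] F_def)
 qed (simp add: Z0[abs_def])
 have hz: "\<zeta> holomorphic_on ball 0 \<rho>"
 proof (rule holomorphic_uniform_sequence[OF open_ball holZ])
  fix x assume "x \<in> ball (0::complex) \<rho>"
  then obtain e where "e > 0" "cball x e \<subseteq> ball 0 \<rho>" using open_contains_cball open_ball by metis
  thus "\<exists>d>0. cball x d \<subseteq> ball 0 \<rho> \<and> uniform_limit (cball x d) Z \<zeta> sequentially"
   using uniform_limit_on_subset[OF ul] by blast
 qed
 have lim: "(\<lambda>n. Z n z) \<longlonglongrightarrow> \<zeta> z" if "z \<in> ball 0 \<rho>" for z by (rule tendsto_uniform_limitI[OF ul that])
 have bz: "norm (\<zeta> z) \<le> \<eta>" if z: "z \<in> ball 0 \<rho>" for z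
  by (rule Lim_bounded[OF tendsto_norm[OF lim[OF z]], of 0]) (use bd[OF z] in auto)
 have fixp: "F z (\<zeta> z) = \<zeta> z" if z: "z \<in> ball 0 \<rho>" for z
 proof -
  have "(\<lambda>n. F z (Z n z)) \<longlonglongrightarrow> F z (\<zeta> z)"
  proof (rule LIM_zero_cancel, rule Lim_null_comparison)
   show "\<forall>\<^sub>F n in sequentially. norm (F z (Z n z) - F z (\<zeta> z)) \<le> norm (Z n z - \<zeta> z) / 2"
    using contr[OF z bd[OF z] bz[OF z]] by simp
   have "(\<lambda>n. norm (Z n z - \<zeta> z) / 2) \<longlonglongrightarrow> norm (\<zeta> z - \<zeta> z) / 2" by (intro tendsto_intros lim z) auto
   thus "(\<lambda>n. norm (Z n z - \<zeta> z) / 2) \<longlonglongrightarrow> 0" by simp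
  qed
  moreover have "(\<lambda>n. F z (Z n z)) \<longlonglongrightarrow> \<zeta> z" using LIMSEQ_Suc[OF lim[OF z]] by (simp add: ZS)
  ultimately show ?thesis using LIMSEQ_unique by blast
 qed
 \<comment> \<open>If x0 + z d already lies on the level, all iterates are 0; for z = 1 the curve
   then passes through x0 + d itself.\<close>
 have const0: "\<zeta> z = 0" if z: "z \<in> ball 0 \<rho>" and "H (x0 + z *s d) = H x0" for z
 proof -
  have "Z n z = 0" for n using that by (induction n) (auto simp: Z0 ZS F_def)
  thus ?thesis using lim[OF z] by (simp add: LIMSEQ_const_iff)
 qed
 have rho: "\<rho> > 0" using \<eta> d by (simp add: \<rho>_def)
 show ?thesis
 proof (rule that[OF hz])
  show "\<zeta> 0 = 0" using const0[of 0] rho by simp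
  show "H (x0 + d) = H x0 \<Longrightarrow> \<rho> > 1 \<Longrightarrow> \<zeta> 1 = 0" using const0[of 1] by simp
  show "\<And>z. z \<in> ball 0 \<rho> \<Longrightarrow> norm (\<zeta> z) \<le> \<eta>" by (rule bz)
  show "H (x0 + z *s d + \<zeta> z *s b) = H x0" if "z \<in> ball 0 \<rho>" for z
   using fixp[OF that] l0 by (simp add: F_def)
 qed
qed

text \<open>The projection of d along b to the levels of H. The curves of \<open>s_curve\<close> are
  its integral curves, so derivatives of G along them are iterated derivations by this one
  field.\<close>

definition Tf :: "complex ^ 4 \<Rightarrow> complex ^ 4 \<Rightarrow> complex ^ 4" where
 "Tf d y = d - (dd H y d / dd H y b) *s b"

lemma nbhd: "ball x0 (2 * \<eta>) \<subseteq> ball x0 r" using \<eta> r by auto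

lemma dH_ball: "y \<in> ball x0 (2 * \<eta>) \<Longrightarrow> dd H y b \<noteq> 0"
 by (rule dH_near(2)) (simp add: dist_norm norm_minus_commute)

lemma tang_Tf: "tang H (Tf d) (ball x0 (2 * \<eta>))"
 unfolding tang_def vhol_def
proof (intro conjI allI ballI)
 have h: "hol (\<lambda>y. dd H y v) (ball x0 (2 * \<eta>))" for v by (rule hol_dd[OF open_ball hol_subset[OF holH nbhd]])
 show "hol (\<lambda>x. Tf d x $ i) (ball x0 (2 * \<eta>))" for i
  unfolding Tf_def by (simp, intro hol_diff hol_mult hol_const hol_divide h dH_ball)
 show "dd H x (Tf d x) = 0" if "x \<in> ball x0 (2 * \<eta>)" for x
  using dH_ball[OF that] by (simp add: Tf_def dd_diff dd_scale)
qed

lemma s_curve_derivs: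
 assumes G: "hol G (ball x0 (2 * \<eta>))" and d: "norm d > 0"
 defines "\<rho> \<equiv> \<eta>' / norm d"
 obtains f where "f holomorphic_on ball 0 \<rho>" "f 0 = G x0" "H (x0 + d) = H x0 \<Longrightarrow> \<rho> > 1 \<Longrightarrow> f 1 = G (x0 + d)"
  "\<And>z. z \<in> ball 0 \<rho> \<Longrightarrow> \<exists>x\<in>ball x0 (2 * \<eta>). f z = G x"
  "\<And>j. (deriv ^^ j) f 0 = Lds (replicate j (Tf d)) G x0"
proof -
 obtain \<zeta> where \<zeta>: "\<zeta> holomorphic_on ball 0 \<rho>" "\<zeta> 0 = 0" "H (x0 + d) = H x0 \<Longrightarrow> \<rho> > 1 \<Longrightarrow> \<zeta> 1 = 0"
  "\<And>z. z \<in> ball 0 \<rho> \<Longrightarrow> norm (\<zeta> z) \<le> \<eta>" "\<And>z. z \<in> ball 0 \<rho> \<Longrightarrow> H (x0 + z *s d + \<zeta> z *s b) = H x0"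
  using s_curve[OF d] unfolding \<rho>_def by blast
 define x where "x = (\<lambda>z. x0 + z *s d + \<zeta> z *s b)"
 have xin: "x z \<in> ball x0 (2 * \<eta>)" if z: "z \<in> ball 0 \<rho>" for z
 proof -
  have "norm (z *s d) \<le> \<eta>'" using z d by (simp add: norm_scale \<rho>_def field_simps)
  hence "norm (z *s d + \<zeta> z *s b) \<le> \<eta>' + \<eta>"
   by (rule norm_triangle_mono) (use \<zeta>(4)[OF z] b in \<open>auto simp: norm_scale\<close>)
  hence "norm (z *s d + \<zeta> z *s b) < 2 * \<eta>" using \<eta> by linarith
  moreover have "x0 - x z = - (z *s d + \<zeta> z *s b)" by (simp add: x_def)
  ultimately show ?thesis by (simp only: mem_ball dist_norm norm_minus_cancel)
 qed
 have xd: "((\<lambda>z. x z $ i) has_field_derivative Tf d (x z) $ i) (at z)" if z: "z \<in> ball 0 \<rho>" for z i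
 proof -
  have 1: "((\<lambda>z. x z $ i) has_field_derivative (d + deriv \<zeta> z *s b) $ i) (at z)" for i
   unfolding x_def using holomorphic_derivI[OF \<zeta>(1) open_ball z] by (auto intro!: derivative_eq_intros)
  have "((\<lambda>z. H (x z)) has_field_derivative dd H (x z) (d + deriv \<zeta> z *s b)) (at z)"
   by (rule hol_path[OF hol_subset[OF holH nbhd] xin[OF z] 1])
  moreover have "((\<lambda>z. H (x z)) has_field_derivative 0) (at z)"
   by (rule has_field_derivative_transform_within_open[of "\<lambda>z. H x0" _ _ "ball 0 \<rho>"]) (use z \<zeta>(5) in \<open>auto simp: x_def\<close>)
  ultimately have "dd H (x z) (d + deriv \<zeta> z *s b) = 0" by (rule DERIV_unique)
  hence "deriv \<zeta> z = - (dd H (x z) d / dd H (x z) b)"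
   using dH_ball[OF xin[OF z]] by (simp add: dd_add dd_scale field_simps eq_neg_iff_add_eq_0)
  hence "d + deriv \<zeta> z *s b = Tf d (x z)" by (simp add: Tf_def vec_eq_iff)
  thus ?thesis using 1[of i] by simp
 qed
 have Lh: "hol (Lds (replicate j (Tf d)) G) (ball x0 (2 * \<eta>))" for j
  by (rule hol_Lds[OF open_ball G]) (use tang_Tf in \<open>auto simp: tang_def\<close>)
 have der: "((\<lambda>z. Lds (replicate j (Tf d)) G (x z)) has_field_derivative Lds (replicate (Suc j) (Tf d)) G (x z)) (at z)" if z: "z \<in> ball 0 \<rho>" for j z
  using hol_path[OF Lh xin[OF z] xd[OF z], of j] by (simp add: Ld_def)
 have ders: "\<forall>z\<in>ball 0 \<rho>. (deriv ^^ j) (\<lambda>z. G (x z)) z = Lds (replicate j (Tf d)) G (x z)" for j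
 proof (induction j)
  case (Suc j)
  show ?case
  proof
   fix z assume z: "z \<in> ball (0::complex) \<rho>"
   have "((deriv ^^ j) (\<lambda>z. G (x z)) has_field_derivative Lds (replicate (Suc j) (Tf d)) G (x z)) (at z)"
    by (rule has_field_derivative_transform_within_open[OF der[OF z] open_ball z]) (use Suc in auto)
   thus "(deriv ^^ Suc j) (\<lambda>z. G (x z)) z = Lds (replicate (Suc j) (Tf d)) G (x z)"
    using DERIV_imp_deriv by auto
  qed
 qed simp
 have rho: "\<rho> > 0" using \<eta> d by (simp add: \<rho>_def)
 have x00: "x 0 = x0" by (simp add: x_def \<zeta>(2))
 show ?thesis
 proof (rule that[of "\<lambda>z. G (x z)"])
  show "(\<lambda>z. G (x z)) holomorphic_on ball 0 \<rho>"
   unfolding holomorphic_on_open[OF open_ball] using der[of _ 0] by (metis Lds.simps(1) replicate_0)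
  show "H (x0 + d) = H x0 \<Longrightarrow> \<rho> > 1 \<Longrightarrow> G (x 1) = G (x0 + d)" using \<zeta>(3) by (simp add: x_def)
  show "(deriv ^^ j) (\<lambda>z. G (x z)) 0 = Lds (replicate j (Tf d)) G x0" for j using ders[of j] rho x00 by auto
 qed (use xin x00 in auto)
qed

lemma jets_const:
 assumes G: "hol G (ball x0 (2 * \<eta>))" and jets: "\<And>j d. j > 0 \<Longrightarrow> Lds (replicate j (Tf d)) G x0 = 0"
  and x: "norm (x - x0) < \<eta>'" "H x = H x0"
 shows "G x = G x0"
proof (cases "x = x0")
 case False
 define d where "d = x - x0"
 have d: "norm d > 0" using False by (simp add: d_def)
 obtain f where f: "f holomorphic_on ball 0 (\<eta>' / norm d)" "f 0 = G x0" "H (x0 + d) = H x0 \<Longrightarrow> \<eta>' / norm d > 1 \<Longrightarrow> f 1 = G (x0 + d)"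
  "\<And>j. (deriv ^^ j) f 0 = Lds (replicate j (Tf d)) G x0"
  using s_curve_derivs[OF G d] by metis
 have rho: "\<eta>' / norm d > 1" using x d by (simp add: d_def)
 have "(\<lambda>n. (deriv ^^ n) f 0 / fact n * (1 - 0) ^ n) sums f 1"
  by (rule holomorphic_power_series[OF f(1)]) (use rho in auto)
 moreover have "(\<lambda>n. (deriv ^^ n) f 0 / fact n * (1 - 0) ^ n) = (\<lambda>n. if n = 0 then f 0 else 0)"
  using f(4) f(2) jets by (auto simp: fun_eq_iff)
 ultimately have "(\<lambda>n. if n = 0 then f 0 else 0) sums f 1" by simp
 hence "f 1 = f 0" using sums_unique2 sums_single[of 0 "\<lambda>_. f 0"] by blast
 thus ?thesis using f(2,3) rho x by (simp add: d_def)
qed simp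

text \<open>G has equal values at z = 0 and z = 1 of the level curve and the Taylor terms 1 to k - 1
  vanish, so the k-th term is minus the tail from k + 1 on; this gains one more power of norm
  d.\<close>

lemma jets_estimate:
 assumes G: "hol G (ball x0 (2 * \<eta>))" and k: "k > 0" and jets: "\<And>j. 0 < j \<Longrightarrow> j < k \<Longrightarrow> Lds (replicate j (Tf d)) G x0 = 0"
  and M: "\<And>y. y \<in> ball x0 (2 * \<eta>) \<Longrightarrow> norm (G y) \<le> M"
  and d: "norm d > 0" "4 * norm d \<le> \<eta>'" "H (x0 + d) = H x0" "G (x0 + d) = G x0"
 shows "norm (Lds (replicate k (Tf d)) G x0) \<le> fact k * (2 * M * (2 * norm d / \<eta>') ^ Suc k)"
proof -
 obtain f where f: "f holomorphic_on ball 0 (\<eta>' / norm d)" "f 0 = G x0" "H (x0 + d) = H x0 \<Longrightarrow> \<eta>' / norm d > 1 \<Longrightarrow> f 1 = G (x0 + d)"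
  "\<And>z. z \<in> ball 0 (\<eta>' / norm d) \<Longrightarrow> \<exists>x\<in>ball x0 (2 * \<eta>). f z = G x"
  "\<And>j. (deriv ^^ j) f 0 = Lds (replicate j (Tf d)) G x0"
  using s_curve_derivs[OF G d(1)] by metis
 have rho: "\<eta>' / norm d \<ge> 4" using d \<eta> by (simp add: field_simps)
 have f1: "f 1 = G x0" using f(3) d rho by simp
 have "norm (f 1 - (\<Sum>j<Suc k. (deriv ^^ j) f 0 / fact j)) \<le> 2 * M * (2 / (\<eta>' / norm d)) ^ Suc k"
  by (rule holomorphic_tail_bound[OF f(1) rho]) (use f(4) M in force)
 moreover have "(\<Sum>j<Suc k. (deriv ^^ j) f 0 / fact j) = f 0 + (deriv ^^ k) f 0 / fact k"
 proof -
  have "(\<Sum>j<k. (deriv ^^ j) f 0 / fact j) = (\<Sum>j<k. if j = 0 then f 0 else 0)"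
   by (rule sum.cong) (use f(5) f(2) jets in auto)
  thus ?thesis using k by simp
 qed
 ultimately have "norm (Lds (replicate k (Tf d)) G x0) / fact k \<le> 2 * M * (2 * norm d / \<eta>') ^ Suc k"
  using f1 f(2) f(5)[of k] by (simp add: norm_divide)
 thus ?thesis by (simp add: divide_le_eq mult.commute)
qed

section \<open>Holomorphic division by H minus its value at the centre\<close>

lemma quotient_on_line:
 assumes F: "F holomorphic_on ball 0 \<delta>0" and hh: "h holomorphic_on ball 0 \<delta>0" and \<delta>: "0 < \<delta>" "\<delta> < \<delta>0"
  and inj: "\<And>v v'. v \<in> ball 0 \<delta>0 \<Longrightarrow> v' \<in> ball 0 \<delta>0 \<Longrightarrow> h v = h v' \<Longrightarrow> v = v'"
  and dh: "\<And>v. v \<in> ball 0 \<delta>0 \<Longrightarrow> deriv h v \<noteq> 0"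
  and z: "\<And>v. v \<in> ball 0 \<delta>0 \<Longrightarrow> h v = 0 \<Longrightarrow> F v = 0" and nz: "h 0 \<noteq> 0" "\<And>v. norm v = \<delta> \<Longrightarrow> h v \<noteq> 0"
 shows "contour_integral (circlepath 0 \<delta>) (\<lambda>v. F v / h v * (1 / v)) = 2 * pi * \<i> * (F 0 / h 0)"
proof -
 have "\<exists>Q. Q holomorphic_on ball 0 \<delta>0 \<and> (\<forall>v\<in>ball 0 \<delta>0. h v \<noteq> 0 \<longrightarrow> Q v = F v / h v)"
 proof (cases "\<exists>w\<in>ball 0 \<delta>0. h w = 0")
  case True
  then obtain w where w: "w \<in> ball 0 \<delta>0" "h w = 0" by blast
  define F1 where "F1 = (\<lambda>u. if u = w then deriv F w else (F u - F w) / (u - w))"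
  define h1 where "h1 = (\<lambda>u. if u = w then deriv h w else (h u - h w) / (u - w))"
  have "F1 holomorphic_on ball 0 \<delta>0" "h1 holomorphic_on ball 0 \<delta>0"
   unfolding F1_def h1_def by (rule pole_lemma; use F hh w in simp)+
  moreover have "h1 u \<noteq> 0" if "u \<in> ball 0 \<delta>0" for u using inj[OF that w(1)] dh[OF w(1)] by (auto simp: h1_def)
  ultimately have "(\<lambda>u. F1 u / h1 u) holomorphic_on ball 0 \<delta>0" by (intro holomorphic_on_divide) auto
  moreover have "F1 u / h1 u = F u / h u" if "h u \<noteq> 0" for u using that w z[OF w] by (auto simp: F1_def h1_def)
  ultimately show ?thesis by blast
 next
  case False
  hence "(\<lambda>u. F u / h u) holomorphic_on ball 0 \<delta>0" using F hh by (intro holomorphic_on_divide) auto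
  thus ?thesis by blast
 qed
 then obtain Q where Q: "Q holomorphic_on ball 0 \<delta>0" "\<And>v. v \<in> ball 0 \<delta>0 \<Longrightarrow> h v \<noteq> 0 \<Longrightarrow> Q v = F v / h v" by blast
 have "((\<lambda>u. Q u / (u - 0)) has_contour_integral (2 * of_real pi * \<i> * Q 0)) (circlepath 0 \<delta>)"
  by (rule Cauchy_integral_circlepath_simple) (use \<delta> in \<open>auto intro: holomorphic_on_subset[OF Q(1)]\<close>)
 hence "((\<lambda>v. F v / h v * (1 / v)) has_contour_integral (2 * of_real pi * \<i> * Q 0)) (circlepath 0 \<delta>)"
  by (rule has_contour_integral_eq) (use Q(2) \<delta> nz(2) in \<open>auto simp: path_image_circlepath sphere_def\<close>)
 thus ?thesis using contour_integral_unique Q(2)[of 0] \<delta> nz(1) by auto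
qed

text \<open>The quotient at x is recovered from a circle of radius s / 4 in direction b that avoids
  the level of x0. This Cauchy integral is holomorphic in x also where x lies on the level, and
  estimating it on the circle meets no small denominator.\<close>

lemma division:
 assumes G: "hol G (ball x0 s)" and s: "0 < s" "s \<le> \<eta>'" and M: "\<And>y. y \<in> ball x0 s \<Longrightarrow> norm (G y - a) \<le> M"
  and a: "\<And>y. y \<in> ball x0 s \<Longrightarrow> H y = H x0 \<Longrightarrow> G y = a"
 defines "\<delta> \<equiv> s / 4" and "\<delta>' \<equiv> l * (s / 4) * r / (16 * B)"
 shows "hol (quot G a H (H x0)) (ball x0 \<delta>')"
  and "\<And>x. x \<in> ball x0 \<delta>' \<Longrightarrow> G x - a = (H x - H x0) * quot G a H (H x0) x"
  and "\<And>x. x \<in> ball x0 \<delta>' \<Longrightarrow> norm (quot G a H (H x0) x) \<le> 16 * M / (l * s)"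
  and "\<delta>' > 0" "\<delta>' \<le> s"
proof -
 have \<delta>: "\<delta> > 0" using s by (simp add: \<delta>_def)
 show \<delta>'0: "\<delta>' > 0" using s l r lB by (simp add: \<delta>'_def)
 have "l * r * (s / 4) \<le> B * (s / 4)" using lB s by (intro mult_right_mono) auto
 hence \<delta>'1: "\<delta>' \<le> \<delta> / 16" using lB by (simp add: \<delta>'_def \<delta>_def field_simps)
 thus \<delta>'s: "\<delta>' \<le> s" using \<delta> by (simp add: \<delta>_def)
 have s\<eta>: "s \<le> \<eta> / 16" using s \<eta> by linarith
 define S where "S = {y \<in> ball x0 s. H y \<noteq> H x0}"
 have sub_r: "ball x0 s \<subseteq> ball x0 r" using s\<eta> \<eta> r by auto
 have Hs: "hol H (ball x0 s)" by (rule hol_subset[OF holH sub_r])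
 have "open (ball x0 s \<inter> H -` (- {H x0}))"
  by (intro continuous_open_preimage hol_continuous[OF Hs]) auto
 hence S: "open S" by (simp add: S_def vimage_def Int_def)
 have line: "x + v *s b \<in> ball x0 s" if "x \<in> ball x0 \<delta>'" "norm v < s / 2" for x v
 proof -
  have "norm (x - x0 + v *s b) < \<delta>' + s / 2"
   using norm_triangle_ineq[of "x - x0" "v *s b"] that b by (simp add: norm_scale dist_norm norm_minus_commute)
  hence "norm (x - x0 + v *s b) < s" using \<delta>'1 \<delta> by (simp add: \<delta>_def)
  thus ?thesis by (simp add: dist_norm norm_minus_commute algebra_simps)
 qed
 have xn: "norm (x - x0) \<le> \<eta>" if "x \<in> ball x0 \<delta>'" for x
  using that \<delta>'s s\<eta> \<eta> by (simp add: dist_norm norm_minus_commute)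
 \<comment> \<open>On the circle H differs from H x by at least l * delta / 2, whereas delta' is so
   small that H x differs from H x0 by at most l * delta / 4.\<close>
 have low: "norm (H (x + v *s b) - H x0) \<ge> l * \<delta> / 4" if x: "x \<in> ball x0 \<delta>'" and v: "norm v = \<delta>" for x v
 proof -
  have v\<eta>: "norm v \<le> \<eta>" using v s\<eta> s \<eta> by (simp add: \<delta>_def)
  have "norm (H (x + v *s b) - H (x + 0 *s b) - lb * (v - 0)) \<le> norm lb / 2 * norm (v - 0)"
   by (rule H_along_b[OF xn[OF x] v\<eta>]) (use \<eta> in auto)
  hence 1: "norm (H (x + v *s b) - H x) \<ge> norm lb / 2 * \<delta>"
   using norm_triangle_ineq2[of "lb * v" "H (x + v *s b) - H x"] v
   by (simp add: norm_mult norm_minus_commute[of "lb * v"] )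
  have "norm (H (x0 + (x - x0)) - H x0) \<le> 4 * B / r * norm (x - x0)" by (rule H_near[OF xn[OF x]])
  also have "\<dots> \<le> 4 * B / r * \<delta>'" using x lB r by (intro mult_left_mono) (auto simp: dist_norm norm_minus_commute)
  also have "\<dots> = l * \<delta> / 4" using r lB by (simp add: \<delta>'_def \<delta>_def field_simps)
  finally have 2: "norm (H x - H x0) \<le> l * \<delta> / 4" by simp
  have "norm lb / 2 * \<delta> \<ge> l / 2 * \<delta>" using l \<delta> by (intro mult_right_mono) auto
  moreover have "norm (H (x + v *s b) - H x0) \<ge> norm (H (x + v *s b) - H x) - norm (H x - H x0)"
   by (metis diff_add_cancel add_diff_eq norm_triangle_ineq2 norm_minus_commute diff_diff_eq2 minus_diff_eq norm_diff_ineq)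
  ultimately show ?thesis using 1 2 by simp
 qed
 have onS: "x + v *s b \<in> S" if x: "x \<in> ball x0 \<delta>'" and v: "norm v = \<delta>" for x v
 proof -
  have "l * \<delta> / 4 > 0" using l \<delta> by simp
  hence "H (x + v *s b) \<noteq> H x0" using low[OF that] by auto
  moreover have "norm v < s / 2" using v s by (simp add: \<delta>_def)
  ultimately show ?thesis using line[OF x] by (simp add: S_def)
 qed
 define q where "q = (\<lambda>y. (G y - a) / (H y - H x0))"
 have hq: "hol q S" unfolding q_def
  by (intro hol_divide hol_diff hol_const hol_subset[OF G] hol_subset[OF Hs]) (auto simp: S_def)
 have kc: "continuous_on (sphere 0 \<delta>) (\<lambda>\<zeta>::complex. 1 / \<zeta>)" by (intro continuous_intros) (use \<delta> in auto)
 define Q where "Q = (\<lambda>x. 1 / (2 * pi * \<i>) * circ q b \<delta> (\<lambda>\<zeta>. 1 / \<zeta>) x)"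
 have hQ: "hol Q (ball x0 \<delta>')" unfolding Q_def
  by (intro hol_mult hol_const circ_hol(1)[OF S hq \<delta> kc] onS)
 have Qq: "Q x = q x" if x: "x \<in> ball x0 \<delta>'" and nz: "H x \<noteq> H x0" for x
 proof -
  have hl: "(\<lambda>v. f (x + v *s b)) holomorphic_on ball 0 (s/2)" if "hol f (ball x0 s)" for f
   by (rule hol_line_holomorphic[OF that]) (use line[OF x] in auto)
  have "contour_integral (circlepath 0 \<delta>) (\<lambda>v. (G (x + v *s b) - a) / (H (x + v *s b) - H x0) * (1 / v))
    = 2 * pi * \<i> * ((G (x + 0 *s b) - a) / (H (x + 0 *s b) - H x0))"
  proof (rule quotient_on_line[of _ "s/2"])
   show "(\<lambda>v. G (x + v *s b) - a) holomorphic_on ball 0 (s/2)" by (intro holomorphic_intros hl G)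
   show "(\<lambda>v. H (x + v *s b) - H x0) holomorphic_on ball 0 (s/2)" by (intro holomorphic_intros hl Hs)
   show "0 < \<delta>" "\<delta> < s / 2" using s by (auto simp: \<delta>_def)
   show "v = v'" if v: "v \<in> ball 0 (s/2)" "v' \<in> ball 0 (s/2)" and e: "H (x + v *s b) - H x0 = H (x + v' *s b) - H x0" for v v'
   proof -
    have "norm (H (x + v *s b) - H (x + v' *s b) - lb * (v - v')) \<le> norm lb / 2 * norm (v - v')"
     by (rule H_along_b[OF xn[OF x]]) (use v s\<eta> s \<eta> in auto)
    \<comment> \<open>H is injective along b, so it meets the level at most once on this disc; with
      the nonzero derivative below the zero is simple, and the numerator vanishes there too.\<close>
    hence "norm lb * norm (v - v') \<le> norm lb / 2 * norm (v - v')" using e by (simp add: norm_mult)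
    thus "v = v'" using l0 by simp
   qed
   show "deriv (\<lambda>v. H (x + v *s b) - H x0) v \<noteq> 0" if v: "v \<in> ball 0 (s/2)" for v
   proof -
    have i: "x + v *s b \<in> ball x0 s" using line[OF x] v by simp
    have "((\<lambda>v. H (x + v *s b) - H x0) has_field_derivative dd H (x + v *s b) b - 0) (at v)"
     by (intro derivative_intros hol_line[OF Hs i])
    moreover have "dd H (x + v *s b) b \<noteq> 0" by (rule dH_ball) (use i s\<eta> \<eta> in auto)
    ultimately show ?thesis using DERIV_imp_deriv by fastforce
   qed
   show "G (x + v *s b) - a = 0" if "v \<in> ball 0 (s/2)" "H (x + v *s b) - H x0 = 0" for v
    using a[OF line[OF x, of v]] that by simp
   show "H (x + 0 *s b) - H x0 \<noteq> 0" using nz by simp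
   show "H (x + v *s b) - H x0 \<noteq> 0" if "norm v = \<delta>" for v using onS[OF x that] by (simp add: S_def)
  qed
  thus ?thesis by (simp add: Q_def circ_def q_def)
 qed
 have Qeq: "quot G a H (H x0) x = Q x" if x: "x \<in> ball x0 \<delta>'" for x
 proof (cases "H x = H x0")
  case False thus ?thesis using Qq[OF x] by (simp add: quot_def q_def)
 next
  case True
  let ?A = "{y. H y \<noteq> H x0}"
  \<comment> \<open>Points off the level accumulate at x along b, so the limit in
    \<open>quot\<close> is unique.\<close>
  have nt: "\<not> trivial_limit (at x within ?A)"
   unfolding trivial_limit_within islimpt_approachable
  proof (intro notI, elim notE, intro allI impI)
   fix e :: real assume e: "e > 0"
   define v where "v = complex_of_real (min (e/2) (s/4))"
   have v: "norm v > 0" "norm v < e" "norm v < s / 2" "norm v \<le> \<eta>" using e s s\<eta> \<eta> by (auto simp: v_def)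
   have "norm (H (x + v *s b) - H (x + 0 *s b) - lb * (v - 0)) \<le> norm lb / 2 * norm (v - 0)"
    by (rule H_along_b[OF xn[OF x] v(4)]) (use \<eta> in auto)
   hence "H (x + v *s b) \<noteq> H x0" using v(1) l0 True by (auto simp: norm_mult)
   moreover have "dist (x + v *s b) x < e" using v b by (simp add: dist_norm norm_scale)
   moreover have "x + v *s b \<noteq> x" using v b by (metis add_cancel_left_right norm_scale mult.right_neutral norm_zero less_irrefl)
   ultimately show "\<exists>x'\<in>?A. x' \<noteq> x \<and> dist x' x < e" by blast
  qed
  have "isCont Q x" using has_derivative_continuous[OF holD[OF hQ x]] .
  hence "(Q \<longlongrightarrow> Q x) (at x within ?A)" by (simp add: continuous_within isCont_def tendsto_within_subset[of _ _ _ UNIV])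
  moreover have "\<forall>\<^sub>F y in at x within ?A. Q y = (G y - a) / (H y - H x0)"
  proof -
   have "\<forall>\<^sub>F y in at x within ?A. y \<in> ball x0 \<delta>'" using filter_leD[OF at_le[OF subset_UNIV] eventually_at_in_open'[OF open_ball x]] .
   moreover have "\<forall>\<^sub>F y in at x within ?A. y \<in> ?A" by (simp add: eventually_at_filter)
   ultimately show ?thesis by eventually_elim (use Qq in \<open>auto simp: q_def\<close>)
  qed
  ultimately have "((\<lambda>y. (G y - a) / (H y - H x0)) \<longlongrightarrow> Q x) (at x within ?A)"
   by (rule Lim_transform_eventually)
  thus ?thesis using True tendsto_Lim[OF nt] by (simp add: quot_def)
 qed
 show "hol (quot G a H (H x0)) (ball x0 \<delta>')" by (rule hol_transform(1)[OF hQ open_ball Qeq])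
 show "G x - a = (H x - H x0) * quot G a H (H x0) x" if x: "x \<in> ball x0 \<delta>'" for x
 proof (cases "H x = H x0")
  case True
  have "x \<in> ball x0 s" using x \<delta>'s by simp
  thus ?thesis using a[of x] True by simp
 qed (simp add: quot_def)
 show "norm (quot G a H (H x0) x) \<le> 16 * M / (l * s)" if x: "x \<in> ball x0 \<delta>'" for x
 proof -
  have M0: "M \<ge> 0" using M[of x0] s by (metis centre_in_ball norm_ge_zero order_trans)
  have cq: "continuous_on (sphere 0 \<delta>) (\<lambda>\<zeta>. q (x + \<zeta> *s b))"
   by (rule continuous_on_compose2[OF hol_continuous[OF hq] continuous_on_scale]) (use onS[OF x] in auto)
  have "(\<lambda>\<zeta>. q (x + \<zeta> *s b) * (1 / \<zeta>)) contour_integrable_on circlepath 0 \<delta>"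
   by (rule contour_integrable_continuous_circlepath, rule continuous_on_subset[OF continuous_on_mult[OF cq kc]]) (use \<delta> in auto)
  hence "norm (circ q b \<delta> (\<lambda>\<zeta>. 1 / \<zeta>) x) \<le> (M / (l * \<delta> / 4) * (1 / \<delta>)) * (2 * pi * \<delta>)"
   unfolding circ_def
  proof (rule has_contour_integral_bound_circlepath[OF has_contour_integral_integral _ \<delta>])
   fix \<zeta> :: complex assume z: "norm (\<zeta> - 0) = \<delta>"
   have "norm (q (x + \<zeta> *s b)) \<le> M / (l * \<delta> / 4)"
    unfolding q_def norm_divide using M[of "x + \<zeta> *s b"] onS[OF x] low[OF x] z l \<delta> M0
    by (intro frac_le) (auto simp: S_def)
   thus "norm (q (x + \<zeta> *s b) * (1 / \<zeta>)) \<le> M / (l * \<delta> / 4) * (1 / \<delta>)"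
    using z \<delta> mult_right_mono[of "norm (q (x + \<zeta> *s b))" "M / (l * \<delta> / 4)" "1 / \<delta>"] by (simp add: norm_mult norm_divide)
  qed (use M0 l \<delta> in auto)
  also have "\<dots> = 2 * pi * (16 * M / (l * s))" using l s by (simp add: \<delta>_def field_simps)
  finally have "norm (Q x) \<le> 16 * M / (l * s)"
   unfolding Q_def by (simp add: norm_mult norm_divide field_simps)
  thus ?thesis using Qeq[OF x] by simp
 qed
qed

end

section \<open>Weighted estimates for the Hamiltonian\<close>

text \<open>Where norm Y is maximal the increment is at most half of that maximum, so the maximum is
  at most twice the initial value.\<close>

lemma gronwall_small:
 fixes Y :: "real \<Rightarrow> complex ^ 'n"
 assumes d: "\<And>t. 0 \<le> t \<Longrightarrow> t \<le> T \<Longrightarrow> (Y has_vector_derivative Y' t) (at t)"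
  and b: "\<And>t. 0 \<le> t \<Longrightarrow> t \<le> T \<Longrightarrow> norm (Y' t) \<le> K * norm (Y t)"
  and K: "K \<ge> 0" "K * T \<le> 1 / 2" and t: "0 \<le> t" "t \<le> T"
 shows "norm (Y t - Y 0) \<le> 2 * K * T * norm (Y 0)" "norm (Y t) \<le> 2 * norm (Y 0)"
proof -
 have T: "T \<ge> 0" using t by linarith
 have cont: "continuous_on {0..T} Y"
 proof (rule continuous_at_imp_continuous_on, rule ballI)
  fix t assume "t \<in> {0..T}"
  thus "isCont Y t" using has_vector_derivative_continuous[OF d[of t]] by simp
 qed
 obtain s where s: "s \<in> {0..T}" "\<And>u. u \<in> {0..T} \<Longrightarrow> norm (Y u) \<le> norm (Y s)"
  using continuous_attains_sup[of "{0..T}" "\<lambda>u. norm (Y u)", OF _ _ continuous_on_norm[OF cont]] T by auto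
 have inc: "norm (Y u - Y 0) \<le> K * T * norm (Y s)" if u: "0 \<le> u" "u \<le> T" for u
 proof (cases "u = 0")
  case False
  hence u0: "0 < u" using u by simp
  have "\<exists>x\<in>{0<..<u}. norm (Y u - Y 0) \<le> norm ((u - 0) *\<^sub>R Y' x)"
  proof (rule mvt_general[OF u0])
   show "continuous_on {0..u} Y" by (rule continuous_on_subset[OF cont]) (use u in auto)
   show "(Y has_derivative (\<lambda>h. h *\<^sub>R Y' x)) (at x)" if "0 < x" "x < u" for x
    using d[of x] that u by (simp add: has_vector_derivative_def)
  qed
  then obtain x where x: "x \<in> {0<..<u}" "norm (Y u - Y 0) \<le> norm ((u - 0) *\<^sub>R Y' x)" by blast
  have "norm ((u - 0) *\<^sub>R Y' x) \<le> u * (K * norm (Y x))" using b[of x] x(1) u by (auto intro: mult_left_mono)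
  also have "\<dots> \<le> T * (K * norm (Y s))" using s(2)[of x] x(1) u K by (intro mult_mono mult_left_mono) auto
  finally show ?thesis using x(2) by (simp add: mult_ac)
 qed (use K T in auto)
 have "norm (Y s) \<le> norm (Y s - Y 0) + norm (Y 0)" by (metis diff_add_cancel norm_triangle_ineq)
 also have "norm (Y s - Y 0) \<le> K * T * norm (Y s)" using inc s(1) by simp
 also have "\<dots> \<le> 1 / 2 * norm (Y s)" using K by (intro mult_right_mono) auto
 finally have s2: "norm (Y s) \<le> 2 * norm (Y 0)" by simp
 have "norm (Y t - Y 0) \<le> K * T * norm (Y s)" by (rule inc[OF t])
 also have "\<dots> \<le> K * T * (2 * norm (Y 0))" using s2 K T by (intro mult_left_mono) auto
 finally show "norm (Y t - Y 0) \<le> 2 * K * T * norm (Y 0)" by simp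
 show "norm (Y t) \<le> 2 * norm (Y 0)" using s(2)[of t] s2 t by simp
qed

lemma linear_ode_zero:
 fixes Y :: "real \<Rightarrow> complex ^ 'n"
 assumes d: "\<And>t. 0 \<le> t \<Longrightarrow> (Y has_vector_derivative Y' t) (at t)"
  and b: "\<And>t. 0 \<le> t \<Longrightarrow> norm (Y' t) \<le> K * norm (Y t)"
  and 0: "Y 0 = 0" and t: "0 \<le> t"
 shows "Y t = 0"
proof -
 define K' where "K' = \<bar>K\<bar> + 1"
 define T where "T = 1 / (2 * K')"
 have K': "K' > 0" "K' \<ge> K" and T: "T > 0" "K' * T \<le> 1 / 2" by (auto simp: K'_def T_def)
 have b': "norm (Y' t) \<le> K' * norm (Y t)" if "0 \<le> t" for t
  using b[OF that] K'(2) by (smt (verit) mult_right_mono norm_ge_zero)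
 have step: "Y u = 0" if "Y s = 0" "0 \<le> s" "s \<le> u" "u \<le> s + T" for s u
 proof -
  have "norm ((\<lambda>v. Y (v + s)) (u - s)) \<le> 2 * norm ((\<lambda>v. Y (v + s)) 0)"
  proof (rule gronwall_small(2)[of T "\<lambda>v. Y (v + s)" "\<lambda>v. Y' (v + s)" K'])
   fix v assume v: "0 \<le> v" "v \<le> T"
   have "((\<lambda>v. v + s) has_vector_derivative 1) (at v)"
    unfolding has_real_derivative_iff_has_vector_derivative[symmetric] by (auto intro!: derivative_eq_intros)
   from vector_diff_chain_at[OF this, of Y "Y' (v + s)"] d[of "v + s"] v that
   show "((\<lambda>v. Y (v + s)) has_vector_derivative Y' (v + s)) (at v)" by (simp add: comp_def)
   show "norm (Y' (v + s)) \<le> K' * norm (Y (v + s))" using b'[of "v + s"] v that by simp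
  qed (use T K' that in auto)
  thus ?thesis using that(1) by simp
 qed
 have "\<forall>u. 0 \<le> u \<longrightarrow> u \<le> real n * T \<longrightarrow> Y u = 0" for n
 proof (induction n)
  case (Suc n)
  show ?case
  proof (intro allI impI)
   fix u assume u: "0 \<le> u" "u \<le> real (Suc n) * T"
   show "Y u = 0"
   proof (cases "u \<le> real n * T")
    case False
    have "Y (real n * T) = 0" using Suc T by simp
    thus ?thesis by (rule step) (use False u T in \<open>auto simp: algebra_simps\<close>)
   qed (use Suc u in auto)
  qed
 qed (use 0 in auto)
 moreover obtain n where "t < real n * T" using reals_Archimedean3[OF T(1)] by blast
 ultimately show ?thesis using t by (meson less_imp_le)
qed

text \<open>Cauchy's inequality on a polydisc with its own radius for each coordinate, to match the
  different weights of q and p.\<close>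

lemma pdiff_bound_poly:
 fixes f :: "complex ^ 'n \<Rightarrow> complex"
 assumes hol: "hol f S" and S: "\<And>x. (\<And>j. norm (x $ j) \<le> \<rho> j) \<Longrightarrow> x \<in> S" and \<rho>: "\<And>j. \<rho> j > 0"
  and M: "\<And>x. (\<And>j. norm (x $ j) \<le> \<rho> j) \<Longrightarrow> norm (f x) \<le> M"
  and u: "\<And>j. norm (u $ j) \<le> \<rho> j / 2"
 shows "norm (pdiff i f u) \<le> 2 * M / \<rho> i"
proof -
 have in_b: "norm ((u + z *s axis i 1) $ j) \<le> \<rho> j" if "z \<in> cball 0 (\<rho> i / 2)" for z j
 proof (cases "j = i")
  case True
  have "norm (u $ i + z) \<le> norm (u $ i) + norm z" by (rule norm_triangle_ineq)
  thus ?thesis using True u[of i] that by (simp add: axis_def)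
 next
  case False thus ?thesis using u[of j] \<rho>[of j] by (simp add: axis_def)
 qed
 have h: "(\<lambda>z. f (u + z *s axis i 1)) holomorphic_on cball 0 (\<rho> i / 2)"
  by (rule hol_line_holomorphic[OF hol S]) (use in_b in auto)
 have "norm ((deriv ^^ 1) (\<lambda>z. f (u + z *s axis i 1)) 0) \<le> fact 1 * M / (\<rho> i / 2) ^ 1"
  by (rule Cauchy_inequality) (use h \<rho>[of i] M in_b in \<open>auto intro: holomorphic_on_subset holomorphic_on_imp_continuous_on\<close>)
 moreover have "deriv (\<lambda>z. f (u + z *s axis i 1)) 0 = pdiff i f u" by (simp add: pdiff_def)
 ultimately show ?thesis by (simp add: mult.commute)
qed

text \<open>For kappa > 1/16 the plain bounds at x and y suffice. Otherwise the complex line from y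
  through x stays in the half polydisc for norm z < 1 / (4 kappa), a radius of at least 4, so the
  derivative changes by O(kappa) between z = 0 and z = 1.\<close>

lemma pdiff_lipschitz_poly:
 fixes f :: "complex ^ 'n \<Rightarrow> complex"
 assumes hol: "hol f S" "open S" and S: "\<And>x. (\<And>j. norm (x $ j) \<le> \<rho> j) \<Longrightarrow> x \<in> S" and \<rho>: "\<And>j. \<rho> j > 0"
  and M: "\<And>x. (\<And>j. norm (x $ j) \<le> \<rho> j) \<Longrightarrow> norm (f x) \<le> M"
  and xy: "\<And>j. norm (x $ j) \<le> \<rho> j / 4" "\<And>j. norm (y $ j) \<le> \<rho> j / 4"
  and \<kappa>: "\<And>j. norm (x $ j - y $ j) \<le> \<kappa> * \<rho> j" "\<kappa> \<ge> 0"
 shows "norm (pdiff i f x - pdiff i f y) \<le> 64 * M / \<rho> i * \<kappa>"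
proof -
 have bd: "norm (pdiff i f u) \<le> 2 * M / \<rho> i" if "\<And>j. norm (u $ j) \<le> \<rho> j / 2" for u
  by (rule pdiff_bound_poly[OF hol(1) S \<rho> M that])
 have half: "norm (x $ j) \<le> \<rho> j / 2" "norm (y $ j) \<le> \<rho> j / 2" for j using xy[of j] \<rho>[of j] by linarith+
 have M0: "M \<ge> 0" using M[of 0] \<rho> by (smt (verit) norm_ge_zero norm_zero zero_index)
 consider "\<kappa> = 0" | "\<kappa> > 1 / 16" | "\<kappa> > 0" "\<kappa> \<le> 1 / 16" using \<kappa>(2) by linarith
 thus ?thesis
 proof cases
  case 1
  hence "x = y" using \<kappa>(1) by (simp add: vec_eq_iff)
  thus ?thesis using 1 by simp
 next
  case 2
  have "norm (pdiff i f x - pdiff i f y) \<le> 2 * M / \<rho> i + 2 * M / \<rho> i"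
   using bd[OF half(1)] bd[OF half(2)] norm_triangle_ineq4 order_trans add_mono by metis
  also have "\<dots> = 64 * M / \<rho> i * (1 / 16)" by simp
  also have "\<dots> \<le> 64 * M / \<rho> i * \<kappa>" using 2 M0 \<rho>[of i] by (intro mult_left_mono) auto
  finally show ?thesis .
 next
  case 3
  define \<psi> where "\<psi> = (\<lambda>z. pdiff i f (y + z *s (x - y)))"
  have in_b: "norm ((y + z *s (x - y)) $ j) \<le> \<rho> j / 2" if "z \<in> ball 0 (1 / (4 * \<kappa>))" for z j
  proof -
   have "norm z * norm (x $ j - y $ j) \<le> 1 / (4 * \<kappa>) * (\<kappa> * \<rho> j)"
    by (rule mult_mono) (use that \<kappa> 3 \<rho>[of j] in auto)
   also have "\<dots> = \<rho> j / 4" using 3 by simp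
   finally have "norm (y $ j) + norm (z * (x $ j - y $ j)) \<le> \<rho> j / 2" using xy(2)[of j] by (simp add: norm_mult)
   moreover have "(y + z *s (x - y)) $ j = y $ j + z * (x $ j - y $ j)" by (simp add: algebra_simps)
   ultimately show ?thesis using norm_triangle_ineq[of "y $ j" "z * (x $ j - y $ j)"] by (simp only:)
  qed
  have inS: "y + z *s (x - y) \<in> S" if "z \<in> ball 0 (1 / (4 * \<kappa>))" for z
   by (rule S) (smt (verit) in_b[OF that] \<rho> field_sum_of_halves)
  have h: "\<psi> holomorphic_on ball 0 (1 / (4 * \<kappa>))"
   unfolding \<psi>_def by (rule hol_line_holomorphic[OF hol_pdiff[OF hol(2,1)] inS])
  have "norm (\<psi> 1 - (\<Sum>j<1. (deriv ^^ j) \<psi> 0 / fact j)) \<le> 2 * (2 * M / \<rho> i) * (2 / (1 / (4 * \<kappa>))) ^ 1"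
   by (rule holomorphic_tail_bound[OF h]) (use 3 bd in_b in \<open>auto simp: \<psi>_def field_simps\<close>)
  hence "norm (pdiff i f x - pdiff i f y) \<le> 32 * M / \<rho> i * \<kappa>" by (simp add: \<psi>_def)
  also have "\<dots> \<le> 64 * M / \<rho> i * \<kappa>" using M0 \<rho>[of i] \<kappa>(2) by (intro mult_right_mono divide_right_mono) auto
  finally show ?thesis .
 qed
qed

definition wt :: "4 \<Rightarrow> nat" where "wt j = (if j = 1 \<or> j = 2 then 2 else 1)"

lemma wt_simps [simp]: "wt 1 = 2" "wt 2 = 2" "wt 3 = 1" "wt 4 = 1" by (simp_all add: wt_def)

lemma weighted_order_sum: "weighted_order \<alpha> = (\<Sum>j\<in>UNIV. wt j * \<alpha> j)"
 by (simp add: weighted_order_def sum_4)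

text \<open>On the polydisc with radii rho * mu^(wt j) a monomial of weighted order w acquires the
  factor mu^w; absolute convergence sums the rest.\<close>

lemma weighted_bound:
 assumes "weighted_order_ge F m"
 shows "\<exists>M \<rho>. \<rho> > 0 \<and> M > 0 \<and> (\<forall>\<mu> x. 0 < \<mu> \<longrightarrow> \<mu> \<le> 1 \<longrightarrow> (\<forall>j. norm (x $ j) \<le> \<rho> * \<mu> ^ wt j) \<longrightarrow> norm (F x) \<le> M * \<mu> ^ m)"
proof -
 obtain c where c: "has_power_series_at F 0 c" "\<And>\<alpha>. c \<alpha> \<noteq> 0 \<Longrightarrow> weighted_order \<alpha> \<ge> m"
  using assms unfolding weighted_order_ge_def by blast
 obtain \<rho>0 where \<rho>0: "\<rho>0 > 0" and sm: "(\<lambda>\<alpha>. norm (c \<alpha>) * \<rho>0 ^ (\<Sum>i\<in>UNIV. \<alpha> i)) summable_on UNIV"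
  and hs: "\<And>x. norm (x - 0) \<le> \<rho>0 \<Longrightarrow> ((\<lambda>\<alpha>. c \<alpha> * (\<Prod>i\<in>UNIV. (x $ i - 0 $ i) ^ \<alpha> i)) has_sum F x) UNIV"
  using power_series_abs_summable[OF c(1)] by blast
 define B where "B = (\<Sum>\<^sub>\<infinity>\<alpha>. norm (c \<alpha>) * \<rho>0 ^ (\<Sum>i\<in>UNIV. \<alpha> i))"
 have B0: "B \<ge> 0" unfolding B_def using \<rho>0 by (intro infsum_nonneg) auto
 show ?thesis
 proof (rule exI[of _ "B + 1"], rule exI[of _ "\<rho>0 / 4"], intro conjI allI impI)
  fix \<mu> :: real and x :: "complex^4"
  assume l: "0 < \<mu>" "\<mu> \<le> 1" and "\<forall>j. norm (x $ j) \<le> \<rho>0 / 4 * \<mu> ^ wt j"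
  hence x: "\<And>j. norm (x $ j) \<le> \<rho>0 / 4 * \<mu> ^ wt j" by blast
  have x1: "norm (x $ j) \<le> \<rho>0 / 4" for j
  proof -
   have "\<rho>0 / 4 * \<mu> ^ wt j \<le> \<rho>0 / 4 * 1" using l \<rho>0 power_le_one[of \<mu> "wt j"] by (intro mult_left_mono) auto
   thus ?thesis using x[of j] by linarith
  qed
  have "norm x \<le> (\<Sum>j\<in>UNIV. norm (x $ j))" unfolding norm_vec_def by (rule L2_set_le_sum) simp
  also have "\<dots> \<le> \<rho>0" using x1[of 1] x1[of 2] x1[of 3] x1[of 4] by (simp add: sum_4)
  finally have h: "((\<lambda>\<alpha>. c \<alpha> * (\<Prod>i\<in>UNIV. (x $ i) ^ \<alpha> i)) has_sum F x) UNIV" using hs[of x] by simp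
  have abs: "(\<lambda>\<alpha>. norm (c \<alpha> * (\<Prod>i\<in>UNIV. (x $ i) ^ \<alpha> i))) summable_on UNIV"
   using has_sum_imp_summable[OF h] by (simp only: summable_on_iff_abs_summable_on_complex)
  have "norm (F x) \<le> (\<Sum>\<^sub>\<infinity>\<alpha>. norm (c \<alpha> * (\<Prod>i\<in>UNIV. (x $ i) ^ \<alpha> i)))"
   using norm_infsum_bound[OF abs] infsumI[OF h] by simp
  also have "\<dots> \<le> (\<Sum>\<^sub>\<infinity>\<alpha>. \<mu> ^ m * (norm (c \<alpha>) * \<rho>0 ^ (\<Sum>i\<in>UNIV. \<alpha> i)))"
  proof (rule infsum_mono[OF abs summable_on_cmult_right[OF sm]])
   fix \<alpha>
   show "norm (c \<alpha> * (\<Prod>i\<in>UNIV. (x $ i) ^ \<alpha> i)) \<le> \<mu> ^ m * (norm (c \<alpha>) * \<rho>0 ^ (\<Sum>i\<in>UNIV. \<alpha> i))"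
   proof (cases "c \<alpha> = 0")
    case False
    have "norm (\<Prod>i\<in>UNIV. (x $ i) ^ \<alpha> i) = (\<Prod>i\<in>UNIV. norm (x $ i) ^ \<alpha> i)" by (simp add: prod_norm[symmetric] norm_power)
    also have "\<dots> \<le> (\<Prod>i\<in>UNIV. (\<rho>0 * \<mu> ^ wt i) ^ \<alpha> i)"
    proof (rule prod_mono, intro conjI power_mono)
     fix i :: 4
     have "\<rho>0 / 4 * \<mu> ^ wt i \<le> \<rho>0 * \<mu> ^ wt i" using \<rho>0 l by (intro mult_right_mono) auto
     thus "norm (x $ i) \<le> \<rho>0 * \<mu> ^ wt i" using x[of i] by linarith
    qed auto
    also have "\<dots> = \<rho>0 ^ (\<Sum>i\<in>UNIV. \<alpha> i) * \<mu> ^ weighted_order \<alpha>"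
     by (simp add: weighted_order_sum power_mult_distrib prod.distrib power_sum power_mult)
    also have "\<dots> \<le> \<rho>0 ^ (\<Sum>i\<in>UNIV. \<alpha> i) * \<mu> ^ m"
     using c(2)[OF False] l \<rho>0 by (intro mult_left_mono power_decreasing) auto
    finally have "norm (c \<alpha>) * norm (\<Prod>i\<in>UNIV. (x $ i) ^ \<alpha> i) \<le> norm (c \<alpha>) * (\<rho>0 ^ (\<Sum>i\<in>UNIV. \<alpha> i) * \<mu> ^ m)"
     by (rule mult_left_mono) simp
    thus ?thesis by (simp add: norm_mult mult_ac)
   qed simp
  qed
  also have "\<dots> = \<mu> ^ m * B" unfolding B_def by (rule infsum_cmult_right')
  also have "\<dots> \<le> (B + 1) * \<mu> ^ m" using l by (simp add: algebra_simps)
  finally show "norm (F x) \<le> (B + 1) * \<mu> ^ m" .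
 qed (use \<rho>0 B0 in auto)
qed

lemma norm_le_4: "norm (x::complex^4) \<le> norm (x $ 1) + norm (x $ 2) + norm (x $ 3) + norm (x $ 4)"
proof -
 have "norm x \<le> (\<Sum>j\<in>UNIV. norm (x $ j))" unfolding norm_vec_def by (rule L2_set_le_sum) simp
 thus ?thesis by (simp add: sum_4)
qed

lemma norm_le_4_mult: "(\<And>j. norm ((x::complex^4) $ j) \<le> B) \<Longrightarrow> norm x \<le> 4 * B"
proof -
 assume b: "\<And>j. norm (x $ j) \<le> B"
 show ?thesis using norm_le_4[of x] b[of 1] b[of 2] b[of 3] b[of 4] by linarith
qed

text \<open>The Hamiltonian is the rotation part \<open>-I\<^sub>1\<close> plus the remainder \<open>rem\<close> of weighted order at least four.\<close>

definition rem :: "complex \<Rightarrow> (complex ^ 4 \<Rightarrow> complex) \<Rightarrow> complex ^ 4 \<Rightarrow> complex" where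
 "rem \<eta> F x = I2 x + \<eta> * (I3 x)\<^sup>2 + F x"

lemma hol_I: "hol I1 S" "hol I2 S" "hol I3 S"
 unfolding I1_def[abs_def] I2_def[abs_def] I3_def[abs_def]
 by (intro hol_diff hol_mult hol_coord hol_divide hol_add hol_power hol_const; simp)+

lemma hol_rem: "hol F S \<Longrightarrow> hol (rem \<eta> F) S" "hol F S \<Longrightarrow> hol (ham \<eta> F) S"
 unfolding rem_def[abs_def] ham_def[abs_def] by (auto intro!: hol_add hol_diff hol_mult hol_I hol_power hol_const hol_uminus)

lemma dd_I1: "dd I1 x v = x $ 2 * v $ 3 + v $ 2 * x $ 3 - (x $ 1 * v $ 4 + v $ 1 * x $ 4)"
 unfolding I1_def[abs_def]
 using dd_minus[OF hol_mult[OF hol_coord hol_coord] hol_mult[OF hol_coord hol_coord], of x UNIV 2 3 1 4 v]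
  dd_mult[OF hol_coord hol_coord, of x UNIV 2 3 v] dd_mult[OF hol_coord hol_coord, of x UNIV 1 4 v] by simp

lemma dd_I2: "dd I2 x v = x $ 1 * v $ 1 + x $ 2 * v $ 2"
proof -
 have e: "I2 = (\<lambda>x. (1/2) * (x $ 1 * x $ 1 + x $ 2 * x $ 2))" by (simp add: I2_def fun_eq_iff power2_eq_square)
 have m: "hol (\<lambda>x::complex^4. x $ i * x $ i) UNIV" for i by (intro hol_mult hol_coord)
 have "dd I2 x v = 1/2 * dd (\<lambda>x. x $ 1 * x $ 1 + x $ 2 * x $ 2) x v"
  unfolding e by (rule dd_cmult[OF hol_add[OF m m] UNIV_I])
 moreover have "dd (\<lambda>x. x $ 1 * x $ 1 + x $ 2 * x $ 2) x v = 2 * (x $ 1 * v $ 1 + x $ 2 * v $ 2)"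
  using dd_plus[OF m m, of x 1 2 v]
   dd_mult[OF hol_coord hol_coord, of x UNIV 1 1 v] dd_mult[OF hol_coord hol_coord, of x UNIV 2 2 v] by (simp add: algebra_simps)
 moreover have "1 / 2 * (2 * a) = a" for a :: complex by simp
 ultimately show ?thesis by (simp only:)
qed

lemma dd_ham:
 assumes "hol F S" "x \<in> S"
 shows "dd (ham \<eta> F) x v = - dd I1 x v + dd (rem \<eta> F) x v"
proof -
 have e: "ham \<eta> F = (\<lambda>x. - I1 x + rem \<eta> F x)" by (simp add: ham_def rem_def fun_eq_iff)
 have "dd (\<lambda>x. - I1 x + rem \<eta> F x) x v = dd (\<lambda>x. - I1 x) x v + dd (rem \<eta> F) x v"
  by (rule dd_plus[OF hol_uminus[OF hol_I(1)] hol_rem(1)[OF assms(1)] assms(2)])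
 thus ?thesis using dd_uminus[OF hol_I(1) UNIV_I, of x v] unfolding e by (simp only:)
qed

lemma ham_vf_comp:
 assumes "hol F S" "x \<in> S"
 shows "ham_vf (ham \<eta> F) x $ 1 = - x $ 2 + pdiff 3 (rem \<eta> F) x" "ham_vf (ham \<eta> F) x $ 2 = x $ 1 + pdiff 4 (rem \<eta> F) x"
  "ham_vf (ham \<eta> F) x $ 3 = - x $ 4 - pdiff 1 (rem \<eta> F) x" "ham_vf (ham \<eta> F) x $ 4 = x $ 3 - pdiff 2 (rem \<eta> F) x"
proof -
 have *: "pdiff i (ham \<eta> F) x = - dd I1 x (axis i 1) + pdiff i (rem \<eta> F) x" for i
  using dd_ham[OF assms, of \<eta> "axis i 1"] by simp
 show "ham_vf (ham \<eta> F) x $ 1 = - x $ 2 + pdiff 3 (rem \<eta> F) x" "ham_vf (ham \<eta> F) x $ 2 = x $ 1 + pdiff 4 (rem \<eta> F) x"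
  "ham_vf (ham \<eta> F) x $ 3 = - x $ 4 - pdiff 1 (rem \<eta> F) x" "ham_vf (ham \<eta> F) x $ 4 = x $ 3 - pdiff 2 (rem \<eta> F) x"
  unfolding ham_vf_def * dd_I1 by (simp_all add: axis_def)
qed

text \<open>Two scalings. The weighted one gives order 4 for everything beyond the rotation. In the
  isotropic one with radius rho * mu^2 the non-quadratic part is O(mu^5), that is O((norm x)^(5/2)),
  so the quadratic part dominates near the origin.\<close>

lemma rem_bound:
 assumes "weighted_order_ge F 5"
 shows "\<exists>M \<rho>. \<rho> > 0 \<and> M > 0 \<and> (\<forall>\<mu> x. 0 < \<mu> \<longrightarrow> \<mu> \<le> 1 \<longrightarrow> (\<forall>j. norm (x $ j) \<le> \<rho> * \<mu> ^ wt j) \<longrightarrow> norm (rem \<eta> F x) \<le> M * \<mu> ^ 4)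
  \<and> (\<forall>\<mu> x. 0 < \<mu> \<longrightarrow> \<mu> \<le> 1 \<longrightarrow> (\<forall>j. norm (x $ j) \<le> \<rho> * \<mu> ^ 2) \<longrightarrow> norm (\<eta> * (I3 x)\<^sup>2 + F x) \<le> M * \<mu> ^ 5)"
proof -
 obtain M \<rho> where *: "\<rho> > 0" "M > 0" and F': "\<forall>\<mu> x. 0 < \<mu> \<longrightarrow> \<mu> \<le> 1 \<longrightarrow> (\<forall>j. norm (x $ j) \<le> \<rho> * \<mu> ^ wt j) \<longrightarrow> norm (F x) \<le> M * \<mu> ^ 5"
  using weighted_bound[OF assms] by blast
 have F: "norm (F x) \<le> M * \<mu> ^ 5" if "0 < \<mu>" "\<mu> \<le> 1" "\<And>j. norm (x $ j) \<le> \<rho> * \<mu> ^ wt j" for \<mu> x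
  using F'[rule_format, OF that] .
 have sq: "norm ((a\<^sup>2 + b\<^sup>2) / 2) \<le> c\<^sup>2" if "norm a \<le> c" "norm b \<le> c" for a b :: complex and c
 proof -
  have "norm (a\<^sup>2 + b\<^sup>2) \<le> norm (a\<^sup>2) + norm (b\<^sup>2)" by (rule norm_triangle_ineq)
  also have "\<dots> \<le> c\<^sup>2 + c\<^sup>2" using that by (intro add_mono) (auto simp: norm_power intro: power_mono)
  finally show ?thesis by (simp add: norm_divide)
 qed
 show ?thesis
 proof (rule exI[of _ "\<rho>\<^sup>2 + norm \<eta> * \<rho> ^ 4 + M"], rule exI[of _ \<rho>], intro conjI allI impI)
  fix \<mu> :: real and x :: "complex^4"
  assume l: "0 < \<mu>" "\<mu> \<le> 1" and "\<forall>j. norm (x $ j) \<le> \<rho> * \<mu> ^ wt j"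
  hence x: "\<And>j. norm (x $ j) \<le> \<rho> * \<mu> ^ wt j" by blast
  have "norm (I2 x) \<le> (\<rho> * \<mu> ^ 2)\<^sup>2" unfolding I2_def by (rule sq) (use x[of 1] x[of 2] in auto)
  moreover have i3: "norm (I3 x) \<le> (\<rho> * \<mu>)\<^sup>2" unfolding I3_def by (rule sq) (use x[of 3] x[of 4] in auto)
  have "norm (\<eta> * (I3 x)\<^sup>2) \<le> norm \<eta> * ((\<rho> * \<mu>)\<^sup>2)\<^sup>2"
   using power_mono[OF i3, of 2] by (simp add: norm_mult norm_power mult_left_mono)
  moreover have "norm (F x) \<le> M * \<mu> ^ 4"
  proof -
   have "norm (F x) \<le> M * \<mu> ^ 5" by (rule F[OF l x])
   also have "\<dots> \<le> M * \<mu> ^ 4" using * l by (intro mult_left_mono power_decreasing) auto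
   finally show ?thesis .
  qed
  moreover have "norm (rem \<eta> F x) \<le> norm (I2 x) + norm (\<eta> * (I3 x)\<^sup>2) + norm (F x)"
   unfolding rem_def by (meson norm_triangle_ineq norm_triangle_mono order_refl)
  ultimately have "norm (rem \<eta> F x) \<le> (\<rho> * \<mu> ^ 2)\<^sup>2 + norm \<eta> * ((\<rho> * \<mu>)\<^sup>2)\<^sup>2 + M * \<mu> ^ 4" by linarith
  thus "norm (rem \<eta> F x) \<le> (\<rho>\<^sup>2 + norm \<eta> * \<rho> ^ 4 + M) * \<mu> ^ 4"
   by (simp add: power_mult_distrib algebra_simps power_mult[symmetric])
 next
  fix \<mu> :: real and x :: "complex^4"
  assume l: "0 < \<mu>" "\<mu> \<le> 1" and "\<forall>j. norm (x $ j) \<le> \<rho> * \<mu> ^ 2"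
  hence x: "\<And>j. norm (x $ j) \<le> \<rho> * \<mu> ^ 2" by blast
  have i3: "norm (I3 x) \<le> (\<rho> * \<mu> ^ 2)\<^sup>2" unfolding I3_def by (rule sq) (use x[of 3] x[of 4] in auto)
  have "norm (\<eta> * (I3 x)\<^sup>2) \<le> norm \<eta> * ((\<rho> * \<mu> ^ 2)\<^sup>2)\<^sup>2"
   using power_mono[OF i3, of 2] by (simp add: norm_mult norm_power mult_left_mono)
  also have "\<dots> = norm \<eta> * \<rho> ^ 4 * \<mu> ^ 8" by (simp add: power_mult_distrib power_mult[symmetric])
  also have "\<dots> \<le> norm \<eta> * \<rho> ^ 4 * \<mu> ^ 5" using l by (intro mult_left_mono power_decreasing) auto
  finally have 1: "norm (\<eta> * (I3 x)\<^sup>2) \<le> norm \<eta> * \<rho> ^ 4 * \<mu> ^ 5" .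
  have 2: "norm (F x) \<le> M * \<mu> ^ 5"
  proof (rule F[OF l])
   fix j
   have "\<rho> * \<mu> ^ 2 \<le> \<rho> * \<mu> ^ wt j" using l * by (intro mult_left_mono power_decreasing) (auto simp: wt_def)
   thus "norm (x $ j) \<le> \<rho> * \<mu> ^ wt j" using x[of j] by linarith
  qed
  have "norm (\<eta> * (I3 x)\<^sup>2 + F x) \<le> norm \<eta> * \<rho> ^ 4 * \<mu> ^ 5 + M * \<mu> ^ 5"
   by (rule norm_triangle_mono[OF 1 2])
  also have "\<dots> \<le> (\<rho>\<^sup>2 + norm \<eta> * \<rho> ^ 4 + M) * \<mu> ^ 5" using l by (simp add: algebra_simps)
  finally show "norm (\<eta> * (I3 x)\<^sup>2 + F x) \<le> (\<rho>\<^sup>2 + norm \<eta> * \<rho> ^ 4 + M) * \<mu> ^ 5" .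
 qed (use * in \<open>auto intro!: add_nonneg_pos\<close>)
qed

text \<open>The quadratic part of the Hamiltonian is nondegenerate, hence the origin is an isolated equilibrium.\<close>

lemma ham_vf_lower_bound:
 assumes F: "hol F U" "open U" "0 \<in> U" and w: "weighted_order_ge F 5"
 obtains r0 where "r0 > 0" "ball 0 r0 \<subseteq> U" "\<And>x. norm x < r0 \<Longrightarrow> norm x \<le> 12 * norm (ham_vf (ham \<eta> F) x)"
  "ham_vf (ham \<eta> F) 0 = 0"
proof -
 obtain M \<rho> where M: "\<rho> > 0" "M > 0" and Qb': "\<forall>\<mu> x. 0 < \<mu> \<longrightarrow> \<mu> \<le> 1 \<longrightarrow> (\<forall>j. norm (x $ j) \<le> \<rho> * \<mu> ^ 2) \<longrightarrow> norm (\<eta> * (I3 x)\<^sup>2 + F x) \<le> M * \<mu> ^ 5"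
  using rem_bound[OF w, of \<eta>] by blast
 have Qb: "norm (\<eta> * (I3 x)\<^sup>2 + F x) \<le> M * \<mu> ^ 5" if "0 < \<mu>" "\<mu> \<le> 1" "\<And>j. norm (x $ j) \<le> \<rho> * \<mu> ^ 2" for \<mu> x
  using Qb'[rule_format, OF that] .
 define Q where "Q = (\<lambda>x. \<eta> * (I3 x)\<^sup>2 + F x)"
 have hQ: "hol Q U" unfolding Q_def by (intro hol_add hol_mult hol_const hol_power hol_I F)
 obtain e where e: "e > 0" "ball 0 e \<subseteq> U" using F open_contains_ball by metis
 define \<mu>0 where "\<mu>0 = min 1 (\<rho>\<^sup>2 / (48 * M))"
 have l0: "\<mu>0 > 0" "\<mu>0 \<le> 1" "4 * M * \<mu>0 / \<rho>\<^sup>2 \<le> 1 / 12" using M by (auto simp: \<mu>0_def min_def field_simps)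
 define r0 where "r0 = min (e / 2) (\<rho> * \<mu>0\<^sup>2 / 2)"
 have r0: "r0 > 0" "r0 \<le> e / 2" "2 * r0 \<le> \<rho> * \<mu>0\<^sup>2" using e M l0 by (auto simp: r0_def)
 have dQ: "norm (pdiff i Q x) \<le> norm x / 12" if x: "norm x < r0" "x \<noteq> 0" for x i
 proof -
  \<comment> \<open>The ball of radius norm x around x then lies in the polydisc of radius rho *
    mu^2, and Cauchy's inequality gives mu^5 / norm x, which is of order mu * norm x.\<close>
  define \<mu> where "\<mu> = sqrt (2 * norm x / \<rho>)"
  have l2: "\<mu>\<^sup>2 = 2 * norm x / \<rho>" using M by (simp add: \<mu>_def)
  have "\<mu>\<^sup>2 \<le> \<mu>0\<^sup>2" unfolding l2 using x r0 M by (simp add: field_simps)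
  hence l: "0 < \<mu>" "\<mu> \<le> \<mu>0" using l0 x M power2_le_imp_le[of \<mu> \<mu>0] by (auto simp: \<mu>_def)
  have "norm (dd Q x (axis i 1)) \<le> M * \<mu> ^ 5 / norm x * norm (axis i (1::complex) :: complex^4)"
  proof (rule dd_bound)
   have sub: "ball x (norm x) \<subseteq> ball 0 e"
   proof
    fix y assume "y \<in> ball x (norm x)"
    hence "norm y < 2 * norm x" using norm_triangle_ineq2[of y x] by (simp add: dist_norm norm_minus_commute)
    thus "y \<in> ball 0 e" using x r0 by simp
   qed
   show "hol Q (ball x (norm x))" using hol_subset[OF hQ] sub e by blast
   show "norm (Q y) \<le> M * \<mu> ^ 5" if y: "y \<in> ball x (norm x)" for y
    unfolding Q_def
   proof (rule Qb)
    have "norm y \<le> 2 * norm x" using y norm_triangle_ineq2[of y x] by (simp add: dist_norm norm_minus_commute)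
    thus "norm (y $ j) \<le> \<rho> * \<mu> ^ 2" for j using component_le[of y j] M unfolding l2 by simp
   qed (use l l0 in auto)
  qed (use x in auto)
  hence "norm (pdiff i Q x) \<le> M * \<mu> * (\<mu>\<^sup>2)\<^sup>2 / norm x" by (simp add: power2_eq_square eval_nat_numeral mult_ac)
  also have "\<dots> = 4 * M * \<mu> / \<rho>\<^sup>2 * norm x" unfolding l2 using x by (simp add: power2_eq_square field_simps)
  also have "\<dots> \<le> 4 * M * \<mu>0 / \<rho>\<^sup>2 * norm x" using l M by (intro mult_right_mono divide_right_mono mult_left_mono) auto
  also have "\<dots> \<le> 1 / 12 * norm x" using l0 by (intro mult_right_mono) auto
  finally show ?thesis by simp
 qed
 have dQ0: "pdiff i Q 0 = 0" for i
 proof -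
  have "isCont (\<lambda>y. dd Q y (axis i 1)) 0" by (rule dd_continuous[OF hQ F(2,3)])
  hence "((\<lambda>y. pdiff i Q y) \<longlongrightarrow> pdiff i Q 0) (at 0)" by (simp add: isCont_def)
  moreover have "((\<lambda>y. pdiff i Q y) \<longlongrightarrow> 0) (at (0::complex^4))"
  proof (rule Lim_null_comparison)
   have "\<forall>\<^sub>F y in at (0::complex^4). y \<in> ball 0 r0 \<and> y \<noteq> 0"
    using r0 by (intro eventually_conj eventually_at_in_open' eventually_neq_at_within) auto
   thus "\<forall>\<^sub>F y in at 0. norm (pdiff i Q y) \<le> norm y / 12" by eventually_elim (use dQ in auto)
   have "((\<lambda>y::complex^4. norm y / 12) \<longlongrightarrow> norm (0::complex^4) / 12) (at 0)" by (intro tendsto_intros) auto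
   thus "((\<lambda>y::complex^4. norm y / 12) \<longlongrightarrow> 0) (at 0)" by simp
  qed
  ultimately show ?thesis by (rule LIM_unique)
 qed
 have comp: "pdiff i (rem \<eta> F) x = dd I2 x (axis i 1) + pdiff i Q x" if "x \<in> U" for x i
 proof -
  have "rem \<eta> F = (\<lambda>x. I2 x + Q x)" by (simp add: rem_def Q_def fun_eq_iff add.assoc)
  thus ?thesis using dd_plus[OF hol_I(2) hQ that, of "axis i 1"] by simp
 qed
 have X: "ham_vf (ham \<eta> F) x $ 1 = - x $ 2 + pdiff 3 Q x" "ham_vf (ham \<eta> F) x $ 2 = x $ 1 + pdiff 4 Q x"
   "ham_vf (ham \<eta> F) x $ 3 = - x $ 4 - x $ 1 - pdiff 1 Q x" "ham_vf (ham \<eta> F) x $ 4 = x $ 3 - x $ 2 - pdiff 2 Q x" if "x \<in> U" for x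
  unfolding ham_vf_comp[OF F(1) that] comp[OF that] dd_I2 by (simp_all add: axis_def)
 show ?thesis
 proof (rule that[OF r0(1)])
  show "ball 0 r0 \<subseteq> U" using r0 e by (auto simp: subset_iff)
  show "ham_vf (ham \<eta> F) 0 = 0" using X[OF F(3)] dQ0 by (simp add: vec4_eq)
  show "norm x \<le> 12 * norm (ham_vf (ham \<eta> F) x)" if x: "norm x < r0" for x
  proof (cases "x = 0")
   case False
   have xU: "x \<in> U" using x r0 e by (auto simp: subset_iff)
   let ?X = "ham_vf (ham \<eta> F) x"
   have Xc: "norm (?X $ j) \<le> norm ?X" for j by (rule component_le)
   have q: "norm (pdiff i Q x) \<le> norm x / 12" for i by (rule dQ[OF x False])
   have n2: "norm (x $ 2) \<le> norm ?X + norm x / 12"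
   proof -
    have "x $ 2 = pdiff 3 Q x - ?X $ 1" using X[OF xU] by simp
    thus ?thesis using norm_triangle_ineq4[of "pdiff 3 Q x" "?X $ 1"] Xc[of 1] q[of 3] by simp
   qed
   have n1: "norm (x $ 1) \<le> norm ?X + norm x / 12"
   proof -
    have "x $ 1 = ?X $ 2 - pdiff 4 Q x" using X[OF xU] by simp
    thus ?thesis using norm_triangle_ineq4[of "?X $ 2" "pdiff 4 Q x"] Xc[of 2] q[of 4] by simp
   qed
   have n4: "norm (x $ 4) \<le> norm ?X + norm (x $ 1) + norm x / 12"
   proof -
    have "- x $ 4 = ?X $ 3 + x $ 1 + pdiff 1 Q x" using X[OF xU] by simp
    hence "norm (x $ 4) = norm (?X $ 3 + x $ 1 + pdiff 1 Q x)" by (metis norm_minus_cancel vector_uminus_component)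
    also have "\<dots> \<le> norm (?X $ 3) + norm (x $ 1) + norm (pdiff 1 Q x)" by (meson norm_triangle_ineq norm_triangle_mono order_refl)
    finally show ?thesis using Xc[of 3] q[of 1] by simp
   qed
   have n3: "norm (x $ 3) \<le> norm ?X + norm (x $ 2) + norm x / 12"
   proof -
    have "x $ 3 = ?X $ 4 + x $ 2 + pdiff 2 Q x" using X[OF xU] by simp
    hence "norm (x $ 3) \<le> norm (?X $ 4) + norm (x $ 2) + norm (pdiff 2 Q x)" by (metis norm_triangle_ineq norm_triangle_mono order_refl)
    thus ?thesis using Xc[of 4] q[of 2] by simp
   qed
   \<comment> \<open>The four bounds add up to 6 * norm ?X + norm x / 2, whence the factor
     12.\<close>
   show ?thesis using norm_le_4[of x] n1 n2 n3 n4 by simp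
  qed simp
 qed
qed

section \<open>Consequences of the leading term\<close>

lemma pow_div_le:
 fixes r :: real
 assumes "0 < r" "a / r ^ n \<le> c / r ^ Suc n"
 shows "a * r \<le> c"
proof -
 have "a / r ^ n * r ^ Suc n \<le> c / r ^ Suc n * r ^ Suc n" using assms by (intro mult_right_mono) auto
 thus ?thesis using assms(1) by simp
qed

lemma vdd_add: "vdd T x (u + v) = vdd T x u + vdd T x v"
 by (simp add: vdd_def vec_eq_iff dd_add)

context sep0
begin

text \<open>Flowing long enough, and to phase psi modulo 2 pi, reaches large tau deep inside the
  sector; the ball of radius norm tau / 4 leaves room for a Cauchy estimate.\<close>

lemma flow_point:
 assumes z: "z \<in> W"
 obtains \<tau> where "norm \<tau> \<ge> T" "ball \<tau> (norm \<tau> / 4) \<subseteq> Lset \<sigma> R" "\<tau> \<in> Lset \<sigma> R"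
  "\<exists>s\<ge>0. \<gamma> (z + of_real (- \<sigma> * s) *s e11) = \<gamma> (pt \<psi> \<tau>) \<and> g\<phi> (z + of_real (- \<sigma> * s) *s e11) = g\<phi> (pt \<psi> \<tau>)"
proof -
 define T' where "T' = \<bar>T\<bar> + 2 * norm (z $ 2) + 2 * \<bar>R\<bar> + 1"
 obtain t k where t: "\<sigma> * t \<le> - T'" "Re (z $ 1) + t = \<psi> + 2 * pi * of_int k"
  using flow_to_phase[OF sig] by blast
 define \<tau> where "\<tau> = z $ 2 + of_real t"
 have "T' \<ge> 0" by (simp add: T'_def)
 hence "\<sigma> * t \<le> 0" using t(1) by linarith
 hence at: "\<bar>t\<bar> = - \<sigma> * t" using sig by auto
 have tT: "\<bar>t\<bar> \<ge> T'" using at t(1) by simp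
 have n1: "norm \<tau> \<ge> \<bar>t\<bar> - norm (z $ 2)" using norm_diff_ineq[of "of_real t" "z $ 2"] by (simp add: \<tau>_def add.commute)
 have n2: "norm \<tau> \<le> \<bar>t\<bar> + norm (z $ 2)" using norm_triangle_ineq[of "z $ 2" "of_real t"] by (simp add: \<tau>_def)
 have ballL: "ball \<tau> (norm \<tau> / 4) \<subseteq> Lset \<sigma> R"
 proof
  fix w assume "w \<in> ball \<tau> (norm \<tau> / 4)"
  hence w: "norm (w - \<tau>) < norm \<tau> / 4" by (simp add: dist_norm norm_minus_commute)
  have "\<sigma> * Re w = \<sigma> * t + \<sigma> * Re (z $ 2) + \<sigma> * Re (w - \<tau>)" by (simp add: \<tau>_def algebra_simps)
  moreover have "\<sigma> * Re u \<le> norm u" for u using sig abs_Re_le_cmod[of u] by auto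
  note this[of "z $ 2"] this[of "w - \<tau>"]
  ultimately have "\<sigma> * Re w \<le> - \<bar>t\<bar> + norm (z $ 2) + norm (w - \<tau>)" using at by linarith
  hence "\<sigma> * Re w < - R" using w n2 tT norm_ge_zero[of "z $ 2"] unfolding T'_def by linarith
  thus "w \<in> Lset \<sigma> R" unfolding Lset_def by (smt (verit) mem_Collect_eq abs_ge_zero)
 qed
 have nT: "norm \<tau> \<ge> \<bar>T\<bar> + 1" using n1 tT norm_ge_zero[of "z $ 2"] unfolding T'_def by linarith
 have "norm \<tau> > 0" using nT by linarith
 hence tL: "\<tau> \<in> Lset \<sigma> R" using ballL by (auto simp: subset_iff)
 define u :: "complex^2" where "u = vector [of_real \<psi>, \<tau>]"
 have u: "u \<in> W" using tL by (simp add: u_def RD_def)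
 have eq: "z + of_real t *s e11 = u + of_real (2 * pi * of_int k) *s e1"
  using z t(2) by (simp add: u_def \<tau>_def vec_eq_iff forall_2 RD_def complex_eq_iff)
 have p: "\<And>z. z \<in> W \<Longrightarrow> \<gamma> (z + of_real (2 * pi) *s e1) = \<gamma> z" "\<And>z. z \<in> W \<Longrightarrow> g\<phi> (z + of_real (2 * pi) *s e1) = g\<phi> z"
  using per g\<phi>_per W_sub by blast+
 have "\<gamma> (z + of_real t *s e11) = \<gamma> u" "g\<phi> (z + of_real t *s e11) = g\<phi> u"
  unfolding eq using periodic_shift_int[of \<sigma> R \<gamma>, OF p(1) u] periodic_shift_int[of \<sigma> R g\<phi>, OF p(2) u] by auto
 moreover have "t = - \<sigma> * \<bar>t\<bar>" using sig at by auto
 ultimately have "\<exists>s\<ge>0. \<gamma> (z + of_real (- \<sigma> * s) *s e11) = \<gamma> u \<and> g\<phi> (z + of_real (- \<sigma> * s) *s e11) = g\<phi> u"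
  by (intro exI[of _ "\<bar>t\<bar>"]) simp
 thus ?thesis using that[of \<tau>] nT ballL tL by (simp add: u_def)
qed

lemma flow_in_W: "z \<in> W \<Longrightarrow> s \<ge> 0 \<Longrightarrow> z + of_real (- \<sigma> * s) *s e11 \<in> W"
 using sig by (auto simp: RD_def Lset_def)

lemma flow_vector_derivative:
 assumes "vhol T D" "z \<in> W" "s \<ge> 0"
 shows "((\<lambda>s. T (z + of_real (- \<sigma> * s) *s e11)) has_vector_derivative of_real (- \<sigma>) *s vdd T (z + of_real (- \<sigma> * s) *s e11) e11) (at s)"
proof -
 have "z + of_real (- \<sigma> * s) *s e11 \<in> D" using flow_in_W[OF assms(2,3)] W_sub by blast
 hence zD: "z + (of_real (- \<sigma>) * of_real s) *s e11 \<in> D" by simp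
 have c: "((\<lambda>u. T (z + (of_real (- \<sigma>) * u) *s e11) $ i) has_field_derivative vdd T (z + of_real (- \<sigma> * s) *s e11) e11 $ i * of_real (- \<sigma>)) (at (of_real s))" for i
  using DERIV_chain2[OF vhol_line[OF assms(1) zD, of i UNIV] DERIV_cmult_Id[of "of_real (- \<sigma>)"]] by simp
 have "((\<lambda>u. T (z + (of_real (- \<sigma>) * of_real u) *s e11) $ i) has_vector_derivative vdd T (z + of_real (- \<sigma> * s) *s e11) e11 $ i * of_real (- \<sigma>)) (at s)" for i
  by (rule has_vector_derivative_real_field[OF c])
 hence "((\<lambda>u. T (z + (of_real (- \<sigma>) * of_real u) *s e11)) has_derivative (\<lambda>h. \<chi> i. h *\<^sub>R (vdd T (z + of_real (- \<sigma> * s) *s e11) e11 $ i * of_real (- \<sigma>)))) (at s)"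
  unfolding has_vector_derivative_def by (intro has_derivative_vec_components)
 moreover have "(\<lambda>h::real. (\<chi> i. h *\<^sub>R (vdd T (z + of_real (- \<sigma> * s) *s e11) e11 $ i * of_real (- \<sigma>)))) = (\<lambda>h. h *\<^sub>R (of_real (- \<sigma>) *s vdd T (z + of_real (- \<sigma> * s) *s e11) e11))"
  by (simp add: fun_eq_iff vec_eq_iff mult.commute)
 ultimately show ?thesis by (simp add: has_vector_derivative_def)
qed

lemma norm_sigma_scale: "norm (of_real (- \<sigma>) *s (v::complex^4)) = norm v"
 using sig by (auto simp: norm_scale)

lemma vdd_linear: "vdd T x (u - c *s v) = vdd T x u - c *s vdd T x v"
 by (simp add: vdd_def vec_eq_iff dd_diff dd_scale)

lemma vhol_X_gamma: "vhol (\<lambda>z. X (\<gamma> z)) D"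
 and vdd_X_gamma: "z \<in> D \<Longrightarrow> vdd (\<lambda>z. X (\<gamma> z)) z e11 = vdd X (\<gamma> z) (X (\<gamma> z))"
proof -
 have pD: "pre V0 = D" using \<gamma>_in by (auto simp: pre_def)
 have hX: "hol (\<lambda>x. X x $ i) V0" for i using vhol_ham_vf[OF V0 holH] vholD by blast
 show "vhol (\<lambda>z. X (\<gamma> z)) D" unfolding vhol_def using hol_pre(1)[OF V0 hX] pD by simp
 show "z \<in> D \<Longrightarrow> vdd (\<lambda>z. X (\<gamma> z)) z e11 = vdd X (\<gamma> z) (X (\<gamma> z))"
  using hol_pre(2)[OF V0 hX, where z=z and v=e11] pD pde[of z] by (simp add: vdd_def vec_eq_iff)
qed

text \<open>Either degeneracy propagates along the flow by a linear differential inequality, up to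
  arbitrarily large tau in the column of phase psi, where the leading term v / tau^n excludes
  it.\<close>

lemma leading_term_consequences:
 assumes K: "\<And>x. x \<in> V0 \<Longrightarrow> norm (X x) \<le> K * norm x" "\<And>x v. x \<in> V0 \<Longrightarrow> norm (vdd X x v) \<le> K * norm v"
  and low: "\<And>x. x \<in> V0 \<Longrightarrow> norm x \<le> 12 * norm (X x)"
  and asym: "\<And>\<tau> j. \<tau> \<in> Lset \<sigma> R \<Longrightarrow> norm (\<gamma> (pt \<psi> \<tau>) $ j - v j / \<tau> ^ n) \<le> C / norm \<tau> ^ Suc n"
  and n: "n > 0" and v: "v i \<noteq> 0" and z: "z \<in> W"
 shows "\<gamma> z \<noteq> 0" and "\<And>a b. a *s g\<phi> z + b *s X (\<gamma> z) = 0 \<Longrightarrow> a = 0 \<and> b = 0"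
proof -
 have large: False if "\<And>T. \<exists>\<tau>. norm \<tau> \<ge> T \<and> norm \<tau> \<le> (B::real)" for B :: real
  using that[of "B + 1"] by fastforce
 show nz: "\<gamma> z \<noteq> 0"
 proof
  assume 0: "\<gamma> z = 0"
  have zero: "\<gamma> (z + of_real (- \<sigma> * s) *s e11) = 0" if s: "s \<ge> 0" for s
  proof (rule linear_ode_zero[where Y = "\<lambda>s. \<gamma> (z + of_real (- \<sigma> * s) *s e11)" and K = K, OF flow_vector_derivative[OF hol\<gamma> z] _ _ s])
   fix t :: real assume t: "t \<ge> 0"
   have D: "z + of_real (- \<sigma> * t) *s e11 \<in> D" using flow_in_W[OF z t] W_sub by blast
   show "norm (of_real (- \<sigma>) *s vdd \<gamma> (z + of_real (- \<sigma> * t) *s e11) e11) \<le> K * norm (\<gamma> (z + of_real (- \<sigma> * t) *s e11))"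
    unfolding norm_sigma_scale pde[OF D] by (rule K(1)[OF \<gamma>_in[OF D]])
  qed (use 0 in auto)
  show False
  proof (rule large[of "C / norm (v i)"])
   fix T :: real
   obtain \<tau> where \<tau>: "norm \<tau> \<ge> \<bar>T\<bar> + 1" "\<tau> \<in> Lset \<sigma> R" "\<exists>s\<ge>0. \<gamma> (z + of_real (- \<sigma> * s) *s e11) = \<gamma> (pt \<psi> \<tau>)"
    using flow_point[OF z] by metis
   have "\<gamma> (pt \<psi> \<tau>) = 0" using \<tau>(3) zero by auto
   hence "norm (v i) / norm \<tau> ^ n \<le> C / norm \<tau> ^ Suc n" using asym[OF \<tau>(2), of i] by (simp add: norm_divide norm_power)
   hence "norm (v i) * norm \<tau> \<le> C" using \<tau>(1) by (intro pow_div_le) auto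
   thus "\<exists>\<tau>. norm (\<tau>::complex) \<ge> T \<and> norm \<tau> \<le> C / norm (v i)" using v \<tau>(1) by (intro exI[of _ \<tau>]) (simp add: field_simps)
  qed
 qed
 fix a b assume ab: "a *s g\<phi> z + b *s X (\<gamma> z) = 0"
 have X0: "X (\<gamma> z) \<noteq> 0" using low[OF \<gamma>_V0[OF z]] nz by auto
 show "a = 0 \<and> b = 0"
 proof (cases "a = 0")
  case True thus ?thesis using ab X0 by simp
 next
  case False
  \<comment> \<open>The relation between the phase derivative and X persists, since both solve the
    variational equation. The tau-derivative then equals (1 - kappa) X. It has size O(tau^(-n-1)),
    while X is at least of order tau^(-n) because of \<open>low\<close>; hence kappa = 1. So the
    tau-derivative vanishes, against its leading term - n v / tau^(n+1).\<close>
  define \<kappa> where "\<kappa> = - b / a"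
  have g0: "g\<phi> z = \<kappa> *s X (\<gamma> z)"
  proof -
   have "g\<phi> z $ i = \<kappa> * X (\<gamma> z) $ i" for i
   proof -
    have "a * g\<phi> z $ i + b * X (\<gamma> z) $ i = 0" using arg_cong[OF ab, of "\<lambda>u. u $ i"] by simp
    thus ?thesis using False by (simp add: \<kappa>_def field_simps eq_neg_iff_add_eq_0)
   qed
   thus ?thesis by (simp add: vec_eq_iff)
  qed
  define Q where "Q = (\<lambda>z. g\<phi> z - \<kappa> *s X (\<gamma> z))"
  have hQ: "vhol Q D" unfolding Q_def vhol_def
   by (simp, intro allI hol_diff hol_mult hol_const vholD[OF vhol_g\<phi>] vholD[OF vhol_X_gamma])
  have vQ: "vdd Q u e11 = vdd X (\<gamma> u) (Q u)" if u: "u \<in> D" for u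
  proof -
   have "vdd Q u e11 = vdd g\<phi> u e11 - \<kappa> *s vdd (\<lambda>z. X (\<gamma> z)) u e11"
    unfolding Q_def vdd_def vec_eq_iff
    by (simp add: dd_minus[OF vholD[OF vhol_g\<phi>] hol_cmult[OF vholD[OF vhol_X_gamma]] u] dd_cmult[OF vholD[OF vhol_X_gamma] u])
   thus ?thesis by (simp add: vdd_g\<phi>[OF u] vdd_X_gamma[OF u] Q_def vdd_linear)
  qed
  have zero: "Q (z + of_real (- \<sigma> * s) *s e11) = 0" if s: "s \<ge> 0" for s
  proof (rule linear_ode_zero[where Y = "\<lambda>s. Q (z + of_real (- \<sigma> * s) *s e11)" and K = K, OF flow_vector_derivative[OF hQ z] _ _ s])
   fix t :: real assume t: "t \<ge> 0"
   have D: "z + of_real (- \<sigma> * t) *s e11 \<in> D" using flow_in_W[OF z t] W_sub by blast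
   show "norm (of_real (- \<sigma>) *s vdd Q (z + of_real (- \<sigma> * t) *s e11) e11) \<le> K * norm (Q (z + of_real (- \<sigma> * t) *s e11))"
    unfolding norm_sigma_scale vQ[OF D] by (rule K(2)[OF \<gamma>_in[OF D]])
  qed (use g0 in \<open>auto simp: Q_def\<close>)
  \<comment> \<open>From Cauchy's inequality with radius norm tau / 8, on a circle where the modulus
    of t is at least norm tau / 2.\<close>
  define C2 where "C2 = C * 2 ^ Suc n * 8"
  have pt: "\<exists>\<tau>. norm \<tau> \<ge> T \<and> norm \<tau> > 0 \<and> \<tau> \<in> Lset \<sigma> R \<and> vdd \<gamma> (pt \<psi> \<tau>) (axis 2 1) = (1 - \<kappa>) *s X (\<gamma> (pt \<psi> \<tau>))
    \<and> (\<forall>j. norm (vdd \<gamma> (pt \<psi> \<tau>) (axis 2 1) $ j + of_nat n * v j / \<tau> ^ Suc n) \<le> C2 / norm \<tau> ^ Suc (Suc n))" for T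
  proof -
   obtain \<tau> where \<tau>: "norm \<tau> \<ge> \<bar>T\<bar> + 1" "ball \<tau> (norm \<tau> / 4) \<subseteq> Lset \<sigma> R" "\<tau> \<in> Lset \<sigma> R"
    "\<exists>s\<ge>0. \<gamma> (z + of_real (- \<sigma> * s) *s e11) = \<gamma> (pt \<psi> \<tau>) \<and> g\<phi> (z + of_real (- \<sigma> * s) *s e11) = g\<phi> (pt \<psi> \<tau>)"
    using flow_point[OF z, of "\<bar>T\<bar> + 1" \<psi>] by blast
   define u :: "complex^2" where "u = vector [of_real \<psi>, \<tau>]"
   have u: "u \<in> D" using \<tau>(3) W_sub by (auto simp: u_def RD_def)
   have \<tau>0: "norm \<tau> > 0" using \<tau>(1) by linarith
   have 1: "g\<phi> u = \<kappa> *s X (\<gamma> u)" using \<tau>(4) zero unfolding u_def[symmetric] Q_def by (metis eq_iff_diff_eq_0)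
   have "e11 = e1 + axis 2 1" by (simp add: vec_eq_iff forall_2 axis_def)
   hence "vdd \<gamma> u e11 = g\<phi> u + vdd \<gamma> u (axis 2 1)" using vdd_add[of \<gamma> u e1 "axis 2 1"] by (metis g\<phi>_def)
   hence 2: "vdd \<gamma> u (axis 2 1) = (1 - \<kappa>) *s X (\<gamma> u)"
    using pde[OF u] 1 by (simp add: vec_eq_iff algebra_simps)
   have 3: "norm (vdd \<gamma> u (axis 2 1) $ j + of_nat n * v j / \<tau> ^ Suc n) \<le> C2 / norm \<tau> ^ Suc (Suc n)" for j
   proof -
    define E where "E = (\<lambda>t. \<gamma> (pt \<psi> t) $ j - v j / t ^ n)"
    have der: "((\<lambda>t. \<gamma> (pt \<psi> t) $ j) has_field_derivative vdd \<gamma> (pt \<psi> t) (axis 2 1) $ j) (at t)" if "t \<in> Lset \<sigma> R" for t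
    proof -
     have e: "vector [of_real \<psi>, t] = (pt \<psi> 0) + t *s axis 2 1" for t
      by (simp add: vec_eq_iff forall_2 axis_def)
     have "(pt \<psi> t) \<in> D" using that W_sub by (auto simp: RD_def)
     hence "((\<lambda>t. \<gamma> (vector [of_real \<psi>, 0] + t *s axis 2 1) $ j) has_field_derivative vdd \<gamma> (vector [of_real \<psi>, 0] + t *s axis 2 1) (axis 2 1) $ j) (at t)"
      by (intro vhol_line[OF hol\<gamma>]) (simp only: e[symmetric])
     thus ?thesis by (simp only: e[symmetric])
    qed
    have b2: "norm t \<ge> norm \<tau> / 2" if "norm (t - \<tau>) \<le> norm \<tau> / 4" for t
     using norm_triangle_sub[of \<tau> t] that norm_ge_zero[of \<tau>] norm_minus_commute[of t \<tau>] by linarith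
    have tn0: "t \<noteq> 0" if "norm (t - \<tau>) \<le> norm \<tau> / 4" for t using b2[OF that] \<tau>0 by auto
    have derE: "(E has_field_derivative vdd \<gamma> (pt \<psi> t) (axis 2 1) $ j + of_nat n * v j / t ^ Suc n) (at t)"
     if "t \<in> Lset \<sigma> R" "t \<noteq> 0" for t
    proof -
     have "((\<lambda>t. v j / t ^ n) has_field_derivative - (of_nat n * v j / t ^ Suc n)) (at t)"
      using that(2) n by (auto intro!: derivative_eq_intros simp: field_simps power_Suc[symmetric] simp del: power_Suc)
       (simp add: field_simps power_Suc[symmetric] power_add[symmetric] del: power_Suc)
     from DERIV_diff[OF der[OF that(1)] this] show ?thesis by (simp add: E_def)
    qed
    have inL: "t \<in> Lset \<sigma> R" if "t \<in> ball \<tau> (norm \<tau> / 4)" for t using \<tau>(2) that by blast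
    have hE: "E holomorphic_on ball \<tau> (norm \<tau> / 4)"
     unfolding holomorphic_on_open[OF open_ball] using derE inL tn0 by (metis dist_norm less_imp_le mem_ball norm_minus_commute)
    have C0: "C \<ge> 0" using asym[OF \<tau>(3), of j] \<tau>0
     by (smt (verit) divide_neg_pos norm_ge_zero zero_less_power)
    have cb: "cball \<tau> (norm \<tau> / 8) \<subseteq> ball \<tau> (norm \<tau> / 4)"
    proof
     fix x assume "x \<in> cball \<tau> (norm \<tau> / 8)"
     hence "dist \<tau> x \<le> norm \<tau> / 8" by simp
     hence "dist \<tau> x < norm \<tau> / 4" using \<tau>0 by linarith
     thus "x \<in> ball \<tau> (norm \<tau> / 4)" by simp
    qed
    have "norm ((deriv ^^ 1) E \<tau>) \<le> fact 1 * (C / (norm \<tau> / 2) ^ Suc n) / (norm \<tau> / 8) ^ 1"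
    proof (rule Cauchy_inequality)
     show "E holomorphic_on ball \<tau> (norm \<tau> / 8)" by (rule holomorphic_on_subset[OF hE]) (use cb ball_subset_cball in blast)
     show "continuous_on (cball \<tau> (norm \<tau> / 8)) E"
      by (rule continuous_on_subset[OF holomorphic_on_imp_continuous_on[OF hE] cb])
     show "norm (E t) \<le> C / (norm \<tau> / 2) ^ Suc n" if "norm (\<tau> - t) = norm \<tau> / 8" for t
     proof -
      have "t \<in> cball \<tau> (norm \<tau> / 8)" using that by (simp add: dist_norm)
      hence t: "t \<in> ball \<tau> (norm \<tau> / 4)" using cb by blast
      hence t2: "norm (t - \<tau>) \<le> norm \<tau> / 4" by (simp add: dist_norm norm_minus_commute)
      have "norm (E t) \<le> C / norm t ^ Suc n" unfolding E_def by (rule asym[OF inL[OF t]])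
      also have "\<dots> \<le> C / (norm \<tau> / 2) ^ Suc n"
       using b2[OF t2] \<tau>0 C0 by (intro divide_left_mono power_mono mult_pos_pos zero_less_power) auto
      finally show ?thesis .
     qed
    qed (use \<tau>0 in auto)
    hence "norm (deriv E \<tau>) \<le> C * 2 ^ Suc n * 8 / norm \<tau> ^ Suc (Suc n)"
     using \<tau>0 by (simp add: power_divide field_simps)
    moreover have "deriv E \<tau> = vdd \<gamma> u (axis 2 1) $ j + of_nat n * v j / \<tau> ^ Suc n"
     unfolding u_def by (rule DERIV_imp_deriv[OF derE[OF \<tau>(3)]]) (use \<tau>0 in auto)
    ultimately show ?thesis by (simp add: C2_def)
   qed
   show ?thesis using \<tau> \<tau>0 2 3 unfolding u_def by (intro exI[of _ \<tau>]) auto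
  qed
  have "\<kappa> = 1"
  proof (rule ccontr)
   assume k: "\<kappa> \<noteq> 1"
   define S where "S = (\<Sum>j\<in>UNIV. of_nat n * norm (v j) + C2)"
   show False
   proof (rule large[of "max (2 * C / norm (v i)) (24 * S / (norm (1 - \<kappa>) * norm (v i)))"])
    fix T :: real
    obtain \<tau> where \<tau>: "norm \<tau> \<ge> \<bar>T\<bar> + 1" "\<tau> \<in> Lset \<sigma> R" "vdd \<gamma> (pt \<psi> \<tau>) (axis 2 1) = (1 - \<kappa>) *s X (\<gamma> (pt \<psi> \<tau>))"
     "\<And>j. norm (vdd \<gamma> (pt \<psi> \<tau>) (axis 2 1) $ j + of_nat n * v j / \<tau> ^ Suc n) \<le> C2 / norm \<tau> ^ Suc (Suc n)"
     using pt[of "\<bar>T\<bar> + 1"] by blast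
    have \<tau>1: "norm \<tau> \<ge> 1" using \<tau>(1) by linarith
    define u :: "complex^2" where "u = vector [of_real \<psi>, \<tau>]"
    have u: "u \<in> D" using \<tau>(2) W_sub by (auto simp: u_def RD_def)
    have C2: "C2 \<ge> 0" using \<tau>(4)[of i] \<tau>1 by (smt (verit) divide_neg_pos norm_ge_zero zero_less_power)
    have gt: "norm (vdd \<gamma> u (axis 2 1) $ j) \<le> (of_nat n * norm (v j) + C2) / norm \<tau> ^ Suc n" for j
    proof -
     have "norm (vdd \<gamma> u (axis 2 1) $ j) \<le> norm (vdd \<gamma> u (axis 2 1) $ j + of_nat n * v j / \<tau> ^ Suc n) + norm (of_nat n * v j / \<tau> ^ Suc n)"
      using norm_triangle_ineq4[of "vdd \<gamma> u (axis 2 1) $ j + of_nat n * v j / \<tau> ^ Suc n" "of_nat n * v j / \<tau> ^ Suc n"] by simp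
     also have "\<dots> \<le> C2 / norm \<tau> ^ Suc (Suc n) + of_nat n * norm (v j) / norm \<tau> ^ Suc n"
      using \<tau>(4)[of j] by (simp add: u_def norm_divide norm_mult norm_power)
     also have "C2 / norm \<tau> ^ Suc (Suc n) \<le> C2 / norm \<tau> ^ Suc n"
      using \<tau>1 C2 by (intro divide_left_mono power_increasing mult_pos_pos zero_less_power) auto
     finally show ?thesis by (simp add: add_divide_distrib)
    qed
    have "norm (1 - \<kappa>) * norm (X (\<gamma> u)) = norm (vdd \<gamma> u (axis 2 1))" unfolding u_def \<tau>(3) norm_scale ..
    also have "\<dots> \<le> (\<Sum>j\<in>UNIV. norm (vdd \<gamma> u (axis 2 1) $ j))" unfolding norm_vec_def by (rule L2_set_le_sum) simp
    also have "\<dots> \<le> (\<Sum>j\<in>UNIV. (of_nat n * norm (v j) + C2) / norm \<tau> ^ Suc n)" by (rule sum_mono) (rule gt)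
    also have "\<dots> = S / norm \<tau> ^ Suc n" by (simp add: S_def sum_divide_distrib)
    finally have 1: "norm (1 - \<kappa>) * norm (X (\<gamma> u)) \<le> S / norm \<tau> ^ Suc n" .
    have 2: "norm (\<gamma> u) \<le> 12 * norm (X (\<gamma> u))" by (rule low[OF \<gamma>_in[OF u]])
    have "norm (v i / \<tau> ^ n) \<le> norm (\<gamma> u $ i) + norm (\<gamma> u $ i - v i / \<tau> ^ n)"
     using norm_triangle_ineq4[of "\<gamma> u $ i" "\<gamma> u $ i - v i / \<tau> ^ n"] by simp
    also have "\<dots> \<le> norm (\<gamma> u) + C / norm \<tau> ^ Suc n"
     using component_le[of "\<gamma> u" i] asym[OF \<tau>(2), of i] by (simp add: u_def)
    finally have 3: "norm (v i) / norm \<tau> ^ n \<le> 12 * norm (X (\<gamma> u)) + C / norm \<tau> ^ Suc n" using 2 by (simp add: norm_divide norm_power)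
    have "norm \<tau> \<le> max (2 * C / norm (v i)) (24 * S / (norm (1 - \<kappa>) * norm (v i)))"
    proof (cases "norm \<tau> \<le> 2 * C / norm (v i)")
     case False
     hence "C \<le> norm (v i) * norm \<tau> / 2" using v by (simp add: field_simps)
     hence "C / norm \<tau> ^ Suc n \<le> norm (v i) * norm \<tau> / 2 / norm \<tau> ^ Suc n" using \<tau>1 by (intro divide_right_mono) auto
     also have "\<dots> = norm (v i) / norm \<tau> ^ n / 2" using \<tau>1 by (cases "\<tau> = 0") (simp_all add: field_simps)
     finally have "norm (v i) / norm \<tau> ^ n \<le> 24 * norm (X (\<gamma> u))" using 3 by simp
     hence "norm (1 - \<kappa>) * (norm (v i) / norm \<tau> ^ n) \<le> 24 * (norm (1 - \<kappa>) * norm (X (\<gamma> u)))"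
      using mult_left_mono[of _ _ "norm (1 - \<kappa>)"] by fastforce
     also have "\<dots> \<le> 24 * (S / norm \<tau> ^ Suc n)" using 1 by simp
     finally have "(norm (1 - \<kappa>) * norm (v i)) / norm \<tau> ^ n \<le> 24 * S / norm \<tau> ^ Suc n" by simp
     hence "(norm (1 - \<kappa>) * norm (v i)) * norm \<tau> \<le> 24 * S" using \<tau>1 by (intro pow_div_le) auto
     moreover have "norm (1 - \<kappa>) * norm (v i) > 0" using k v by simp
     ultimately have "norm \<tau> \<le> 24 * S / (norm (1 - \<kappa>) * norm (v i))" by (simp add: pos_le_divide_eq mult.commute)
     thus ?thesis by simp
    qed simp
    thus "\<exists>\<tau>. norm (\<tau>::complex) \<ge> T \<and> norm \<tau> \<le> max (2 * C / norm (v i)) (24 * S / (norm (1 - \<kappa>) * norm (v i)))"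
     using \<tau>(1) by (intro exI[of _ \<tau>]) auto
   qed
  qed
  have False
  proof (rule large[of "C2 / (of_nat n * norm (v i))"])
   fix T :: real
   obtain \<tau> where \<tau>: "norm \<tau> \<ge> \<bar>T\<bar> + 1" "vdd \<gamma> (pt \<psi> \<tau>) (axis 2 1) = (1 - \<kappa>) *s X (\<gamma> (pt \<psi> \<tau>))"
     "\<And>j. norm (vdd \<gamma> (pt \<psi> \<tau>) (axis 2 1) $ j + of_nat n * v j / \<tau> ^ Suc n) \<le> C2 / norm \<tau> ^ Suc (Suc n)"
     using pt[of "\<bar>T\<bar> + 1"] by blast
   have "of_nat n * norm (v i) / norm \<tau> ^ Suc n \<le> C2 / norm \<tau> ^ Suc (Suc n)"
    using \<tau>(3)[of i] \<open>\<kappa> = 1\<close> unfolding \<tau>(2) by (simp add: norm_divide norm_mult norm_power)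
   moreover have "norm \<tau> > 0" using \<tau>(1) by linarith
   ultimately have "of_nat n * norm (v i) * norm \<tau> \<le> C2" by (intro pow_div_le)
   moreover have "of_nat n * norm (v i) > 0" using n v by simp
   ultimately show "\<exists>\<tau>. norm (\<tau>::complex) \<ge> T \<and> norm \<tau> \<le> C2 / (of_nat n * norm (v i))"
    using \<tau>(1) by (intro exI[of _ \<tau>]) (simp add: pos_le_divide_eq mult.commute)
  qed
  thus ?thesis ..
 qed
qed

lemma first_integral_const:
 assumes V: "open V" "V \<subseteq> V0" and G: "hol G V" and XG: "\<And>x. x \<in> V \<Longrightarrow> dd G x (X x) = 0"
  and \<gamma>V: "\<And>z. z \<in> W \<Longrightarrow> \<gamma> z \<in> V"
  and bd: "\<And>\<tau>. \<bar>Re \<tau>\<bar> \<le> 7 \<Longrightarrow> \<bar>Im \<tau>\<bar> \<ge> Y \<Longrightarrow> norm (G (\<gamma> (pt \<psi> \<tau>))) \<le> B * \<bar>Im \<tau>\<bar> ^ m"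
 obtains c where "\<And>z. z \<in> W \<Longrightarrow> G (\<gamma> z) = c"
proof (rule invariant_const[OF sig, of R "\<lambda>z. G (\<gamma> z)" \<psi> Y B m])
 fix z t assume z: "z \<in> W" and t: "\<sigma> * t \<le> 0"
 define S where "S = closed_segment 0 t"
 have conv: "convex S" by (simp add: S_def)
 have Sd: "\<sigma> * s \<le> 0" if "s \<in> S" for s
  using that t sig by (auto simp: S_def closed_segment_eq_real_ivl split: if_splits)
 obtain c where "\<And>s. s \<in> S \<Longrightarrow> G (\<gamma> (z + of_real s *s e11)) = c"
 proof (rule has_vector_derivative_zero_constant[OF conv, of "\<lambda>s. G (\<gamma> (z + of_real s *s e11))"])
  fix s assume "s \<in> S"
  hence "\<sigma> * s \<le> 0" by (rule Sd)
  hence sW: "z + of_real s *s e11 \<in> W" using z by (simp add: RD_def Lset_def algebra_simps)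
  hence sp: "z + of_real s *s e11 \<in> pre V" "z + of_real s *s e11 \<in> D" using \<gamma>V W_sub by (auto simp: pre_def)
  have "((\<lambda>t. G (\<gamma> (z + t *s e11))) has_field_derivative dd (\<lambda>z. G (\<gamma> z)) (z + of_real s *s e11) e11) (at (of_real s))"
   by (rule hol_line[OF hol_pre(1)[OF V(1) G] sp(1)])
  also have "dd (\<lambda>z. G (\<gamma> z)) (z + of_real s *s e11) e11 = 0"
   using hol_pre(2)[OF V(1) G sp(1), of e11] pde[OF sp(2)] XG[OF \<gamma>V[OF sW]] by simp
  finally show "((\<lambda>s. G (\<gamma> (z + of_real s *s e11))) has_vector_derivative 0) (at s within S)"
   by (rule has_vector_derivative_at_within[OF has_vector_derivative_real_field])
 qed blast
 from this[of t] this[of 0] show "G (\<gamma> (z + of_real t *s e11)) = G (\<gamma> z)" by (simp add: S_def)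
next
 show "\<And>z. z \<in> W \<Longrightarrow> G (\<gamma> (z + of_real (2 * pi) *s e1)) = G (\<gamma> z)" using per W_sub by auto
next
 have e: "vector [of_real \<psi>, t] = (pt \<psi> 0) + t *s axis 2 1" for t
  by (simp add: vec_eq_iff forall_2 axis_def)
 have "(\<lambda>\<tau>. G (\<gamma> (vector [of_real \<psi>, 0] + \<tau> *s axis 2 1))) holomorphic_on Lset \<sigma> R"
 proof (rule hol_line_holomorphic[OF hol_pre(1)[OF V(1) G]])
  fix t assume "t \<in> Lset \<sigma> R"
  hence "(pt \<psi> t) \<in> W" by (simp add: RD_def)
  thus "(pt \<psi> 0) + t *s axis 2 1 \<in> pre V" unfolding e[symmetric] using \<gamma>V W_sub by (auto simp: pre_def)
 qed
 thus "(\<lambda>\<tau>. G (\<gamma> (pt \<psi> \<tau>))) holomorphic_on Lset \<sigma> R" by (simp only: e[symmetric])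
qed (use bd that in auto)

end

section \<open>First integrals on the energy level\<close>

lemma poly_exp_small:
 fixes a C \<epsilon> :: real
 assumes "a > 0" "\<epsilon> > 0"
 obtains Y where "Y \<ge> 1" "\<And>y. y \<ge> Y \<Longrightarrow> C * y ^ P * exp (- a * y) \<le> \<epsilon>"
proof -
 have "((\<lambda>y. (a * y) ^ P / exp (a * y)) \<longlongrightarrow> 0) at_top"
  by (rule filterlim_compose[OF tendsto_power_div_exp_0])
   (rule filterlim_tendsto_pos_mult_at_top[OF tendsto_const assms(1) filterlim_ident])
 hence "((\<lambda>y. C / a ^ P * ((a * y) ^ P / exp (a * y))) \<longlongrightarrow> 0) at_top" by (rule tendsto_mult_right_zero)
 hence "\<forall>\<^sub>F y in at_top. C / a ^ P * ((a * y) ^ P / exp (a * y)) < \<epsilon>" using assms(2) by (rule order_tendstoD)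
 moreover have "C / a ^ P * ((a * y) ^ P / exp (a * y)) = C * y ^ P * exp (- a * y)" for y
  using assms(1) by (simp add: power_mult_distrib exp_minus field_simps)
 ultimately have "\<forall>\<^sub>F y in at_top. C * y ^ P * exp (- a * y) < \<epsilon>" by simp
 then obtain Y where "\<And>y. y \<ge> Y \<Longrightarrow> C * y ^ P * exp (- a * y) < \<epsilon>" by (auto simp: eventually_at_top_linorder)
 thus ?thesis by (intro that[of "max 1 Y"]) (auto intro: less_imp_le)
qed

lemma norm_symp: "norm (symp x y) \<le> 4 * norm x * norm y"
proof -
 have p: "norm (x $ i * y $ j) \<le> norm x * norm y" for i j
  unfolding norm_mult by (intro mult_mono component_le) auto
 have "norm (symp x y) \<le> norm (x $ 1 * y $ 3) + norm (x $ 2 * y $ 4) + norm (x $ 3 * y $ 1) + norm (x $ 4 * y $ 2)"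
  unfolding symp_def by (intro norm_triangle_le_diff norm_triangle_le add_mono order_refl)
 thus ?thesis using p[of 1 3] p[of 2 4] p[of 3 1] p[of 4 2] by linarith
qed

text \<open>Bounds in the single column of phase phi0; |Re tau| \<le> 7 covers a full period.
  \<open>x'\<close> is the corresponding point of the other separatrix, enclosed by
  \<open>nearby\<close> from above and transversally by \<open>faraway\<close> from below;
  \<open>n\<close> is the rate at which dH may degenerate.\<close>

locale first_int_col = first_int +
 fixes \<phi>0 Y0 r B cH c Cg :: real and x' :: "complex \<Rightarrow> complex ^ 4" and m n :: nat
 assumes r: "r > 0" and cH: "cH > 0" and c_pos: "c > 0" and Cg: "Cg > 0" and B: "\<And>x. x \<in> V0 \<Longrightarrow> norm (H x) \<le> B"
  and Y0: "Y0 \<ge> 1" "\<And>\<tau>. \<bar>Re \<tau>\<bar> \<le> 7 \<Longrightarrow> \<bar>Im \<tau>\<bar> \<ge> Y0 \<Longrightarrow> \<tau> \<in> Lset \<sigma> R"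
  and ballV0: "\<And>\<tau>. \<bar>Re \<tau>\<bar> \<le> 7 \<Longrightarrow> \<bar>Im \<tau>\<bar> \<ge> Y0 \<Longrightarrow> ball (\<gamma> (pt \<phi>0 \<tau>)) r \<subseteq> V0"
  and ballV: "\<And>\<tau>. \<bar>Re \<tau>\<bar> \<le> 7 \<Longrightarrow> \<bar>Im \<tau>\<bar> \<ge> Y0 \<Longrightarrow> ball (\<gamma> (pt \<phi>0 \<tau>)) (1 / \<bar>Im \<tau>\<bar> ^ m) \<subseteq> V"
  and G_le: "\<And>\<tau> x. \<bar>Re \<tau>\<bar> \<le> 7 \<Longrightarrow> \<bar>Im \<tau>\<bar> \<ge> Y0 \<Longrightarrow> x \<in> ball (\<gamma> (pt \<phi>0 \<tau>)) (1 / \<bar>Im \<tau>\<bar> ^ m) \<Longrightarrow> norm (G x) \<le> \<bar>Im \<tau>\<bar> ^ m"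
  and x'_lev: "\<And>\<tau>. \<bar>Re \<tau>\<bar> \<le> 7 \<Longrightarrow> \<bar>Im \<tau>\<bar> \<ge> Y0 \<Longrightarrow> H (x' \<tau>) = H0 \<and> G (x' \<tau>) = a0"
  and nearby: "\<And>\<epsilon>. \<epsilon> > 0 \<Longrightarrow> \<exists>A Y. \<forall>\<tau>. \<bar>Re \<tau>\<bar> \<le> 7 \<longrightarrow> \<bar>Im \<tau>\<bar> \<ge> Y \<longrightarrow> norm (x' \<tau> - \<gamma> (pt \<phi>0 \<tau>)) \<le> A * exp (- (1 - \<epsilon>) * \<bar>Im \<tau>\<bar>)"
  and faraway: "\<And>\<tau>. \<bar>Re \<tau>\<bar> \<le> 7 \<Longrightarrow> \<bar>Im \<tau>\<bar> \<ge> Y0 \<Longrightarrow> c * exp (- \<bar>Im \<tau>\<bar>) \<le> norm (symp (x' \<tau> - \<gamma> (pt \<phi>0 \<tau>)) (g\<phi> (pt \<phi>0 \<tau>)))"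
  and dH: "\<And>\<tau>. \<bar>Re \<tau>\<bar> \<le> 7 \<Longrightarrow> \<bar>Im \<tau>\<bar> \<ge> Y0 \<Longrightarrow> \<exists>b. norm b = 1 \<and> cH / \<bar>Im \<tau>\<bar> ^ n \<le> norm (dd H (\<gamma> (pt \<phi>0 \<tau>)) b)"
  and g_le: "\<And>\<tau>. \<bar>Re \<tau>\<bar> \<le> 7 \<Longrightarrow> \<bar>Im \<tau>\<bar> \<ge> Y0 \<Longrightarrow> norm (g\<phi> (pt \<phi>0 \<tau>)) \<le> Cg"
begin

abbreviation "col \<tau> \<equiv> \<bar>Re \<tau>\<bar> \<le> 7 \<and> \<bar>Im \<tau>\<bar> \<ge> Y0"
abbreviation "zz \<tau> \<equiv> pt \<phi>0 \<tau>"

definition "N = n + m"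
definition "B' = \<bar>B\<bar> + 1"
text \<open>The lower bound cH / y^n is weakened to cl / y^N with N = n + m, so that the chart has
  size at most y^(-m) and stays in V. The cap 32 * B' / r^2 makes the coefficient in 2 * eta at most
  1.\<close>

definition "cl = min cH (32 * B' / r\<^sup>2)"
definition "c\<eta> = cl * (cl * r\<^sup>2 / (64 * B')) * r / (16 * B')"

lemma col_consts: "B' > 0" "cl > 0" "cl \<le> cH" "2 * (cl * r\<^sup>2 / (64 * B')) \<le> 1" "c\<eta> > 0"
proof -
 show B': "B' > 0" by (simp add: B'_def)
 show cl: "cl > 0" using B' cH r by (simp add: cl_def)
 show "cl \<le> cH" by (simp add: cl_def)
 have "cl * r\<^sup>2 \<le> 32 * B' / r\<^sup>2 * r\<^sup>2" by (intro mult_right_mono) (auto simp: cl_def)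
 thus "2 * (cl * r\<^sup>2 / (64 * B')) \<le> 1" using B' r by (simp add: field_simps)
 show "c\<eta> > 0" using B' cl r by (simp add: c\<eta>_def)
qed

lemma zz_W: "col \<tau> \<Longrightarrow> zz \<tau> \<in> W"
 using Y0(2)[of \<tau>] by (simp add: RD_def)

lemma column_chart:
 assumes "col \<tau>"
 defines "y \<equiv> \<bar>Im \<tau>\<bar>"
 obtains b where "chart H (\<gamma> (zz \<tau>)) r B' b (cl / y ^ N)"
  "2 * chart.\<eta> r B' (cl / y ^ N) \<le> 1 / y ^ m"
  "chart.\<eta>' r B' (cl / y ^ N) = c\<eta> / y ^ (2 * N)"
  "ball (\<gamma> (zz \<tau>)) (2 * chart.\<eta> r B' (cl / y ^ N)) \<subseteq> V"
proof -
 have y: "y \<ge> 1" using assms Y0 by (simp add: y_def)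
 obtain b where b: "norm b = 1" "cH / y ^ n \<le> norm (dd H (\<gamma> (zz \<tau>)) b)"
  using dH[of \<tau>] assms(1) unfolding y_def by blast
 have "cl / y ^ N \<le> cH / y ^ N" using col_consts y by (intro divide_right_mono) auto
 also have "\<dots> \<le> cH / y ^ n" using y cH by (intro divide_left_mono power_increasing) (auto simp: N_def)
 finally have l: "cl / y ^ N \<le> norm (dd H (\<gamma> (zz \<tau>)) b)" using b(2) by simp
 have V0': "ball (\<gamma> (zz \<tau>)) r \<subseteq> V0" using ballV0 assms(1) by blast
 interpret chart H "\<gamma> (zz \<tau>)" r B' b "cl / y ^ N"
 proof
  show "hol H (ball (\<gamma> (zz \<tau>)) r)" by (rule hol_subset[OF holH V0'])
  show "norm (H x) \<le> B'" if "x \<in> ball (\<gamma> (zz \<tau>)) r" for x using B[of x] that V0' by (auto simp: B'_def)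
  show "cl / y ^ N > 0" using col_consts(2) y by simp
 qed (use r b(1) l in auto)
 have "2 * \<eta> = (2 * (cl * r\<^sup>2 / (64 * B'))) / y ^ N" by (simp add: \<eta>_def)
 also have "\<dots> \<le> 1 / y ^ N" by (rule divide_right_mono[OF col_consts(4)]) (use y in auto)
 also have "\<dots> \<le> 1 / y ^ m" using y by (intro divide_left_mono power_increasing) (auto simp: N_def)
 finally have e: "2 * \<eta> \<le> 1 / y ^ m" .
 show ?thesis
 proof (rule that[of b])
  show "\<eta>' = c\<eta> / y ^ (2 * N)" by (simp add: \<eta>'_def \<eta>_def c\<eta>_def mult_2 power_add)
  show "ball (\<gamma> (zz \<tau>)) (2 * \<eta>) \<subseteq> V"
   using ballV[of \<tau>] assms(1) subset_ball[OF e, of "\<gamma> (zz \<tau>)"] unfolding y_def by blast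
 qed (use e chart_axioms in auto)
qed

lemma Cf_small:
 assumes van: "Van k" "k > 0" and e: "e > 0"
 shows "\<exists>Y. \<forall>\<tau>. \<bar>Re \<tau>\<bar> \<le> 7 \<longrightarrow> \<bar>Im \<tau>\<bar> \<ge> Y \<longrightarrow> norm (Cf k (zz \<tau>)) \<le> e"
proof -
 \<comment> \<open>With this value (1 - eps) (k + 1) = k + 1/2: a factor exp (- y / 2) is left over
   to beat the powers of y.\<close>
 define \<epsilon> where "\<epsilon> = 1 / (2 * real (Suc k))"
 have \<epsilon>: "\<epsilon> > 0" "\<epsilon> \<le> 1 / 4" "\<epsilon> * real (Suc k) = 1 / 2" using van(2) by (auto simp: \<epsilon>_def field_simps)
 obtain A' Y1 where AY': "\<And>\<tau>. \<bar>Re \<tau>\<bar> \<le> 7 \<Longrightarrow> \<bar>Im \<tau>\<bar> \<ge> Y1 \<Longrightarrow> norm (x' \<tau> - \<gamma> (zz \<tau>)) \<le> A' * exp (- (1 - \<epsilon>) * \<bar>Im \<tau>\<bar>)"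
  using nearby[OF \<epsilon>(1)] by blast
 define A where "A = \<bar>A'\<bar> + 1"
 have A: "A > 0" by (simp add: A_def)
 have AY: "norm (x' \<tau> - \<gamma> (zz \<tau>)) \<le> A * exp (- (1 - \<epsilon>) * \<bar>Im \<tau>\<bar>)" if "\<bar>Re \<tau>\<bar> \<le> 7" "\<bar>Im \<tau>\<bar> \<ge> Y1" for \<tau>
  by (rule order_trans[OF AY'[OF that] mult_right_mono]) (simp_all add: A_def)
 define K1 where "K1 = 32 * B' / r\<^sup>2 * A\<^sup>2 / cl * Cg"
 define K2 where "K2 = fact k * (2 * (2 * A / c\<eta>) ^ Suc k) / (c / 2) ^ k"
 define P where "P = m + 2 * N * Suc k"
 have half: "(0::real) < 1/2" and c2: "c / 2 > 0" and r4: "r / 4 > 0" using c_pos r by auto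
 obtain Y2 where Y2: "Y2 \<ge> 1" "\<And>y. y \<ge> Y2 \<Longrightarrow> K1 * y ^ N * exp (- (1/2) * y) \<le> c / 2"
  using poly_exp_small[OF half c2] by metis
 obtain Y3 where Y3: "Y3 \<ge> 1" "\<And>y. y \<ge> Y3 \<Longrightarrow> (4 * A / c\<eta>) * y ^ (2 * N) * exp (- (1/2) * y) \<le> 1"
  using poly_exp_small[OF half zero_less_one] by metis
 obtain Y4 where Y4: "Y4 \<ge> 1" "\<And>y. y \<ge> Y4 \<Longrightarrow> K2 * y ^ P * exp (- (1/2) * y) \<le> e"
  using poly_exp_small[OF half e] by metis
 obtain Y5 where Y5: "Y5 \<ge> 1" "\<And>y. y \<ge> Y5 \<Longrightarrow> A * y ^ 0 * exp (- (1/2) * y) \<le> r / 4"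
  using poly_exp_small[OF half r4] by metis
 show ?thesis
 proof (intro exI[of _ "Max {Y0, Y1, Y2, Y3, Y4, Y5}"] allI impI)
  fix \<tau> assume t: "\<bar>Re \<tau>\<bar> \<le> 7" and im: "Max {Y0, Y1, Y2, Y3, Y4, Y5} \<le> \<bar>Im \<tau>\<bar>"
  define y where "y = \<bar>Im \<tau>\<bar>"
  let ?x = "\<gamma> (zz \<tau>)"
  have yY: "y \<ge> Y0" "y \<ge> Y1" "y \<ge> Y2" "y \<ge> Y3" "y \<ge> Y4" "y \<ge> Y5" using im by (auto simp: y_def)
  have y: "y \<ge> 1" using yY Y0 by linarith
  have cl\<tau>: "col \<tau>" using t yY by (simp add: y_def)
  define d where "d = x' \<tau> - ?x"
  define g where "g = g\<phi> (zz \<tau>)"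
  obtain b where ch: "chart H ?x r B' b (cl / y ^ N)"
   "2 * chart.\<eta> r B' (cl / y ^ N) \<le> 1 / y ^ m"
   "chart.\<eta>' r B' (cl / y ^ N) = c\<eta> / y ^ (2 * N)"
   "ball ?x (2 * chart.\<eta> r B' (cl / y ^ N)) \<subseteq> V"
   using column_chart[OF cl\<tau>] unfolding y_def by blast
  interpret C: chart H "\<gamma> (zz \<tau>)" r B' b "cl / y ^ N" by (rule ch(1))
  have far': "c * exp (- y) \<le> norm (symp d g)" using faraway[of \<tau>] t yY by (simp add: y_def d_def g_def)
  have gC: "norm g \<le> Cg" using g_le[of \<tau>] t yY by (simp add: y_def g_def)
  have dA: "norm d \<le> A * exp (- (1 - \<epsilon>) * y)" using AY[of \<tau>] t yY by (simp add: y_def d_def)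
  have e34: "exp (- (1 - \<epsilon>) * y) \<le> exp (- (3/4) * y)" unfolding exp_le_cancel_iff using \<epsilon>(2) y by (intro mult_right_mono) auto
  have e12: "exp (- (1 - \<epsilon>) * y) \<le> exp (- (1/2) * y)" unfolding exp_le_cancel_iff using \<epsilon>(2) y by (intro mult_right_mono) auto
  have d0: "norm d > 0" using far' c_pos by (auto simp: symp_def dest: order.strict_trans2[OF mult_pos_pos[OF c_pos exp_gt_zero]])
  have d\<eta>: "4 * norm d \<le> C.\<eta>'"
  proof -
   have le: "4 * norm d \<le> 4 * A * exp (- (1/2) * y)" using dA mult_left_mono[OF e12, of A] A by linarith
   have "4 * norm d * y ^ (2 * N) \<le> (4 * A * exp (- (1/2) * y)) * y ^ (2 * N)" by (rule mult_right_mono[OF le]) (use y in simp)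
   also have "\<dots> \<le> c\<eta>" using Y3(2)[OF yY(4)] col_consts(5) by (simp add: field_simps)
   finally have "4 * norm d * y ^ (2 * N) \<le> c\<eta>" .
   thus ?thesis unfolding ch(3) using y by (simp add: field_simps)
  qed
  have dr: "4 * norm d \<le> r" using d\<eta> C.\<eta> C.\<eta>(2) r by linarith
  have Hx: "H (?x + d) = H ?x" "G (?x + d) = G ?x"
   using x'_lev[of \<tau>] t yY H\<gamma>[OF zz_W[OF cl\<tau>]] G\<gamma>[OF zz_W[OF cl\<tau>]] by (auto simp: d_def y_def)
  let ?V' = "ball ?x (2 * C.\<eta>)"
  have tT: "tang H (C.Tf d) ?V'" by (rule C.tang_Tf)
  have G': "hol G ?V'" by (rule hol_subset[OF holG ch(4)])
  have in': "?x \<in> ?V'" using C.\<eta>(1) by simp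
  have jet: "Lds (replicate k (C.Tf d)) G ?x = Cf k (zz \<tau>) * symp (C.Tf d ?x) g ^ k"
   using Lds_Cf[OF van(1) open_ball ch(4), of "replicate k (C.Tf d)" "zz \<tau>"] tT zz_W[OF cl\<tau>] in'
   by (simp add: prod_list_replicate g_def)
  have "norm (Lds (replicate k (C.Tf d)) G ?x) \<le> fact k * (2 * y ^ m * (2 * norm d / C.\<eta>') ^ Suc k)"
  proof (rule C.jets_estimate[OF G' van(2) _ _ d0 d\<eta> Hx])
   show "Lds (replicate j (C.Tf d)) G ?x = 0" if "0 < j" "j < k" for j
    by (rule VanD[OF van(1) open_ball ch(4)]) (use tT zz_W[OF cl\<tau>] in' that in auto)
   show "norm (G x) \<le> y ^ m" if "x \<in> ?V'" for x
    using G_le[of \<tau> x] t yY that subset_ball[OF ch(2), of "?x"] unfolding y_def by blast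
  qed
  also have "\<dots> \<le> fact k * (2 * y ^ m * (2 * A / c\<eta> * y ^ (2 * N) * exp (- (1 - \<epsilon>) * y)) ^ Suc k)"
  proof (intro mult_left_mono power_mono)
   have "2 * norm d / C.\<eta>' = 2 * norm d * (y ^ (2 * N) / c\<eta>)" unfolding ch(3) by simp
   also have "\<dots> \<le> 2 * (A * exp (- (1 - \<epsilon>) * y)) * (y ^ (2 * N) / c\<eta>)"
    using dA col_consts(5) y by (intro mult_right_mono mult_left_mono) auto
   finally show "2 * norm d / C.\<eta>' \<le> 2 * A / c\<eta> * y ^ (2 * N) * exp (- (1 - \<epsilon>) * y)" by (simp add: mult_ac)
  qed (use C.\<eta>(3) y in auto)
  also have "fact k * (2 * y ^ m * (2 * A / c\<eta> * y ^ (2 * N) * exp (- (1 - \<epsilon>) * y)) ^ Suc k)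
    = K2 * (c / 2) ^ k * y ^ P * exp (- (1 - \<epsilon>) * y) ^ Suc k"
  proof -
   have "y ^ P = y ^ m * (y ^ (2 * N)) ^ Suc k" by (simp only: P_def power_add power_mult)
   moreover have "K2 * (c / 2) ^ k = fact k * (2 * (2 * A / c\<eta>) ^ Suc k)" using c_pos by (simp add: K2_def)
   ultimately show ?thesis unfolding power_mult_distrib[of "2 * A / c\<eta> * y ^ (2 * N)"] power_mult_distrib[of "2 * A / c\<eta>" "y ^ (2 * N)"]
    by (simp add: mult_ac del: power_Suc)
  qed
  also have "exp (- (1 - \<epsilon>) * y) ^ Suc k = exp (- y) ^ k * exp (- (1/2) * y)"
  proof -
   have "s * (- (1 - \<epsilon>) * y) = (\<epsilon> * s) * y - s * y" for s by (simp add: algebra_simps)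
   hence "real (Suc k) * (- (1 - \<epsilon>) * y) = (\<epsilon> * real (Suc k)) * y - real (Suc k) * y" .
   also have "\<dots> = real k * (- y) + (- (1/2) * y)" unfolding \<epsilon>(3) by (simp add: distrib_right)
   finally have "real (Suc k) * (- (1 - \<epsilon>) * y) = real k * (- y) + (- (1/2) * y)" .
   thus ?thesis unfolding exp_of_nat_mult[symmetric] exp_add[symmetric] by simp
  qed
  finally have up: "norm (Cf k (zz \<tau>)) * norm (symp (C.Tf d ?x) g) ^ k \<le> (K2 * y ^ P * exp (- (1/2) * y)) * ((c / 2) * exp (- y)) ^ k"
   unfolding jet norm_mult norm_power power_mult_distrib[of "c / 2" "exp (- y)"] by (simp only: mult_ac)
  \<comment> \<open>\<open>Tf d\<close> differs from d by a multiple of b. Both ends lie on one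
    level, so \<open>dd H\<close> of d is quadratic in d; the correction is O(y^N exp (-3 y / 2))
    and costs at most half of the displacement c * exp (- y).\<close>
  have low: "(c / 2) * exp (- y) \<le> norm (symp (C.Tf d ?x) g)"
  proof -
   have "norm (H (?x + d) - H ?x - dd H ?x d) \<le> 8 * B' / r\<^sup>2 * (norm d)\<^sup>2"
    by (rule hol_first_order(2)[OF C.holH r C.B dr])
   hence q: "norm (dd H ?x d) \<le> 8 * B' / r\<^sup>2 * (norm d)\<^sup>2" using Hx by simp
   have b4: "norm (symp b g) \<le> 4 * Cg" using norm_symp[of b g] C.b gC by simp
   have "norm (dd H ?x d / dd H ?x b * symp b g) \<le> (8 * B' / r\<^sup>2 * (norm d)\<^sup>2) / (cl / y ^ N) * (4 * Cg)"
    unfolding norm_mult norm_divide using q b4 C.l C.lB(2) col_consts(2) y by (intro mult_mono frac_le) auto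
   also have "\<dots> \<le> (8 * B' / r\<^sup>2 * (A * exp (- (3/4) * y))\<^sup>2) / (cl / y ^ N) * (4 * Cg)"
   proof -
    have "norm d \<le> A * exp (- (3/4) * y)" using dA mult_left_mono[OF e34, of A] A by linarith
    thus ?thesis using C.l(1) C.lB(2) Cg by (intro mult_right_mono divide_right_mono mult_left_mono power_mono) auto
   qed
   also have "\<dots> = K1 * y ^ N * exp (- (1/2) * y) * exp (- y)"
   proof -
    have "(exp (- (3/4) * y))\<^sup>2 = exp (- (1/2) * y) * exp (- y)"
     unfolding exp_double[symmetric] exp_add[symmetric] by simp
    thus ?thesis by (simp add: K1_def power_mult_distrib)
   qed
   also have "\<dots> \<le> c / 2 * exp (- y)" using Y2(2)[OF yY(3)] by (intro mult_right_mono) auto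
   finally have "norm (dd H ?x d / dd H ?x b * symp b g) \<le> c / 2 * exp (- y)" .
   moreover have "symp (C.Tf d ?x) g = symp d g - dd H ?x d / dd H ?x b * symp b g"
    by (simp add: C.Tf_def symp_diff_left symp_scale_left)
   ultimately show ?thesis using far' norm_triangle_ineq2[of "symp d g" "dd H ?x d / dd H ?x b * symp b g"] by simp
  qed
  have "norm (Cf k (zz \<tau>)) * ((c / 2) * exp (- y)) ^ k \<le> norm (Cf k (zz \<tau>)) * norm (symp (C.Tf d ?x) g) ^ k"
   using low c_pos by (intro mult_left_mono power_mono) auto
  also note up
  finally have "norm (Cf k (zz \<tau>)) \<le> K2 * y ^ P * exp (- (1/2) * y)" using c_pos by (subst (asm) mult_le_cancel_right_pos) auto
  also have "\<dots> \<le> e" by (rule Y4(2)[OF yY(5)])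
  finally show "norm (Cf k (zz \<tau>)) \<le> e" .
 qed
qed

lemma Van_all: "Van k"
proof (induction k)
 case 0 show ?case by (simp add: Van_def)
next
 case (Suc k)
 show ?case
 proof (cases "k = 0")
  case True thus ?thesis using Van_1 by simp
 next
  case False
  hence k: "k > 0" by simp
  show ?thesis by (rule Van_Suc_small[OF Suc k Cf_small[OF Suc k]])
 qed
qed

lemma const_on_level:
 assumes "chart H (\<gamma> z) r' B'' b l" "z \<in> W" "ball (\<gamma> z) (2 * chart.\<eta> r' B'' l) \<subseteq> V"
  "norm (x - \<gamma> z) < chart.\<eta>' r' B'' l" "H x = H0"
 shows "G x = a0"
proof -
 interpret C: chart H "\<gamma> z" r' B'' b l by (rule assms(1))
 have "G x = G (\<gamma> z)"
 proof (rule C.jets_const[OF hol_subset[OF holG assms(3)] _ assms(4)])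
  show "Lds (replicate j (C.Tf d)) G (\<gamma> z) = 0" if "j > 0" for j d
   by (rule VanD[OF Van_all[of "Suc j"] open_ball assms(3)]) (use C.tang_Tf assms(2) that C.\<eta> in auto)
  show "H x = H (\<gamma> z)" using assms(5) H\<gamma>[OF assms(2)] by simp
 qed
 thus ?thesis using G\<gamma>[OF assms(2)] by simp
qed

text \<open>At an arbitrary point of the separatrix no rate is required: b is a normalised vector
  with \<open>dd H\<close> nonzero and the radius may depend on z. Rates matter only in the column,
  in \<open>division_col\<close>.\<close>

lemma division_at:
 assumes z: "z \<in> W"
 obtains s where "s > 0" "ball (\<gamma> z) s \<subseteq> V" "hol (quot G a0 H H0) (ball (\<gamma> z) s)"
  "\<And>x. x \<in> ball (\<gamma> z) s \<Longrightarrow> G x - a0 = (H x - H0) * quot G a0 H H0 x"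
proof -
 have "X (\<gamma> z) \<noteq> 0" using indep[OF z, of 0 1] by auto
 then obtain b0 where b0: "dd H (\<gamma> z) b0 \<noteq> 0" using symp_nondegenerate[of "X (\<gamma> z)"] symp_ham_vf by metis
 hence b00: "b0 \<noteq> 0" by (auto simp: dd_def)
 define b where "b = of_real (1 / norm b0) *s b0"
 have b: "norm b = 1" "dd H (\<gamma> z) b \<noteq> 0" using b0 b00 by (auto simp: b_def norm_scale dd_scale norm_divide)
 obtain r1 M1 where r1: "r1 > 0" "ball (\<gamma> z) r1 \<subseteq> V" "\<And>y. y \<in> ball (\<gamma> z) r1 \<Longrightarrow> norm (H y) \<le> M1"
  using hol_locally_bounded[OF hol_subset[OF holH V(2)] V(1) \<gamma>V[OF z]] by metis
 obtain r2 M2 where r2: "r2 > 0" "ball (\<gamma> z) r2 \<subseteq> V" "\<And>y. y \<in> ball (\<gamma> z) r2 \<Longrightarrow> norm (G y) \<le> M2"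
  using hol_locally_bounded[OF holG V(1) \<gamma>V[OF z]] by metis
 define l where "l = norm (dd H (\<gamma> z) b)"
 interpret C: chart H "\<gamma> z" r1 M1 b l
 proof
  show "hol H (ball (\<gamma> z) r1)" by (rule hol_subset[OF holH]) (use r1(2) V(2) in blast)
 qed (use r1 b in \<open>auto simp: l_def\<close>)
 have sV: "ball (\<gamma> z) (2 * C.\<eta>) \<subseteq> V" using C.nbhd r1(2) by blast
 define s where "s = min C.\<eta>' r2"
 have s: "s > 0" "s \<le> C.\<eta>'" "s \<le> r2" using C.\<eta> r2 by (auto simp: s_def)
 have sub: "ball (\<gamma> z) s \<subseteq> ball (\<gamma> z) r2" by (rule subset_ball[OF s(3)])
 have Hz: "H (\<gamma> z) = H0" by (rule H\<gamma>[OF z])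
 have bd: "norm (G y - a0) \<le> M2 + norm a0" if "y \<in> ball (\<gamma> z) s" for y
  using r2(3)[of y] that sub norm_triangle_ineq4[of "G y" a0] by auto
 have co: "G y = a0" if "y \<in> ball (\<gamma> z) s" "H y = H (\<gamma> z)" for y
  by (rule const_on_level[OF C.chart_axioms z sV]) (use that s(2) Hz in \<open>auto simp: dist_norm norm_minus_commute\<close>)
 have sV2: "ball (\<gamma> z) s \<subseteq> V" using sub r2(2) by blast
 define \<delta> where "\<delta> = l * (s / 4) * r1 / (16 * M1)"
 note div0 = C.division[OF hol_subset[OF holG sV2] s(1,2), where a = a0 and M = "M2 + norm a0", folded \<delta>_def, unfolded Hz]
 have div: "hol (quot G a0 H H0) (ball (\<gamma> z) \<delta>)" "\<And>x. x \<in> ball (\<gamma> z) \<delta> \<Longrightarrow> G x - a0 = (H x - H0) * quot G a0 H H0 x"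
  "\<delta> > 0" "\<delta> \<le> s"
  by (rule div0(1) div0(2) div0(4) div0(5); use bd co Hz in simp)+
 have "ball (\<gamma> z) \<delta> \<subseteq> V" using subset_ball[OF div(4), of "\<gamma> z"] sV2 by blast
 thus ?thesis using that[OF div(3) _ div(1) div(2)] by blast
qed

lemma division_col:
 "\<exists>Y m'. Y \<ge> 1 \<and> (\<forall>\<tau>. \<bar>Re \<tau>\<bar> \<le> 7 \<longrightarrow> \<bar>Im \<tau>\<bar> \<ge> Y \<longrightarrow>
   ball (\<gamma> (zz \<tau>)) (1 / \<bar>Im \<tau>\<bar> ^ m') \<subseteq> V \<and> hol (quot G a0 H H0) (ball (\<gamma> (zz \<tau>)) (1 / \<bar>Im \<tau>\<bar> ^ m')) \<and>
   (\<forall>x\<in>ball (\<gamma> (zz \<tau>)) (1 / \<bar>Im \<tau>\<bar> ^ m'). norm (quot G a0 H H0 x) \<le> \<bar>Im \<tau>\<bar> ^ m' \<and> G x - a0 = (H x - H0) * quot G a0 H H0 x))"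
proof -
 define cs where "cs = min 1 c\<eta>"
 define M where "M = 2 * N + m"
 define cd where "cd = cl * (cs / 4) * r / (16 * B')"
 define Y where "Y = Max {Y0, 1 / cd, 16 * (1 + norm a0) / (cl * cs)}"
 \<comment> \<open>The exponent absorbs the losses of \<open>division\<close>: the radius is of
   order y^(-N-M) and the bound of order y^(m+N+M). The extra 1 pays for the constants once y is
   large.\<close>
 define m' where "m' = Suc (N + 2 * M)"
 have cs: "cs > 0" "cs \<le> 1" "cs \<le> c\<eta>" using col_consts by (auto simp: cs_def)
 have cd: "cd > 0" using cs col_consts r by (simp add: cd_def)
 show ?thesis
 proof (intro exI[of _ Y] exI[of _ m'] conjI allI impI)
  show "Y \<ge> 1" using Y0(1) by (simp add: Y_def)
  fix \<tau> assume t: "\<bar>Re \<tau>\<bar> \<le> 7" and im: "Y \<le> \<bar>Im \<tau>\<bar>"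
  define y where "y = \<bar>Im \<tau>\<bar>"
  let ?x = "\<gamma> (zz \<tau>)"
  have yY: "y \<ge> Y0" "y \<ge> 1 / cd" "y \<ge> 16 * (1 + norm a0) / (cl * cs)" using im by (auto simp: y_def Y_def)
  have y: "y \<ge> 1" using yY Y0 by linarith
  have cl\<tau>: "col \<tau>" using t yY by (simp add: y_def)
  obtain b where ch: "chart H ?x r B' b (cl / y ^ N)"
   "2 * chart.\<eta> r B' (cl / y ^ N) \<le> 1 / y ^ m"
   "chart.\<eta>' r B' (cl / y ^ N) = c\<eta> / y ^ (2 * N)"
   "ball ?x (2 * chart.\<eta> r B' (cl / y ^ N)) \<subseteq> V"
   using column_chart[OF cl\<tau>] unfolding y_def by blast
  interpret C: chart H "\<gamma> (zz \<tau>)" r B' b "cl / y ^ N" by (rule ch(1))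
  define s where "s = cs / y ^ M"
  have s0: "s > 0" using cs y by (simp add: s_def)
  have "s \<le> c\<eta> / y ^ M" using cs y by (simp add: s_def divide_right_mono)
  also have "\<dots> \<le> c\<eta> / y ^ (2 * N)" using y col_consts by (intro divide_left_mono power_increasing) (auto simp: M_def)
  finally have s\<eta>: "s \<le> C.\<eta>'" by (simp add: ch(3))
  have "s \<le> 1 / y ^ M" using cs y by (simp add: s_def divide_right_mono)
  also have "\<dots> \<le> 1 / y ^ m" using y by (intro divide_left_mono power_increasing) (auto simp: M_def)
  finally have sm: "s \<le> 1 / y ^ m" .
  have sV: "ball ?x s \<subseteq> V" using subset_ball[OF sm, of "?x"] ballV[of \<tau>] t yY unfolding y_def by blast
  have Hz: "H ?x = H0" by (rule H\<gamma>[OF zz_W[OF cl\<tau>]])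
  have bd: "norm (G x - a0) \<le> y ^ m * (1 + norm a0)" if "x \<in> ball ?x s" for x
  proof -
   have "norm (G x) \<le> y ^ m" using G_le[of \<tau> x] t yY that subset_ball[OF sm, of "?x"] unfolding y_def by blast
   moreover have "norm a0 \<le> y ^ m * norm a0" using y mult_right_mono[of 1 "y ^ m" "norm a0"] by simp
   ultimately show ?thesis using norm_triangle_ineq4[of "G x" a0] by (simp add: distrib_left)
  qed
  have co: "G x = a0" if "x \<in> ball ?x s" "H x = H ?x" for x
   by (rule const_on_level[OF ch(1) zz_W[OF cl\<tau>] ch(4)]) (use that s\<eta> Hz in \<open>auto simp: dist_norm norm_minus_commute\<close>)
  define \<delta> where "\<delta> = cl / y ^ N * (s / 4) * r / (16 * B')"
  note div0 = C.division[OF hol_subset[OF holG sV] s0 s\<eta>, where a = a0 and M = "y ^ m * (1 + norm a0)", folded \<delta>_def, unfolded Hz]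
  have div: "hol (quot G a0 H H0) (ball ?x \<delta>)" "\<And>x. x \<in> ball ?x \<delta> \<Longrightarrow> G x - a0 = (H x - H0) * quot G a0 H H0 x"
   "\<And>x. x \<in> ball ?x \<delta> \<Longrightarrow> norm (quot G a0 H H0 x) \<le> 16 * (y ^ m * (1 + norm a0)) / (cl / y ^ N * s)" "\<delta> \<le> s"
   by (rule div0(1) div0(2) div0(3) div0(5); use bd co Hz in simp)+
  have "1 / y ^ m' \<le> cd / y ^ (N + M)"
  proof -
   have "1 \<le> cd * y" using yY(2) cd by (simp add: field_simps)
   hence "1 * y ^ (N + M) \<le> (cd * y) * y ^ (N + M)" using y by (intro mult_right_mono) auto
   also have "\<dots> = cd * y ^ Suc (N + M)" by simp
   also have "\<dots> \<le> cd * y ^ m'" using cd y by (intro mult_left_mono power_increasing) (auto simp: m'_def)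
   finally show ?thesis using y by (simp add: field_simps)
  qed
  also have "\<dots> = cl / y ^ N * (s / 4) * r / (16 * B')" by (simp add: cd_def s_def power_add)
  finally have le: "1 / y ^ m' \<le> \<delta>" by (simp add: \<delta>_def)
  note sub = subset_ball[OF le, of "?x"]
  have qb: "16 * (y ^ m * (1 + norm a0)) / (cl / y ^ N * s) \<le> y ^ m'"
  proof -
   have "16 * (y ^ m * (1 + norm a0)) / (cl / y ^ N * s) = 16 * (1 + norm a0) / (cl * cs) * y ^ (m + N + M)"
    using y by (simp add: s_def power_add)
   also have "\<dots> \<le> y * y ^ (m + N + M)" using yY(3) y by (intro mult_right_mono) auto
   also have "\<dots> = y ^ Suc (m + N + M)" by simp
   also have "\<dots> \<le> y ^ m'" using y by (intro power_increasing) (auto simp: m'_def M_def)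
   finally show ?thesis .
  qed
  show "ball ?x (1 / \<bar>Im \<tau>\<bar> ^ m') \<subseteq> V"
   unfolding y_def[symmetric] using sub subset_ball[OF div(4), of "?x"] sV by blast
  show "hol (quot G a0 H H0) (ball ?x (1 / \<bar>Im \<tau>\<bar> ^ m'))"
   unfolding y_def[symmetric] by (rule hol_subset[OF div(1) sub])
  show "\<forall>x\<in>ball ?x (1 / \<bar>Im \<tau>\<bar> ^ m'). norm (quot G a0 H H0 x) \<le> \<bar>Im \<tau>\<bar> ^ m' \<and> G x - a0 = (H x - H0) * quot G a0 H H0 x"
   unfolding y_def[symmetric]
  proof (intro ballI conjI)
   fix x assume "x \<in> ball ?x (1 / y ^ m')"
   hence x: "x \<in> ball ?x \<delta>" using sub by blast
   show "norm (quot G a0 H H0 x) \<le> y ^ m'" using div(3)[OF x] qb by simp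
   show "G x - a0 = (H x - H0) * quot G a0 H H0 x" by (rule div(2)[OF x])
  qed
 qed
qed

end

section \<open>Repeated division by the Hamiltonian\<close>

text \<open>A nonconstant holomorphic function has a zero of some finite order n at 0, which
  contradicts flatness of order n + 1.\<close>

lemma holomorphic_infinite_order_zero:
 assumes f: "f holomorphic_on ball 0 \<rho>"
  and flat: "\<And>n. \<exists>C s. s > 0 \<and> (\<forall>t. norm t < s \<longrightarrow> norm (f t) \<le> C * norm t ^ n)" and w: "w \<in> ball 0 \<rho>"
 shows "f w = 0"
proof (rule ccontr)
 assume fw: "f w \<noteq> 0"
 have \<rho>: "\<rho> > 0" using w by (smt (verit) mem_ball zero_le_dist)
 obtain C s where Cs: "s > 0" "\<And>t. norm t < s \<Longrightarrow> norm (f t) \<le> C * norm t ^ 1" using flat[of 1] by blast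
 have f0: "f 0 = 0" using Cs(2)[of 0] Cs(1) by simp
 have nc: "\<not> f constant_on ball 0 \<rho>" using fw f0 w \<rho> unfolding constant_on_def by (metis centre_in_ball)
 obtain g r n where n: "0 < n" "0 < r" "ball (0::complex) r \<subseteq> ball 0 \<rho>" "g holomorphic_on ball 0 r"
  "\<And>w. w \<in> ball 0 r \<Longrightarrow> f w = (w - 0) ^ n * g w" "\<And>w. w \<in> ball 0 r \<Longrightarrow> g w \<noteq> 0"
 proof (rule holomorphic_factor_zero_nonconstant[OF f open_ball connected_ball _ f0 nc])
  fix g r n
  assume a: "0 < n" "0 < r" "ball (0::complex) r \<subseteq> ball 0 \<rho>" "g holomorphic_on ball 0 r"
   "\<And>w. w \<in> ball 0 r \<Longrightarrow> f w = (w - 0) ^ n * g w" "\<And>w. w \<in> ball 0 r \<Longrightarrow> g w \<noteq> 0"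
  show thesis by (rule that[OF a(1-4)]) (use a(5,6) in blast)+
 qed (use \<rho> in simp)
 obtain C s where Cs: "s > 0" "\<And>t. norm t < s \<Longrightarrow> norm (f t) \<le> C * norm t ^ Suc n" using flat[of "Suc n"] by blast
 have "isCont g 0" using n(2,4) holomorphic_on_imp_continuous_on continuous_on_interior by (metis centre_in_ball interior_open open_ball)
 hence "((\<lambda>t. norm (g t)) \<longlongrightarrow> norm (g 0)) (at 0)" unfolding isCont_def by (rule tendsto_norm)
 moreover have "((\<lambda>t::complex. C * norm t) \<longlongrightarrow> C * norm (0::complex)) (at 0)" by (intro tendsto_intros)
 moreover have "\<forall>\<^sub>F t in at 0. norm (g t) \<le> C * norm t"
  unfolding eventually_at
 proof (intro exI[of _ "min r s"] conjI ballI impI)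
  fix t :: complex assume t: "t \<noteq> 0 \<and> dist t 0 < min r s"
  have "norm t ^ n * norm (g t) \<le> norm t ^ n * (C * norm t)"
   using n(5)[of t] Cs(2)[of t] t by (simp add: norm_mult norm_power mult_ac)
  thus "norm (g t) \<le> C * norm t" using t by simp
 qed (use n Cs in auto)
 ultimately have "norm (g 0) \<le> C * norm (0::complex)" by (intro tendsto_le[of "at (0::complex)"]) auto
 thus False using n(2) n(6)[of 0] by simp
qed

definition minor :: "(complex ^ 'n \<Rightarrow> complex) \<Rightarrow> (complex ^ 'n \<Rightarrow> complex) \<Rightarrow> 'n \<Rightarrow> 'n \<Rightarrow> complex ^ 'n \<Rightarrow> complex" where
 "minor G H i j x = pdiff i G x * pdiff j H x - pdiff j G x * pdiff i H x"

text \<open>Density puts an independent point into every neighbourhood of x. There some partial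
  derivative of H is nonzero, and if all minors with this index vanished, the gradients would be
  proportional.\<close>

lemma independent_imp_minor:
 assumes "functionally_independent_on G H V" "open A" "x \<in> A" "x \<in> V"
 obtains y i j where "y \<in> A" "minor G H i j y \<noteq> 0"
proof -
 have "x \<in> closure {x \<in> V. \<forall>a b. a *s grad G x + b *s grad H x = 0 \<longrightarrow> a = 0 \<and> b = 0}"
  using assms(1,4) unfolding functionally_independent_on_def by blast
 hence "A \<inter> closure {x \<in> V. \<forall>a b. a *s grad G x + b *s grad H x = 0 \<longrightarrow> a = 0 \<and> b = 0} \<noteq> {}" using assms(3) by blast
 hence "A \<inter> {x \<in> V. \<forall>a b. a *s grad G x + b *s grad H x = 0 \<longrightarrow> a = 0 \<and> b = 0} \<noteq> {}"
  unfolding open_Int_closure_eq_empty[OF assms(2)] .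
 then obtain y where "y \<in> A \<inter> {x \<in> V. \<forall>a b. a *s grad G x + b *s grad H x = 0 \<longrightarrow> a = 0 \<and> b = 0}" unfolding ex_in_conv[symmetric] by (rule exE)
 hence y: "y \<in> A" "\<And>a b. a *s grad G y + b *s grad H y = 0 \<Longrightarrow> a = 0 \<and> b = 0" by simp_all
 have "grad H y \<noteq> 0" using y(2)[of 0 1] by auto
 then obtain j where j: "pdiff j H y \<noteq> 0" by (auto simp: grad_def vec_eq_iff)
 have "\<exists>i. minor G H i j y \<noteq> 0"
 proof (rule ccontr)
  assume "\<not> (\<exists>i. minor G H i j y \<noteq> 0)"
  hence "pdiff j H y *s grad G y + (- pdiff j G y) *s grad H y = 0" by (simp add: minor_def grad_def vec_eq_iff mult.commute)
  thus False using y(2) j by blast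
 qed
 thus ?thesis using that y(1) by blast
qed

text \<open>On the complex line from x1 to x the function is flat of every order at x1, because H -
  H x1 is O(norm t). The disc is taken with radius above 1 so that it contains the parameter of
  x.\<close>

lemma minor_flat_zero:
 fixes H :: "complex ^ 4 \<Rightarrow> complex"
 assumes s0: "s0 > 0" and M: "hol M (ball x1 s0)" and H: "hol H (ball x1 s0)"
  and flat: "\<And>n. \<exists>s>0. \<exists>g. hol g (ball x1 s) \<and> (\<forall>x\<in>ball x1 s. M x = (H x - H x1) ^ n * g x)" and x: "x \<in> ball x1 s0"
 shows "M x = 0"
proof -
 define v where "v = x - x1"
 have nv: "norm v < s0" using x by (simp add: v_def dist_norm norm_minus_commute)
 obtain \<rho> where \<rho>: "\<rho> > 1" "\<rho> * norm v < s0"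
 proof (cases "v = 0")
  case True thus ?thesis using that[of 2] s0 by simp
 next
  case False
  have "1 < s0 / norm v" using nv False by simp
  then obtain \<rho> where "1 < \<rho>" "\<rho> < s0 / norm v" using dense by blast
  thus ?thesis using that[of \<rho>] False by (simp add: field_simps)
 qed
 have inb: "x1 + t *s v \<in> ball x1 s0" if "t \<in> ball 0 \<rho>" for t
 proof -
  have "norm t * norm v \<le> \<rho> * norm v" using that by (intro mult_right_mono) auto
  thus ?thesis using \<rho>(2) by (simp add: dist_norm norm_scale)
 qed
 have "M (x1 + 1 *s v) = 0"
 proof (rule holomorphic_infinite_order_zero[where f = "\<lambda>t. M (x1 + t *s v)" and \<rho> = \<rho>])
  show "(\<lambda>t. M (x1 + t *s v)) holomorphic_on ball 0 \<rho>" by (rule hol_line_holomorphic[OF M]) (use inb in auto)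
  fix n
  obtain s g where sg: "s > 0" "hol g (ball x1 s)" "\<And>x. x \<in> ball x1 s \<Longrightarrow> M x = (H x - H x1) ^ n * g x" using flat[of n] by blast
  obtain r1 M1 where r1: "r1 > 0" "ball x1 r1 \<subseteq> ball x1 s" "\<And>y. y \<in> ball x1 r1 \<Longrightarrow> norm (g y) \<le> M1" "M1 \<ge> 0"
   using hol_locally_bounded[OF sg(2) open_ball, of x1] sg(1) by (metis centre_in_ball)
  obtain r2 M2 where r2: "r2 > 0" "ball x1 r2 \<subseteq> ball x1 s0" "\<And>y. y \<in> ball x1 r2 \<Longrightarrow> norm (H y) \<le> M2" "M2 \<ge> 0"
   using hol_locally_bounded[OF H open_ball, of x1] s0 by (metis centre_in_ball)
  define L where "L = 4 * M2 / r2 * norm v"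
  define q where "q = min r1 (r2 / 4) / (norm v + 1)"
  have q: "q > 0" using r1 r2 by (simp add: q_def add_nonneg_pos)
  show "\<exists>C s. 0 < s \<and> (\<forall>t. norm t < s \<longrightarrow> norm (M (x1 + t *s v)) \<le> C * norm t ^ n)"
  proof (rule exI[of _ "L ^ n * M1"], rule exI[of _ q], intro conjI allI impI q)
   fix t :: complex assume t: "norm t < q"
   have "norm t * norm v \<le> norm t * (norm v + 1)" by (intro mult_left_mono) auto
   also have "\<dots> < q * (norm v + 1)" using t by (intro mult_strict_right_mono) (auto simp: add_nonneg_pos)
   also have "\<dots> = min r1 (r2 / 4)" using add_nonneg_pos[OF norm_ge_zero[of v] zero_less_one] unfolding q_def by (metis less_irrefl nonzero_eq_divide_eq)
   finally have tv: "norm (t *s v) < min r1 (r2 / 4)" by (simp add: norm_scale)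
   have m1: "x1 + t *s v \<in> ball x1 r1" using tv by (simp add: dist_norm)
   have hH: "norm (H (x1 + t *s v) - H x1) \<le> 4 * M2 / r2 * norm (t *s v)"
    by (rule hol_first_order(1)[OF hol_subset[OF H r2(2)] r2(1) r2(3)]) (use tv in auto)
   have "norm (M (x1 + t *s v)) = norm (H (x1 + t *s v) - H x1) ^ n * norm (g (x1 + t *s v))"
    using sg(3)[of "x1 + t *s v"] m1 r1(2) by (auto simp: norm_mult norm_power)
   also have "\<dots> \<le> (L * norm t) ^ n * M1"
   proof (rule mult_mono[OF _ r1(3)[OF m1]])
    show "norm (H (x1 + t *s v) - H x1) ^ n \<le> (L * norm t) ^ n"
     using hH by (intro power_mono) (auto simp: L_def norm_scale mult_ac)
    show "0 \<le> (L * norm t) ^ n" using r2(1,4) by (simp add: L_def)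
   qed simp
   finally show "norm (M (x1 + t *s v)) \<le> L ^ n * M1 * norm t ^ n" by (simp add: power_mult_distrib mult_ac)
  qed
 qed (use \<rho> in auto)
 thus ?thesis by (simp add: v_def)
qed

text \<open>Both sectors contain the column, and there the two solutions can be compared. The
  transversal lower bound appears with either phase derivative, because either separatrix serves as
  base point of jets.\<close>

locale sep_pair = m: sep H V0 \<gamma>m h 1 R H0 + p: sep H V0 \<gamma>p h "- 1" R H0
 for H :: "complex ^ 4 \<Rightarrow> complex" and V0 \<gamma>m \<gamma>p h R H0 +
 fixes \<phi>0 Y0 r B cH c Cg :: real and n :: nat
 assumes r: "r > 0" and cH: "cH > 0" and c_pos: "c > 0" and Cg: "Cg > 0" and B: "\<And>x. x \<in> V0 \<Longrightarrow> norm (H x) \<le> B"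
  and Y0: "Y0 \<ge> 1" "\<And>\<tau>. \<bar>Re \<tau>\<bar> \<le> 7 \<Longrightarrow> \<bar>Im \<tau>\<bar> \<ge> Y0 \<Longrightarrow> \<tau> \<in> Lset 1 R" "\<And>\<tau>. \<bar>Re \<tau>\<bar> \<le> 7 \<Longrightarrow> \<bar>Im \<tau>\<bar> \<ge> Y0 \<Longrightarrow> \<tau> \<in> Lset (- 1) R"
  and ballm: "\<And>\<tau>. \<bar>Re \<tau>\<bar> \<le> 7 \<Longrightarrow> \<bar>Im \<tau>\<bar> \<ge> Y0 \<Longrightarrow> ball (\<gamma>m (pt \<phi>0 \<tau>)) r \<subseteq> V0"
  and ballp: "\<And>\<tau>. \<bar>Re \<tau>\<bar> \<le> 7 \<Longrightarrow> \<bar>Im \<tau>\<bar> \<ge> Y0 \<Longrightarrow> ball (\<gamma>p (pt \<phi>0 \<tau>)) r \<subseteq> V0"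
  and nearby: "\<And>\<epsilon>. \<epsilon> > 0 \<Longrightarrow> \<exists>A Y. \<forall>\<tau>. \<bar>Re \<tau>\<bar> \<le> 7 \<longrightarrow> \<bar>Im \<tau>\<bar> \<ge> Y \<longrightarrow> norm (\<gamma>p (pt \<phi>0 \<tau>) - \<gamma>m (pt \<phi>0 \<tau>)) \<le> A * exp (- (1 - \<epsilon>) * \<bar>Im \<tau>\<bar>)"
  and farm: "\<And>\<tau>. \<bar>Re \<tau>\<bar> \<le> 7 \<Longrightarrow> \<bar>Im \<tau>\<bar> \<ge> Y0 \<Longrightarrow> c * exp (- \<bar>Im \<tau>\<bar>) \<le> norm (symp (\<gamma>p (pt \<phi>0 \<tau>) - \<gamma>m (pt \<phi>0 \<tau>)) (m.g\<phi> (pt \<phi>0 \<tau>)))"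
  and farp: "\<And>\<tau>. \<bar>Re \<tau>\<bar> \<le> 7 \<Longrightarrow> \<bar>Im \<tau>\<bar> \<ge> Y0 \<Longrightarrow> c * exp (- \<bar>Im \<tau>\<bar>) \<le> norm (symp (\<gamma>p (pt \<phi>0 \<tau>) - \<gamma>m (pt \<phi>0 \<tau>)) (p.g\<phi> (pt \<phi>0 \<tau>)))"
  and dHm: "\<And>\<tau>. \<bar>Re \<tau>\<bar> \<le> 7 \<Longrightarrow> \<bar>Im \<tau>\<bar> \<ge> Y0 \<Longrightarrow> \<exists>b. norm b = 1 \<and> cH / \<bar>Im \<tau>\<bar> ^ n \<le> norm (dd H (\<gamma>m (pt \<phi>0 \<tau>)) b)"
  and dHp: "\<And>\<tau>. \<bar>Re \<tau>\<bar> \<le> 7 \<Longrightarrow> \<bar>Im \<tau>\<bar> \<ge> Y0 \<Longrightarrow> \<exists>b. norm b = 1 \<and> cH / \<bar>Im \<tau>\<bar> ^ n \<le> norm (dd H (\<gamma>p (pt \<phi>0 \<tau>)) b)"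
  and gm: "\<And>\<tau>. \<bar>Re \<tau>\<bar> \<le> 7 \<Longrightarrow> \<bar>Im \<tau>\<bar> \<ge> Y0 \<Longrightarrow> norm (m.g\<phi> (pt \<phi>0 \<tau>)) \<le> Cg"
  and gp: "\<And>\<tau>. \<bar>Re \<tau>\<bar> \<le> 7 \<Longrightarrow> \<bar>Im \<tau>\<bar> \<ge> Y0 \<Longrightarrow> norm (p.g\<phi> (pt \<phi>0 \<tau>)) \<le> Cg"
begin

abbreviation "zz \<tau> \<equiv> pt \<phi>0 \<tau>"

text \<open>First integrals near both separatrices whose domain and size are controlled by powers of
  |Im tau| in the column. A quotient lives only on balls that shrink towards the origin; this form
  of control survives the next division.\<close>

definition GGV where
 "GGV G V k Y \<longleftrightarrow> Y \<ge> Y0 \<and> open V \<and> V \<subseteq> V0 \<and> hol G V \<and> (\<forall>x\<in>V. dd G x (ham_vf H x) = 0) \<and> (\<forall>z\<in>m.W. \<gamma>m z \<in> V) \<and> (\<forall>z\<in>p.W. \<gamma>p z \<in> V) \<and>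
  (\<forall>\<tau>. \<bar>Re \<tau>\<bar> \<le> 7 \<longrightarrow> \<bar>Im \<tau>\<bar> \<ge> Y \<longrightarrow> (\<forall>x\<in>ball (\<gamma>m (zz \<tau>)) (1 / \<bar>Im \<tau>\<bar> ^ k) \<union> ball (\<gamma>p (zz \<tau>)) (1 / \<bar>Im \<tau>\<bar> ^ k). x \<in> V \<and> norm (G x) \<le> \<bar>Im \<tau>\<bar> ^ k))"

lemma GGVD:
 assumes "GGV G V k Y"
 shows "open V" "V \<subseteq> V0" "hol G V" "\<And>x. x \<in> V \<Longrightarrow> dd G x (ham_vf H x) = 0" "\<And>z. z \<in> m.W \<Longrightarrow> \<gamma>m z \<in> V" "\<And>z. z \<in> p.W \<Longrightarrow> \<gamma>p z \<in> V" "Y \<ge> Y0"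
  and "\<And>\<tau> x. \<bar>Re \<tau>\<bar> \<le> 7 \<Longrightarrow> \<bar>Im \<tau>\<bar> \<ge> Y \<Longrightarrow> x \<in> ball (\<gamma>m (zz \<tau>)) (1 / \<bar>Im \<tau>\<bar> ^ k) \<Longrightarrow> x \<in> V \<and> norm (G x) \<le> \<bar>Im \<tau>\<bar> ^ k"
  and "\<And>\<tau> x. \<bar>Re \<tau>\<bar> \<le> 7 \<Longrightarrow> \<bar>Im \<tau>\<bar> \<ge> Y \<Longrightarrow> x \<in> ball (\<gamma>p (zz \<tau>)) (1 / \<bar>Im \<tau>\<bar> ^ k) \<Longrightarrow> x \<in> V \<and> norm (G x) \<le> \<bar>Im \<tau>\<bar> ^ k"
 using assms unfolding GGV_def by - (elim conjE; simp)+

definition "GG G \<longleftrightarrow> (\<exists>V k Y. GGV G V k Y)"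

lemma zz_W: "\<bar>Re \<tau>\<bar> \<le> 7 \<Longrightarrow> \<bar>Im \<tau>\<bar> \<ge> Y0 \<Longrightarrow> zz \<tau> \<in> m.W" "\<bar>Re \<tau>\<bar> \<le> 7 \<Longrightarrow> \<bar>Im \<tau>\<bar> \<ge> Y0 \<Longrightarrow> zz \<tau> \<in> p.W"
 using Y0(2,3)[of \<tau>] by (simp_all add: RD_def)

text \<open>The Liouville argument gives one value on each separatrix. They agree because
  corresponding points are exponentially close while the derivative of G grows at most
  polynomially.\<close>

lemma GG_constant:
 assumes "GGV G V k Y"
 obtains a where "\<And>z. z \<in> m.W \<Longrightarrow> G (\<gamma>m z) = a" "\<And>z. z \<in> p.W \<Longrightarrow> G (\<gamma>p z) = a"
proof -
 note V = GGVD(1-7)[OF assms] and bd = GGVD(8)[OF assms] and bd' = GGVD(9)[OF assms]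
 have pos: "1 / \<bar>Im \<tau>\<bar> ^ k > 0" if "\<bar>Im \<tau>\<bar> \<ge> Y" for \<tau> using that V(7) Y0(1) by simp
 have b1: "norm (G (\<gamma>m (zz \<tau>))) \<le> 1 * \<bar>Im \<tau>\<bar> ^ k" "norm (G (\<gamma>p (zz \<tau>))) \<le> 1 * \<bar>Im \<tau>\<bar> ^ k" if "\<bar>Re \<tau>\<bar> \<le> 7" "\<bar>Im \<tau>\<bar> \<ge> Y" for \<tau>
  using bd[OF that, of "\<gamma>m (zz \<tau>)"] bd'[OF that, of "\<gamma>p (zz \<tau>)"] pos[OF that(2)] by auto
 obtain a where a: "\<And>z. z \<in> m.W \<Longrightarrow> G (\<gamma>m z) = a" by (rule m.first_integral_const[OF V(1-5) b1(1)]) auto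
 obtain a' where a': "\<And>z. z \<in> p.W \<Longrightarrow> G (\<gamma>p z) = a'" by (rule p.first_integral_const[OF V(1-4) V(6) b1(2)]) auto
 have small: "norm (a' - a) \<le> 0 + e" if e: "e > 0" for e
 proof -
  obtain A Y1 where A: "\<And>\<tau>. \<bar>Re \<tau>\<bar> \<le> 7 \<Longrightarrow> \<bar>Im \<tau>\<bar> \<ge> Y1 \<Longrightarrow> norm (\<gamma>p (zz \<tau>) - \<gamma>m (zz \<tau>)) \<le> A * exp (- (1 - 1/2) * \<bar>Im \<tau>\<bar>)"
   using nearby[of "1/2"] by auto
  have half: "(0::real) < 1/2" by simp
  obtain Y2 where Y2: "Y2 \<ge> 1" "\<And>y. y \<ge> Y2 \<Longrightarrow> (4 * A) * y ^ (k + k) * exp (- (1/2) * y) \<le> e" using poly_exp_small[OF half e] by metis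
  obtain Y3 where Y3: "Y3 \<ge> 1" "\<And>y. y \<ge> Y3 \<Longrightarrow> (4 * A) * y ^ k * exp (- (1/2) * y) \<le> 1" using poly_exp_small[OF half zero_less_one] by metis
  define y where "y = Max {Y, Y1, Y2, Y3}"
  have yY: "y \<ge> Y" "y \<ge> Y1" "y \<ge> Y2" "y \<ge> Y3" by (auto simp: y_def)
  have y: "y \<ge> 1" using yY(1) V(7) Y0(1) by linarith
  define \<tau> where "\<tau> = Complex 0 y"
  have \<tau>: "\<bar>Re \<tau>\<bar> \<le> 7" "\<bar>Im \<tau>\<bar> = y" using y by (auto simp: \<tau>_def)
  define v where "v = \<gamma>p (zz \<tau>) - \<gamma>m (zz \<tau>)"
  have v: "norm v \<le> A * exp (- (1/2) * y)" using A[of \<tau>] \<tau> yY(2) by (simp add: v_def)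
  have "4 * norm v * y ^ k \<le> 4 * (A * exp (- (1/2) * y)) * y ^ k" using v y by (intro mult_right_mono mult_left_mono) auto
  also have "\<dots> \<le> 1" using Y3(2)[OF yY(4)] by (simp only: mult_ac)
  finally have 4: "4 * norm v \<le> 1 / y ^ k" using y by (simp add: field_simps)
  have bb: "x \<in> V \<and> norm (G x) \<le> y ^ k" if "x \<in> ball (\<gamma>m (zz \<tau>)) (1 / y ^ k)" for x using bd[OF \<tau>(1), of x] \<tau>(2) yY(1) that by auto
  have hG: "hol G (ball (\<gamma>m (zz \<tau>)) (1 / y ^ k))" by (rule hol_subset[OF V(3)]) (use bb in blast)
  have "norm (G (\<gamma>m (zz \<tau>) + v) - G (\<gamma>m (zz \<tau>))) \<le> 4 * y ^ k / (1 / y ^ k) * norm v"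
   by (rule hol_first_order(1)[OF hG _ _ 4]) (use y bb in auto)
  also have "\<dots> \<le> 4 * y ^ k / (1 / y ^ k) * (A * exp (- (1/2) * y))" using v y by (intro mult_left_mono) auto
  also have "\<dots> = (4 * A) * y ^ (k + k) * exp (- (1/2) * y)" by (simp add: power_add)
  also have "\<dots> \<le> e" by (rule Y2(2)[OF yY(3)])
  finally show ?thesis using a[OF zz_W(1)[of \<tau>]] a'[OF zz_W(2)[of \<tau>]] \<tau> yY(1) V(7) by (simp add: v_def)
 qed
 have "norm (a' - a) \<le> 0" by (rule field_le_epsilon[OF small])
 hence "a' = a" by simp
 thus ?thesis using that a a' by blast
qed

text \<open>Differentiating G - a = (H - H0) Q along X gives (H - H0) dQ(X) = 0. If dQ(X) were
  nonzero at x, then H = H0 near x by continuity, so dH and X would vanish at x.\<close>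

lemma dd_quotient_zero:
 assumes "open A" "A \<subseteq> V0" "hol G A" "hol Q A" "\<And>x. x \<in> A \<Longrightarrow> G x - a = (H x - H0) * Q x" "x \<in> A" "\<And>x. x \<in> A \<Longrightarrow> dd G x (ham_vf H x) = 0"
 shows "dd Q x (ham_vf H x) = 0"
proof (rule ccontr)
 assume nz: "dd Q x (ham_vf H x) \<noteq> 0"
 have hH: "hol H A" using hol_subset[OF m.holH assms(2)] .
 have hHm: "hol (\<lambda>x. H x - H0) A" by (rule hol_diff[OF hH hol_const])
 have prod0: "(H y - H0) * dd Q y (ham_vf H y) = 0" if y: "y \<in> A" for y
 proof -
  have "dd G y (ham_vf H y) = dd (\<lambda>x. a + (H x - H0) * Q x) y (ham_vf H y)"
   by (rule hol_transform(2)[symmetric, OF assms(3,1) _ y]) (use assms(5) in \<open>simp add: algebra_simps\<close>)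
  also have "\<dots> = (H y - H0) * dd Q y (ham_vf H y) + dd (\<lambda>x. H x - H0) y (ham_vf H y) * Q y"
   by (simp add: dd_plus[OF hol_const hol_mult[OF hHm assms(4)] y] dd_mult[OF hHm assms(4) y])
  also have "dd (\<lambda>x. H x - H0) y (ham_vf H y) = 0"
   by (simp add: dd_minus[OF hH hol_const y] dd_ham_vf_self)
  finally show ?thesis using assms(7)[OF y] by simp
 qed
 have "hol (Ld (ham_vf H) Q) A" by (rule hol_Ld[OF assms(1,4) vhol_ham_vf[OF assms(1) hH]])
 hence "isCont (Ld (ham_vf H) Q) x" using assms(1,6) hol_continuous continuous_on_eq_continuous_at by blast
 moreover have "Ld (ham_vf H) Q x \<noteq> 0" using nz by (simp add: Ld_def)
 ultimately obtain \<delta>1 where \<delta>1: "\<delta>1 > 0" "\<And>y. dist x y < \<delta>1 \<Longrightarrow> Ld (ham_vf H) Q y \<noteq> 0"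
  using continuous_at_avoid[of x "Ld (ham_vf H) Q" 0] by blast
 obtain \<delta>2 where \<delta>2: "\<delta>2 > 0" "ball x \<delta>2 \<subseteq> A" using assms(1,6) openE by blast
 define \<delta> where "\<delta> = min \<delta>1 \<delta>2"
 have const: "H0 = H y" if "y \<in> ball x \<delta>" for y
 proof -
  have "y \<in> A" "Ld (ham_vf H) Q y \<noteq> 0" using that \<delta>1(2)[of y] \<delta>2(2) by (auto simp: \<delta>_def)
  thus ?thesis using prod0[of y] by (simp add: Ld_def)
 qed
 have sub: "ball x \<delta> \<subseteq> A" using \<delta>2(2) by (auto simp: \<delta>_def)
 have "dd H x w = 0" for w
  using hol_transform(2)[OF hol_subset[OF hH sub] open_ball const, of x w] \<delta>1 \<delta>2 by (simp add: \<delta>_def)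
 hence "ham_vf H x = 0" by (intro symp_nondegenerate) (simp add: symp_ham_vf)
 thus False using nz by (simp add: dd_def)
qed

lemma GG_divide:
 assumes "GG G"
 obtains a where "GG (quot G a H H0)"
  "\<And>z. z \<in> m.W \<Longrightarrow> \<exists>s>0. ball (\<gamma>m z) s \<subseteq> V0 \<and> hol G (ball (\<gamma>m z) s) \<and> hol (quot G a H H0) (ball (\<gamma>m z) s) \<and> (\<forall>x\<in>ball (\<gamma>m z) s. G x - a = (H x - H0) * quot G a H H0 x)"
proof -
 obtain V k Y where gg: "GGV G V k Y" using assms by (auto simp: GG_def)
 note V = GGVD(1-7)[OF gg] and bd = GGVD(8)[OF gg] and bd' = GGVD(9)[OF gg]
 obtain a where a: "\<And>z. z \<in> m.W \<Longrightarrow> G (\<gamma>m z) = a" "\<And>z. z \<in> p.W \<Longrightarrow> G (\<gamma>p z) = a" using GG_constant[OF gg] by blast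
 have nearby': "\<exists>A Y. \<forall>\<tau>. \<bar>Re \<tau>\<bar> \<le> 7 \<longrightarrow> \<bar>Im \<tau>\<bar> \<ge> Y \<longrightarrow> norm (\<gamma>m (zz \<tau>) - \<gamma>p (zz \<tau>)) \<le> A * exp (- (1 - \<epsilon>) * \<bar>Im \<tau>\<bar>)" if "\<epsilon> > 0" for \<epsilon>
  using nearby[OF that] by (simp add: norm_minus_commute)
 have sw: "norm (symp (u - v) w) = norm (symp (v - u) w)" for u v w
  by (simp add: symp_diff_left norm_minus_commute)
 have farp': "c * exp (- \<bar>Im \<tau>\<bar>) \<le> norm (symp (\<gamma>m (zz \<tau>) - \<gamma>p (zz \<tau>)) (p.g\<phi> (zz \<tau>)))" if "\<bar>Re \<tau>\<bar> \<le> 7" "\<bar>Im \<tau>\<bar> \<ge> Y0" for \<tau>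
  using farp[OF that] sw by metis
 \<comment> \<open>Each separatrix in turn is the base of the jets, the other one supplying the
   points \<open>x'\<close>.\<close>
 have C1: "first_int_col H V0 \<gamma>m h 1 R H0 G V a \<phi>0 Y r B cH c Cg (\<lambda>\<tau>. \<gamma>p (zz \<tau>)) k n"
 proof
  show "H (\<gamma>p (zz \<tau>)) = H0 \<and> G (\<gamma>p (zz \<tau>)) = a" if "\<bar>Re \<tau>\<bar> \<le> 7" "\<bar>Im \<tau>\<bar> \<ge> Y" for \<tau>
   using a(2)[OF zz_W(2)] p.H\<gamma>[OF zz_W(2)] that V(7) by auto
  show "ball (\<gamma>m (zz \<tau>)) (1 / \<bar>Im \<tau>\<bar> ^ k) \<subseteq> V" if "\<bar>Re \<tau>\<bar> \<le> 7" "\<bar>Im \<tau>\<bar> \<ge> Y" for \<tau> using bd[OF that] by blast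
  show "norm (G x) \<le> \<bar>Im \<tau>\<bar> ^ k" if "\<bar>Re \<tau>\<bar> \<le> 7" "\<bar>Im \<tau>\<bar> \<ge> Y" "x \<in> ball (\<gamma>m (zz \<tau>)) (1 / \<bar>Im \<tau>\<bar> ^ k)" for \<tau> x using bd[OF that] by blast
  show "\<And>\<epsilon>. \<epsilon> > 0 \<Longrightarrow> \<exists>A Y. \<forall>\<tau>. \<bar>Re \<tau>\<bar> \<le> 7 \<longrightarrow> \<bar>Im \<tau>\<bar> \<ge> Y \<longrightarrow> norm (\<gamma>p (zz \<tau>) - \<gamma>m (zz \<tau>)) \<le> A * exp (- (1 - \<epsilon>) * \<bar>Im \<tau>\<bar>)" by (rule nearby)
 qed (use V a(1) r cH c_pos Cg B Y0 order_trans[OF Y0(1) V(7)] order_trans[OF V(7)] ballm farm dHm gm in auto)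
 have C2: "first_int_col H V0 \<gamma>p h (- 1) R H0 G V a \<phi>0 Y r B cH c Cg (\<lambda>\<tau>. \<gamma>m (zz \<tau>)) k n"
 proof
  show "H (\<gamma>m (zz \<tau>)) = H0 \<and> G (\<gamma>m (zz \<tau>)) = a" if "\<bar>Re \<tau>\<bar> \<le> 7" "\<bar>Im \<tau>\<bar> \<ge> Y" for \<tau>
   using a(1)[OF zz_W(1)] m.H\<gamma>[OF zz_W(1)] that V(7) by auto
  show "ball (\<gamma>p (zz \<tau>)) (1 / \<bar>Im \<tau>\<bar> ^ k) \<subseteq> V" if "\<bar>Re \<tau>\<bar> \<le> 7" "\<bar>Im \<tau>\<bar> \<ge> Y" for \<tau> using bd'[OF that] by blast
  show "norm (G x) \<le> \<bar>Im \<tau>\<bar> ^ k" if "\<bar>Re \<tau>\<bar> \<le> 7" "\<bar>Im \<tau>\<bar> \<ge> Y" "x \<in> ball (\<gamma>p (zz \<tau>)) (1 / \<bar>Im \<tau>\<bar> ^ k)" for \<tau> x using bd'[OF that] by blast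
  show "\<And>\<epsilon>. \<epsilon> > 0 \<Longrightarrow> \<exists>A Y. \<forall>\<tau>. \<bar>Re \<tau>\<bar> \<le> 7 \<longrightarrow> \<bar>Im \<tau>\<bar> \<ge> Y \<longrightarrow> norm (\<gamma>m (zz \<tau>) - \<gamma>p (zz \<tau>)) \<le> A * exp (- (1 - \<epsilon>) * \<bar>Im \<tau>\<bar>)" by (rule nearby')
 qed (use V a(2) r cH c_pos Cg B Y0 order_trans[OF Y0(1) V(7)] order_trans[OF V(7)] ballp farp' dHp gp in auto)
 interpret c1: first_int_col H V0 \<gamma>m h 1 R H0 G V a \<phi>0 Y r B cH c Cg "\<lambda>\<tau>. \<gamma>p (zz \<tau>)" k n by (rule C1)
 interpret c2: first_int_col H V0 \<gamma>p h "- 1" R H0 G V a \<phi>0 Y r B cH c Cg "\<lambda>\<tau>. \<gamma>m (zz \<tau>)" k n by (rule C2)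
 define Q where "Q = quot G a H H0"
 define good where "good x s \<longleftrightarrow> s > 0 \<and> ball x s \<subseteq> V \<and> hol Q (ball x s) \<and> (\<forall>u\<in>ball x s. G u - a = (H u - H0) * Q u)" for x s
 \<comment> \<open>The union of all balls on which division works. As \<open>Q\<close> is defined
   without reference to a chart, it is holomorphic on the whole union.\<close>
 define V1 where "V1 = \<Union>{ball x s | x s. good x s}"
 have goodV1: "ball x s \<subseteq> V1" if "good x s" for x s using that by (auto simp: V1_def)
 have g1: "\<exists>s. good (\<gamma>m z) s" if "z \<in> m.W" for z
  using c1.division_at[OF that] unfolding good_def Q_def by metis
 have g2: "\<exists>s. good (\<gamma>p z) s" if "z \<in> p.W" for z
  using c2.division_at[OF that] unfolding good_def Q_def by metis
 obtain Y1 k1 where d1: "Y1 \<ge> 1" "\<And>\<tau>. \<bar>Re \<tau>\<bar> \<le> 7 \<Longrightarrow> \<bar>Im \<tau>\<bar> \<ge> Y1 \<Longrightarrow> good (\<gamma>m (zz \<tau>)) (1 / \<bar>Im \<tau>\<bar> ^ k1) \<and> (\<forall>x\<in>ball (\<gamma>m (zz \<tau>)) (1 / \<bar>Im \<tau>\<bar> ^ k1). norm (Q x) \<le> \<bar>Im \<tau>\<bar> ^ k1)"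
 proof -
  obtain Y1 k1 where *: "Y1 \<ge> 1" "\<And>\<tau>. \<bar>Re \<tau>\<bar> \<le> 7 \<Longrightarrow> \<bar>Im \<tau>\<bar> \<ge> Y1 \<Longrightarrow> ball (\<gamma>m (zz \<tau>)) (1 / \<bar>Im \<tau>\<bar> ^ k1) \<subseteq> V \<and> hol (quot G a H H0) (ball (\<gamma>m (zz \<tau>)) (1 / \<bar>Im \<tau>\<bar> ^ k1)) \<and>
   (\<forall>x\<in>ball (\<gamma>m (zz \<tau>)) (1 / \<bar>Im \<tau>\<bar> ^ k1). norm (quot G a H H0 x) \<le> \<bar>Im \<tau>\<bar> ^ k1 \<and> G x - a = (H x - H0) * quot G a H H0 x)"
   using c1.division_col by blast
  show ?thesis by (rule that[OF *(1)]) (use * in \<open>force simp: good_def Q_def\<close>)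
 qed
 obtain Y2 k2 where d2: "Y2 \<ge> 1" "\<And>\<tau>. \<bar>Re \<tau>\<bar> \<le> 7 \<Longrightarrow> \<bar>Im \<tau>\<bar> \<ge> Y2 \<Longrightarrow> good (\<gamma>p (zz \<tau>)) (1 / \<bar>Im \<tau>\<bar> ^ k2) \<and> (\<forall>x\<in>ball (\<gamma>p (zz \<tau>)) (1 / \<bar>Im \<tau>\<bar> ^ k2). norm (Q x) \<le> \<bar>Im \<tau>\<bar> ^ k2)"
 proof -
  obtain Y2 k2 where *: "Y2 \<ge> 1" "\<And>\<tau>. \<bar>Re \<tau>\<bar> \<le> 7 \<Longrightarrow> \<bar>Im \<tau>\<bar> \<ge> Y2 \<Longrightarrow> ball (\<gamma>p (zz \<tau>)) (1 / \<bar>Im \<tau>\<bar> ^ k2) \<subseteq> V \<and> hol (quot G a H H0) (ball (\<gamma>p (zz \<tau>)) (1 / \<bar>Im \<tau>\<bar> ^ k2)) \<and>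
   (\<forall>x\<in>ball (\<gamma>p (zz \<tau>)) (1 / \<bar>Im \<tau>\<bar> ^ k2). norm (quot G a H H0 x) \<le> \<bar>Im \<tau>\<bar> ^ k2 \<and> G x - a = (H x - H0) * quot G a H H0 x)"
   using c2.division_col by blast
  show ?thesis by (rule that[OF *(1)]) (use * in \<open>force simp: good_def Q_def\<close>)
 qed
 have shrink: "x \<in> ball u (1 / t ^ i) \<and> t ^ i \<le> t ^ j" if "x \<in> ball u (1 / t ^ j)" "i \<le> j" "t \<ge> 1" for x u :: "complex^4" and t :: real and i j
 proof -
  have "t ^ i \<le> t ^ j" using that by (intro power_increasing)
  moreover from this have "1 / t ^ j \<le> 1 / t ^ i" using that(3) by (intro divide_left_mono) auto
  ultimately show ?thesis using that(1) by auto
 qed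
 have "GGV Q V1 (max k1 k2) (Max {Y, Y1, Y2})"
  unfolding GGV_def
 proof (intro conjI allI impI ballI)
  show "Y0 \<le> Max {Y, Y1, Y2}" using V(7) by auto
  show "open V1" unfolding V1_def by (intro open_Union) auto
  show "V1 \<subseteq> V0" using V(2) by (auto simp: V1_def good_def)
  show "hol Q V1" unfolding hol_def by (auto simp: V1_def good_def hol_def)
  show "\<gamma>m z \<in> V1" if "z \<in> m.W" for z using g1[OF that] goodV1 by (metis centre_in_ball good_def subsetD)
  show "\<gamma>p z \<in> V1" if "z \<in> p.W" for z using g2[OF that] goodV1 by (metis centre_in_ball good_def subsetD)
  show "dd Q x (ham_vf H x) = 0" if x: "x \<in> V1" for x
  proof -
   obtain u s where us: "good u s" "x \<in> ball u s" using x by (auto simp: V1_def)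
   show ?thesis
    by (rule dd_quotient_zero[of "ball u s" G Q a x]) (use us V hol_subset[OF V(3)] in \<open>auto simp: good_def subset_iff\<close>)
  qed
  fix \<tau> x assume \<tau>: "\<bar>Re \<tau>\<bar> \<le> 7" "Max {Y, Y1, Y2} \<le> \<bar>Im \<tau>\<bar>"
   and x: "x \<in> ball (\<gamma>m (zz \<tau>)) (1 / \<bar>Im \<tau>\<bar> ^ max k1 k2) \<union> ball (\<gamma>p (zz \<tau>)) (1 / \<bar>Im \<tau>\<bar> ^ max k1 k2)"
  have y: "\<bar>Im \<tau>\<bar> \<ge> Y1" "\<bar>Im \<tau>\<bar> \<ge> Y2" "\<bar>Im \<tau>\<bar> \<ge> 1" using \<tau>(2) d1(1) by auto
  have "x \<in> V1 \<and> norm (Q x) \<le> \<bar>Im \<tau>\<bar> ^ max k1 k2"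
  proof (cases "x \<in> ball (\<gamma>m (zz \<tau>)) (1 / \<bar>Im \<tau>\<bar> ^ max k1 k2)")
   case True
   from shrink[OF True max.cobounded1 y(3)] d1(2)[OF \<tau>(1) y(1)] show ?thesis using goodV1 order_trans by (meson subsetD)
  next
   case False
   hence "x \<in> ball (\<gamma>p (zz \<tau>)) (1 / \<bar>Im \<tau>\<bar> ^ max k1 k2)" using x by blast
   from shrink[OF this max.cobounded2 y(3)] d2(2)[OF \<tau>(1) y(2)] show ?thesis using goodV1 order_trans by (meson subsetD)
  qed
  thus "x \<in> V1" "norm (Q x) \<le> \<bar>Im \<tau>\<bar> ^ max k1 k2" by auto
 qed
 hence "GG Q" by (auto simp: GG_def)
 moreover have "\<exists>s>0. ball (\<gamma>m z) s \<subseteq> V0 \<and> hol G (ball (\<gamma>m z) s) \<and> hol Q (ball (\<gamma>m z) s) \<and> (\<forall>x\<in>ball (\<gamma>m z) s. G x - a = (H x - H0) * Q x)" if "z \<in> m.W" for z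
 proof -
  obtain s where "good (\<gamma>m z) s" using g1[OF \<open>z \<in> m.W\<close>] by blast
  thus ?thesis using V(2) hol_subset[OF V(3), of "ball (\<gamma>m z) s"] by (intro exI[of _ s]) (auto simp: good_def)
 qed
 ultimately show ?thesis using that unfolding Q_def by blast
qed

text \<open>In dG = (H - H0) dQ + Q dH the second term is proportional to dH and drops out of the
  minors.\<close>

lemma minor_quotient:
 assumes "open A" "A \<subseteq> V0" "hol G A" "hol Q A" "\<And>x. x \<in> A \<Longrightarrow> G x - a = (H x - H0) * Q x" "x \<in> A"
 shows "minor G H i j x = (H x - H0) * minor Q H i j x"
proof -
 have hH: "hol H A" using hol_subset[OF m.holH assms(2)] .
 have hHm: "hol (\<lambda>x. H x - H0) A" by (rule hol_diff[OF hH hol_const])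
 have "dd G x v = (H x - H0) * dd Q x v + dd H x v * Q x" for v
 proof -
  have "dd G x v = dd (\<lambda>x. a + (H x - H0) * Q x) x v"
   by (rule hol_transform(2)[symmetric, OF assms(3,1) _ assms(6)]) (use assms(5) in \<open>simp add: algebra_simps\<close>)
  thus ?thesis by (simp add: dd_plus[OF hol_const hol_mult[OF hHm assms(4)] assms(6)] dd_mult[OF hHm assms(4,6)] dd_minus[OF hH hol_const assms(6)])
 qed
 hence "pdiff k G x = (H x - H0) * pdiff k Q x + pdiff k H x * Q x" for k unfolding pdiff_dd .
 thus ?thesis by (simp add: minor_def) (simp add: algebra_simps)
qed

lemma hol_minor: "open A \<Longrightarrow> hol G A \<Longrightarrow> hol H A \<Longrightarrow> hol (minor G H i j) A"
 unfolding minor_def[abs_def] by (intro hol_diff hol_mult hol_pdiff)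

lemma minor_order:
 assumes "GG G" "z \<in> m.W"
 shows "\<exists>s>0. \<exists>g. hol g (ball (\<gamma>m z) s) \<and> (\<forall>x\<in>ball (\<gamma>m z) s. minor G H i j x = (H x - H0) ^ N * g x)"
 using assms(1)
proof (induction N arbitrary: G)
 case 0
 from GG_divide[OF this] obtain s where s: "s > 0" "ball (\<gamma>m z) s \<subseteq> V0" "hol G (ball (\<gamma>m z) s)" using assms(2) by metis
 hence "hol (minor G H i j) (ball (\<gamma>m z) s)" by (intro hol_minor hol_subset[OF m.holH] open_ball)
 thus ?case using s by auto
next
 case (Suc N)
 obtain a where a: "GG (quot G a H H0)"
  "\<exists>s>0. ball (\<gamma>m z) s \<subseteq> V0 \<and> hol G (ball (\<gamma>m z) s) \<and> hol (quot G a H H0) (ball (\<gamma>m z) s) \<and> (\<forall>x\<in>ball (\<gamma>m z) s. G x - a = (H x - H0) * quot G a H H0 x)"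
  using GG_divide[OF Suc.prems] assms(2) by metis
 obtain s1 g where 1: "s1 > 0" "hol g (ball (\<gamma>m z) s1)" "\<And>x. x \<in> ball (\<gamma>m z) s1 \<Longrightarrow> minor (quot G a H H0) H i j x = (H x - H0) ^ N * g x"
  using Suc.IH[OF a(1)] by blast
 obtain s2 where 2: "s2 > 0" "ball (\<gamma>m z) s2 \<subseteq> V0" "hol G (ball (\<gamma>m z) s2)" "hol (quot G a H H0) (ball (\<gamma>m z) s2)"
  "\<And>x. x \<in> ball (\<gamma>m z) s2 \<Longrightarrow> G x - a = (H x - H0) * quot G a H H0 x" using a(2) by blast
 have "minor G H i j x = (H x - H0) ^ Suc N * g x" if "x \<in> ball (\<gamma>m z) (min s1 s2)" for x
  using minor_quotient[OF open_ball 2(2-5), of x i j] 1(3)[of x] that by simp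
 moreover have "hol g (ball (\<gamma>m z) (min s1 s2))" by (rule hol_subset[OF 1(2)]) auto
 ultimately show ?case using 1(1) 2(1) by (intro exI[of _ "min s1 s2"]) auto
qed

theorem dependent:
 assumes "GG G" "open V" "hol G V" "z \<in> m.W" "\<gamma>m z \<in> V"
 shows "\<not> functionally_independent_on G H V"
proof
 assume ind: "functionally_independent_on G H V"
 have Hz: "H (\<gamma>m z) = H0" by (rule m.H\<gamma>[OF assms(4)])
 obtain s where s: "s > 0" "ball (\<gamma>m z) s \<subseteq> V \<inter> V0"
  using openE[of "V \<inter> V0" "\<gamma>m z"] assms(2,5) m.V0 m.\<gamma>_V0[OF assms(4)] by blast
 have hh: "hol G (ball (\<gamma>m z) s)" "hol H (ball (\<gamma>m z) s)" using hol_subset[OF assms(3)] hol_subset[OF m.holH] s(2) by blast+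
 obtain y i j where y: "y \<in> ball (\<gamma>m z) s" "minor G H i j y \<noteq> 0"
  using independent_imp_minor[OF ind open_ball, of "\<gamma>m z"] s(1) assms(5) by (metis centre_in_ball)
 have "minor G H i j y = 0"
  by (rule minor_flat_zero[OF s(1) hol_minor[OF open_ball hh] hh(2) _ y(1)]) (use minor_order[OF assms(1,4)] Hz in simp)
 thus False using y(2) by blast
qed

end

section \<open>Asymptotics of a separatrix\<close>

text \<open>If the argument of w = tau + r were at most theta < pi/4 in modulus, then |Im w| \<le>
  Re w, which the sector excludes.\<close>

lemma Lset_subset_Dminus:
 assumes "0 < \<theta>" "\<theta> < pi / 4" "r \<le> R"
 shows "Lset 1 R \<subseteq> Dminus \<theta> r"
proof
 fix \<tau> assume "\<tau> \<in> Lset 1 R"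
 define w where "w = \<tau> + of_real r"
 have w: "Re w < \<bar>Im w\<bar>" using \<open>\<tau> \<in> _\<close> assms(3) by (simp add: Lset_def w_def)
 have "\<bar>Arg w\<bar> > \<theta>"
 proof (rule ccontr)
  assume "\<not> \<bar>Arg w\<bar> > \<theta>"
  define a where "a = \<bar>Arg w\<bar>"
  have a: "0 \<le> a" "a \<le> pi / 4" using \<open>\<not> _\<close> assms by (auto simp: a_def)
  have "sin a \<le> sin (pi / 4)" by (rule sin_monotone_2pi_le) (use a in auto)
  also have "\<dots> = cos (pi / 4)" by (simp add: sin_45 cos_45)
  also have "\<dots> \<le> cos a" by (rule cos_monotone_0_pi_le) (use a in auto)
  finally have sc: "sin a \<le> cos a" .
  have sa: "\<bar>sin (Arg w)\<bar> \<le> sin a"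
   using sin_ge_zero[of a] a unfolding a_def by (cases "Arg w \<ge> 0") auto
  have "w = rcis (norm w) (Arg w)" by (simp add: rcis_cmod_Arg)
  hence "Re w = norm w * cos (Arg w)" "Im w = norm w * sin (Arg w)" by (metis Re_rcis, metis Im_rcis)
  moreover have "cos (Arg w) = cos a" by (simp add: a_def)
  moreover have "norm w * \<bar>sin (Arg w)\<bar> \<le> norm w * cos a" using sa sc by (intro mult_left_mono) auto
  ultimately have "\<bar>Im w\<bar> \<le> Re w" by (simp add: abs_mult)
  thus False using w by simp
 qed
 thus "\<tau> \<in> Dminus \<theta> r" by (simp add: Dminus_def w_def)
qed

lemma Lset_subset_Dplus:
 assumes "0 < \<theta>" "\<theta> < pi / 4" "r \<le> R"
 shows "Lset (- 1) R \<subseteq> Dplus \<theta> r"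
proof
 fix \<tau> assume "\<tau> \<in> Lset (- 1) R"
 hence "- \<tau> \<in> Lset 1 R" by (simp add: Lset_def)
 hence "- \<tau> \<in> Dminus \<theta> r" using Lset_subset_Dminus[OF assms] by blast
 thus "\<tau> \<in> Dplus \<theta> r" unfolding Dplus_def by (rule image_eqI[rotated]) simp
qed

lemma Lset_norm: "\<sigma> = 1 \<or> \<sigma> = -1 \<Longrightarrow> \<tau> \<in> Lset \<sigma> R \<Longrightarrow> R / 2 \<le> norm \<tau>"
 using abs_Re_le_cmod[of \<tau>] abs_Im_le_cmod[of \<tau>] by (auto simp: Lset_def)

text \<open>Multiplied by exp (- i k0 t), with k0 the lowest frequency, a trigonometric polynomial
  becomes an ordinary polynomial on the unit circle. Its constant coefficient is nonzero, so it
  cannot vanish on that infinite set.\<close>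

lemma trig_eval_nonzero:
 assumes "p \<noteq> 0"
 obtains \<psi> :: real where "trig_eval p (of_real \<psi>) \<noteq> 0"
proof -
 define K where "K = Poly_Mapping.keys p"
 have K: "finite K" "K \<noteq> {}" using assms by (auto simp: K_def)
 define k0 where "k0 = Min K"
 define P where "P = (\<Sum>k\<in>K. monom (Poly_Mapping.lookup p k) (nat (k - k0)))"
 have k0: "k0 \<in> K" "\<And>k. k \<in> K \<Longrightarrow> k0 \<le> k" using K by (auto simp: k0_def)
 have "coeff P 0 = (\<Sum>k\<in>K. if k = k0 then Poly_Mapping.lookup p k else 0)"
  unfolding P_def coeff_sum
 proof (rule sum.cong[OF refl])
  fix k assume "k \<in> K"
  from k0(2)[OF this] show "coeff (monom (Poly_Mapping.lookup p k) (nat (k - k0))) 0 = (if k = k0 then Poly_Mapping.lookup p k else 0)"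
   by auto
 qed
 also have "\<dots> = Poly_Mapping.lookup p k0" using K k0 by simp
 finally have "coeff P 0 = Poly_Mapping.lookup p k0" .
 moreover have "Poly_Mapping.lookup p k0 \<noteq> 0" using k0(1) unfolding K_def by (simp add: in_keys_iff)
 ultimately have P: "P \<noteq> 0" by auto
 have ev: "exp (- \<i> * of_int k0 * of_real t) * trig_eval p (of_real t) = poly P (cis t)" for t
 proof -
  have "exp (- \<i> * of_int k0 * of_real t) * trig_eval p (of_real t) = (\<Sum>k\<in>K. Poly_Mapping.lookup p k * cis t ^ nat (k - k0))"
   unfolding trig_eval_def K_def[symmetric] sum_distrib_left
  proof (rule sum.cong[OF refl])
   fix k assume "k \<in> K"
   have "cis t ^ nat (k - k0) = exp (of_nat (nat (k - k0)) * (\<i> * of_real t))"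
    by (simp add: cis_conv_exp exp_of_nat_mult)
   also have "of_nat (nat (k - k0)) = (of_int (k - k0) :: complex)" using k0(2)[OF \<open>k \<in> K\<close>] by (simp add: of_nat_nat)
   also have "exp (of_int (k - k0) * (\<i> * of_real t)) = exp (- \<i> * of_int k0 * of_real t) * exp (\<i> * of_int k * of_real t)"
    unfolding exp_add[symmetric] by (simp add: algebra_simps)
   finally show "exp (- \<i> * of_int k0 * of_real t) * (Poly_Mapping.lookup p k * exp (\<i> * of_int k * of_real t)) = Poly_Mapping.lookup p k * cis t ^ nat (k - k0)"
    by simp
  qed
  thus ?thesis by (simp add: P_def poly_sum poly_monom)
 qed
 have "\<exists>t. poly P (cis t) \<noteq> 0"
 proof (rule ccontr)
  assume "\<not> (\<exists>t. poly P (cis t) \<noteq> 0)"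
  hence "range cis \<subseteq> {x. poly P x = 0}" by auto
  hence fin: "finite (range cis)" using poly_roots_finite[OF P] finite_subset by blast
  \<comment> \<open>The circle is infinite: a finite connected set has at most one point, but 1 and
    -1 both lie on it.\<close>
  have "connected (range cis)" by (intro connected_continuous_image continuous_intros) (auto simp: convex_connected)
  then obtain x where "range cis \<subseteq> {x}" using connected_finite_iff_sing[of "range cis"] fin by auto
  moreover have "cis 0 = 1" "cis pi = -1" by auto
  ultimately show False by (metis one_neq_neg_one rangeI singletonD subsetD)
 qed
 thus ?thesis using ev that by (metis mult_zero_right)
qed

text \<open>One of the solutions Gamma^- and Gamma^+, treated alike through sigma; \<open>r0\<close>
  is the value of R from which the sector lies in the domain of the solution.\<close>

locale branch =
 fixes \<eta> :: complex and F :: "complex ^ 4 \<Rightarrow> complex" and U :: "(complex ^ 4) set" and h r0 :: real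
  and Dom :: "complex set" and \<Gamma>f :: "trig_poly fps ^ 4" and \<Gamma> :: "complex \<Rightarrow> complex \<Rightarrow> complex ^ 4" and \<sigma> :: real
 assumes holF: "hol F U" and U: "open U" "0 \<in> U" and h: "h > 0"
  and sepa: "analytic_separatrix U (ham \<eta> F) h Dom \<Gamma>f \<Gamma>"
  and form: "\<exists>g1 g2 g3 g4. \<Gamma>f = vector [fps_X ^ 2 * g1, fps_X ^ 2 * g2, fps_X * g3, fps_X * g4]"
  and sig: "\<sigma> = 1 \<or> \<sigma> = -1" and Dom: "\<And>R. r0 \<le> R \<Longrightarrow> Lset \<sigma> R \<subseteq> Dom"
begin

definition \<gamma> :: "complex ^ 2 \<Rightarrow> complex ^ 4" where "\<gamma> z = \<Gamma> (z $ 1) (z $ 2)"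
abbreviation "H \<equiv> ham \<eta> F"
abbreviation "S \<equiv> {z :: complex ^ 2. z $ 1 \<in> strip h \<and> z $ 2 \<in> Dom}"

lemma hol_H: "hol H U" by (rule hol_rem(2)[OF holF])

lemma vhol_\<gamma>: "vhol \<gamma> S"
 using sepa mv_analytic_imp_hol by (auto simp: vhol_def analytic_separatrix_def \<gamma>_def)

lemma \<gamma>_vector [simp]: "\<gamma> (vector [\<phi>, \<tau>]) = \<Gamma> \<phi> \<tau>" by (simp add: \<gamma>_def)

lemma vdd_dphi: "\<phi> \<in> strip h \<Longrightarrow> \<tau> \<in> Dom \<Longrightarrow> vdd \<gamma> (vector [\<phi>, \<tau>]) e1 = dphi \<Gamma> \<phi> \<tau>"
 and DERIV_\<phi>: "\<phi> \<in> strip h \<Longrightarrow> \<tau> \<in> Dom \<Longrightarrow> ((\<lambda>s. \<Gamma> s \<tau> $ i) has_field_derivative vdd \<gamma> (vector [\<phi>, \<tau>]) e1 $ i) (at \<phi>)"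
proof -
 assume a: "\<phi> \<in> strip h" "\<tau> \<in> Dom"
 have e: "vector [0, \<tau>] + s *s e1 = vector [s, \<tau>]" for s by (simp add: vec_eq_iff forall_2)
 have "(vector [0, \<tau>] + \<phi> *s e1 :: complex^2) \<in> S" using a by (simp add: e)
 from vhol_line[OF vhol_\<gamma> this, of _ UNIV] have d: "((\<lambda>s. \<Gamma> s \<tau> $ i) has_field_derivative vdd \<gamma> (vector [\<phi>, \<tau>]) e1 $ i) (at \<phi>)" for i
  by (simp add: e)
 thus "((\<lambda>s. \<Gamma> s \<tau> $ i) has_field_derivative vdd \<gamma> (vector [\<phi>, \<tau>]) e1 $ i) (at \<phi>)" .
 show "vdd \<gamma> (vector [\<phi>, \<tau>]) e1 = dphi \<Gamma> \<phi> \<tau>" using DERIV_imp_deriv[OF d] by (simp add: dphi_def vec_eq_iff)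
qed

lemma vdd_dtau: "\<phi> \<in> strip h \<Longrightarrow> \<tau> \<in> Dom \<Longrightarrow> vdd \<gamma> (vector [\<phi>, \<tau>]) (axis 2 1) = dtau \<Gamma> \<phi> \<tau>"
 and DERIV_\<tau>: "\<phi> \<in> strip h \<Longrightarrow> \<tau> \<in> Dom \<Longrightarrow> ((\<lambda>t. \<Gamma> \<phi> t $ i) has_field_derivative vdd \<gamma> (vector [\<phi>, \<tau>]) (axis 2 1) $ i) (at \<tau>)"
proof -
 assume a: "\<phi> \<in> strip h" "\<tau> \<in> Dom"
 have e: "vector [\<phi>, 0] + s *s axis 2 1 = (vector [\<phi>, s] :: complex^2)" for s by (simp add: vec_eq_iff forall_2 axis_def)
 have "(vector [\<phi>, 0] + \<tau> *s axis 2 1 :: complex^2) \<in> S" using a by (simp add: e)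
 from vhol_line[OF vhol_\<gamma> this, of _ UNIV] have d: "((\<lambda>s. \<Gamma> \<phi> s $ i) has_field_derivative vdd \<gamma> (vector [\<phi>, \<tau>]) (axis 2 1) $ i) (at \<tau>)" for i
  by (simp add: e)
 thus "((\<lambda>s. \<Gamma> \<phi> s $ i) has_field_derivative vdd \<gamma> (vector [\<phi>, \<tau>]) (axis 2 1) $ i) (at \<tau>)" .
 show "vdd \<gamma> (vector [\<phi>, \<tau>]) (axis 2 1) = dtau \<Gamma> \<phi> \<tau>" using DERIV_imp_deriv[OF d] by (simp add: dtau_def vec_eq_iff)
qed

lemma vdd_e11: "vdd \<gamma> z e11 = vdd \<gamma> z e1 + vdd \<gamma> z (axis 2 1)"
proof -
 have "e11 = e1 + axis 2 1" by (simp add: vec_eq_iff forall_2 axis_def)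
 thus ?thesis by (metis vdd_add)
qed

lemma pde_\<gamma>: "z \<in> S \<Longrightarrow> vdd \<gamma> z e11 = ham_vf H (\<gamma> z)"
proof -
 assume z: "z \<in> S"
 have "z = vector [z $ 1, z $ 2]" by (simp add: vec_eq_iff forall_2)
 hence "vdd \<gamma> z e11 = dphi \<Gamma> (z $ 1) (z $ 2) + dtau \<Gamma> (z $ 1) (z $ 2)"
  using vdd_e11[of z] vdd_dphi[of "z $ 1" "z $ 2"] vdd_dtau[of "z $ 1" "z $ 2"] z by simp
 thus ?thesis using sepa z by (simp add: analytic_separatrix_def \<gamma>_def)
qed

lemma DD_sub: "r0 \<le> R \<Longrightarrow> DD h \<sigma> R \<subseteq> S"
 using Dom by (auto simp: DD_def strip_def)

lemma low_coeffs: "fps_nth (\<Gamma>f $ j) k = 0" if "k < wt j"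
proof -
 obtain g1 g2 g3 g4 where g: "\<Gamma>f = vector [fps_X ^ 2 * g1, fps_X ^ 2 * g2, fps_X * g3, fps_X * g4]" using form by blast
 have "j = 1 \<or> j = 2 \<or> j = 3 \<or> j = 4" using exhaust_4 by blast
 thus ?thesis using that by (auto simp: g fps_X_power_mult_nth)
qed

text \<open>One pair of constants for all components, but a truncation order for each: the order
  \<open>wt\<close> yields the weighted decay, a constant order the leading term.\<close>

lemma expansion_bound:
 "\<exists>C R. C > 0 \<and> R > 0 \<and> (\<forall>\<phi>\<in>strip h. \<forall>\<tau>\<in>Dom. R \<le> norm \<tau> \<longrightarrow> (\<forall>j.
   norm (\<Gamma> \<phi> \<tau> $ j - (\<Sum>k<N j. trig_eval (fps_nth (\<Gamma>f $ j) k) \<phi> / \<tau> ^ k)) \<le> C / norm \<tau> ^ N j))"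
proof -
 have "\<exists>C R. R > 0 \<and> (\<forall>\<phi>\<in>strip h. \<forall>\<tau>\<in>Dom. R \<le> norm \<tau> \<longrightarrow>
   norm (\<Gamma> \<phi> \<tau> $ j - (\<Sum>k<N j. trig_eval (fps_nth (\<Gamma>f $ j) k) \<phi> / \<tau> ^ k)) \<le> C / norm \<tau> ^ N j)" for j
  using sepa unfolding analytic_separatrix_def asymptotic_expansion_def by blast
 then obtain C R where CR: "\<And>j. R j > 0" "\<And>j \<phi> \<tau>. \<phi> \<in> strip h \<Longrightarrow> \<tau> \<in> Dom \<Longrightarrow> R j \<le> norm \<tau> \<Longrightarrow>
   norm (\<Gamma> \<phi> \<tau> $ j - (\<Sum>k<N j. trig_eval (fps_nth (\<Gamma>f $ j) k) \<phi> / \<tau> ^ k)) \<le> C j / norm \<tau> ^ N j"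
  by metis
 define C' where "C' = (\<Sum>j\<in>UNIV. \<bar>C j\<bar>) + 1"
 have C': "C j \<le> C'" for j
 proof -
  have "\<bar>C j\<bar> \<le> (\<Sum>j\<in>UNIV. \<bar>C j\<bar>)" by (rule member_le_sum) auto
  thus ?thesis by (simp add: C'_def)
 qed
 have R: "R j \<le> (\<Sum>j\<in>UNIV. R j)" for j by (rule member_le_sum) (use CR(1) in \<open>auto intro: less_imp_le\<close>)
 show ?thesis
 proof (rule exI[of _ C'], rule exI[of _ "\<Sum>j\<in>UNIV. R j"], intro conjI ballI impI allI)
  show "C' > 0" unfolding C'_def by (intro add_nonneg_pos sum_nonneg) auto
  show "(\<Sum>j\<in>UNIV. R j) > 0" using CR(1) by (intro sum_pos) auto
  fix \<phi> \<tau> j assume a: "\<phi> \<in> strip h" "\<tau> \<in> Dom" "(\<Sum>j\<in>UNIV. R j) \<le> norm \<tau>"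
  show "norm (\<Gamma> \<phi> \<tau> $ j - (\<Sum>k<N j. trig_eval (fps_nth (\<Gamma>f $ j) k) \<phi> / \<tau> ^ k)) \<le> C' / norm \<tau> ^ N j"
   by (rule order_trans[OF CR(2)[OF a(1,2) order_trans[OF R a(3)]] divide_right_mono[OF C']]) simp
 qed
qed

lemma weighted_decay:
 "\<exists>C R. C > 0 \<and> R > 0 \<and> (\<forall>\<phi>\<in>strip h. \<forall>\<tau>\<in>Dom. R \<le> norm \<tau> \<longrightarrow> (\<forall>j. norm (\<Gamma> \<phi> \<tau> $ j) \<le> C / norm \<tau> ^ wt j))"
proof -
 have "(\<Sum>k<wt j. trig_eval (fps_nth (\<Gamma>f $ j) k) \<phi> / \<tau> ^ k) = 0" for j \<phi> \<tau>
  by (rule sum.neutral) (simp add: low_coeffs trig_eval_def)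
 thus ?thesis using expansion_bound[of wt] by simp
qed

lemma decay:
 assumes "e > 0"
 shows "\<exists>R>0. \<forall>\<phi>\<in>strip h. \<forall>\<tau>\<in>Dom. R \<le> norm \<tau> \<longrightarrow> norm (\<Gamma> \<phi> \<tau>) < e"
proof -
 obtain C R where CR: "C > 0" "R > 0" "\<And>\<phi> \<tau> j. \<phi> \<in> strip h \<Longrightarrow> \<tau> \<in> Dom \<Longrightarrow> R \<le> norm \<tau> \<Longrightarrow> norm (\<Gamma> \<phi> \<tau> $ j) \<le> C / norm \<tau> ^ wt j"
  using weighted_decay by metis
 show ?thesis
 proof (rule exI[of _ "Max {R, 1, 4 * C / e + 1}"], intro conjI ballI impI)
  show "Max {R, 1, 4 * C / e + 1} > 0" by (auto simp: max_def)
  fix \<phi> \<tau> assume a: "\<phi> \<in> strip h" "\<tau> \<in> Dom" "Max {R, 1, 4 * C / e + 1} \<le> norm \<tau>"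
  have t: "R \<le> norm \<tau>" "1 \<le> norm \<tau>" "4 * C / e + 1 \<le> norm \<tau>" using a(3) by auto
  have "norm (\<Gamma> \<phi> \<tau> $ j) \<le> C / norm \<tau>" for j
  proof -
   have "norm \<tau> ^ 1 \<le> norm \<tau> ^ wt j" using t by (intro power_increasing) (auto simp: wt_def)
   hence "C / norm \<tau> ^ wt j \<le> C / norm \<tau>" using t(2) CR(1) by (intro divide_left_mono) (auto intro!: mult_pos_pos zero_less_power)
   thus ?thesis using CR(3)[OF a(1,2) t(1), of j] by linarith
  qed
  hence "norm (\<Gamma> \<phi> \<tau>) \<le> 4 * (C / norm \<tau>)" by (rule norm_le_4_mult)
  moreover have "4 * (C / norm \<tau>) < e"
  proof -
   have "4 * C < e * norm \<tau>" using t(3) assms by (simp add: field_simps)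
   moreover have "norm \<tau> > 0" using t(2) by linarith
   ultimately show ?thesis by (simp add: field_simps)
  qed
  ultimately show "norm (\<Gamma> \<phi> \<tau>) < e" by linarith
 qed
qed

lemma sep0I:
 assumes "e > 0" "e \<le> r1" "ball 0 r1 \<subseteq> U"
 shows "\<exists>R1\<ge>r0. \<forall>R\<ge>R1. sep0 H (ball 0 r1) \<gamma> h \<sigma> R \<and> (\<forall>z\<in>DD h \<sigma> R. norm (\<gamma> z) < e)"
proof -
 obtain R where R: "R > 0" "\<And>\<phi> \<tau>. \<phi> \<in> strip h \<Longrightarrow> \<tau> \<in> Dom \<Longrightarrow> R \<le> norm \<tau> \<Longrightarrow> norm (\<Gamma> \<phi> \<tau>) < e" using decay[OF assms(1)] by metis
 show ?thesis
 proof (rule exI[of _ "max r0 (2 * R)"], intro conjI allI impI)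
  fix R' assume "max r0 (2 * R) \<le> R'"
  hence R': "r0 \<le> R'" "R \<le> R' / 2" by auto
  note sub = DD_sub[OF R'(1)]
  have small: "norm (\<gamma> z) < e" if z: "z \<in> DD h \<sigma> R'" for z
  proof -
   have "z \<in> S" using sub z by blast
   moreover have "R \<le> norm (z $ 2)" using Lset_norm[OF sig, of "z $ 2" R'] z R'(2) by (simp add: DD_def)
   ultimately show ?thesis using R(2) by (simp add: \<gamma>_def)
  qed
  thus "\<forall>z\<in>DD h \<sigma> R'. norm (\<gamma> z) < e" by blast
  show "sep0 H (ball 0 r1) \<gamma> h \<sigma> R'"
  proof
   show "hol H (ball 0 r1)" by (rule hol_subset[OF hol_H assms(3)])
   show "vhol \<gamma> (DD h \<sigma> R')" by (rule vhol_subset[OF vhol_\<gamma> sub])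
   show "\<gamma> z \<in> ball 0 r1" if "z \<in> DD h \<sigma> R'" for z using small[OF that] assms(2) by simp
   show "vdd \<gamma> z e11 = ham_vf H (\<gamma> z)" if "z \<in> DD h \<sigma> R'" for z using pde_\<gamma> sub that by blast
   show "\<gamma> (z + of_real (2 * pi) *s e1) = \<gamma> z" if "z \<in> DD h \<sigma> R'" for z
    using sepa sub that by (auto simp: analytic_separatrix_def \<gamma>_def)
  qed (use sig h in auto)
 qed simp
qed

lemma leading_term:
 assumes n: "\<And>k j. k < n \<Longrightarrow> fps_nth (\<Gamma>f $ j) k = 0"
 shows "\<exists>C R. C > 0 \<and> R > 0 \<and> (\<forall>\<phi>\<in>strip h. \<forall>\<tau>\<in>Dom. R \<le> norm \<tau> \<longrightarrow> (\<forall>j. norm (\<Gamma> \<phi> \<tau> $ j - trig_eval (fps_nth (\<Gamma>f $ j) n) \<phi> / \<tau> ^ n) \<le> C / norm \<tau> ^ Suc n))"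
proof -
 have "(\<Sum>k<n. trig_eval (fps_nth (\<Gamma>f $ j) k) \<phi> / \<tau> ^ k) = 0" for j \<phi> \<tau>
  by (rule sum.neutral) (simp add: n trig_eval_def)
 thus ?thesis using expansion_bound[of "\<lambda>_. Suc n"] by (simp del: power_Suc)
qed

end

section \<open>Difference of the two separatrices\<close>

text \<open>The eigencoordinates q1 + i q2, q1 - i q2, p1 + i p2, p1 - i p2 of the rotation
  generated by -I1, with eigenvalues i * sg j.\<close>

definition cb :: "4 \<Rightarrow> complex ^ 4 \<Rightarrow> complex" where
 "cb j d = (if j = 1 then d $ 1 + \<i> * d $ 2 else if j = 2 then d $ 1 - \<i> * d $ 2
   else if j = 3 then d $ 3 + \<i> * d $ 4 else d $ 3 - \<i> * d $ 4)"
definition sg :: "4 \<Rightarrow> real" where "sg j = (if j = 1 \<or> j = 3 then 1 else - 1)"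

lemma cb_simps [simp]: "cb 1 d = d $ 1 + \<i> * d $ 2" "cb 2 d = d $ 1 - \<i> * d $ 2" "cb 3 d = d $ 3 + \<i> * d $ 4" "cb 4 d = d $ 3 - \<i> * d $ 4"
 by (simp_all add: cb_def)
lemma sg_simps [simp]: "sg 1 = 1" "sg 2 = - 1" "sg 3 = 1" "sg 4 = - 1"
 by (simp_all add: sg_def)

lemma norm_cb_le: "norm (cb j d) \<le> 2 * norm d"
proof -
 have *: "norm (a + \<i> * b) \<le> norm a + norm b" "norm (a - \<i> * b) \<le> norm a + norm b" for a b
  using norm_triangle_ineq[of a "\<i> * b"] norm_triangle_ineq4[of a "\<i> * b"] by (simp_all add: norm_mult)
 have "norm (d $ i) + norm (d $ k) \<le> 2 * norm d" for i k using component_le[of d i] component_le[of d k] by simp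
 moreover have "j = 1 \<or> j = 2 \<or> j = 3 \<or> j = 4" using exhaust_4 by blast
 ultimately show ?thesis using *[of "d $ 1" "d $ 2"] *[of "d $ 3" "d $ 4"] by (auto intro: order_trans)
qed

lemma cb_component:
 assumes "\<And>j. norm (cb j d) \<le> \<kappa> j" "\<kappa> 1 = \<kappa> 2" "\<kappa> 3 = \<kappa> 4"
 shows "norm (d $ j) \<le> \<kappa> j"
proof -
 have half: "norm ((u + v) / 2) \<le> B" "norm ((u - v) / (2 * \<i>)) \<le> B" if "norm u \<le> B" "norm v \<le> B" for u v :: complex and B
  using norm_triangle_ineq[of u v] norm_triangle_ineq4[of u v] that by (auto simp: norm_divide norm_mult)
 have "d $ 1 = (cb 1 d + cb 2 d) / 2" "d $ 2 = (cb 1 d - cb 2 d) / (2 * \<i>)" "d $ 3 = (cb 3 d + cb 4 d) / 2" "d $ 4 = (cb 3 d - cb 4 d) / (2 * \<i>)"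
  by (simp_all add: cb_def field_simps)
 note d = this
 have "norm (d $ 1) \<le> \<kappa> 1" "norm (d $ 2) \<le> \<kappa> 2"
  unfolding d(1,2) using half[of "cb 1 d" "\<kappa> 1" "cb 2 d"] assms(1)[of 1] assms(1)[of 2] assms(2) by auto
 moreover have "norm (d $ 3) \<le> \<kappa> 3" "norm (d $ 4) \<le> \<kappa> 4"
  unfolding d(3,4) using half[of "cb 3 d" "\<kappa> 3" "cb 4 d"] assms(1)[of 3] assms(1)[of 4] assms(3) by auto
 moreover have "j = 1 \<or> j = 2 \<or> j = 3 \<or> j = 4" using exhaust_4 by blast
 ultimately show ?thesis by blast
qed

text \<open>Beyond the rotation H has weighted order 4, and a conjugate pair q, p has total weight
  3. The p-gradient thus has order 3, which drives q of weight 2, and the q-gradient order 2, which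
  drives p of weight 1. In both cases one order is gained, that is a factor 1/T with mu = C1 /
  T.\<close>

lemma weighted_lipschitz:
 assumes F: "hol F U" "open U" "0 \<in> U" and w: "weighted_order_ge F 5" and C0: "C0 > 0"
 shows "\<exists>C T0. C > 0 \<and> T0 > 0 \<and> (\<forall>T x y \<kappa>. T \<ge> T0 \<longrightarrow> \<kappa> \<ge> 0 \<longrightarrow> (\<forall>j. norm (x $ j) \<le> C0 / T ^ wt j) \<longrightarrow> (\<forall>j. norm (y $ j) \<le> C0 / T ^ wt j) \<longrightarrow>
   (\<forall>j. norm (x $ j - y $ j) \<le> \<kappa> / T ^ wt j) \<longrightarrow>
   (\<forall>j. T ^ wt j * norm (cb j (ham_vf (ham \<eta> F) x - ham_vf (ham \<eta> F) y) - \<i> * sg j * cb j (x - y)) \<le> C * \<kappa> / T))"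
proof -
 obtain M \<rho>0 where rb: "\<rho>0 > 0" "M > 0" "\<And>\<mu> x. 0 < \<mu> \<Longrightarrow> \<mu> \<le> 1 \<Longrightarrow> (\<And>j. norm (x $ j) \<le> \<rho>0 * \<mu> ^ wt j) \<Longrightarrow> norm (rem \<eta> F x) \<le> M * \<mu> ^ 4"
  using rem_bound[OF w, of \<eta>] by metis
 obtain r where r: "r > 0" "ball 0 r \<subseteq> U" using F openE by blast
 define \<rho> where "\<rho> = min \<rho>0 (r / 5)"
 have \<rho>: "\<rho> > 0" "\<rho> \<le> \<rho>0" "5 * \<rho> \<le> r" using rb r by (auto simp: \<rho>_def)
 define C1 where "C1 = max 1 (4 * C0 / \<rho>)"
 have C1: "C1 \<ge> 1" "4 * C0 \<le> \<rho> * C1" using \<rho> by (auto simp: C1_def max_def field_simps)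
 define K0 where "K0 = 64 * M / \<rho>\<^sup>2"
 have K0: "K0 > 0" using rb \<rho> by (simp add: K0_def)
 define C where "C = 2 * K0 * C1 ^ 3"
 have C: "C > 0" using K0 C1 by (simp add: C_def)
 have inU: "x \<in> U" if "0 < \<mu>" "\<mu> \<le> 1" "\<And>j. norm (x $ j) \<le> \<rho> * \<mu> ^ wt j" for \<mu> x
 proof -
  have "\<rho> * \<mu> ^ wt j \<le> \<rho> * 1" for j using that(1,2) \<rho>(1) by (intro mult_left_mono power_le_one) auto
  hence "norm (x $ j) \<le> \<rho>" for j using that(3)[of j] by (metis mult.right_neutral order_trans)
  hence "norm x \<le> 4 * \<rho>" by (rule norm_le_4_mult)
  thus ?thesis using r \<rho> by (auto simp: subset_iff)
 qed
 show ?thesis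
 proof (rule exI[of _ C], rule exI[of _ C1], intro conjI C allI impI)
  show "C1 > 0" using C1 by linarith
  fix T :: real and x y :: "complex^4" and \<kappa> :: real and j :: 4
  assume T: "C1 \<le> T" and \<kappa>: "0 \<le> \<kappa>" and x: "\<forall>j. norm (x $ j) \<le> C0 / T ^ wt j" and y: "\<forall>j. norm (y $ j) \<le> C0 / T ^ wt j"
   and d: "\<forall>j. norm (x $ j - y $ j) \<le> \<kappa> / T ^ wt j"
  have T0: "T > 0" using T C1 by linarith
  define \<mu> where "\<mu> = C1 / T"
  have \<mu>: "0 < \<mu>" "\<mu> \<le> 1" using T T0 C1 by (auto simp: \<mu>_def)
  have C1wt: "C1 \<le> C1 ^ wt j" for j using power_increasing[of 1 "wt j" C1] C1 by (simp add: wt_def)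
  have small: "C0 / T ^ wt j \<le> \<rho> * \<mu> ^ wt j / 4" for j
  proof -
   have "4 * C0 \<le> \<rho> * C1 ^ wt j" using C1 mult_left_mono[OF C1wt, of \<rho>] \<rho>(1) by (meson less_imp_le order_trans)
   thus ?thesis using T0 by (simp add: \<mu>_def power_divide field_simps)
  qed
  have lip: "norm (pdiff i (rem \<eta> F) x - pdiff i (rem \<eta> F) y) \<le> 64 * (M * \<mu> ^ 4) / (\<rho> * \<mu> ^ wt i) * (\<kappa> / \<rho>)" for i
  proof (rule pdiff_lipschitz_poly[OF hol_rem(1)[OF F(1)] F(2), where \<rho> = "\<lambda>j. \<rho> * \<mu> ^ wt j"])
   show "u \<in> U" if "\<And>j. norm (u $ j) \<le> \<rho> * \<mu> ^ wt j" for u by (rule inU[OF \<mu> that])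
   show "norm (rem \<eta> F u) \<le> M * \<mu> ^ 4" if "\<And>j. norm (u $ j) \<le> \<rho> * \<mu> ^ wt j" for u
   proof (rule rb(3)[OF \<mu>])
    fix j
    have "\<rho> * \<mu> ^ wt j \<le> \<rho>0 * \<mu> ^ wt j" using \<mu>(1) by (intro mult_right_mono[OF \<rho>(2)]) simp
    with that[of j] show "norm (u $ j) \<le> \<rho>0 * \<mu> ^ wt j" by (rule order_trans)
   qed
   show "norm (x $ j - y $ j) \<le> \<kappa> / \<rho> * (\<rho> * \<mu> ^ wt j)" for j
   proof -
    have "\<kappa> / T ^ wt j \<le> \<kappa> * C1 ^ wt j / T ^ wt j" using C1wt[of j] C1(1) \<kappa> T0 by (intro divide_right_mono) (auto simp: mult_le_cancel_left1)
    thus ?thesis using d[rule_format, of j] \<rho>(1) by (simp add: \<mu>_def power_divide)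
   qed
   show "norm (x $ j) \<le> \<rho> * \<mu> ^ wt j / 4" "norm (y $ j) \<le> \<rho> * \<mu> ^ wt j / 4" for j
    using order_trans[OF x[rule_format] small] order_trans[OF y[rule_format] small] by blast+
  qed (use \<rho> \<mu> \<kappa> in simp_all)
  have p1: "norm (pdiff i (rem \<eta> F) x - pdiff i (rem \<eta> F) y) \<le> K0 * \<mu> ^ 2 * \<kappa>" if "wt i = 2" for i
   using lip[of i] \<mu>(1) \<rho>(1) that by (simp add: K0_def power2_eq_square power4_eq_xxxx field_simps)
  have p3: "norm (pdiff i (rem \<eta> F) x - pdiff i (rem \<eta> F) y) \<le> K0 * \<mu> ^ 3 * \<kappa>" if "wt i = 1" for i
   using lip[of i] \<mu>(1) \<rho>(1) that by (simp add: K0_def power2_eq_square power3_eq_cube power4_eq_xxxx field_simps)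
  have tri: "norm (u + \<i> * v) \<le> 2 * B" "norm (u - \<i> * v) \<le> 2 * B" if "norm u \<le> B" "norm v \<le> B" for u v B
   using norm_triangle_ineq[of u "\<i> * v"] norm_triangle_ineq4[of u "\<i> * v"] that by (simp_all add: norm_mult)
  have xU: "x \<in> U" "y \<in> U"
  proof -
   have "\<rho> * \<mu> ^ wt j / 4 \<le> \<rho> * \<mu> ^ wt j" for j using \<rho>(1) \<mu>(1) by simp
   note le = order_trans[OF small this]
   show "x \<in> U" by (rule inU[OF \<mu> order_trans[OF x[rule_format] le]])
   show "y \<in> U" by (rule inU[OF \<mu> order_trans[OF y[rule_format] le]])
  qed
  let ?X = "ham_vf (ham \<eta> F)" and ?r = "\<lambda>i. pdiff i (rem \<eta> F) x - pdiff i (rem \<eta> F) y"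
  note vf = ham_vf_comp[OF F(1) xU(1), of \<eta>] ham_vf_comp[OF F(1) xU(2), of \<eta>]
  have e: "cb 1 (?X x - ?X y) - \<i> * sg 1 * cb 1 (x - y) = ?r 3 + \<i> * ?r 4"
    "cb 2 (?X x - ?X y) - \<i> * sg 2 * cb 2 (x - y) = ?r 3 - \<i> * ?r 4"
    "cb 3 (?X x - ?X y) - \<i> * sg 3 * cb 3 (x - y) = - (?r 1 + \<i> * ?r 2)"
    "cb 4 (?X x - ?X y) - \<i> * sg 4 * cb 4 (x - y) = - (?r 1 - \<i> * ?r 2)"
   by (simp_all add: vf algebra_simps)
  have e2: "T ^ 2 * (2 * (K0 * \<mu> ^ 3 * \<kappa>)) = C * \<kappa> / T"
   using T0 by (simp add: \<mu>_def C_def power_divide power2_eq_square power3_eq_cube)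
  have e1: "T * (2 * (K0 * \<mu> ^ 2 * \<kappa>)) \<le> C * \<kappa> / T"
  proof -
   have "T * (2 * (K0 * \<mu> ^ 2 * \<kappa>)) = 2 * K0 * C1 ^ 2 * \<kappa> / T" using T0 by (simp add: \<mu>_def power_divide power2_eq_square)
   also have "\<dots> \<le> 2 * K0 * C1 ^ 3 * \<kappa> / T"
    using T0 K0 \<kappa> C1 by (intro divide_right_mono mult_right_mono mult_left_mono power_increasing) auto
   finally show ?thesis by (simp add: C_def)
  qed
  have "j = 1 \<or> j = 2 \<or> j = 3 \<or> j = 4" using exhaust_4 by blast
  thus "T ^ wt j * norm (cb j (?X x - ?X y) - \<i> * sg j * cb j (x - y)) \<le> C * \<kappa> / T"
  proof (elim disjE)
   assume j: "j = 1"
   show ?thesis unfolding j e wt_simps e2[symmetric] by (intro mult_left_mono tri p3) (use T0 in auto)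
  next
   assume j: "j = 2"
   show ?thesis unfolding j e wt_simps e2[symmetric] by (intro mult_left_mono tri p3) (use T0 in auto)
  next
   assume j: "j = 3"
   have "T * norm (?r 1 + \<i> * ?r 2) \<le> T * (2 * (K0 * \<mu> ^ 2 * \<kappa>))" by (intro mult_left_mono tri p1) (use T0 in auto)
   thus ?thesis unfolding j e wt_simps norm_minus_cancel using e1 by simp
  next
   assume j: "j = 4"
   have "T * norm (?r 1 - \<i> * ?r 2) \<le> T * (2 * (K0 * \<mu> ^ 2 * \<kappa>))" by (intro mult_left_mono tri p1) (use T0 in auto)
   thus ?thesis unfolding j e wt_simps norm_minus_cancel using e1 by simp
  qed
 qed
qed

lemma has_vector_derivative_vec:
 fixes Y :: "real \<Rightarrow> complex ^ 'n"
 assumes "\<And>i. ((\<lambda>t. Y t $ i) has_vector_derivative Y' $ i) (at t)"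
 shows "(Y has_vector_derivative Y') (at t)"
proof -
 have "(Y has_derivative (\<lambda>h. \<chi> i. h *\<^sub>R (Y' $ i))) (at t)"
  using assms unfolding has_vector_derivative_def by (intro has_derivative_vec_components)
 moreover have "(\<lambda>h. \<chi> i. h *\<^sub>R (Y' $ i)) = (\<lambda>h. h *\<^sub>R Y')" by (simp add: fun_eq_iff vec_eq_iff)
 ultimately show ?thesis by (simp add: has_vector_derivative_def)
qed

lemma (in branch) DERIV_flow:
 assumes "z + of_real (s * t) *s e11 \<in> S"
 shows "((\<lambda>t. \<gamma> (z + of_real (s * t) *s e11) $ i) has_vector_derivative of_real s * ham_vf H (\<gamma> (z + of_real (s * t) *s e11)) $ i) (at t)"
proof -
 have zS: "z + (of_real s * of_real t) *s e11 \<in> S" using assms by simp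
 have "((\<lambda>u. \<gamma> (z + (of_real s * u) *s e11) $ i) has_field_derivative vdd \<gamma> (z + (of_real s * of_real t) *s e11) e11 $ i * of_real s) (at (of_real t))"
  by (rule DERIV_chain2[OF vhol_line[OF vhol_\<gamma> zS, of i UNIV] DERIV_cmult_Id])
 from has_vector_derivative_real_field[OF this] show ?thesis using pde_\<gamma>[OF zS] by (simp add: mult.commute)
qed

locale two_branches = m: branch \<eta> F U h r0 Dm \<Gamma>f \<Gamma>m 1 + p: branch \<eta> F U h r0 Dp \<Gamma>f \<Gamma>p "- 1"
 for \<eta> F U h r0 Dm Dp \<Gamma>f \<Gamma>m \<Gamma>p +
 fixes \<psi> :: real
 assumes w: "weighted_order_ge F 5"
begin

definition "\<Delta> \<tau> = \<Gamma>p (of_real \<psi>) \<tau> - \<Gamma>m (of_real \<psi>) \<tau>"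
definition "f j \<tau> = \<tau> ^ wt j * cb j (\<Delta> \<tau>)"

lemma Dom_both: "r0 \<le> R \<Longrightarrow> \<bar>Re \<tau>\<bar> < \<bar>Im \<tau>\<bar> - R \<Longrightarrow> \<tau> \<in> Dm \<and> \<tau> \<in> Dp"
proof -
 assume a: "r0 \<le> R" "\<bar>Re \<tau>\<bar> < \<bar>Im \<tau>\<bar> - R"
 hence "\<tau> \<in> Lset 1 R" "\<tau> \<in> Lset (- 1) R" by (auto simp: Lset_def)
 thus ?thesis using m.Dom[OF a(1)] p.Dom[OF a(1)] by blast
qed

lemma real_strip: "Im \<phi> = 0 \<Longrightarrow> \<phi> \<in> strip h" using m.h by (simp add: strip_def)

text \<open>Both solutions share one asymptotic expansion, and its partial sums cancel in the
  difference.\<close>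

lemma \<Delta>_flat: "\<exists>C R. R > 0 \<and> C > 0 \<and> (\<forall>\<tau>\<in>Dm \<inter> Dp. R \<le> norm \<tau> \<longrightarrow> norm (\<Delta> \<tau>) \<le> C / norm \<tau> ^ N)"
proof -
 let ?s = "\<lambda>j \<phi> \<tau>. (\<Sum>k<N. trig_eval (fps_nth (\<Gamma>f $ j) k) \<phi> / \<tau> ^ k)"
 obtain C1 R1 where 1: "C1 > 0" "R1 > 0" "\<And>\<phi> \<tau> j. \<phi> \<in> strip h \<Longrightarrow> \<tau> \<in> Dm \<Longrightarrow> R1 \<le> norm \<tau> \<Longrightarrow> norm (\<Gamma>m \<phi> \<tau> $ j - ?s j \<phi> \<tau>) \<le> C1 / norm \<tau> ^ N"
  using m.expansion_bound[of "\<lambda>_. N"] by metis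
 obtain C2 R2 where 2: "C2 > 0" "R2 > 0" "\<And>\<phi> \<tau> j. \<phi> \<in> strip h \<Longrightarrow> \<tau> \<in> Dp \<Longrightarrow> R2 \<le> norm \<tau> \<Longrightarrow> norm (\<Gamma>p \<phi> \<tau> $ j - ?s j \<phi> \<tau>) \<le> C2 / norm \<tau> ^ N"
  using p.expansion_bound[of "\<lambda>_. N"] by metis
 show ?thesis
 proof (rule exI[of _ "4 * (C2 + C1)"], rule exI[of _ "R1 + R2"], intro conjI ballI impI)
  fix \<tau> assume a: "\<tau> \<in> Dm \<inter> Dp" "R1 + R2 \<le> norm \<tau>"
  have s: "of_real \<psi> \<in> strip h" by (rule real_strip) simp
  have "norm (\<Delta> \<tau> $ j) \<le> (C2 + C1) / norm \<tau> ^ N" for j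
  proof -
   have "\<Delta> \<tau> $ j = (\<Gamma>p (of_real \<psi>) \<tau> $ j - ?s j (of_real \<psi>) \<tau>) - (\<Gamma>m (of_real \<psi>) \<tau> $ j - ?s j (of_real \<psi>) \<tau>)" by (simp add: \<Delta>_def)
   also have "norm \<dots> \<le> C2 / norm \<tau> ^ N + C1 / norm \<tau> ^ N"
    by (rule order_trans[OF norm_triangle_ineq4 add_mono[OF 2(3) 1(3)]]) (use a s 1(2) 2(2) in auto)
   finally show ?thesis by (simp add: add_divide_distrib)
  qed
  from norm_le_4_mult[OF this] show "norm (\<Delta> \<tau>) \<le> 4 * (C2 + C1) / norm \<tau> ^ N" by simp
 qed (use 1 2 in auto)
qed

text \<open>Both solutions are followed from (psi, tau) over the time 2 pi s. The phase and the
  rotation return to their start, and in weighted eigencoordinates the remaining motion of the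
  difference is O(1/T) relative to its size.\<close>

lemma shift_bound:
 "\<exists>C Y. C > 0 \<and> Y > 0 \<and> (\<forall>s \<tau> j. (s = 1 \<or> s = -1) \<longrightarrow> \<bar>Re \<tau>\<bar> \<le> 20 \<longrightarrow> \<bar>Im \<tau>\<bar> \<ge> Y \<longrightarrow>
   norm (f j (\<tau> + of_real (s * (2 * pi))) - f j \<tau>) \<le> C / \<bar>Im \<tau>\<bar> * (\<Sum>l\<in>UNIV. norm (f l \<tau>)))"
proof -
 obtain Cm Rm where bm: "Cm > 0" "Rm > 0" "\<And>\<phi> \<tau> j. \<phi> \<in> strip h \<Longrightarrow> \<tau> \<in> Dm \<Longrightarrow> Rm \<le> norm \<tau> \<Longrightarrow> norm (\<Gamma>m \<phi> \<tau> $ j) \<le> Cm / norm \<tau> ^ wt j"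
  using m.weighted_decay by metis
 obtain Cp Rp where bp: "Cp > 0" "Rp > 0" "\<And>\<phi> \<tau> j. \<phi> \<in> strip h \<Longrightarrow> \<tau> \<in> Dp \<Longrightarrow> Rp \<le> norm \<tau> \<Longrightarrow> norm (\<Gamma>p \<phi> \<tau> $ j) \<le> Cp / norm \<tau> ^ wt j"
  using p.weighted_decay by metis
 define C0 where "C0 = 4 * max Cm Cp"
 have C0: "C0 > 0" "4 * Cm \<le> C0" "4 * Cp \<le> C0" using bm bp by (auto simp: C0_def)
 obtain C2 T0 where L: "C2 > 0" "T0 > 0" "\<And>T x y \<kappa> j. T \<ge> T0 \<Longrightarrow> \<kappa> \<ge> 0 \<Longrightarrow> (\<And>j. norm (x $ j) \<le> C0 / T ^ wt j) \<Longrightarrow> (\<And>j. norm (y $ j) \<le> C0 / T ^ wt j) \<Longrightarrow>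
   (\<And>j. norm (x $ j - y $ j) \<le> \<kappa> / T ^ wt j) \<Longrightarrow>
   T ^ wt j * norm (cb j (ham_vf (ham \<eta> F) x - ham_vf (ham \<eta> F) y) - \<i> * sg j * cb j (x - y)) \<le> C2 * \<kappa> / T"
  using weighted_lipschitz[OF m.holF m.U w C0(1), of \<eta>] by metis
 \<comment> \<open>The 40 keeps |Re tau| \<le> 20 together with a shift of at most 8 inside the
   common sector; the term with \<open>C2\<close> makes the rate times 2 pi at most 1/2, as
   \<open>gronwall_small\<close> demands.\<close>
 define Y where "Y = Max {\<bar>r0\<bar> + 40, 2 * Rm, 2 * Rp, T0, 16 * pi * C2 * 2, 40}"
 show ?thesis
 proof (rule exI[of _ "48 + 16 * pi * C2"], rule exI[of _ Y], intro conjI allI impI)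
  show "48 + 16 * pi * C2 > 0" using L(1) pi_gt_zero by (intro add_pos_pos mult_pos_pos) auto
  show "Y > 0" by (auto simp: Y_def max_def)
  fix s :: real and \<tau> and j assume s: "s = 1 \<or> s = -1" and \<tau>: "\<bar>Re \<tau>\<bar> \<le> 20" and im: "Y \<le> \<bar>Im \<tau>\<bar>"
  define T where "T = norm \<tau>"
  have y: "\<bar>r0\<bar> + 40 \<le> \<bar>Im \<tau>\<bar>" "2 * Rm \<le> \<bar>Im \<tau>\<bar>" "2 * Rp \<le> \<bar>Im \<tau>\<bar>" "T0 \<le> \<bar>Im \<tau>\<bar>" "16 * pi * C2 * 2 \<le> \<bar>Im \<tau>\<bar>" "40 \<le> \<bar>Im \<tau>\<bar>"
   by (rule order_trans[OF Max_ge im[unfolded Y_def]]; simp)+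
  have TI: "\<bar>Im \<tau>\<bar> \<le> T" by (simp add: T_def abs_Im_le_cmod)
  have T: "T > 0" "T \<ge> 40" "T \<ge> T0" using y TI by linarith+
  define z where "z = (pt \<psi> \<tau>)"
  define u where "u t = z + of_real (s * t) *s e11" for t
  have st: "\<bar>s * t\<bar> \<le> 8" if "0 \<le> t" "t \<le> 2 * pi" for t using s that pi_less_4 by auto
  have uD: "u t $ 1 \<in> strip h" "u t $ 2 \<in> Dm" "u t $ 2 \<in> Dp" "norm (u t $ 2) \<ge> T / 2" if t: "0 \<le> t" "t \<le> 2 * pi" for t
  proof -
   have u2: "u t $ 2 = \<tau> + of_real (s * t)" "u t $ 1 = of_real (\<psi> + s * t)" by (simp_all add: u_def z_def)
   show "u t $ 1 \<in> strip h" unfolding u2 by (rule real_strip) simp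
   have re: "\<bar>Re (u t $ 2)\<bar> < \<bar>Im (u t $ 2)\<bar> - \<bar>r0\<bar>" using st[OF t] \<tau> y(1) by (auto simp: u2)
   show "u t $ 2 \<in> Dm" "u t $ 2 \<in> Dp" using Dom_both[OF _ re] by auto
   have "norm \<tau> \<le> norm (u t $ 2) + \<bar>s * t\<bar>" using norm_triangle_ineq4[of "u t $ 2" "of_real (s * t)"] unfolding norm_of_real by (simp add: u2)
   thus "norm (u t $ 2) \<ge> T / 2" using st[OF t] T(2) unfolding T_def by linarith
  qed
  have uS: "u t \<in> m.S" "u t \<in> p.S" if t: "0 \<le> t" "t \<le> 2 * pi" for t using uD[OF t] by auto
  define x where "x t = p.\<gamma> (u t)" for t
  define v where "v t = m.\<gamma> (u t)" for t
  have wtT: "C / norm (u t $ 2) ^ wt j \<le> 4 * C / T ^ wt j" if t: "0 \<le> t" "t \<le> 2 * pi" and C: "C > 0" for t j C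
  proof -
   have "C / norm (u t $ 2) ^ wt j \<le> C / (T / 2) ^ wt j"
    using uD(4)[OF t] T C by (intro divide_left_mono power_mono) (auto intro!: mult_pos_pos zero_less_power)
   also have "\<dots> = C * 2 ^ wt j / T ^ wt j" by (simp add: power_divide)
   also have "\<dots> \<le> C * 4 / T ^ wt j" using C T by (intro divide_right_mono mult_left_mono) (auto simp: wt_def)
   finally show ?thesis by (simp add: mult.commute)
  qed
  have xb: "norm (x t $ j) \<le> C0 / T ^ wt j" if t: "0 \<le> t" "t \<le> 2 * pi" for t j
  proof -
   have "norm (x t $ j) \<le> Cp / norm (u t $ 2) ^ wt j"
    unfolding x_def p.\<gamma>_def using uD[OF t] y(3) TI by (intro bp(3)) auto
   also have "\<dots> \<le> 4 * Cp / T ^ wt j" by (rule wtT[OF t bp(1)])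
   also have "\<dots> \<le> C0 / T ^ wt j" using C0 T by (intro divide_right_mono) auto
   finally show ?thesis .
  qed
  have vb: "norm (v t $ j) \<le> C0 / T ^ wt j" if t: "0 \<le> t" "t \<le> 2 * pi" for t j
  proof -
   have "norm (v t $ j) \<le> Cm / norm (u t $ 2) ^ wt j"
    unfolding v_def m.\<gamma>_def using uD[OF t] y(2) TI by (intro bm(3)) auto
   also have "\<dots> \<le> 4 * Cm / T ^ wt j" by (rule wtT[OF t bm(1)])
   also have "\<dots> \<le> C0 / T ^ wt j" using C0 T by (intro divide_right_mono) auto
   finally show ?thesis .
  qed
  let ?X = "ham_vf (ham \<eta> F)"
  \<comment> \<open>The integrating factor that removes the rotation; it has modulus 1 and returns
    to 1 after one period.\<close>
  define E where "E j t = exp (- (\<i> * of_real (sg j * s * t)))" for j t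
  have nE: "norm (E j t) = 1" for j t by (simp add: E_def norm_exp_eq_Re)
  \<comment> \<open>The weight uses the initial tau, frozen along the flow; the change of its power
    over one period is restored afterwards by the factor \<open>q\<close>, which is 1 +
    O(1/T).\<close>
  define w where "w t = (\<chi> j. E j t * (\<tau> ^ wt j * cb j (x t - v t)))" for t
  define w' where "w' t = (\<chi> j. E j t * (\<tau> ^ wt j * (of_real s * (cb j (?X (x t) - ?X (v t)) - \<i> * sg j * cb j (x t - v t)))))" for t
  have dw: "(w has_vector_derivative w' t) (at t)" if t: "0 \<le> t" "t \<le> 2 * pi" for t
  proof (rule has_vector_derivative_vec)
   fix j
   have dx: "((\<lambda>t. x t $ i) has_vector_derivative of_real s * ?X (x t) $ i) (at t)" for i
    using p.DERIV_flow[of z s t i] uS(2)[OF t] unfolding x_def u_def by blast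
   have dv: "((\<lambda>t. v t $ i) has_vector_derivative of_real s * ?X (v t) $ i) (at t)" for i
    using m.DERIV_flow[of z s t i] uS(1)[OF t] unfolding v_def u_def by blast
   have dd: "((\<lambda>t. (x t - v t) $ i) has_vector_derivative of_real s * (?X (x t) - ?X (v t)) $ i) (at t)" for i
    using has_vector_derivative_diff[OF dx[of i] dv[of i]] by (simp add: algebra_simps)
   have dcb: "((\<lambda>t. cb j (x t - v t)) has_vector_derivative of_real s * cb j (?X (x t) - ?X (v t))) (at t)"
   proof -
    note D = has_vector_derivative_add[OF dd[of 1] has_vector_derivative_mult_right[OF dd[of 2], of \<i>]]
      has_vector_derivative_diff[OF dd[of 1] has_vector_derivative_mult_right[OF dd[of 2], of \<i>]]
      has_vector_derivative_add[OF dd[of 3] has_vector_derivative_mult_right[OF dd[of 4], of \<i>]]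
      has_vector_derivative_diff[OF dd[of 3] has_vector_derivative_mult_right[OF dd[of 4], of \<i>]]
    have "j = 1 \<or> j = 2 \<or> j = 3 \<or> j = 4" using exhaust_4 by blast
    thus ?thesis using D by (elim disjE) (simp_all add: algebra_simps)
   qed
   have "((\<lambda>z. exp (- (\<i> * of_real (sg j * s) * z))) has_field_derivative exp (- (\<i> * of_real (sg j * s) * of_real t)) * (- (\<i> * of_real (sg j * s)))) (at (of_real t))"
    by (auto intro!: derivative_eq_intros)
   from has_vector_derivative_real_field[OF this]
   have dE: "(E j has_vector_derivative E j t * (- (\<i> * of_real (sg j * s)))) (at t)"
    by (simp add: E_def[abs_def] mult_ac)
   have "((\<lambda>t. E j t * (\<tau> ^ wt j * cb j (x t - v t))) has_vector_derivative E j t * (\<tau> ^ wt j * (of_real s * cb j (?X (x t) - ?X (v t)))) + E j t * (- (\<i> * of_real (sg j * s))) * (\<tau> ^ wt j * cb j (x t - v t))) (at t)"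
    by (rule has_vector_derivative_mult[OF dE has_vector_derivative_mult_right[OF dcb]])
   also have "E j t * (\<tau> ^ wt j * (of_real s * cb j (?X (x t) - ?X (v t)))) + E j t * (- (\<i> * of_real (sg j * s))) * (\<tau> ^ wt j * cb j (x t - v t)) = w' t $ j"
    by (simp add: w'_def algebra_simps)
   finally show "((\<lambda>t. w t $ j) has_vector_derivative w' t $ j) (at t)" by (simp add: w_def)
  qed
  have bw: "norm (w' t) \<le> 4 * C2 / T * norm (w t)" if t: "0 \<le> t" "t \<le> 2 * pi" for t
  proof -
   have cbw: "norm (cb j (x t - v t)) \<le> norm (w t) / T ^ wt j" for j
   proof -
    have "T ^ wt j * norm (cb j (x t - v t)) = norm (w t $ j)" by (simp add: w_def norm_mult nE T_def norm_power)
    also have "\<dots> \<le> norm (w t)" by (rule component_le)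
    finally show ?thesis using T(1) by (simp add: field_simps)
   qed
   have dw: "norm (x t $ j - v t $ j) \<le> norm (w t) / T ^ wt j" for j
    using cb_component[of "x t - v t" "\<lambda>j. norm (w t) / T ^ wt j" j, OF cbw] by simp
   have "norm (w' t $ j) \<le> C2 * norm (w t) / T" for j
   proof -
    have "norm (w' t $ j) = T ^ wt j * norm (cb j (?X (x t) - ?X (v t)) - \<i> * sg j * cb j (x t - v t))"
     using s by (auto simp: w'_def norm_mult nE T_def norm_power)
    also have "\<dots> \<le> C2 * norm (w t) / T" by (rule L(3)[OF T(3) norm_ge_zero xb[OF t] vb[OF t] dw])
    finally show ?thesis .
   qed
   hence "norm (w' t) \<le> 4 * (C2 * norm (w t) / T)" by (rule norm_le_4_mult)
   thus ?thesis by simp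
  qed
  have "4 * C2 / T * (2 * pi) \<le> 1 / 2" using y(5) TI T(1) by (simp add: field_simps)
  note gr = gronwall_small[of "2 * pi" w w' "4 * C2 / T", OF dw bw _ this, of "2 * pi"]
  have g: "norm (w (2 * pi) - w 0) \<le> 2 * (4 * C2 / T) * (2 * pi) * norm (w 0)" "norm (w (2 * pi)) \<le> 2 * norm (w 0)"
   using gr L(1) T(1) by auto
  have w0: "w 0 $ j = f j \<tau>" for j
   by (simp add: w_def E_def f_def \<Delta>_def x_def v_def u_def z_def)
  have w2: "w (2 * pi) $ j = \<tau> ^ wt j * cb j (\<Delta> (\<tau> + of_real (s * (2 * pi))))" for j
  proof -
   have "E j (2 * pi) = 1"
   proof -
    have "sg j * s = 1 \<or> sg j * s = -1" using s by (auto simp: sg_def)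
    hence "E j (2 * pi) = exp (- (\<i> * of_real (1 * (2 * pi)))) \<or> E j (2 * pi) = exp (- (\<i> * of_real (- 1 * (2 * pi))))"
     unfolding E_def by metis
    moreover have "exp (\<i> * (2 * of_real pi)) = 1" using exp_two_pi_i by (simp only: mult_ac)
    ultimately show ?thesis by (auto simp: exp_minus)
   qed
   moreover have "u (2 * pi) = vector [of_real \<psi> + of_real (s * (2 * pi)), \<tau> + of_real (s * (2 * pi))]"
    by (simp add: u_def z_def vec_eq_iff forall_2)
   moreover have "\<Gamma>m (of_real \<psi> + of_real (s * (2 * pi))) \<tau>' = \<Gamma>m (of_real \<psi>) \<tau>'" if "\<tau>' \<in> Dm" for \<tau>'
   proof -
    have P: "\<Gamma>m (\<phi> + 2 * of_real pi) \<tau>' = \<Gamma>m \<phi> \<tau>'" if "\<phi> \<in> strip h" for \<phi>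
     using m.sepa that \<open>\<tau>' \<in> Dm\<close> by (auto simp: analytic_separatrix_def)
    show ?thesis using s P[of "of_real \<psi>"] P[of "of_real \<psi> - 2 * of_real pi"] real_strip by auto
   qed
   moreover have "\<Gamma>p (of_real \<psi> + of_real (s * (2 * pi))) \<tau>' = \<Gamma>p (of_real \<psi>) \<tau>'" if "\<tau>' \<in> Dp" for \<tau>'
   proof -
    have P: "\<Gamma>p (\<phi> + 2 * of_real pi) \<tau>' = \<Gamma>p \<phi> \<tau>'" if "\<phi> \<in> strip h" for \<phi>
     using p.sepa that \<open>\<tau>' \<in> Dp\<close> by (auto simp: analytic_separatrix_def)
    show ?thesis using s P[of "of_real \<psi>"] P[of "of_real \<psi> - 2 * of_real pi"] real_strip by auto
   qed
   moreover have "\<tau> + of_real (s * (2 * pi)) \<in> Dm" "\<tau> + of_real (s * (2 * pi)) \<in> Dp"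
    using uD(2,3)[of "2 * pi"] by (simp_all add: u_def z_def)
   ultimately show ?thesis by (simp add: w_def x_def v_def \<Delta>_def)
  qed
  define q where "q = ((\<tau> + of_real (s * (2 * pi))) / \<tau>) ^ wt j"
  have \<tau>0: "\<tau> \<noteq> 0" using T(1) by (auto simp: T_def)
  have q: "norm (q - 1) \<le> 24 / T"
  proof -
   define a where "a = of_real (s * (2 * pi)) / \<tau>"
   have na: "norm a = 2 * pi / T" using s by (auto simp: a_def norm_divide norm_mult T_def)
   have a1: "norm a \<le> 1" using T(2) pi_less_4 by (simp add: na)
   have "(\<tau> + of_real (s * (2 * pi))) / \<tau> = 1 + a" using \<tau>0 by (simp add: a_def add_divide_distrib)
   hence "q = (1 + a) ^ wt j" by (simp add: q_def)
   hence "q - 1 = a \<or> q - 1 = a * (a + 2)" by (auto simp: wt_def power2_eq_square algebra_simps)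
   moreover have "norm (a * (a + 2)) \<le> norm a * 3"
    unfolding norm_mult using a1 norm_triangle_ineq[of a 2] by (intro mult_left_mono) auto
   ultimately have "norm (q - 1) \<le> norm a * 3" using norm_ge_zero[of a] by (metis (no_types) mult.right_neutral mult_left_mono one_le_numeral order_trans order_refl)
   also have "\<dots> \<le> 24 / T" unfolding na using T(1) pi_less_4 by (simp add: field_simps)
   finally show ?thesis .
  qed
  have fq: "f j (\<tau> + of_real (s * (2 * pi))) = q * w (2 * pi) $ j"
   using \<tau>0 by (simp add: f_def w2 q_def power_divide)
  have "f j (\<tau> + of_real (s * (2 * pi))) - f j \<tau> = (q - 1) * w (2 * pi) $ j + (w (2 * pi) - w 0) $ j"
   unfolding fq w0[symmetric] by (simp add: algebra_simps)
  hence "norm (f j (\<tau> + of_real (s * (2 * pi))) - f j \<tau>) \<le> norm (q - 1) * norm (w (2 * pi) $ j) + norm ((w (2 * pi) - w 0) $ j)"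
   by (metis norm_mult norm_triangle_ineq)
  also have "\<dots> \<le> 24 / T * (2 * norm (w 0)) + 2 * (4 * C2 / T) * (2 * pi) * norm (w 0)"
  proof (intro add_mono)
   show "norm (q - 1) * norm (w (2 * pi) $ j) \<le> 24 / T * (2 * norm (w 0))"
    by (rule mult_mono[OF q order_trans[OF component_le g(2)]]) (use T(1) in simp_all)
   show "norm ((w (2 * pi) - w 0) $ j) \<le> 2 * (4 * C2 / T) * (2 * pi) * norm (w 0)"
    by (rule order_trans[OF component_le g(1)])
  qed
  also have "\<dots> = (48 + 16 * pi * C2) / T * norm (w 0)" using T(1) by (simp add: field_simps)
  also have "\<dots> \<le> (48 + 16 * pi * C2) / \<bar>Im \<tau>\<bar> * (\<Sum>l\<in>UNIV. norm (f l \<tau>))"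
  proof (intro mult_mono divide_left_mono TI)
   show "norm (w 0) \<le> (\<Sum>l\<in>UNIV. norm (f l \<tau>))"
    unfolding norm_vec_def w0 by (rule L2_set_le_sum) simp
  qed (use y T L(1) in auto)
  finally show "norm (f j (\<tau> + of_real (s * (2 * pi))) - f j \<tau>) \<le> (48 + 16 * pi * C2) / \<bar>Im \<tau>\<bar> * (\<Sum>l\<in>UNIV. norm (f l \<tau>))" .
 qed
qed

end

section \<open>Lower bounds from the Stokes limits, and local constants of the vector field\<close>

lemma limit_lower_top:
 assumes "((\<lambda>\<tau>. g \<tau> * exp (- \<i> * (\<tau> - of_real \<psi>))) \<longlongrightarrow> \<Theta>) (inf (filtercomap Im at_top) (principal A))" "\<Theta> \<noteq> 0"
 shows "\<exists>Y. \<forall>\<tau>\<in>A. Im \<tau> \<ge> Y \<longrightarrow> norm \<Theta> / 2 * exp (- Im \<tau>) \<le> norm (g \<tau>)"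
proof -
 have "\<forall>\<^sub>F \<tau> in inf (filtercomap Im at_top) (principal A). norm \<Theta> / 2 < norm (g \<tau> * exp (- \<i> * (\<tau> - of_real \<psi>)))"
  by (rule order_tendstoD(1)[OF tendsto_norm[OF assms(1)]]) (use assms(2) in simp)
 then obtain Y where Y: "\<And>\<tau>. Im \<tau> \<ge> Y \<Longrightarrow> \<tau> \<in> A \<Longrightarrow> norm \<Theta> / 2 < norm (g \<tau> * exp (- \<i> * (\<tau> - of_real \<psi>)))"
  unfolding eventually_inf_principal eventually_filtercomap_at_top_linorder by blast
 have "norm \<Theta> / 2 * exp (- Im \<tau>) \<le> norm (g \<tau>)" if "\<tau> \<in> A" "Im \<tau> \<ge> Y" for \<tau>
  using Y[OF that(2,1)] by (simp add: norm_mult exp_minus field_simps)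
 thus ?thesis by blast
qed

lemma limit_lower_bot:
 assumes "((\<lambda>\<tau>. g \<tau> * exp (\<i> * (\<tau> - of_real \<psi>))) \<longlongrightarrow> \<Theta>) (inf (filtercomap Im at_bot) (principal A))" "\<Theta> \<noteq> 0"
 shows "\<exists>Y. \<forall>\<tau>\<in>A. Im \<tau> \<le> Y \<longrightarrow> norm \<Theta> / 2 * exp (Im \<tau>) \<le> norm (g \<tau>)"
proof -
 have "\<forall>\<^sub>F \<tau> in inf (filtercomap Im at_bot) (principal A). norm \<Theta> / 2 < norm (g \<tau> * exp (\<i> * (\<tau> - of_real \<psi>)))"
  by (rule order_tendstoD(1)[OF tendsto_norm[OF assms(1)]]) (use assms(2) in simp)
 then obtain Y where Y: "\<And>\<tau>. Im \<tau> \<le> Y \<Longrightarrow> \<tau> \<in> A \<Longrightarrow> norm \<Theta> / 2 < norm (g \<tau> * exp (\<i> * (\<tau> - of_real \<psi>)))"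
  unfolding eventually_inf_principal eventually_filtercomap_at_bot_linorder by blast
 have "norm \<Theta> / 2 * exp (Im \<tau>) \<le> norm (g \<tau>)" if "\<tau> \<in> A" "Im \<tau> \<le> Y" for \<tau>
  using Y[OF that(2,1)] by (simp add: norm_mult exp_minus field_simps)
 thus ?thesis by blast
qed

lemma pdiff_lower: "\<exists>k. norm (ham_vf H x) \<le> 4 * norm (pdiff k H x)"
proof (rule ccontr)
 assume "\<not> ?thesis"
 hence *: "4 * norm (pdiff k H x) < norm (ham_vf H x)" for k by (simp add: not_le)
 show False using norm_le_4[of "ham_vf H x"] *[of 1] *[of 2] *[of 3] *[of 4] by (simp add: ham_vf_def)
qed

lemma vf_constants:
 assumes U: "open U" "0 \<in> U" and H: "hol H U" and X0: "ham_vf H 0 = 0"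
 shows "\<exists>r K. r > 0 \<and> K > 0 \<and> ball 0 r \<subseteq> U \<and> (\<forall>x\<in>ball 0 r. norm (ham_vf H x) \<le> K * norm x \<and> (\<forall>v. norm (vdd (ham_vf H) x v) \<le> K * norm v)
   \<and> (\<forall>y\<in>ball 0 r. norm (ham_vf H x - ham_vf H y) \<le> K * norm (x - y)))"
proof -
 let ?X = "ham_vf H"
 have vX: "vhol ?X U" by (rule vhol_ham_vf[OF U(1) H])
 have "\<exists>r M. r > 0 \<and> ball 0 r \<subseteq> U \<and> M \<ge> 0 \<and> (\<forall>y\<in>ball 0 r. norm (?X y $ i) \<le> M)" for i
  using hol_locally_bounded[OF vholD[OF vX, of i] U] by metis
 then obtain r M where rM: "\<And>i. r i > 0" "\<And>i. ball 0 (r i) \<subseteq> U" "\<And>i. M i \<ge> 0" "\<And>i y. y \<in> ball 0 (r i) \<Longrightarrow> norm (?X y $ i) \<le> M i" by metis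
 define \<rho> where "\<rho> = Min (range r) / 2"
 have \<rho>: "\<rho> > 0" "2 * \<rho> \<le> r i" for i using rM(1) by (auto simp: \<rho>_def)
 define K where "K = (\<Sum>i\<in>UNIV. M i / \<rho>) + 1"
 have K: "K > 0" unfolding K_def using \<rho>(1) rM(3) by (intro add_nonneg_pos sum_nonneg) auto
 have sub: "ball 0 \<rho> \<subseteq> U" using rM(2)[of 1] \<rho>(2)[of 1] \<rho>(1) by (auto simp: subset_iff)
 have b: "norm (vdd ?X x v) \<le> K * norm v" if x: "x \<in> ball 0 \<rho>" for x v
 proof -
  have c: "norm (vdd ?X x v $ i) \<le> M i / \<rho> * norm v" for i
  proof -
   have s: "ball x \<rho> \<subseteq> ball 0 (r i)"
   proof
    fix u assume "u \<in> ball x \<rho>"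
    hence "dist 0 u < 2 * \<rho>" using dist_triangle[of 0 u x] x by simp
    thus "u \<in> ball 0 (r i)" using \<rho>(2)[of i] by simp
   qed
   show ?thesis unfolding vdd_def
   proof -
    have "norm (dd (\<lambda>y. ?X y $ i) x v) \<le> M i / \<rho> * norm v"
     by (rule dd_bound[OF hol_subset[OF vholD[OF vX, of i]] \<rho>(1)]) (use s rM(2)[of i] rM(4)[of _ i] in blast)+
    thus "norm ((\<chi> i. dd (\<lambda>y. ?X y $ i) x v) $ i) \<le> M i / \<rho> * norm v" by simp
   qed
  qed
  have "norm (vdd ?X x v) \<le> (\<Sum>i\<in>UNIV. norm (vdd ?X x v $ i))" unfolding norm_vec_def by (rule L2_set_le_sum) simp
  also have "\<dots> \<le> (\<Sum>i\<in>UNIV. M i / \<rho> * norm v)" by (rule sum_mono) (rule c)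
  also have "\<dots> \<le> K * norm v" unfolding K_def sum_distrib_right[symmetric] by (intro mult_right_mono) auto
  finally show ?thesis .
 qed
 have lip: "norm (?X x - ?X y) \<le> K * norm (x - y)" if "x \<in> ball 0 \<rho>" "y \<in> ball 0 \<rho>" for x y
 proof (rule differentiable_bound[of "ball 0 \<rho>" ?X "vdd ?X"])
  show "(?X has_derivative vdd ?X u) (at u within ball 0 \<rho>)" if "u \<in> ball 0 \<rho>" for u
  proof (rule has_derivative_at_withinI)
   have "(?X has_derivative (\<lambda>h. \<chi> i. dd (\<lambda>y. ?X y $ i) u h)) (at u)"
    by (rule has_derivative_vec_components) (use holD[OF vholD[OF vX]] sub that in blast)
   thus "(?X has_derivative vdd ?X u) (at u)" by (simp add: vdd_def[abs_def])
  qed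
  show "onorm (vdd ?X u) \<le> K" if "u \<in> ball 0 \<rho>" for u by (rule onorm_le) (rule b[OF that])
 qed (use that in auto)
 show ?thesis
 proof (rule exI[of _ \<rho>], rule exI[of _ K], intro conjI ballI allI \<rho> K sub)
  fix x :: "complex^4" assume x: "x \<in> ball 0 \<rho>"
  show "norm (?X x) \<le> K * norm x" using lip[OF x, of 0] X0 \<rho>(1) by simp
 qed (use b lip in auto)
qed

text \<open>Cauchy's inequality in the phase, on a disc of radius h / 2 inside the strip; it gives 2
  * B / h for each of the four components.\<close>

lemma (in branch) phi_derivative_bound:
 assumes "\<tau> \<in> Dom" "\<And>\<phi>. \<phi> \<in> strip h \<Longrightarrow> norm (\<Gamma> \<phi> \<tau>) \<le> B"
 shows "norm (vdd \<gamma> (pt \<psi> \<tau>) e1) \<le> 8 * B / h"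
proof -
 have h2: "h / 2 > 0" using h by simp
 have st: "s \<in> strip h" if "norm (of_real \<psi> - s) \<le> h / 2" for s
  using abs_Im_le_cmod[of "of_real \<psi> - s"] that h by (simp add: strip_def)
 have "norm (vdd \<gamma> (pt \<psi> \<tau>) e1 $ i) \<le> 2 * B / h" for i
 proof -
  have hol: "(\<lambda>s. \<Gamma> s \<tau> $ i) holomorphic_on strip h"
   unfolding holomorphic_on_def field_differentiable_def using DERIV_\<phi>[OF _ assms(1)] has_field_derivative_at_within by blast
  have "norm ((deriv ^^ 1) (\<lambda>s. \<Gamma> s \<tau> $ i) (of_real \<psi>)) \<le> fact 1 * B / (h / 2) ^ 1"
  proof (rule Cauchy_inequality[OF _ _ h2])
   show "(\<lambda>s. \<Gamma> s \<tau> $ i) holomorphic_on ball (of_real \<psi>) (h / 2)"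
    by (rule holomorphic_on_subset[OF hol]) (use st in \<open>auto simp: dist_norm\<close>)
   show "continuous_on (cball (of_real \<psi>) (h / 2)) (\<lambda>s. \<Gamma> s \<tau> $ i)"
    by (rule continuous_on_subset[OF holomorphic_on_imp_continuous_on[OF hol]]) (use st in \<open>auto simp: dist_norm\<close>)
   show "norm (\<Gamma> s \<tau> $ i) \<le> B" if "norm (of_real \<psi> - s) = h / 2" for s
    by (rule order_trans[OF component_le assms(2)[OF st]]) (use that in simp)
  qed
  moreover have "deriv (\<lambda>s. \<Gamma> s \<tau> $ i) (of_real \<psi>) = vdd \<gamma> (pt \<psi> \<tau>) e1 $ i"
   by (rule DERIV_imp_deriv[OF DERIV_\<phi>[OF _ assms(1)]]) (use h in \<open>simp add: strip_def\<close>)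
  ultimately show ?thesis by (simp add: mult.commute)
 qed
 hence "norm (vdd \<gamma> (pt \<psi> \<tau>) e1) \<le> 4 * (2 * B / h)" by (rule norm_le_4_mult)
 thus ?thesis by simp
qed

context two_branches
begin

lemma f_holomorphic: "r0 \<le> R \<Longrightarrow> f j holomorphic_on {\<tau>. \<bar>Re \<tau>\<bar> < \<bar>Im \<tau>\<bar> - R}"
 and \<Delta>_holomorphic: "r0 \<le> R \<Longrightarrow> (\<lambda>\<tau>. \<Delta> \<tau> $ i) holomorphic_on {\<tau>. \<bar>Re \<tau>\<bar> < \<bar>Im \<tau>\<bar> - R}"
proof -
 assume R: "r0 \<le> R"
 let ?A = "{\<tau>. \<bar>Re \<tau>\<bar> < \<bar>Im \<tau>\<bar> - R}"
 have s: "of_real \<psi> \<in> strip h" by (rule real_strip) simp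
 have 1: "(\<lambda>\<tau>. \<Gamma>m (of_real \<psi>) \<tau> $ i) holomorphic_on ?A" for i
  unfolding holomorphic_on_def field_differentiable_def using m.DERIV_\<tau>[OF s] Dom_both[OF R] has_field_derivative_at_within by blast
 have 2: "(\<lambda>\<tau>. \<Gamma>p (of_real \<psi>) \<tau> $ i) holomorphic_on ?A" for i
  unfolding holomorphic_on_def field_differentiable_def using p.DERIV_\<tau>[OF s] Dom_both[OF R] has_field_derivative_at_within by blast
 have 3: "(\<lambda>\<tau>. \<Delta> \<tau> $ i) holomorphic_on ?A" for i
  unfolding \<Delta>_def using holomorphic_on_diff[OF 2[of i] 1[of i]] by simp
 thus "(\<lambda>\<tau>. \<Delta> \<tau> $ i) holomorphic_on ?A" .
 have "j = 1 \<or> j = 2 \<or> j = 3 \<or> j = 4" using exhaust_4 by blast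
 hence "(\<lambda>\<tau>. cb j (\<Delta> \<tau>)) holomorphic_on ?A"
  using holomorphic_on_add[OF 3 holomorphic_on_mult[OF holomorphic_on_const[of \<i>] 3]] holomorphic_on_diff[OF 3 holomorphic_on_mult[OF holomorphic_on_const[of \<i>] 3]]
  by auto
 thus "f j holomorphic_on ?A" unfolding f_def[abs_def] by (intro holomorphic_intros)
qed

text \<open>For s = -1 the map tau -> - tau carries the lower end to the upper one and exchanges the
  two shifts, so \<open>almost_periodic_decay\<close> covers both ends.\<close>

lemma f_decay:
 assumes s: "s = 1 \<or> s = -1" and \<epsilon>: "\<epsilon> > 0"
 shows "\<exists>A Y. A > 0 \<and> (\<forall>j \<tau>. \<bar>Re \<tau>\<bar> \<le> 8 \<longrightarrow> Im \<tau> \<ge> Y \<longrightarrow> norm (f j (of_real s * \<tau>)) \<le> A * exp (- (1 - \<epsilon>) * Im \<tau>))"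
proof -
 obtain C Y1 where C: "C > 0" "Y1 > 0" "\<And>s \<tau> j. s = 1 \<or> s = -1 \<Longrightarrow> \<bar>Re \<tau>\<bar> \<le> 20 \<Longrightarrow> \<bar>Im \<tau>\<bar> \<ge> Y1 \<Longrightarrow>
   norm (f j (\<tau> + of_real (s * (2 * pi))) - f j \<tau>) \<le> C / \<bar>Im \<tau>\<bar> * (\<Sum>l\<in>UNIV. norm (f l \<tau>))"
  using shift_bound by metis
 have sR: "\<bar>Re (of_real s * \<tau>)\<bar> = \<bar>Re \<tau>\<bar>" "\<bar>Im (of_real s * \<tau>)\<bar> = \<bar>Im \<tau>\<bar>" "norm (of_real s * \<tau>) = norm \<tau>" for \<tau>
  using s by (auto simp: norm_mult)
 have hol: "(\<lambda>\<tau>. f j (of_real s * \<tau>)) holomorphic_on {\<tau>. \<bar>Re \<tau>\<bar> < Im \<tau> - \<bar>r0\<bar>}" for j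
 proof (rule holomorphic_on_compose_gen[unfolded comp_def, OF _ f_holomorphic[of "\<bar>r0\<bar>"]])
  show "(*) (of_real s) ` {\<tau>. \<bar>Re \<tau>\<bar> < Im \<tau> - \<bar>r0\<bar>} \<subseteq> {\<tau>. \<bar>Re \<tau>\<bar> < \<bar>Im \<tau>\<bar> - \<bar>r0\<bar>}" using s by auto
 qed (auto intro!: holomorphic_intros)
 have super: "\<exists>C Y. \<forall>j \<tau>. \<bar>Re \<tau>\<bar> \<le> 7 \<longrightarrow> Im \<tau> \<ge> Y \<longrightarrow> norm (f j (of_real s * \<tau>)) \<le> C / Im \<tau> ^ N" for N
 proof -
  obtain C R where CR: "R > 0" "C > 0" "\<And>\<tau>. \<tau> \<in> Dm \<inter> Dp \<Longrightarrow> R \<le> norm \<tau> \<Longrightarrow> norm (\<Delta> \<tau>) \<le> C / norm \<tau> ^ (N + 2)"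
   using \<Delta>_flat[of "N + 2"] by metis
  show ?thesis
  proof (rule exI[of _ "2 * C"], rule exI[of _ "\<bar>r0\<bar> + R + 8"], intro allI impI)
   fix j \<tau> assume t: "\<bar>Re \<tau>\<bar> \<le> 7" "\<bar>r0\<bar> + R + 8 \<le> Im \<tau>"
   define u where "u = of_real s * \<tau>"
   have I: "Im \<tau> \<le> norm u" using abs_Im_le_cmod[of \<tau>] sR(3) by (simp add: u_def)
   have n1: "norm u \<ge> 1" "R \<le> norm u" "Im \<tau> > 0" using I t(2) CR(1) by linarith+
   have "\<bar>Re u\<bar> < \<bar>Im u\<bar> - \<bar>r0\<bar>" unfolding u_def sR using t CR(1) by linarith
   hence "u \<in> Dm \<inter> Dp" using Dom_both[of "\<bar>r0\<bar>" u] by simp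
   from CR(3)[OF this n1(2)] have d: "norm (\<Delta> u) \<le> C / norm u ^ (N + 2)" .
   have "norm (f j u) \<le> norm u ^ 2 * (2 * (C / norm u ^ (N + 2)))"
    unfolding f_def norm_mult norm_power
   proof (intro mult_mono power_increasing n1)
    show "norm (cb j (\<Delta> u)) \<le> 2 * (C / norm u ^ (N + 2))" using norm_cb_le[of j "\<Delta> u"] d by linarith
   qed (auto simp: wt_def)
   also have "\<dots> = 2 * C / norm u ^ N"
   proof -
    have "norm u > 0" using n1(1) by linarith
    thus ?thesis by (simp add: power_add power2_eq_square)
   qed
   also have "\<dots> \<le> 2 * C / Im \<tau> ^ N" using CR(2) I n1 by (intro divide_left_mono power_mono mult_pos_pos zero_less_power) auto
   finally show "norm (f j (of_real s * \<tau>)) \<le> 2 * C / Im \<tau> ^ N" by (simp add: u_def)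
  qed
 qed
 have rec: "norm (f j (of_real s * (\<tau> + of_real (\<sigma> * (2 * pi)))) - f j (of_real s * \<tau>)) \<le> C / Im \<tau> * (\<Sum>l\<in>UNIV. norm (f l (of_real s * \<tau>)))"
  if "\<bar>Re \<tau>\<bar> \<le> 20" "Im \<tau> \<ge> Y1" "\<sigma> = 1 \<or> \<sigma> = -1" for j \<tau> \<sigma>
 proof -
  have "of_real s * (\<tau> + of_real (\<sigma> * (2 * pi))) = of_real s * \<tau> + of_real ((s * \<sigma>) * (2 * pi))" by (simp add: algebra_simps)
  moreover have "s * \<sigma> = 1 \<or> s * \<sigma> = -1" using s that(3) by auto
  moreover have "Im \<tau> > 0" using that(2) C(2) by linarith
  ultimately show ?thesis using C(3)[of "s * \<sigma>" "of_real s * \<tau>" j] that(1,2) unfolding sR by simp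
 qed
 have r1: "norm (f j (of_real s * (\<tau> + 2 * of_real pi)) - f j (of_real s * \<tau>)) \<le> C / Im \<tau> * (\<Sum>l\<in>UNIV. norm (f l (of_real s * \<tau>)))"
  if "\<bar>Re \<tau>\<bar> \<le> 20" "Im \<tau> \<ge> Y1" for j \<tau> using rec[OF that, of 1 j] by simp
 have r2: "norm (f j (of_real s * (\<tau> - 2 * of_real pi)) - f j (of_real s * \<tau>)) \<le> C / Im \<tau> * (\<Sum>l\<in>UNIV. norm (f l (of_real s * \<tau>)))"
  if "\<bar>Re \<tau>\<bar> \<le> 20" "Im \<tau> \<ge> Y1" for j \<tau> using rec[OF that, of "-1" j] by simp
 obtain A Y where "A > 0" "\<And>j \<tau>. \<bar>Re \<tau>\<bar> \<le> 8 \<Longrightarrow> Im \<tau> \<ge> Y \<Longrightarrow> norm (f j (of_real s * \<tau>)) \<le> A * exp (- (1 - \<epsilon>) * Im \<tau>)"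
 proof (rule almost_periodic_decay[of "\<lambda>j \<tau>. f j (of_real s * \<tau>)" "\<bar>r0\<bar>" Y1 C \<epsilon>])
  fix A Y assume a: "A > 0" and b: "\<And>j \<tau>. \<bar>Re \<tau>\<bar> \<le> 8 \<Longrightarrow> Im \<tau> \<ge> Y \<Longrightarrow> norm (f j (of_real s * \<tau>)) \<le> A * exp (- (1 - \<epsilon>) * Im \<tau>)"
  show thesis by (rule that[OF a]) (rule b)
 qed (use hol super C(1) \<epsilon> r1 r2 in simp_all)
 thus ?thesis by blast
qed

lemma \<Delta>_decay:
 assumes \<epsilon>: "\<epsilon> > 0"
 shows "\<exists>A Y. A > 0 \<and> Y \<ge> 1 \<and> (\<forall>\<tau>. \<bar>Re \<tau>\<bar> \<le> 8 \<longrightarrow> \<bar>Im \<tau>\<bar> \<ge> Y \<longrightarrow> norm (\<Delta> \<tau>) \<le> A * exp (- (1 - \<epsilon>) * \<bar>Im \<tau>\<bar>))"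
proof -
 obtain A1 Y1 where 1: "A1 > 0" "\<And>j \<tau>. \<bar>Re \<tau>\<bar> \<le> 8 \<Longrightarrow> Im \<tau> \<ge> Y1 \<Longrightarrow> norm (f j (of_real 1 * \<tau>)) \<le> A1 * exp (- (1 - \<epsilon>) * Im \<tau>)"
  using f_decay[of 1, OF _ \<epsilon>] by auto
 obtain A2 Y2 where 2: "A2 > 0" "\<And>j \<tau>. \<bar>Re \<tau>\<bar> \<le> 8 \<Longrightarrow> Im \<tau> \<ge> Y2 \<Longrightarrow> norm (f j (of_real (- 1) * \<tau>)) \<le> A2 * exp (- (1 - \<epsilon>) * Im \<tau>)"
  using f_decay[of "-1", OF _ \<epsilon>] by auto
 show ?thesis
 proof (rule exI[of _ "4 * (A1 + A2)"], rule exI[of _ "max 1 (max Y1 Y2)"], intro conjI allI impI)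
  fix \<tau> assume t: "\<bar>Re \<tau>\<bar> \<le> 8" "max 1 (max Y1 Y2) \<le> \<bar>Im \<tau>\<bar>"
  define e where "e = exp (- (1 - \<epsilon>) * \<bar>Im \<tau>\<bar>)"
  have fb: "norm (f j \<tau>) \<le> (A1 + A2) * e" for j
  proof (cases "Im \<tau> \<ge> 0")
   case True
   hence "norm (f j \<tau>) \<le> A1 * e" using 1(2)[of \<tau> j] t by (simp add: e_def)
   also have "\<dots> \<le> (A1 + A2) * e" using 2(1) by (intro mult_right_mono) (auto simp: e_def)
   finally show ?thesis .
  next
   case False
   hence "norm (f j \<tau>) \<le> A2 * e" using 2(2)[of "- \<tau>" j] t by (simp add: e_def)
   also have "\<dots> \<le> (A1 + A2) * e" using 1(1) by (intro mult_right_mono) (auto simp: e_def)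
   finally show ?thesis .
  qed
  have n1: "norm \<tau> \<ge> 1" using t(2) abs_Im_le_cmod[of \<tau>] by linarith
  have "norm (cb j (\<Delta> \<tau>)) \<le> (A1 + A2) * e" for j
  proof -
   have "1 * norm (cb j (\<Delta> \<tau>)) \<le> norm \<tau> ^ wt j * norm (cb j (\<Delta> \<tau>))" by (intro mult_right_mono one_le_power n1) auto
   also have "\<dots> = norm (f j \<tau>)" by (simp add: f_def norm_mult norm_power)
   finally show ?thesis using fb[of j] by simp
  qed
  from cb_component[of "\<Delta> \<tau>" "\<lambda>_. (A1 + A2) * e", OF this refl refl]
  have "norm (\<Delta> \<tau> $ j) \<le> (A1 + A2) * e" for j .
  hence "norm (\<Delta> \<tau>) \<le> 4 * ((A1 + A2) * e)" by (rule norm_le_4_mult)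
  thus "norm (\<Delta> \<tau>) \<le> 4 * (A1 + A2) * exp (- (1 - \<epsilon>) * \<bar>Im \<tau>\<bar>)" unfolding e_def by (simp only: mult.assoc)
 qed (use 1 2 in auto)
qed

text \<open>By the equation the phase derivative is X minus the tau-derivative. The X-values differ
  by the Lipschitz constant times the distance, the tau-derivatives are compared by Cauchy's
  inequality on a unit disc; this is why the decay is available on the wider strip |Re tau| \<le>
  8.\<close>

lemma \<Delta>_phi_decay:
 assumes K: "K > 0" "\<And>x y. norm x < \<rho> \<Longrightarrow> norm y < \<rho> \<Longrightarrow> norm (ham_vf m.H x - ham_vf m.H y) \<le> K * norm (x - y)" and \<rho>: "\<rho> > 0"
 shows "\<exists>A Y. A > 0 \<and> Y \<ge> 1 \<and> (\<forall>\<tau>. \<bar>Re \<tau>\<bar> \<le> 7 \<longrightarrow> \<bar>Im \<tau>\<bar> \<ge> Y \<longrightarrow>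
   norm (vdd p.\<gamma> (pt \<psi> \<tau>) e1 - vdd m.\<gamma> (pt \<psi> \<tau>) e1) \<le> A * exp (- (3/4) * \<bar>Im \<tau>\<bar>))"
proof -
 obtain A Y where A: "A > 0" "Y \<ge> 1" "\<And>\<tau>. \<bar>Re \<tau>\<bar> \<le> 8 \<Longrightarrow> \<bar>Im \<tau>\<bar> \<ge> Y \<Longrightarrow> norm (\<Delta> \<tau>) \<le> A * exp (- (1 - 1/4) * \<bar>Im \<tau>\<bar>)"
  using \<Delta>_decay[of "1/4"] by auto
 obtain Rm where Rm: "Rm > 0" "\<And>\<phi> \<tau>. \<phi> \<in> strip h \<Longrightarrow> \<tau> \<in> Dm \<Longrightarrow> Rm \<le> norm \<tau> \<Longrightarrow> norm (\<Gamma>m \<phi> \<tau>) < \<rho>" using m.decay[OF \<rho>] by metis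
 obtain Rp where Rp: "Rp > 0" "\<And>\<phi> \<tau>. \<phi> \<in> strip h \<Longrightarrow> \<tau> \<in> Dp \<Longrightarrow> Rp \<le> norm \<tau> \<Longrightarrow> norm (\<Gamma>p \<phi> \<tau>) < \<rho>" using p.decay[OF \<rho>] by metis
 show ?thesis
 proof (rule exI[of _ "(K + 12) * A"], rule exI[of _ "Y + \<bar>r0\<bar> + Rm + Rp + 20"], intro conjI allI impI)
  show "(K + 12) * A > 0" using K A by simp
  show "Y + \<bar>r0\<bar> + Rm + Rp + 20 \<ge> 1" using A Rm Rp by linarith
  fix \<tau> assume t: "\<bar>Re \<tau>\<bar> \<le> 7" "Y + \<bar>r0\<bar> + Rm + Rp + 20 \<le> \<bar>Im \<tau>\<bar>"
  define e where "e = exp (- (3/4) * \<bar>Im \<tau>\<bar>)"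
  let ?z = "vector [of_real \<psi>, \<tau>] :: complex^2"
  have s: "of_real \<psi> \<in> strip h" by (rule real_strip) simp
  have reg: "\<bar>Re \<tau>'\<bar> < \<bar>Im \<tau>'\<bar> - \<bar>r0\<bar>" "\<bar>Re \<tau>'\<bar> \<le> 8" "\<bar>Im \<tau>'\<bar> \<ge> \<bar>Im \<tau>\<bar> - 1" if "norm (\<tau> - \<tau>') \<le> 1" for \<tau>'
   using that t A(2) Rm(1) Rp(1) abs_Re_le_cmod[of "\<tau> - \<tau>'"] abs_Im_le_cmod[of "\<tau> - \<tau>'"] unfolding minus_complex.sel by linarith+
  have D: "\<tau> \<in> Dm" "\<tau> \<in> Dp" using Dom_both[OF _ reg(1)[of \<tau>]] by auto
  have n\<tau>: "Rm \<le> norm \<tau>" "Rp \<le> norm \<tau>" using t(2) abs_Im_le_cmod[of \<tau>] A(2) Rm(1) Rp(1) by linarith+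
  have z: "?z \<in> m.S" "?z \<in> p.S" using s D by auto
  have dX: "norm (ham_vf m.H (p.\<gamma> ?z) - ham_vf m.H (m.\<gamma> ?z)) \<le> K * (A * e)"
  proof -
   have "norm (ham_vf m.H (p.\<gamma> ?z) - ham_vf m.H (m.\<gamma> ?z)) \<le> K * norm (\<Delta> \<tau>)"
    using K(2)[OF Rp(2)[OF s D(2) n\<tau>(2)] Rm(2)[OF s D(1) n\<tau>(1)]] by (simp add: \<Delta>_def)
   also have "\<dots> \<le> K * (A * e)" using A(3)[of \<tau>] t A(2) Rm(1) Rp(1) K(1) by (intro mult_left_mono) (auto simp: e_def)
   finally show ?thesis .
  qed
  have dT: "norm (vdd p.\<gamma> ?z (axis 2 1) - vdd m.\<gamma> ?z (axis 2 1)) \<le> 12 * (A * e)"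
  proof -
   have hol: "(\<lambda>\<tau>. \<Delta> \<tau> $ i) holomorphic_on {\<tau>. \<bar>Re \<tau>\<bar> < \<bar>Im \<tau>\<bar> - \<bar>r0\<bar>}" for i by (rule \<Delta>_holomorphic) simp
   have "norm ((vdd p.\<gamma> ?z (axis 2 1) - vdd m.\<gamma> ?z (axis 2 1)) $ i) \<le> 3 * (A * e)" for i
   proof -
    have "norm ((deriv ^^ 1) (\<lambda>\<tau>. \<Delta> \<tau> $ i) \<tau>) \<le> fact 1 * (3 * (A * e)) / 1 ^ 1"
    proof (rule Cauchy_inequality)
     show "(\<lambda>\<tau>. \<Delta> \<tau> $ i) holomorphic_on ball \<tau> 1" by (rule holomorphic_on_subset[OF hol]) (use reg(1) in \<open>auto simp: dist_norm\<close>)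
     show "continuous_on (cball \<tau> 1) (\<lambda>\<tau>. \<Delta> \<tau> $ i)"
      by (rule continuous_on_subset[OF holomorphic_on_imp_continuous_on[OF hol]]) (use reg(1) in \<open>auto simp: dist_norm\<close>)
     show "norm (\<Delta> t' $ i) \<le> 3 * (A * e)" if "norm (\<tau> - t') = 1" for t'
     proof -
      have t': "norm (\<tau> - t') \<le> 1" using that by simp
      have I: "\<bar>Im t'\<bar> \<ge> Y" using reg(3)[OF t'] t(2) Rm(1) Rp(1) by linarith
      have "norm (\<Delta> t' $ i) \<le> A * exp (- (1 - 1/4) * \<bar>Im t'\<bar>)" by (rule order_trans[OF component_le A(3)[OF reg(2)[OF t'] I]])
      also have "\<dots> \<le> A * (exp 1 * e)"
       unfolding e_def exp_add[symmetric] using A(1) reg(3)[OF t'] by (intro mult_left_mono) auto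
      also have "\<dots> \<le> A * (3 * e)" using exp_le A(1) by (intro mult_left_mono mult_right_mono) (auto simp: e_def)
      finally show ?thesis by simp
     qed
    qed simp
    moreover have "deriv (\<lambda>\<tau>. \<Delta> \<tau> $ i) \<tau> = (vdd p.\<gamma> ?z (axis 2 1) - vdd m.\<gamma> ?z (axis 2 1)) $ i"
     unfolding \<Delta>_def using DERIV_imp_deriv[OF DERIV_diff[OF p.DERIV_\<tau>[OF s D(2)] m.DERIV_\<tau>[OF s D(1)], of i i]] by simp
    ultimately show ?thesis by simp
   qed
   hence "norm (vdd p.\<gamma> ?z (axis 2 1) - vdd m.\<gamma> ?z (axis 2 1)) \<le> 4 * (3 * (A * e))"
    by (rule norm_le_4_mult)
   thus ?thesis by simp
  qed
  have eq: "vdd p.\<gamma> ?z e1 - vdd m.\<gamma> ?z e1 = (ham_vf m.H (p.\<gamma> ?z) - ham_vf m.H (m.\<gamma> ?z)) - (vdd p.\<gamma> ?z (axis 2 1) - vdd m.\<gamma> ?z (axis 2 1))"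
   unfolding m.pde_\<gamma>[OF z(1), symmetric] p.pde_\<gamma>[OF z(2), symmetric] m.vdd_e11 p.vdd_e11 by (simp only: algebra_simps)
  have "norm (vdd p.\<gamma> ?z e1 - vdd m.\<gamma> ?z e1) \<le> K * (A * e) + 12 * (A * e)"
   unfolding eq by (rule order_trans[OF norm_triangle_ineq4 add_mono[OF dX dT]])
  thus "norm (vdd p.\<gamma> ?z e1 - vdd m.\<gamma> ?z e1) \<le> (K + 12) * A * exp (- (3/4) * \<bar>Im \<tau>\<bar>)" by (simp add: e_def algebra_simps)
 qed
qed

end

section \<open>Non-integrability\<close>

text \<open>The leading term keeps norm x at least V / (2 * norm tau^n), the field is at least norm
  x / 12, and some partial derivative at least a quarter of it: 2 * 12 * 4 = 96. The factor 2^n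
  comes from norm tau \<le> 2 * |Im tau|.\<close>

lemma (in branch) lower_bound_column:
 assumes n: "\<And>k j. k < n \<Longrightarrow> fps_nth (\<Gamma>f $ j) k = 0"
  and v: "trig_eval (fps_nth (\<Gamma>f $ i) n) (of_real \<psi>) \<noteq> 0"
  and low: "\<And>x. norm x < \<rho> \<Longrightarrow> norm x \<le> 12 * norm (ham_vf H x)" and \<rho>: "\<rho> > 0"
 shows "\<exists>c Y. c > 0 \<and> (\<forall>\<tau>\<in>Dom. \<bar>Re \<tau>\<bar> \<le> 7 \<longrightarrow> \<bar>Im \<tau>\<bar> \<ge> Y \<longrightarrow> (\<exists>b. norm b = 1 \<and> c / \<bar>Im \<tau>\<bar> ^ n \<le> norm (dd H (\<gamma> (pt \<psi> \<tau>)) b)))"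
proof -
 define V where "V = norm (trig_eval (fps_nth (\<Gamma>f $ i) n) (of_real \<psi>))"
 have V: "V > 0" using v by (simp add: V_def)
 have s: "of_real \<psi> \<in> strip h" using h by (simp add: strip_def)
 obtain C R where CR: "C > 0" "R > 0" "\<And>\<phi> \<tau> j. \<phi> \<in> strip h \<Longrightarrow> \<tau> \<in> Dom \<Longrightarrow> R \<le> norm \<tau> \<Longrightarrow>
   norm (\<Gamma> \<phi> \<tau> $ j - trig_eval (fps_nth (\<Gamma>f $ j) n) \<phi> / \<tau> ^ n) \<le> C / norm \<tau> ^ Suc n"
  using leading_term[of n, OF n] by metis
 obtain R2 where R2: "R2 > 0" "\<And>\<phi> \<tau>. \<phi> \<in> strip h \<Longrightarrow> \<tau> \<in> Dom \<Longrightarrow> R2 \<le> norm \<tau> \<Longrightarrow> norm (\<Gamma> \<phi> \<tau>) < \<rho>" using decay[OF \<rho>] by metis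
 define c where "c = V / (96 * 2 ^ n)"
 show ?thesis
 proof (rule exI[of _ c], rule exI[of _ "R + R2 + 7 + 2 * C / V"], intro conjI ballI impI)
  show "c > 0" using V by (simp add: c_def)
  fix \<tau> assume \<tau>: "\<tau> \<in> Dom" "\<bar>Re \<tau>\<bar> \<le> 7" "R + R2 + 7 + 2 * C / V \<le> \<bar>Im \<tau>\<bar>"
  define y where "y = \<bar>Im \<tau>\<bar>"
  define x where "x = \<gamma> (pt \<psi> \<tau>)"
  have CV: "2 * C / V > 0" using CR(1) V by simp
  have I: "y \<le> norm \<tau>" "norm \<tau> \<le> 7 + y" using abs_Im_le_cmod[of \<tau>] cmod_le[of \<tau>] \<tau>(2) by (auto simp: y_def)
  have n\<tau>: "R \<le> norm \<tau>" "R2 \<le> norm \<tau>" "2 * C / V \<le> norm \<tau>" "norm \<tau> \<le> 2 * y" "norm \<tau> > 0" "y > 0"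
   using I \<tau>(3) CR(2) R2(1) CV unfolding y_def[symmetric] by linarith+
  have "V / norm \<tau> ^ n = norm (trig_eval (fps_nth (\<Gamma>f $ i) n) (of_real \<psi>) / \<tau> ^ n)" by (simp add: V_def norm_divide norm_power)
  also have "\<dots> \<le> norm (x $ i) + norm (x $ i - trig_eval (fps_nth (\<Gamma>f $ i) n) (of_real \<psi>) / \<tau> ^ n)"
   using norm_triangle_ineq4[of "x $ i" "x $ i - trig_eval (fps_nth (\<Gamma>f $ i) n) (of_real \<psi>) / \<tau> ^ n"] by simp
  also have "\<dots> \<le> norm x + C / norm \<tau> ^ Suc n"
   using CR(3)[OF s \<tau>(1) n\<tau>(1), of i] component_le[of x i] by (simp add: x_def)
  also have "C / norm \<tau> ^ Suc n \<le> V / norm \<tau> ^ n / 2"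
  proof -
   have "C \<le> V / 2 * norm \<tau>" using n\<tau>(3) V by (simp add: field_simps)
   hence "C / norm \<tau> ^ Suc n \<le> V / 2 * norm \<tau> / norm \<tau> ^ Suc n" using n\<tau>(5) by (intro divide_right_mono) auto
   thus ?thesis using n\<tau>(5) by simp
  qed
  finally have 1: "V / norm \<tau> ^ n \<le> 2 * norm x" by simp
  have "V / (2 * y) ^ n \<le> V / norm \<tau> ^ n" using n\<tau> V by (intro divide_left_mono power_mono mult_pos_pos zero_less_power) auto
  hence 2: "V / (2 ^ n * y ^ n) \<le> 2 * norm x" using 1 by (simp add: power_mult_distrib)
  have "norm x < \<rho>" using R2(2)[OF s \<tau>(1) n\<tau>(2)] by (simp add: x_def)
  hence "norm x \<le> 12 * norm (ham_vf H x)" by (rule low)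
  moreover obtain k where "norm (ham_vf H x) \<le> 4 * norm (pdiff k H x)" using pdiff_lower by blast
  ultimately have "V / (2 ^ n * y ^ n) \<le> 96 * norm (pdiff k H x)" using 2 by linarith
  hence "c / y ^ n \<le> norm (dd H x (axis k 1))" by (simp add: c_def)
  thus "\<exists>b. norm b = 1 \<and> c / \<bar>Im \<tau>\<bar> ^ n \<le> norm (dd H (\<gamma> (pt \<psi> \<tau>)) b)"
   unfolding x_def y_def by (intro exI[of _ "axis k 1"]) simp
 qed
qed

context two_branches
begin

text \<open>Exchanging the phase derivatives changes the symplectic product by at most a constant
  times the product of two quantities of size exp (-3 y / 4), eventually below half of c * exp (-
  y).\<close>

lemma far_plus:
 assumes K: "K > 0" "\<And>x y. norm x < \<rho> \<Longrightarrow> norm y < \<rho> \<Longrightarrow> norm (ham_vf m.H x - ham_vf m.H y) \<le> K * norm (x - y)" and \<rho>: "\<rho> > 0"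
  and c: "c > 0" and far: "\<And>\<tau>. \<tau> \<in> Dm \<Longrightarrow> \<tau> \<in> Dp \<Longrightarrow> \<bar>Im \<tau>\<bar> \<ge> Yc \<Longrightarrow> c * exp (- \<bar>Im \<tau>\<bar>) \<le> norm (symp (\<Delta> \<tau>) (vdd m.\<gamma> (pt \<psi> \<tau>) e1))"
 shows "\<exists>Y. \<forall>\<tau>. \<tau> \<in> Dm \<longrightarrow> \<tau> \<in> Dp \<longrightarrow> \<bar>Re \<tau>\<bar> \<le> 7 \<longrightarrow> \<bar>Im \<tau>\<bar> \<ge> Y \<longrightarrow> c / 2 * exp (- \<bar>Im \<tau>\<bar>) \<le> norm (symp (\<Delta> \<tau>) (vdd p.\<gamma> (pt \<psi> \<tau>) e1))"
proof -
 obtain A1 Y1 where 1: "A1 > 0" "Y1 \<ge> 1" "\<And>\<tau>. \<bar>Re \<tau>\<bar> \<le> 7 \<Longrightarrow> \<bar>Im \<tau>\<bar> \<ge> Y1 \<Longrightarrow>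
   norm (vdd p.\<gamma> (pt \<psi> \<tau>) e1 - vdd m.\<gamma> (pt \<psi> \<tau>) e1) \<le> A1 * exp (- (3/4) * \<bar>Im \<tau>\<bar>)"
  using \<Delta>_phi_decay[OF K \<rho>] by metis
 obtain A2 Y2 where 2: "A2 > 0" "Y2 \<ge> 1" "\<And>\<tau>. \<bar>Re \<tau>\<bar> \<le> 8 \<Longrightarrow> \<bar>Im \<tau>\<bar> \<ge> Y2 \<Longrightarrow> norm (\<Delta> \<tau>) \<le> A2 * exp (- (1 - 1/4) * \<bar>Im \<tau>\<bar>)"
  using \<Delta>_decay[of "1/4"] by auto
 have half: "(0::real) < 1/2" and c2: "c / 2 > 0" using c by auto
 obtain Y3 where Y3: "Y3 \<ge> 1" "\<And>y. y \<ge> Y3 \<Longrightarrow> (4 * A2 * A1) * y ^ 0 * exp (- (1/2) * y) \<le> c / 2" using poly_exp_small[OF half c2] by metis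
 show ?thesis
 proof (rule exI[of _ "Max {Yc, Y1, Y2, Y3}"], intro allI impI)
  fix \<tau> assume D: "\<tau> \<in> Dm" "\<tau> \<in> Dp" and t: "\<bar>Re \<tau>\<bar> \<le> 7" "Max {Yc, Y1, Y2, Y3} \<le> \<bar>Im \<tau>\<bar>"
  define y where "y = \<bar>Im \<tau>\<bar>"
  have yY: "y \<ge> Yc" "y \<ge> Y1" "y \<ge> Y2" "y \<ge> Y3" using t(2) by (auto simp: y_def)
  define gm where "gm = vdd m.\<gamma> (pt \<psi> \<tau>) e1"
  define gp where "gp = vdd p.\<gamma> (pt \<psi> \<tau>) e1"
  have d1: "norm (gp - gm) \<le> A1 * exp (- (3/4) * y)" using 1(3)[of \<tau>] t yY by (simp add: y_def gp_def gm_def)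
  have d2: "norm (\<Delta> \<tau>) \<le> A2 * exp (- (3/4) * y)" using 2(3)[of \<tau>] t yY by (simp add: y_def)
  have "norm (symp (\<Delta> \<tau>) (gp - gm)) \<le> 4 * norm (\<Delta> \<tau>) * norm (gp - gm)" by (rule norm_symp)
  also have "\<dots> \<le> 4 * (A2 * exp (- (3/4) * y)) * (A1 * exp (- (3/4) * y))" using d1 d2 2(1) by (intro mult_mono) auto
  also have "\<dots> = (4 * A2 * A1) * y ^ 0 * exp (- (1/2) * y) * exp (- y)"
  proof -
   have "exp (- (3/4) * y) * exp (- (3/4) * y) = exp (- (1/2) * y) * exp (- y)" unfolding exp_add[symmetric] by simp
   thus ?thesis by (simp add: mult_ac)
  qed
  also have "\<dots> \<le> c / 2 * exp (- y)" by (rule mult_right_mono[OF Y3(2)[OF yY(4)]]) simp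
  finally have "norm (symp (\<Delta> \<tau>) (gp - gm)) \<le> c / 2 * exp (- y)" .
  moreover have "c * exp (- y) \<le> norm (symp (\<Delta> \<tau>) gm)" using far[OF D] yY by (simp add: y_def gm_def)
  moreover have "symp (\<Delta> \<tau>) gp = symp (\<Delta> \<tau>) gm + symp (\<Delta> \<tau>) (gp - gm)" by (simp add: symp_add_right[symmetric])
  ultimately have "c / 2 * exp (- y) \<le> norm (symp (\<Delta> \<tau>) gp)"
   using norm_triangle_ineq2[of "symp (\<Delta> \<tau>) gm" "- symp (\<Delta> \<tau>) (gp - gm)"] by simp
  thus "c / 2 * exp (- \<bar>Im \<tau>\<bar>) \<le> norm (symp (\<Delta> \<tau>) (vdd p.\<gamma> (pt \<psi> \<tau>) e1))" by (simp add: y_def gp_def)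
 qed
qed

theorem non_integrable:
 assumes n: "n > 0" "\<And>k j. k < n \<Longrightarrow> fps_nth (\<Gamma>f $ j) k = 0"
  and v: "trig_eval (fps_nth (\<Gamma>f $ i) n) (of_real \<psi>) \<noteq> 0"
  and c: "c > 0" and far: "\<And>\<tau>. \<tau> \<in> Dm \<Longrightarrow> \<tau> \<in> Dp \<Longrightarrow> \<bar>Im \<tau>\<bar> \<ge> Yf \<Longrightarrow> c * exp (- \<bar>Im \<tau>\<bar>) \<le> norm (symp (\<Delta> \<tau>) (vdd m.\<gamma> (pt \<psi> \<tau>) e1))"
 shows "\<not> integrable_at_origin (ham \<eta> F)"
proof
 assume "integrable_at_origin (ham \<eta> F)"
 then obtain V G where V: "open V" "0 \<in> V" and GV: "mv_analytic_on G V" "first_integral_on G (ham \<eta> F) V" "functionally_independent_on G (ham \<eta> F) V"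
  unfolding integrable_at_origin_def by blast
 let ?H = "ham \<eta> F"
 have hG: "hol G V" by (rule mv_analytic_imp_hol[OF GV(1)])
 have XG: "dd G x (ham_vf ?H x) = 0" if "x \<in> V" for x
  using GV(2) that by (simp add: first_integral_on_def dd_def mult.commute)
 obtain ra where ra: "ra > 0" "\<And>x. norm x < ra \<Longrightarrow> norm x \<le> 12 * norm (ham_vf ?H x)" "ham_vf ?H 0 = 0"
  using ham_vf_lower_bound[OF m.holF m.U w, of \<eta>] by metis
 obtain rb K where rb: "rb > 0" "K > 0" "ball 0 rb \<subseteq> U" "\<And>x. x \<in> ball 0 rb \<Longrightarrow> norm (ham_vf ?H x) \<le> K * norm x"
   "\<And>x v. x \<in> ball 0 rb \<Longrightarrow> norm (vdd (ham_vf ?H) x v) \<le> K * norm v"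
   "\<And>x y. x \<in> ball 0 rb \<Longrightarrow> y \<in> ball 0 rb \<Longrightarrow> norm (ham_vf ?H x - ham_vf ?H y) \<le> K * norm (x - y)"
  using vf_constants[OF m.U m.hol_H ra(3)] by metis
 obtain rc B where rc: "rc > 0" "ball 0 rc \<subseteq> U" "\<And>x. x \<in> ball 0 rc \<Longrightarrow> norm (?H x) \<le> B" "B \<ge> 0"
  using hol_locally_bounded[OF m.hol_H m.U] by metis
 obtain rd M where rd: "rd > 0" "ball 0 rd \<subseteq> V" "\<And>x. x \<in> ball 0 rd \<Longrightarrow> norm (G x) \<le> M" "M \<ge> 0"
  using hol_locally_bounded[OF hG V] by metis
 \<comment> \<open>One ball on which the estimates for H, its field and G hold together. The
   separatrices will be kept in the ball of half this radius, so that balls of radius rho / 2 around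
   their points still fit.\<close>
 define \<rho> where "\<rho> = Min {ra, rb, rc, rd}"
 have \<rho>: "\<rho> > 0" "\<rho> \<le> ra" "\<rho> \<le> rb" "\<rho> \<le> rc" "\<rho> \<le> rd" using ra rb rc rd by (auto simp: \<rho>_def)
 define V0 where "V0 = ball (0::complex^4) \<rho>"
 have sub: "V0 \<subseteq> ball 0 rb" "V0 \<subseteq> ball 0 rc" "V0 \<subseteq> ball 0 rd" "V0 \<subseteq> U" "V0 \<subseteq> V"
  using \<rho> rb(3) rd(2) subset_ball[of \<rho> rb 0] subset_ball[of \<rho> rc 0] subset_ball[of \<rho> rd 0] by (auto simp: V0_def)
 have \<rho>2: "\<rho> / 2 > 0" "\<rho> / 2 \<le> \<rho>" using \<rho> by auto
 obtain Ra where Ra: "Ra \<ge> r0" "\<And>R. R \<ge> Ra \<Longrightarrow> sep0 ?H V0 m.\<gamma> h 1 R" "\<And>R z. R \<ge> Ra \<Longrightarrow> z \<in> DD h 1 R \<Longrightarrow> norm (m.\<gamma> z) < \<rho> / 2"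
  using m.sep0I[OF \<rho>2 sub(4)[unfolded V0_def]] unfolding V0_def by metis
 obtain Rb where Rb: "Rb \<ge> r0" "\<And>R. R \<ge> Rb \<Longrightarrow> sep0 ?H V0 p.\<gamma> h (- 1) R" "\<And>R z. R \<ge> Rb \<Longrightarrow> z \<in> DD h (- 1) R \<Longrightarrow> norm (p.\<gamma> z) < \<rho> / 2"
  using p.sep0I[OF \<rho>2 sub(4)[unfolded V0_def]] unfolding V0_def by metis
 obtain Ca Rc where Rc: "Ca > 0" "Rc > 0" "\<And>\<phi> \<tau> j. \<phi> \<in> strip h \<Longrightarrow> \<tau> \<in> Dm \<Longrightarrow> Rc \<le> norm \<tau> \<Longrightarrow>
   norm (\<Gamma>m \<phi> \<tau> $ j - trig_eval (fps_nth (\<Gamma>f $ j) n) \<phi> / \<tau> ^ n) \<le> Ca / norm \<tau> ^ Suc n"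
  using m.leading_term[of n, OF n(2)] by metis
 obtain Cb Rd where Rd: "Cb > 0" "Rd > 0" "\<And>\<phi> \<tau> j. \<phi> \<in> strip h \<Longrightarrow> \<tau> \<in> Dp \<Longrightarrow> Rd \<le> norm \<tau> \<Longrightarrow>
   norm (\<Gamma>p \<phi> \<tau> $ j - trig_eval (fps_nth (\<Gamma>f $ j) n) \<phi> / \<tau> ^ n) \<le> Cb / norm \<tau> ^ Suc n"
  using p.leading_term[of n, OF n(2)] by metis
 \<comment> \<open>On the sector norm tau is at least R / 2 by \<open>Lset_norm\<close>, whence the
   factors 2.\<close>
 define R where "R = \<bar>Ra\<bar> + \<bar>Rb\<bar> + 2 * Rc + 2 * Rd"
 have R: "R \<ge> Ra" "R \<ge> Rb" "R / 2 \<ge> Rc" "R / 2 \<ge> Rd" "R \<ge> r0" "R \<ge> 0" using Rc Rd Ra(1) by (auto simp: R_def)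
 interpret sm: sep0 ?H V0 m.\<gamma> h 1 R by (rule Ra(2)[OF R(1)])
 interpret sp: sep0 ?H V0 p.\<gamma> h "- 1" R by (rule Rb(2)[OF R(2)])
 let ?z = "pt \<psi>"
 have s: "of_real \<psi> \<in> strip h" by (rule real_strip) simp
 have KV: "norm (ham_vf ?H x) \<le> K * norm x" "norm (vdd (ham_vf ?H) x v) \<le> K * norm v" "norm x \<le> 12 * norm (ham_vf ?H x)" if "x \<in> V0" for x v
  using that rb(4,5) sub(1) ra(2)[of x] \<rho>(2) by (auto simp: V0_def)
 have Lm: "\<tau> \<in> Dm \<and> Rc \<le> norm \<tau>" if "\<tau> \<in> Lset 1 R" for \<tau>
  using that m.Dom[OF R(5)] Lset_norm[of 1 \<tau> R] R(3) by auto
 have Lp: "\<tau> \<in> Dp \<and> Rd \<le> norm \<tau>" if "\<tau> \<in> Lset (- 1) R" for \<tau>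
  using that p.Dom[OF R(5)] Lset_norm[of "-1" \<tau> R] R(4) by auto
 have asm: "norm (m.\<gamma> (?z \<tau>) $ j - trig_eval (fps_nth (\<Gamma>f $ j) n) (of_real \<psi>) / \<tau> ^ n) \<le> Ca / norm \<tau> ^ Suc n" if "\<tau> \<in> Lset 1 R" for \<tau> j
  using Rc(3)[OF s] Lm[OF that] by simp
 have asp: "norm (p.\<gamma> (?z \<tau>) $ j - trig_eval (fps_nth (\<Gamma>f $ j) n) (of_real \<psi>) / \<tau> ^ n) \<le> Cb / norm \<tau> ^ Suc n" if "\<tau> \<in> Lset (- 1) R" for \<tau> j
  using Rd(3)[OF s] Lp[OF that] by simp
 have indm: "a = 0 \<and> b = 0" if "z \<in> RD 1 R" "a *s vdd m.\<gamma> z e1 + b *s ham_vf ?H (m.\<gamma> z) = 0" for z a b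
  using sm.leading_term_consequences(2)[where v = "\<lambda>j. trig_eval (fps_nth (\<Gamma>f $ j) n) (of_real \<psi>)", OF KV(1,2,3) asm n(1) v that(1), of a b] that(2)
  by (simp add: sm.g\<phi>_def)
 have indp: "a = 0 \<and> b = 0" if "z \<in> RD (- 1) R" "a *s vdd p.\<gamma> z e1 + b *s ham_vf ?H (p.\<gamma> z) = 0" for z a b
  using sp.leading_term_consequences(2)[where v = "\<lambda>j. trig_eval (fps_nth (\<Gamma>f $ j) n) (of_real \<psi>)", OF KV(1,2,3) asp n(1) v that(1), of a b] that(2)
  by (simp add: sp.g\<phi>_def)
 define Y1 where "Y1 = R + 40"
 have Y1: "\<tau> \<in> Lset 1 R" "\<tau> \<in> Lset (- 1) R" "\<bar>Re \<tau>\<bar> < \<bar>Im \<tau>\<bar> - R" if "\<bar>Re \<tau>\<bar> \<le> 7" "\<bar>Im \<tau>\<bar> \<ge> Y1" for \<tau>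
  using that by (auto simp: Lset_def Y1_def)
 have zW: "?z \<tau> \<in> RD 1 R" "?z \<tau> \<in> RD (- 1) R" "?z \<tau> \<in> DD h 1 R" "?z \<tau> \<in> DD h (- 1) R" if "\<bar>Re \<tau>\<bar> \<le> 7" "\<bar>Im \<tau>\<bar> \<ge> Y1" for \<tau>
  using Y1[OF that] m.h by (simp_all add: RD_def DD_def)
 have small: "norm (m.\<gamma> (?z \<tau>)) < \<rho> / 2" "norm (p.\<gamma> (?z \<tau>)) < \<rho> / 2" if "\<bar>Re \<tau>\<bar> \<le> 7" "\<bar>Im \<tau>\<bar> \<ge> Y1" for \<tau>
  using Ra(3)[OF R(1) zW(3)[OF that]] Rb(3)[OF R(2) zW(4)[OF that]] .
 have BV: "norm (?H x) \<le> B" if "x \<in> V0" for x using rc(3) sub(2) that by blast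
 have halfball: "ball x (\<rho> / 2) \<subseteq> V0" if "norm x < \<rho> / 2" for x :: "complex^4"
 proof
  fix u assume "u \<in> ball x (\<rho> / 2)"
  hence "norm (u - x) < \<rho> / 2" by (simp add: dist_norm norm_minus_commute)
  hence "norm u < \<rho>" using norm_triangle_ineq[of "u - x" x] that by simp
  thus "u \<in> V0" by (simp add: V0_def)
 qed
 have Bm: "norm (?H (m.\<gamma> (?z \<tau>))) \<le> B" "norm (?H (p.\<gamma> (?z \<tau>))) \<le> B" if "\<bar>Re \<tau>\<bar> \<le> 7" "\<bar>Im \<tau>\<bar> \<ge> Y1" for \<tau>
  by (rule BV[OF sm.\<gamma>_V0[OF zW(1)[OF that]]] BV[OF sp.\<gamma>_V0[OF zW(2)[OF that]]])+
 obtain Hm where Hm: "\<And>z. z \<in> RD 1 R \<Longrightarrow> ?H (m.\<gamma> z) = Hm"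
  by (rule sm.first_integral_const[OF sm.V0 order_refl sm.holH, where Y = Y1 and B = B and m = 0 and \<psi> = \<psi>])
   (use sm.\<gamma>_V0 dd_ham_vf_self Bm in simp_all)
 obtain Hp where Hp: "\<And>z. z \<in> RD (- 1) R \<Longrightarrow> ?H (p.\<gamma> z) = Hp"
  by (rule sp.first_integral_const[OF sp.V0 order_refl sp.holH, where Y = Y1 and B = B and m = 0 and \<psi> = \<psi>])
   (use sp.\<gamma>_V0 dd_ham_vf_self Bm in simp_all)
 \<comment> \<open>Each solution has its own energy constant; they coincide because the solutions
   approach each other in the column and H is Lipschitz there.\<close>
 have HH: "Hp = Hm"
 proof -
  have "norm (Hp - Hm) \<le> 0 + e" if e: "e > 0" for e
  proof -
   obtain A Y where A: "A > 0" "Y \<ge> 1" "\<And>\<tau>. \<bar>Re \<tau>\<bar> \<le> 8 \<Longrightarrow> \<bar>Im \<tau>\<bar> \<ge> Y \<Longrightarrow> norm (\<Delta> \<tau>) \<le> A * exp (- (1 - 1/2) * \<bar>Im \<tau>\<bar>)"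
    using \<Delta>_decay[of "1/2"] by auto
   define \<epsilon> where "\<epsilon> = min (\<rho> / 8) (e * \<rho> / (8 * (B + 1)))"
   have \<epsilon>: "\<epsilon> > 0" "4 * \<epsilon> \<le> \<rho> / 2" "\<epsilon> \<le> e * \<rho> / (8 * (B + 1))" using \<rho>(1) e rc(4) by (auto simp: \<epsilon>_def)
   have half: "(0::real) < 1/2" by simp
   obtain Y2 where Y2: "Y2 \<ge> 1" "\<And>y. y \<ge> Y2 \<Longrightarrow> A * y ^ 0 * exp (- (1/2) * y) \<le> \<epsilon>" using poly_exp_small[OF half \<epsilon>(1)] by metis
   define \<tau> where "\<tau> = Complex 0 (Max {Y1, Y, Y2})"
   have M: "Y1 \<le> Max {Y1, Y, Y2}" "Y \<le> Max {Y1, Y, Y2}" "Y2 \<le> Max {Y1, Y, Y2}" by auto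
   have \<tau>: "\<bar>Re \<tau>\<bar> \<le> 7" "\<bar>Im \<tau>\<bar> \<ge> Y1" "\<bar>Im \<tau>\<bar> \<ge> Y" "\<bar>Im \<tau>\<bar> \<ge> Y2" using M unfolding \<tau>_def complex.sel by linarith+
   have d: "norm (\<Delta> \<tau>) \<le> \<epsilon>" using A(3)[of \<tau>] Y2(2)[OF \<tau>(4)] \<tau> by simp
   have "norm (?H (m.\<gamma> (?z \<tau>) + \<Delta> \<tau>) - ?H (m.\<gamma> (?z \<tau>))) \<le> 4 * B / (\<rho> / 2) * norm (\<Delta> \<tau>)"
    by (rule hol_first_order(1)[OF hol_subset[OF sm.holH halfball[OF small(1)[OF \<tau>(1,2)]]] \<rho>2(1)])
     (use BV halfball[OF small(1)[OF \<tau>(1,2)]] d \<epsilon>(2) in auto)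
   also have "\<dots> \<le> 4 * (B + 1) / (\<rho> / 2) * (e * \<rho> / (8 * (B + 1)))"
    using d \<epsilon>(3) \<rho>(1) rc(4) e by (intro mult_mono divide_right_mono) auto
   also have "\<dots> = e"
   proof -
    have "4 * b / (\<rho> / 2) * (e * \<rho> / (8 * b)) = e" if "b > 0" for b using that \<rho>(1) by (simp add: field_simps)
    from this[of "B + 1"] rc(4) show ?thesis by linarith
   qed
   finally show ?thesis using Hm[OF zW(1)[OF \<tau>(1,2)]] Hp[OF zW(2)[OF \<tau>(1,2)]] by (simp add: \<Delta>_def)
  qed
  hence "norm (Hp - Hm) \<le> 0" by (rule field_le_epsilon)
  thus ?thesis by simp
 qed
 interpret m1: sep ?H V0 m.\<gamma> h 1 R Hm by unfold_locales (use indm Hm in auto)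
 interpret p1: sep ?H V0 p.\<gamma> h "- 1" R Hm by unfold_locales (use indp Hp HH in auto)
 have low: "norm x \<le> 12 * norm (ham_vf ?H x)" if "norm x < \<rho>" for x using KV(3)[of x] that by (simp add: V0_def)
 obtain c1 Y2 where c1: "c1 > 0" "\<And>\<tau>. \<tau> \<in> Dm \<Longrightarrow> \<bar>Re \<tau>\<bar> \<le> 7 \<Longrightarrow> \<bar>Im \<tau>\<bar> \<ge> Y2 \<Longrightarrow> \<exists>b. norm b = 1 \<and> c1 / \<bar>Im \<tau>\<bar> ^ n \<le> norm (dd ?H (m.\<gamma> (?z \<tau>)) b)"
  using m.lower_bound_column[OF n(2) v low \<rho>(1)] by metis
 obtain c2 Y3 where c2: "c2 > 0" "\<And>\<tau>. \<tau> \<in> Dp \<Longrightarrow> \<bar>Re \<tau>\<bar> \<le> 7 \<Longrightarrow> \<bar>Im \<tau>\<bar> \<ge> Y3 \<Longrightarrow> \<exists>b. norm b = 1 \<and> c2 / \<bar>Im \<tau>\<bar> ^ n \<le> norm (dd ?H (p.\<gamma> (?z \<tau>)) b)"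
  using p.lower_bound_column[OF n(2) v low \<rho>(1)] by metis
 have lip: "norm (ham_vf ?H x - ham_vf ?H y) \<le> K * norm (x - y)" if "norm x < \<rho>" "norm y < \<rho>" for x y
  using rb(6) that \<rho>(3) by simp
 have "\<exists>Y. \<forall>\<tau>. \<tau> \<in> Dm \<longrightarrow> \<tau> \<in> Dp \<longrightarrow> \<bar>Re \<tau>\<bar> \<le> 7 \<longrightarrow> \<bar>Im \<tau>\<bar> \<ge> Y \<longrightarrow> c / 2 * exp (- \<bar>Im \<tau>\<bar>) \<le> norm (symp (\<Delta> \<tau>) (vdd p.\<gamma> (?z \<tau>) e1))"
  by (rule far_plus[OF rb(2) _ \<rho>(1) c, where Yc = Yf]; (rule lip far; assumption)?)
 then obtain Y4 where Y4: "\<And>\<tau>. \<tau> \<in> Dm \<Longrightarrow> \<tau> \<in> Dp \<Longrightarrow> \<bar>Re \<tau>\<bar> \<le> 7 \<Longrightarrow> \<bar>Im \<tau>\<bar> \<ge> Y4 \<Longrightarrow> c / 2 * exp (- \<bar>Im \<tau>\<bar>) \<le> norm (symp (\<Delta> \<tau>) (vdd p.\<gamma> (?z \<tau>) e1))"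
  by blast
 define Y0 where "Y0 = Max {1, Y1, Y2, Y3, Y4, Yf}"
 have Y0: "1 \<le> Y0" "Y1 \<le> Y0" "Y2 \<le> Y0" "Y3 \<le> Y0" "Y4 \<le> Y0" "Yf \<le> Y0" unfolding Y0_def by simp_all
 define cH where "cH = min c1 c2"
 have cHb: "\<exists>b. norm b = 1 \<and> cH / \<bar>Im \<tau>\<bar> ^ n \<le> norm (dd ?H x b)" if "\<exists>b. norm b = 1 \<and> c' / \<bar>Im \<tau>\<bar> ^ n \<le> norm (dd ?H x b)" "cH \<le> c'" for x \<tau> c'
  using that order_trans[OF divide_right_mono[OF that(2), of "\<bar>Im \<tau>\<bar> ^ n"]] by fastforce
 have gb: "norm (vdd m.\<gamma> (?z \<tau>) e1) \<le> 8 * (\<rho> / 2) / h" "norm (vdd p.\<gamma> (?z \<tau>) e1) \<le> 8 * (\<rho> / 2) / h" if "\<bar>Re \<tau>\<bar> \<le> 7" "\<bar>Im \<tau>\<bar> \<ge> Y1" for \<tau>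
 proof -
  have "norm (\<Gamma>m \<phi> \<tau>) \<le> \<rho> / 2" "norm (\<Gamma>p \<phi> \<tau>) \<le> \<rho> / 2" if "\<phi> \<in> strip h" for \<phi>
  proof -
   have "vector [\<phi>, \<tau>] \<in> DD h 1 R" "vector [\<phi>, \<tau>] \<in> DD h (- 1) R"
    using Y1[OF \<open>\<bar>Re \<tau>\<bar> \<le> 7\<close> \<open>Y1 \<le> \<bar>Im \<tau>\<bar>\<close>] \<open>\<phi> \<in> strip h\<close> by (simp_all add: DD_def strip_def)
   from Ra(3)[OF R(1) this(1)] Rb(3)[OF R(2) this(2)] show "norm (\<Gamma>m \<phi> \<tau>) \<le> \<rho> / 2" "norm (\<Gamma>p \<phi> \<tau>) \<le> \<rho> / 2" by simp_all
  qed
  thus "norm (vdd m.\<gamma> (?z \<tau>) e1) \<le> 8 * (\<rho> / 2) / h" "norm (vdd p.\<gamma> (?z \<tau>) e1) \<le> 8 * (\<rho> / 2) / h"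
   using Lm[OF Y1(1)[OF that]] Lp[OF Y1(2)[OF that]] by (intro m.phi_derivative_bound p.phi_derivative_bound; blast)+
 qed
 have DD2: "\<tau> \<in> Dm" "\<tau> \<in> Dp" if "\<bar>Re \<tau>\<bar> \<le> 7" "\<bar>Im \<tau>\<bar> \<ge> Y0" for \<tau>
  using Lm[OF Y1(1)] Lp[OF Y1(2)] that Y0(2) by auto
 have dz: "p.\<gamma> (?z \<tau>) - m.\<gamma> (?z \<tau>) = \<Delta> \<tau>" for \<tau> by (simp add: \<Delta>_def)
 interpret P: sep_pair ?H V0 m.\<gamma> p.\<gamma> h R Hm \<psi> Y0 "\<rho> / 2" B cH "c / 2" "8 * (\<rho> / 2) / h" n
 proof
  show "\<exists>A Y. \<forall>\<tau>. \<bar>Re \<tau>\<bar> \<le> 7 \<longrightarrow> \<bar>Im \<tau>\<bar> \<ge> Y \<longrightarrow> norm (p.\<gamma> (?z \<tau>) - m.\<gamma> (?z \<tau>)) \<le> A * exp (- (1 - \<epsilon>) * \<bar>Im \<tau>\<bar>)" if \<epsilon>: "\<epsilon> > 0" for \<epsilon>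
  proof -
   obtain A Y where "\<And>\<tau>. \<bar>Re \<tau>\<bar> \<le> 8 \<Longrightarrow> \<bar>Im \<tau>\<bar> \<ge> Y \<Longrightarrow> norm (\<Delta> \<tau>) \<le> A * exp (- (1 - \<epsilon>) * \<bar>Im \<tau>\<bar>)"
    using \<Delta>_decay[OF \<epsilon>] by metis
   thus ?thesis unfolding dz by (intro exI[of _ A] exI[of _ Y]) auto
  qed
  fix \<tau> assume t: "\<bar>Re \<tau>\<bar> \<le> 7" "Y0 \<le> \<bar>Im \<tau>\<bar>"
  note t1 = t(1) order_trans[OF Y0(2) t(2)]
  show "\<tau> \<in> Lset 1 R" "\<tau> \<in> Lset (- 1) R" using Y1[OF t1] by auto
  show "ball (m.\<gamma> (?z \<tau>)) (\<rho> / 2) \<subseteq> V0" "ball (p.\<gamma> (?z \<tau>)) (\<rho> / 2) \<subseteq> V0" using halfball small[OF t1] by auto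
  have f: "c * exp (- \<bar>Im \<tau>\<bar>) \<le> norm (symp (\<Delta> \<tau>) (vdd m.\<gamma> (?z \<tau>) e1))" by (rule far[OF DD2[OF t]]) (use Y0(6) t in linarith)
  have "c / 2 * exp (- \<bar>Im \<tau>\<bar>) \<le> c * exp (- \<bar>Im \<tau>\<bar>)" using c by (intro mult_right_mono) auto
  thus "c / 2 * exp (- \<bar>Im \<tau>\<bar>) \<le> norm (symp (p.\<gamma> (?z \<tau>) - m.\<gamma> (?z \<tau>)) (sm.g\<phi> (?z \<tau>)))"
   unfolding dz sm.g\<phi>_def using f by linarith
  show "c / 2 * exp (- \<bar>Im \<tau>\<bar>) \<le> norm (symp (p.\<gamma> (?z \<tau>) - m.\<gamma> (?z \<tau>)) (sp.g\<phi> (?z \<tau>)))"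
   unfolding dz sp.g\<phi>_def by (rule Y4[OF DD2[OF t] t(1)]) (use Y0(5) t in linarith)
  show "\<exists>b. norm b = 1 \<and> cH / \<bar>Im \<tau>\<bar> ^ n \<le> norm (dd ?H (m.\<gamma> (?z \<tau>)) b)"
   by (rule cHb[OF c1(2)[OF DD2(1)[OF t] t(1)]]) (use Y0(3) t in \<open>auto simp: cH_def\<close>)
  show "\<exists>b. norm b = 1 \<and> cH / \<bar>Im \<tau>\<bar> ^ n \<le> norm (dd ?H (p.\<gamma> (?z \<tau>)) b)"
   by (rule cHb[OF c2(2)[OF DD2(2)[OF t] t(1)]]) (use Y0(4) t in \<open>auto simp: cH_def\<close>)
  show "norm (sm.g\<phi> (?z \<tau>)) \<le> 8 * (\<rho> / 2) / h" unfolding sm.g\<phi>_def by (rule gb(1)[OF t1])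
  show "norm (sp.g\<phi> (?z \<tau>)) \<le> 8 * (\<rho> / 2) / h" unfolding sp.g\<phi>_def by (rule gb(2)[OF t1])
 qed (use \<rho> c m.h c1(1) c2(1) BV Y0(1) in \<open>auto simp: cH_def\<close>)
 \<comment> \<open>G is bounded by M on the whole ball \<open>V0\<close>, so the exponent 1 suffices
   as soon as |Im tau| exceeds M and 2 / rho.\<close>
 have "P.GGV G V0 1 (Max {Y0, 2 / \<rho>, M})"
  unfolding P.GGV_def
 proof (intro conjI allI impI ballI)
  fix \<tau> x assume t: "\<bar>Re \<tau>\<bar> \<le> 7" "Max {Y0, 2 / \<rho>, M} \<le> \<bar>Im \<tau>\<bar>"
   and x: "x \<in> ball (m.\<gamma> (?z \<tau>)) (1 / \<bar>Im \<tau>\<bar> ^ 1) \<union> ball (p.\<gamma> (?z \<tau>)) (1 / \<bar>Im \<tau>\<bar> ^ 1)"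
  have y: "\<bar>Im \<tau>\<bar> \<ge> Y0" "\<bar>Im \<tau>\<bar> \<ge> 2 / \<rho>" "\<bar>Im \<tau>\<bar> \<ge> M" using t(2) by simp_all
  have y0: "\<bar>Im \<tau>\<bar> > 0" using y(1) Y0(1) by linarith
  have "2 \<le> \<bar>Im \<tau>\<bar> * \<rho>" using y(2) \<rho>(1) by (simp add: divide_le_eq)
  hence "1 / \<bar>Im \<tau>\<bar> ^ 1 \<le> \<rho> / 2" using y0 by (simp add: field_simps)
  hence "x \<in> ball (m.\<gamma> (?z \<tau>)) (\<rho> / 2) \<union> ball (p.\<gamma> (?z \<tau>)) (\<rho> / 2)" using x by auto
  thus "x \<in> V0" using halfball[OF small(1)[OF t(1) order_trans[OF Y0(2) y(1)]]] halfball[OF small(2)[OF t(1) order_trans[OF Y0(2) y(1)]]] by blast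
  hence "norm (G x) \<le> M" using rd(3) sub(3) by blast
  thus "norm (G x) \<le> \<bar>Im \<tau>\<bar> ^ 1" using y(3) by simp
 qed (use sm.V0 hol_subset[OF hG sub(5)] XG sub(5) sm.\<gamma>_V0 sp.\<gamma>_V0 in auto)
 hence "P.GG G" by (auto simp: P.GG_def)
 moreover define \<tau>0 where "\<tau>0 = Complex 0 Y0"
 have \<tau>0: "\<bar>Re \<tau>0\<bar> \<le> 7" "Y1 \<le> \<bar>Im \<tau>0\<bar>" using Y0(1,2) by (auto simp: \<tau>0_def)
 have "m.\<gamma> (?z \<tau>0) \<in> V" using sm.\<gamma>_V0[OF zW(1)[OF \<tau>0]] sub(5) by blast
 ultimately show False using P.dependent[OF _ V(1) hG zW(1)[OF \<tau>0]] GV(3) by blast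
qed

end

theorem corollary3p8:
 fixes \<eta> K :: complex
  and F :: "complex ^ 4 \<Rightarrow> complex"
  and U :: "(complex ^ 4) set"
  and h \<theta> :: real
 assumes "\<eta> \<noteq> 0"
  and "open U" and "0 \<in> U"
  and "mv_analytic_on F U" and "bounded (F ` U)"
  and "weighted_order_ge F 5"
  and "0 < h" and "0 < \<theta>" and "\<theta> < pi / 4"
  and "is_stokes_constant U (ham \<eta> F) h \<theta> K"
  and "K \<noteq> 0"
 shows "\<not> integrable_at_origin (ham \<eta> F)"
proof -
 obtain \<Gamma>f r \<Gamma>p \<Gamma>m \<Theta>p \<Theta>m where st: "formal_separatrix (ham \<eta> F) \<Gamma>f" "r > 0"
  "analytic_separatrix U (ham \<eta> F) h (Dplus \<theta> r) \<Gamma>f \<Gamma>p" "analytic_separatrix U (ham \<eta> F) h (Dminus \<theta> r) \<Gamma>f \<Gamma>m"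
  and lim: "\<And>\<phi>. \<phi> \<in> strip h \<Longrightarrow> ((\<lambda>\<tau>. symp (\<Gamma>p \<phi> \<tau> - \<Gamma>m \<phi> \<tau>) (dphi \<Gamma>m \<phi> \<tau>) * exp (- \<i> * (\<tau> - \<phi>))) \<longlongrightarrow> \<Theta>p)
       (inf (filtercomap Im at_top) (principal (Dplus \<theta> r \<inter> Dminus \<theta> r)))"
   "\<And>\<phi>. \<phi> \<in> strip h \<Longrightarrow> ((\<lambda>\<tau>. symp (\<Gamma>p \<phi> \<tau> - \<Gamma>m \<phi> \<tau>) (dphi \<Gamma>m \<phi> \<tau>) * exp (\<i> * (\<tau> - \<phi>))) \<longlongrightarrow> \<Theta>m)
       (inf (filtercomap Im at_bot) (principal (Dplus \<theta> r \<inter> Dminus \<theta> r)))"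
  and KK: "K = \<Theta>p * \<Theta>m"
  using assms(10) unfolding is_stokes_constant_def by blast
 have \<Theta>: "\<Theta>p \<noteq> 0" "\<Theta>m \<noteq> 0" using KK assms(11) by auto
 have form: "\<exists>g1 g2 g3 g4. \<Gamma>f = vector [fps_X ^ 2 * g1, fps_X ^ 2 * g2, fps_X * g3, fps_X * g4]" and nz: "\<Gamma>f \<noteq> 0"
  using st(1) unfolding formal_separatrix_def by blast+
 interpret m: branch \<eta> F U h r "Dminus \<theta> r" \<Gamma>f \<Gamma>m 1
  by unfold_locales (use assms mv_analytic_imp_hol st form Lset_subset_Dminus in auto)
 interpret p: branch \<eta> F U h r "Dplus \<theta> r" \<Gamma>f \<Gamma>p "- 1"
  by unfold_locales (use assms mv_analytic_imp_hol st form Lset_subset_Dplus in auto)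
 define P where "P k \<longleftrightarrow> (\<exists>j. fps_nth (\<Gamma>f $ j) k \<noteq> 0)" for k
 have "\<exists>j. \<Gamma>f $ j \<noteq> 0" using nz by (auto simp: vec_eq_iff)
 hence "\<exists>k. P k" unfolding P_def by (metis fps_ext fps_zero_nth)
 \<comment> \<open>The lowest power of 1 / tau with a nonzero coefficient. It is positive by
   \<open>low_coeffs\<close>, and psi is then a phase at which a component of this coefficient does
   not vanish; this selects the column.\<close>
 define n where "n = (LEAST k. P k)"
 have "P n" unfolding n_def using \<open>\<exists>k. P k\<close> by (rule LeastI_ex)
 then obtain i where i: "fps_nth (\<Gamma>f $ i) n \<noteq> 0" by (auto simp: P_def)
 have n: "fps_nth (\<Gamma>f $ j) k = 0" if "k < n" for k j using not_less_Least[of k P] that unfolding n_def P_def by blast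
 have n0: "n > 0" using i m.low_coeffs[of 0 i] by (cases n) (auto simp: wt_def)
 obtain \<psi> :: real where \<psi>: "trig_eval (fps_nth (\<Gamma>f $ i) n) (of_real \<psi>) \<noteq> 0" using trig_eval_nonzero[OF i] by blast
 interpret two_branches \<eta> F U h r "Dminus \<theta> r" "Dplus \<theta> r" \<Gamma>f \<Gamma>m \<Gamma>p \<psi>
  by unfold_locales (rule assms(6))
 have s: "of_real \<psi> \<in> strip h" by (rule real_strip) simp
 define A where "A = Dplus \<theta> r \<inter> Dminus \<theta> r"
 obtain Y1 where Y1: "\<And>\<tau>. \<tau> \<in> A \<Longrightarrow> Im \<tau> \<ge> Y1 \<Longrightarrow> norm \<Theta>p / 2 * exp (- Im \<tau>) \<le> norm (symp (\<Gamma>p (of_real \<psi>) \<tau> - \<Gamma>m (of_real \<psi>) \<tau>) (dphi \<Gamma>m (of_real \<psi>) \<tau>))"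
  using limit_lower_top[OF lim(1)[OF s] \<Theta>(1)] unfolding A_def by blast
 obtain Y2 where Y2: "\<And>\<tau>. \<tau> \<in> A \<Longrightarrow> Im \<tau> \<le> Y2 \<Longrightarrow> norm \<Theta>m / 2 * exp (Im \<tau>) \<le> norm (symp (\<Gamma>p (of_real \<psi>) \<tau> - \<Gamma>m (of_real \<psi>) \<tau>) (dphi \<Gamma>m (of_real \<psi>) \<tau>))"
  using limit_lower_bot[OF lim(2)[OF s] \<Theta>(2)] unfolding A_def by blast
 \<comment> \<open>K nonzero forces both limits to be nonzero, and half of the smaller modulus
   serves as a lower bound at both ends.\<close>
 define c where "c = min (norm \<Theta>p / 2) (norm \<Theta>m / 2)"
 show ?thesis
 proof (rule non_integrable[OF n0 n \<psi>])
  show "c > 0" using \<Theta> by (simp add: c_def)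
  fix \<tau> assume D: "\<tau> \<in> Dminus \<theta> r" "\<tau> \<in> Dplus \<theta> r" and im: "max Y1 (max (- Y2) 1) \<le> \<bar>Im \<tau>\<bar>"
  have A: "\<tau> \<in> A" using D by (simp add: A_def)
  have c1: "c * exp (- \<bar>Im \<tau>\<bar>) \<le> norm \<Theta>p / 2 * exp (- \<bar>Im \<tau>\<bar>)" "c * exp (- \<bar>Im \<tau>\<bar>) \<le> norm \<Theta>m / 2 * exp (- \<bar>Im \<tau>\<bar>)"
   by (auto intro!: mult_right_mono simp: c_def)
  show "c * exp (- \<bar>Im \<tau>\<bar>) \<le> norm (symp (\<Delta> \<tau>) (vdd m.\<gamma> (pt \<psi> \<tau>) e1))"
   unfolding m.vdd_dphi[OF s D(1)] \<Delta>_def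
  proof (cases "Im \<tau> \<ge> 0")
   case True
   hence e: "\<bar>Im \<tau>\<bar> = Im \<tau>" by simp
   show "c * exp (- \<bar>Im \<tau>\<bar>) \<le> norm (symp (\<Gamma>p (of_real \<psi>) \<tau> - \<Gamma>m (of_real \<psi>) \<tau>) (dphi \<Gamma>m (of_real \<psi>) \<tau>))"
    by (rule order_trans[OF c1(1)]) (use Y1[OF A] im e in simp)
  next
   case False
   hence e: "\<bar>Im \<tau>\<bar> = - Im \<tau>" by simp
   show "c * exp (- \<bar>Im \<tau>\<bar>) \<le> norm (symp (\<Gamma>p (of_real \<psi>) \<tau> - \<Gamma>m (of_real \<psi>) \<tau>) (dphi \<Gamma>m (of_real \<psi>) \<tau>))"
    by (rule order_trans[OF c1(2)]) (use Y2[OF A] im e in simp)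
  qed
 qed
qed

end
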